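(* Let $k\in\mathbb{N}$ and let $f\in S_{k+\frac12}(\Gamma_0(4))$ be an eigenform for all Hecke operators $\mathcal{T}_{n^2}$, $n\ge 1$, and for the Fricke operator $W_4$. Let $L(s,f)$ be the associated $L$-function. Then the imaginary parts of the nontrivial zeros of $L(s,f)$ are uniformly distributed modulo one.
   Context: Square roots: $\sqrt z=z^{1/2}$ is chosen with $-\frac{\pi}{2}<\arg(z^{1/2})\le\frac{\pi}{2}$, and $z^{m/2}=(z^{1/2})^m$ for $m\in\mathbb{Z}$. Let $\mathbb{H}=\{z\in\mathbb{C}:\mathrm{Im}(z)>0\}$. Cusp forms: $S_{k+\frac12}(\Gamma_0(4))$ is the space of cusp forms of weight $k+\frac12$ on $\Gamma_0(4)$, i.e. holomorphic functions $f$ on $\mathbb{H}$, vanishing at all cusps, with $$f\left(\frac{az+b}{cz+d}\right)=\left(\frac{c}{d}\right)^{2k+1}\epsilon_d^{-2k-1}(cz+d)^{k+\frac12}f(z)\qquad\text{for all }\begin{pmatrix}a&b\\c&d\end{pmatrix}\in\Gamma_0(4),$$ where $\left(\frac{c}{d}\right)$ is Shimura's extension of the Jacobi symbol and $\epsilon_d=1$ if $d\equiv1\pmod 4$, $\epsilon_d=i$ if $d\equiv 3\pmod 4$. (Equivalently, the automorphy factor is $(\theta(\gamma z)/\theta(z))^{2k+1}$ with $\theta(z)=\sum_{n\in\mathbb{Z}}e^{2\pi i n^2z}$.) Such $f$ has a Fourier expansion $f(z)=\sum_{n\ge1}a_f(n)e^{2\pi i nz}$. Hecke operators: $\mathcal{T}_{n^2}$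 are Shimura's Hecke operators on $S_{k+\frac12}(\Gamma_0(4))$; they are generated by the $\mathcal{T}_{p^2}$, $p$ prime, where the $n$-th Fourier coefficient of $\mathcal{T}_{p^2}f$ is $a_f(p^2n)+\left(\frac{(-1)^kn}{p}\right)p^{k-1}a_f(n)+p^{2k-1}a_f(n/p^2)$ for $p$ odd (with $a_f(n/p^2)=0$ if $p^2\nmid n$), and $a_f(4n)$ for $p=2$. An eigenform is a nonzero simultaneous eigenvector. Fricke operator: $(f|W_4)(z)=i^{k+\frac12}2^{-k-\frac12}z^{-k-\frac12}f\left(-\frac{1}{4z}\right)$. It is an involution, so an eigenform satisfies $f|W_4=(-1)^\ell f$ with $\ell\in\{0,1\}$. $L$-function: $L(s,f)=\sum_{n\ge1}a_f(n)n^{-s}$ for $\mathrm{Re}(s)$ sufficiently large, continued to an entire function of $s$. For $f|W_4=(-1)^\ell f$ it satisfies $\pi^{-s}\Gamma(s)L(s,f)=(-1)^\ell\pi^{-(k+\frac12-s)}\Gamma(k+\frac12-s)L(k+\frac12-s,f)$. The trivial zeros of $L(s,f)$ are those at the nonpositive integers; all other zeros are nontrivial. Uniform distribution: a real sequence $(\gamma_n)_{n\in\mathbb{N}}$ is uniformly distributed modulo one if for all $0\le a<b\le1$, $\lim_{N\to\infty}\frac1N\#\{n\le N: a\le\{\gamma_n\}<b\}=b-a$, where $\{x\}$ is the fractional part of $x$. The nontrivial zeros $\rho=\beta+i\gamma$ are counted with multiplicity and their imaginary parts $\gamma$ (of either sign) are listed in order of nondecreasing $|\gamma|$. *)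

theory Defs
  imports "HOL-Complex_Analysis.Complex_Analysis" "HOL-Number_Theory.Number_Theory"
begin

definition upper_half_plane :: "complex set" where
  "upper_half_plane = {z. Im z > 0}"

text \<open>\<open>half_pow z m\<close> is $z^{m/2}$; \<^const>\<open>csqrt\<close> is the branch of the square root with
  argument in $(-\pi/2, \pi/2]$.\<close>

definition half_pow :: "complex \<Rightarrow> int \<Rightarrow> complex" where
  "half_pow z m = csqrt z powi m"


text \<open>Shimura's extension of the Jacobi symbol to all integers $c$ and odd $d$: it is the Jacobi
  symbol $(c/|d|)$, with an additional sign when both $c$ and $d$ are negative. The empty product
  gives $(0/\pm 1) = 1$.\<close>

definition shimura_symbol :: "int \<Rightarrow> int \<Rightarrow> int" where
  "shimura_symbol c d =
     (if c < 0 \<and> d < 0 then -1 else 1) * (\<Prod>p\<in>#prime_factorization \<bar>d\<bar>. Legendre c p)"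

definition theta_eps :: "int \<Rightarrow> complex" where
  "theta_eps d = (if d mod 4 = 1 then 1 else \<i>)"

text \<open>Vanishing at the cusp $\gamma\infty$, for $\gamma \in SL_2(\mathbb{Z})$ with rows $(a, b)$ and
  $(c, d)$, means that $(cz+d)^{-k-1/2} f(\gamma z)$ tends to $0$ as $\mathrm{Im}(z) \to \infty$;
  every cusp is of this form. Values of \<open>f\<close> outside the upper half-plane are irrelevant.\<close>

definition cusp_forms :: "nat \<Rightarrow> (complex \<Rightarrow> complex) set" where
  "cusp_forms k = {f.
     f holomorphic_on upper_half_plane \<and>
     (\<forall>a b c d :: int. a * d - b * c = 1 \<longrightarrow> 4 dvd c \<longrightarrow>
       (\<forall>z\<in>upper_half_plane.
          f ((of_int a * z + of_int b) / (of_int c * z + of_int d)) =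
            of_int (shimura_symbol c d) ^ (2 * k + 1) * theta_eps d powi (- (2 * int k + 1)) *
            half_pow (of_int c * z + of_int d) (2 * int k + 1) * f z)) \<and>
     (\<forall>a b c d :: int. a * d - b * c = 1 \<longrightarrow>
       ((\<lambda>z. half_pow (of_int c * z + of_int d) (- (2 * int k + 1)) *
             f ((of_int a * z + of_int b) / (of_int c * z + of_int d))) \<longlongrightarrow> 0)
         (filtercomap Im at_top))}"


text \<open>The \<open>n\<close>-th Fourier coefficient, computed along the segment from $i$ to $1 + i$.\<close>

definition fourier_coeff :: "(complex \<Rightarrow> complex) \<Rightarrow> nat \<Rightarrow> complex" where
  "fourier_coeff f n =
     integral {0..1} (\<lambda>x. f (Complex x 1) * exp (- (2 * of_real pi * \<i> * of_nat n * Complex x 1)))"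

text \<open>The operators $\mathcal{T}_{p^2}$ on coefficient sequences. The exponents are integers so
  that $p^{k-1}$ and $p^{2k-1}$ are not truncated for $k = 0$.\<close>

definition hecke_prime_coeff :: "nat \<Rightarrow> nat \<Rightarrow> (nat \<Rightarrow> complex) \<Rightarrow> nat \<Rightarrow> complex" where
  "hecke_prime_coeff k p a n =
     (if p = 2 then a (4 * n)
      else a (p\<^sup>2 * n)
        + of_int (Legendre ((-1) ^ k * int n) (int p)) * of_nat p powi (int k - 1) * a n
        + of_nat p powi (2 * int k - 1) * (if p\<^sup>2 dvd n then a (n div p\<^sup>2) else 0))"

text \<open>The operators $\mathcal{T}_{p^{2j}}$, as polynomials in $\mathcal{T}_{p^2}$. Shimura's
  $\mathcal{T}_{p^{2j}}$ is given by the single double coset of $\mathrm{diag}(1, p^{2j})$; hence, for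
  odd \<open>p\<close>, the relations are
  $\mathcal{T}_{p^4} = \mathcal{T}_{p^2}^2 - (p^{2k-1} + p^{2k-2})$ and
  $\mathcal{T}_{p^{2j+2}} = \mathcal{T}_{p^2} \mathcal{T}_{p^{2j}} - p^{2k-1} \mathcal{T}_{p^{2j-2}}$
  for $j \ge 2$, while $\mathcal{T}_{4^j} = \mathcal{T}_4^j$.\<close>

fun hecke_prime_power_coeff :: "nat \<Rightarrow> nat \<Rightarrow> nat \<Rightarrow> (nat \<Rightarrow> complex) \<Rightarrow> nat \<Rightarrow> complex" where
  "hecke_prime_power_coeff k p 0 a = a"
| "hecke_prime_power_coeff k p (Suc 0) a = hecke_prime_coeff k p a"
| "hecke_prime_power_coeff k p (Suc (Suc j)) a = (\<lambda>n.
     hecke_prime_coeff k p (hecke_prime_power_coeff k p (Suc j) a) n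
     - (if p = 2 then 0
        else if j = 0 then of_nat p powi (2 * int k - 1) + of_nat p powi (2 * int k - 2)
        else of_nat p powi (2 * int k - 1)) * hecke_prime_power_coeff k p j a n)"

text \<open>$\mathcal{T}_{n^2}$ is the product of the $\mathcal{T}_{p^{2j}}$ with $p^j$ exactly dividing
  \<open>n\<close>. These operators commute, so the order of composition does not matter.\<close>

definition hecke_coeff :: "nat \<Rightarrow> nat \<Rightarrow> (nat \<Rightarrow> complex) \<Rightarrow> nat \<Rightarrow> complex" where
  "hecke_coeff k n =
     foldr (\<lambda>p. hecke_prime_power_coeff k p (multiplicity p n)) (sorted_list_of_set (prime_factors n))"

definition hecke_op :: "nat \<Rightarrow> nat \<Rightarrow> (complex \<Rightarrow> complex) \<Rightarrow> complex \<Rightarrow> complex" where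
  "hecke_op k n f z =
     (\<Sum>m. hecke_coeff k n (fourier_coeff f) (Suc m) * exp (2 * of_real pi * \<i> * of_nat (Suc m) * z))"

definition fricke_op :: "nat \<Rightarrow> (complex \<Rightarrow> complex) \<Rightarrow> complex \<Rightarrow> complex" where
  "fricke_op k f z =
     half_pow \<i> (2 * int k + 1) * half_pow 2 (- (2 * int k + 1)) * half_pow z (- (2 * int k + 1)) *
     f (- 1 / (4 * z))"

definition eigenvector_of ::
    "((complex \<Rightarrow> complex) \<Rightarrow> complex \<Rightarrow> complex) \<Rightarrow> (complex \<Rightarrow> complex) \<Rightarrow> bool" where
  "eigenvector_of T f \<longleftrightarrow>
     (\<exists>z\<in>upper_half_plane. f z \<noteq> 0) \<and> (\<exists>c. \<forall>z\<in>upper_half_plane. T f z = c * f z)"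


text \<open>The entire function continuing the Dirichlet series $\sum_{n \ge 1} a_f(n) n^{-s}$, unique by
  the identity theorem.\<close>

definition L_function :: "(complex \<Rightarrow> complex) \<Rightarrow> complex \<Rightarrow> complex" where
  "L_function f = (THE L. L holomorphic_on UNIV \<and>
     (\<exists>\<sigma>::real. \<forall>s. Re s > \<sigma> \<longrightarrow>
        (\<lambda>n. fourier_coeff f (Suc n) * of_nat (Suc n) powr (- s)) sums L s))"

definition nontrivial_zeros :: "(complex \<Rightarrow> complex) \<Rightarrow> complex set" where
  "nontrivial_zeros L = {s. L s = 0} - nonpos_Ints"

text \<open>\<open>\<rho>\<close> lists the nontrivial zeros of \<open>L\<close>, each as often as its multiplicity, by nondecreasing
  absolute value of the imaginary part.\<close>

definition lists_nontrivial_zeros :: "(complex \<Rightarrow> complex) \<Rightarrow> (nat \<Rightarrow> complex) \<Rightarrow> bool" where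
  "lists_nontrivial_zeros L \<rho> \<longleftrightarrow>
     range \<rho> \<subseteq> nontrivial_zeros L \<and>
     (\<forall>z\<in>nontrivial_zeros L. finite {n. \<rho> n = z} \<and> int (card {n. \<rho> n = z}) = zorder L z) \<and>
     mono (\<lambda>n. \<bar>Im (\<rho> n)\<bar>)"

definition uniformly_distributed_mod_1 :: "(nat \<Rightarrow> real) \<Rightarrow> bool" where
  "uniformly_distributed_mod_1 \<gamma> \<longleftrightarrow>
     (\<forall>a b. 0 \<le> a \<longrightarrow> a < b \<longrightarrow> b \<le> 1 \<longrightarrow>
        (\<lambda>N. real (card {n. n < N \<and> a \<le> frac (\<gamma> n) \<and> frac (\<gamma> n) < b}) / real N)
          \<longlonglongrightarrow> b - a)"

end

theory Submission
  imports Defs "HOL-Probability.Probability" "HOL-Real_Asymp.Real_Asymp"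
begin

text \<open>
  The zeros are studied through two-dimensional integrals of $\log|L|$. Green's identity turns the sum
  of a product weight $\alpha(\beta)\, b(\gamma)$ over the zeros $\beta + i\gamma$ into $1/(2\pi)$ times
  the integral of $\log|L|$ against the Laplacian of the weight (\<open>Green_log_norm\<close>); this replaces
  the argument principle and needs no bound for the argument of $L$. Write $c = \kappa/2$ with
  $\kappa = k + 1/2$, so that the functional equation relates $s$ and $2c - s$.

  The input is that $\log|L(\sigma+it)|$ is, in $L^1$ mean over $|t| \le T$, equal to
  $2\max(c-\sigma, 0)\log T + o(\log T)$ (\<open>log_main_term\<close>). To the right of $c$ the mean square of $L$
  on vertical lines bounds $\log^+|L|$, since a logarithm lies below its tangents. The Laplacian of a nonnegative
  weight pairs nonnegatively with $\log|L|$; if the weight is convex in $\sigma$ across the critical strip, this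
  bounds the integral of $\log^-|L|$ by that of $\log^+|L|$ (\<open>mean_abs_G\<close>). To the left of $c$ the functional equation and Stirling's formula
  supply the main term. Inserting this into Green's identity, with a weight that is $1$ in $\sigma$ on the
  strip containing all nontrivial zeros, gives
  $\sum_\gamma b_T(\gamma) = \frac{1}{\pi} \log T \int b_T + o(T \log T)$ for all $C^2$ weights $b_T$ on
  $[-T, T]$ that are bounded together with their second derivatives (\<open>nontrivial_zero_sum\<close>). For a plateau
  function this is of order $T \log T$; for the same function times $\cos(\omega t + \phi)$ with
  $\omega \ne 0$ the integral stays bounded, so that the sum is $o(T \log T)$. With
  $\omega = 2\pi m$, Weyl's criterion gives the uniform distribution (\<open>Weyl_criterion\<close>). Since $T \log T$
  grows regularly, passing from the smoothed sums to the first $N$ zeros costs an arbitrarily small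
  proportion of them (\<open>average_from_smoothed\<close>).

  The mean square (\<open>Lam_mean_square\<close>) uses the function $\Phi(w) = e^{\kappa w/2} f(i e^w/2)$ on the strip
  $|\mathrm{Im}\, w| < \pi/2$, whose Fourier transform is the completed $L$-function
  $\Lambda(s) = \pi^{-s}\Gamma(s) L(s)$. On the line $\mathrm{Im}\, w = \theta$ the transform is
  $e^{t\theta}\Lambda(\sigma + it)$; with $\theta = \pm(\pi/2 - 1/T)$ the exponential balances the decay of the Gamma factor
  for $|t| \le T$, and Plancherel's inequality bounds the mean square of $e^{\pi|t|/2}|\Lambda|$ over $|t| \le T$ by
  $T^{2\sigma}\log T$. Near the real axis it needs the estimate $|f(z)| \ll (\mathrm{Im}\, z)^{-\kappa/2}$ (\<open>f_growth\<close>). The latter follows from modularity: $f^8$ has trivial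
  multiplier, and $\mathrm{SL}_2(\mathbb{Z})$ moves every point to a point with imaginary part at least $1/2$. The
  Fricke eigenvalue enters as the symmetry $\Phi(-w) = \epsilon \Phi(w)$, which is the functional equation.
\<close>

section \<open>Cut-off functions and Green's identity\<close>

lemma DERIV_max_0_power:
  "((\<lambda>x::real. max 0 x ^ Suc (Suc n)) has_real_derivative real (Suc (Suc n)) * max 0 x ^ Suc n) (at x)"
proof -
  consider "x < 0" | "x > 0" | "x = 0" by linarith
  thus ?thesis
  proof cases
    case 1
    have "((\<lambda>x::real. 0) has_real_derivative 0) (at x)" by simp
    hence "((\<lambda>x::real. max 0 x ^ Suc (Suc n)) has_real_derivative 0) (at x)"
      by (rule has_field_derivative_transform_within_open[of _ _ _ "{..<0}"]) (use 1 in auto)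
    thus ?thesis using 1 by simp
  next
    case 2
    have "((\<lambda>x::real. x ^ Suc (Suc n)) has_real_derivative real (Suc (Suc n)) * x ^ Suc n) (at x)"
      using DERIV_pow[of "Suc (Suc n)" x] by simp
    hence "((\<lambda>x::real. max 0 x ^ Suc (Suc n)) has_real_derivative real (Suc (Suc n)) * x ^ Suc n) (at x)"
      by (rule has_field_derivative_transform_within_open[of _ _ _ "{0<..}"]) (use 2 in auto)
    thus ?thesis using 2 by simp
  next
    case 3
    show ?thesis unfolding CARAT_DERIV
    proof (intro exI[of _ "\<lambda>z. max 0 z ^ Suc n"] conjI allI)
      show "isCont (\<lambda>z. max 0 z ^ Suc n) x" by (intro continuous_intros)
    qed (auto simp: 3 max_def)
  qed
qed

text \<open>A $C^2$ step from $0$ to $1$: the integral of the quadratic B-spline. It equals $x^3/6$ on $[0,1]$,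
  so that it starts off convex; the zero counting needs this initial convexity.\<close>

definition bspline_step :: "real \<Rightarrow> real" where
  "bspline_step x = (max 0 x ^ 3 - 3 * max 0 (x - 1) ^ 3 + 3 * max 0 (x - 2) ^ 3 - max 0 (x - 3) ^ 3) / 6"

definition bspline_step' :: "real \<Rightarrow> real" where
  "bspline_step' x = (max 0 x ^ 2 - 3 * max 0 (x - 1) ^ 2 + 3 * max 0 (x - 2) ^ 2 - max 0 (x - 3) ^ 2) / 2"

definition bspline_step'' :: "real \<Rightarrow> real" where
  "bspline_step'' x = max 0 x - 3 * max 0 (x - 1) + 3 * max 0 (x - 2) - max 0 (x - 3)"

lemma bspline_step_derivs:
  "(bspline_step has_real_derivative bspline_step' x) (at x)"
  "(bspline_step' has_real_derivative bspline_step'' x) (at x)"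
proof -
  have d: "((\<lambda>x. x - c) has_real_derivative 1) (at x)" for c :: real
    by (auto intro!: derivative_eq_intros)
  have 3: "((\<lambda>x. max 0 (x - c) ^ 3) has_real_derivative 3 * max 0 (x - c) ^ 2) (at x)" for c :: real
    using DERIV_chain2[OF DERIV_max_0_power[of 1 "x - c"] d] by (simp add: numeral_3_eq_3 numeral_2_eq_2)
  have 2: "((\<lambda>x. max 0 (x - c) ^ 2) has_real_derivative 2 * max 0 (x - c)) (at x)" for c :: real
    using DERIV_chain2[OF DERIV_max_0_power[of 0 "x - c"] d] by (simp add: numeral_2_eq_2)
  have 30: "((\<lambda>x. max 0 x ^ 3) has_real_derivative 3 * max 0 (x - 0) ^ 2) (at x)" using 3[of 0] by simp
  have 20: "((\<lambda>x. max 0 x ^ 2) has_real_derivative 2 * max 0 (x - 0)) (at x)" using 2[of 0] by simp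
  have "(bspline_step has_real_derivative (3 * max 0 (x - 0) ^ 2 - 3 * (3 * max 0 (x - 1) ^ 2)
      + 3 * (3 * max 0 (x - 2) ^ 2) - 3 * max 0 (x - 3) ^ 2) / 6) (at x)"
    unfolding bspline_step_def[abs_def]
    by (intro DERIV_diff DERIV_add DERIV_cmult DERIV_cdivide 3 30)
  thus "(bspline_step has_real_derivative bspline_step' x) (at x)"
    by (rule DERIV_cong) (simp add: bspline_step'_def field_simps)
  have "(bspline_step' has_real_derivative (2 * max 0 (x - 0) - 3 * (2 * max 0 (x - 1))
      + 3 * (2 * max 0 (x - 2)) - 2 * max 0 (x - 3)) / 2) (at x)"
    unfolding bspline_step'_def[abs_def]
    by (intro DERIV_diff DERIV_add DERIV_cmult DERIV_cdivide 2 20)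
  thus "(bspline_step' has_real_derivative bspline_step'' x) (at x)"
    by (rule DERIV_cong) (simp add: bspline_step''_def field_simps)
qed

lemma bspline_step_left: "x \<le> 0 \<Longrightarrow> bspline_step x = 0 \<and> bspline_step' x = 0 \<and> bspline_step'' x = 0"
  by (simp add: bspline_step_def bspline_step'_def bspline_step''_def)

lemma bspline_step_right: "x \<ge> 3 \<Longrightarrow> bspline_step x = 1 \<and> bspline_step' x = 0 \<and> bspline_step'' x = 0"
  by (simp add: bspline_step_def bspline_step'_def bspline_step''_def) (simp add: algebra_simps power2_eq_square power3_eq_cube)

lemma bspline_step_first: "0 \<le> x \<Longrightarrow> x \<le> 1 \<Longrightarrow> bspline_step x = x ^ 3 / 6 \<and> bspline_step'' x = x"
  by (simp add: bspline_step_def bspline_step''_def)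

lemma bspline_step_reflect:
  "bspline_step (3 - x) = 1 - bspline_step x" "bspline_step'' (3 - x) = - bspline_step'' x"
proof -
  have m: "max 0 (- y) ^ 3 = max 0 y ^ 3 - y ^ 3" "max 0 (- y) = max 0 y - y" for y :: real
    by (auto simp: max_def)
  show "bspline_step (3 - x) = 1 - bspline_step x"
    unfolding bspline_step_def using m(1)[of "x - 3"] m(1)[of "x - 2"] m(1)[of "x - 1"] m(1)[of x]
    by (simp add: field_simps) (simp add: algebra_simps power2_eq_square power3_eq_cube)
  show "bspline_step'' (3 - x) = - bspline_step'' x"
    unfolding bspline_step''_def using m(2)[of "x - 3"] m(2)[of "x - 2"] m(2)[of "x - 1"] m(2)[of x]
    by (simp add: field_simps)
qed

lemma bspline_step_half:
  assumes "x \<le> 3/2"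
  shows "0 \<le> bspline_step x" "bspline_step x \<le> 1/2" "0 \<le> bspline_step'' x" "bspline_step'' x \<le> 1"
proof -
  consider "x \<le> 0" | "0 \<le> x" "x \<le> 1" | "1 \<le> x" "x \<le> 3/2" using assms by linarith
  hence "0 \<le> bspline_step x \<and> bspline_step x \<le> 1/2 \<and> 0 \<le> bspline_step'' x \<and> bspline_step'' x \<le> 1"
  proof cases
    case 1 thus ?thesis by (simp add: bspline_step_left)
  next
    case 2 thus ?thesis using power_le_one[of x 3] by (simp add: bspline_step_first)
  next
    case 3
    define u where "u = x - 1"
    have u: "0 \<le> u" "u \<le> 1/2" "x = u + 1" using 3 by (auto simp: u_def)
    have e: "bspline_step x = (1 + 3 * u + 3 * u\<^sup>2 - 2 * u ^ 3) / 6" "bspline_step'' x = 1 - 2 * u"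
      using u by (simp_all add: bspline_step_def bspline_step''_def) (simp add: algebra_simps power2_eq_square power3_eq_cube)
    have "u\<^sup>2 \<le> u * (1/2)" unfolding power2_eq_square using u by (intro mult_left_mono) auto
    moreover have "u ^ 3 \<le> u\<^sup>2 * 1" unfolding power3_eq_cube power2_eq_square using u by (intro mult_left_mono) auto
    moreover have "u ^ 3 \<ge> 0" "u\<^sup>2 \<ge> 0" using u by auto
    moreover have "3 * u\<^sup>2 - 2 * u ^ 3 \<le> 1/2"
    proof -
      have "1/2 - (3 * u\<^sup>2 - 2 * u ^ 3) = 2 * (1/2 - u) * (1/2 + u - u\<^sup>2)"
        by (simp add: algebra_simps power2_eq_square power3_eq_cube)
      moreover have "\<dots> \<ge> 0" using u \<open>u\<^sup>2 \<le> u * (1/2)\<close> by (intro mult_nonneg_nonneg) auto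
      ultimately show ?thesis by linarith
    qed
    moreover have "2 * u ^ 3 \<le> 1 + 3 * u + 3 * u\<^sup>2" using calculation u by linarith
    ultimately show ?thesis using u unfolding e by simp
  qed
  thus "0 \<le> bspline_step x" "bspline_step x \<le> 1/2" "0 \<le> bspline_step'' x" "bspline_step'' x \<le> 1" by auto
qed

text \<open>The symmetry about $3/2$ reduces everything to the left half, where the second derivative is
  nonnegative.\<close>

lemma bspline_step_bounds: "0 \<le> bspline_step x" "bspline_step x \<le> 1" "\<bar>bspline_step'' x\<bar> \<le> 1"
  "bspline_step'' x \<ge> - 2 * bspline_step x" "bspline_step'' x \<le> 2 * (1 - bspline_step x)"
proof -
  have "0 \<le> bspline_step x \<and> bspline_step x \<le> 1 \<and> \<bar>bspline_step'' x\<bar> \<le> 1 \<and>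
    bspline_step'' x \<ge> - 2 * bspline_step x \<and> bspline_step'' x \<le> 2 * (1 - bspline_step x)"
  proof (cases "x \<le> 3/2")
    case True
    thus ?thesis using bspline_step_half[OF True] by auto
  next
    case False
    hence "3 - x \<le> 3/2" by simp
    from bspline_step_half[OF this] show ?thesis unfolding bspline_step_reflect by auto
  qed
  thus "0 \<le> bspline_step x" "bspline_step x \<le> 1" "\<bar>bspline_step'' x\<bar> \<le> 1"
    "bspline_step'' x \<ge> - 2 * bspline_step x" "bspline_step'' x \<le> 2 * (1 - bspline_step x)" by auto
qed

text \<open>Both derivatives are parameters, because the identities below are stated in terms of explicit
  derivatives of explicit weights.\<close>

definition C2_supported :: "real \<Rightarrow> real \<Rightarrow> (real \<Rightarrow> real) \<Rightarrow> (real \<Rightarrow> real) \<Rightarrow> (real \<Rightarrow> real) \<Rightarrow> bool" where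
  "C2_supported a b f f' f'' \<longleftrightarrow> a < b \<and>
     (\<forall>x. (f has_real_derivative f' x) (at x)) \<and> (\<forall>x. (f' has_real_derivative f'' x) (at x)) \<and>
     continuous_on UNIV f'' \<and> (\<forall>x. x \<notin> {a<..<b} \<longrightarrow> f x = 0 \<and> f' x = 0 \<and> f'' x = 0)"

lemma C2_supported_continuous:
  assumes "C2_supported a b f f' f''"
  shows "continuous_on A f" "continuous_on A f'" "continuous_on A f''"
  using assms unfolding C2_supported_def
  by (auto intro!: continuous_at_imp_continuous_on intro: DERIV_isCont)[2]
     (use assms in \<open>auto simp: C2_supported_def intro: continuous_on_subset\<close>)

lemma C2_supported_measurable:
  assumes "C2_supported a b f f' f''"
  shows "f \<in> borel_measurable borel" "f' \<in> borel_measurable borel" "f'' \<in> borel_measurable borel"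
  using C2_supported_continuous[OF assms, of UNIV] by (auto intro: borel_measurable_continuous_onI)

lemma C2_supported_bounded:
  assumes "C2_supported a b f f' f''"
  shows "\<exists>C>0. \<forall>x. \<bar>f x\<bar> \<le> C \<and> \<bar>f' x\<bar> \<le> C \<and> \<bar>f'' x\<bar> \<le> C"
proof -
  have *: "\<exists>C. \<forall>x\<in>{a..b}. \<bar>g x\<bar> \<le> C" if "continuous_on {a..b} g" for g :: "real \<Rightarrow> real"
    using compact_imp_bounded[OF compact_continuous_image[OF that compact_Icc]]
    by (auto simp: bounded_iff)
  obtain C1 C2 C3 where C: "\<forall>x\<in>{a..b}. \<bar>f x\<bar> \<le> C1" "\<forall>x\<in>{a..b}. \<bar>f' x\<bar> \<le> C2" "\<forall>x\<in>{a..b}. \<bar>f'' x\<bar> \<le> C3"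
    using *[OF C2_supported_continuous(1)[OF assms]] *[OF C2_supported_continuous(2)[OF assms]]
      *[OF C2_supported_continuous(3)[OF assms]] by blast
  have z: "f x = 0 \<and> f' x = 0 \<and> f'' x = 0" if "x \<notin> {a..b}" for x
    using assms that by (auto simp: C2_supported_def)
  show ?thesis
  proof (intro exI[of _ "max 1 (max C1 (max C2 C3))"] conjI allI)
    fix x
    show "\<bar>f x\<bar> \<le> max 1 (max C1 (max C2 C3))" "\<bar>f' x\<bar> \<le> max 1 (max C1 (max C2 C3))" "\<bar>f'' x\<bar> \<le> max 1 (max C1 (max C2 C3))"
      using C z[of x] by (cases "x \<in> {a..b}"; simp add: le_max_iff_disj)+
  qed auto
qed

lemma indicator_scaleR_absorb:
  fixes g :: "'a \<Rightarrow> 'b::real_vector"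
  assumes "\<And>x. x \<notin> A \<Longrightarrow> g x = 0"
  shows "(\<lambda>x. indicator A x *\<^sub>R g x) = g"
proof (rule ext)
  show "indicator A x *\<^sub>R g x = g x" for x using assms[of x] by (cases "x \<in> A") auto
qed

lemma integral_parts_C2:
  assumes f: "C2_supported a b f f' f''"
  assumes u: "\<And>x. x \<in> {a..b} \<Longrightarrow> (u has_real_derivative u' x) (at x)"
             "\<And>x. x \<in> {a..b} \<Longrightarrow> (u' has_real_derivative u'' x) (at x)"
             "continuous_on {a..b} u''"
  shows "(\<integral>x. u x * f'' x \<partial>lborel) = (\<integral>x. u'' x * f x \<partial>lborel)"
proof -
  have ab: "a \<le> b" using f by (simp add: C2_supported_def)
  have cu: "continuous_on {a..b} u"
    by (intro continuous_at_imp_continuous_on ballI) (meson DERIV_isCont u(1))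
  note cf = C2_supported_continuous[OF f, of "{a..b}"]
  have z: "f x = 0" "f' x = 0" "f'' x = 0" if "x \<notin> {a<..<b}" for x using f that by (auto simp: C2_supported_def)
  have z': "f x = 0" "f'' x = 0" if "x \<notin> {a..b}" for x using f that by (auto simp: C2_supported_def)
  have "(\<integral>x. indicator {a..b} x *\<^sub>R (u x * f'' x - u'' x * f x) \<partial>lborel) =
      (u b * f' b - u' b * f b) - (u a * f' a - u' a * f a)"
  proof (rule integral_FTC_atLeastAtMost[OF ab])
    show "continuous_on {a..b} (\<lambda>x. u x * f'' x - u'' x * f x)"
      by (intro continuous_intros cf cu u)
    fix x assume x: "a \<le> x" "x \<le> b"
    have "((\<lambda>x. u x * f' x - u' x * f x) has_real_derivative (u x * f'' x - u'' x * f x)) (at x)"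
      using f x unfolding C2_supported_def
      by (auto intro!: derivative_eq_intros u simp: algebra_simps)
    thus "((\<lambda>x. u x * f' x - u' x * f x) has_vector_derivative u x * f'' x - u'' x * f x) (at x within {a..b})"
      unfolding has_real_derivative_iff_has_vector_derivative by (rule has_vector_derivative_at_within)
  qed
  also have "\<dots> = 0" using z[of a] z[of b] by simp
  also have "(\<lambda>x. indicator {a..b} x *\<^sub>R (u x * f'' x - u'' x * f x)) = (\<lambda>x. u x * f'' x - u'' x * f x)"
    by (rule indicator_scaleR_absorb) (use z' in simp)
  also have "(\<integral>x. u x * f'' x - u'' x * f x \<partial>lborel) = (\<integral>x. u x * f'' x \<partial>lborel) - (\<integral>x. u'' x * f x \<partial>lborel)"
  proof (rule Bochner_Integration.integral_diff)
    have "integrable lborel (\<lambda>x. indicator {a..b} x *\<^sub>R (u x * f'' x))"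
      by (intro borel_integrable_compact continuous_intros cf cu) auto
    also have "(\<lambda>x. indicator {a..b} x *\<^sub>R (u x * f'' x)) = (\<lambda>x. u x * f'' x)"
      by (rule indicator_scaleR_absorb) (use z' in simp)
    finally show "integrable lborel (\<lambda>x. u x * f'' x)" .
    have "integrable lborel (\<lambda>x. indicator {a..b} x *\<^sub>R (u'' x * f x))"
      by (intro borel_integrable_compact continuous_intros cf u) auto
    also have "(\<lambda>x. indicator {a..b} x *\<^sub>R (u'' x * f x)) = (\<lambda>x. u'' x * f x)"
      by (rule indicator_scaleR_absorb) (use z' in simp)
    finally show "integrable lborel (\<lambda>x. u'' x * f x)" .
  qed
  finally show ?thesis by simp
qed

lemma integrable_continuous_box:
  fixes g :: "real \<times> real \<Rightarrow> real"
  assumes "continuous_on ({a..b} \<times> {c..d}) g" "\<And>p. p \<notin> {a..b} \<times> {c..d} \<Longrightarrow> g p = 0"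
  shows "integrable lborel g"
proof -
  have "integrable lborel (\<lambda>p. indicator ({a..b} \<times> {c..d}) p *\<^sub>R g p)"
    by (intro borel_integrable_compact assms compact_Times compact_Icc)
  also have "(\<lambda>p. indicator ({a..b} \<times> {c..d}) p *\<^sub>R g p) = g"
    by (rule indicator_scaleR_absorb) (use assms(2) in simp)
  finally show ?thesis .
qed

lemma Fubini_fst:
  fixes f :: "real \<times> real \<Rightarrow> real"
  shows "integrable lborel f \<Longrightarrow> (\<integral>p. f p \<partial>lborel) = (\<integral>x. (\<integral>y. f (x, y) \<partial>lborel) \<partial>lborel)"
  using lborel_pair.integral_fst'[of f, unfolded lborel_prod] by simp

lemma Fubini_snd:
  fixes f :: "real \<times> real \<Rightarrow> real"
  shows "integrable lborel f \<Longrightarrow> (\<integral>p. f p \<partial>lborel) = (\<integral>y. (\<integral>x. f (x, y) \<partial>lborel) \<partial>lborel)"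
  using lborel_pair.integral_snd[of "\<lambda>x y. f (x, y)", unfolded lborel_prod] by (simp add: case_prod_eta)

lemma continuous_on_fst_snd:
  fixes g :: "real \<Rightarrow> real"
  assumes "continuous_on UNIV g"
  shows "continuous_on A (\<lambda>p::real\<times>real. g (fst p))" "continuous_on A (\<lambda>p::real\<times>real. g (snd p))"
  by (rule continuous_on_compose2[OF assms]; auto intro!: continuous_intros)+

text \<open>Integration by parts twice in each variable; no boundary terms occur, since the weight vanishes with
  its first derivatives on the boundary of the rectangle.\<close>

lemma Green_smooth:
  assumes \<alpha>: "C2_supported a b \<alpha> \<alpha>' \<alpha>''" and \<beta>: "C2_supported c d \<beta> \<beta>' \<beta>''"
  assumes u: "\<And>x y. x \<in> {a..b} \<Longrightarrow> y \<in> {c..d} \<Longrightarrow> ((\<lambda>x. u x y) has_real_derivative u1 x y) (at x)"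
             "\<And>x y. x \<in> {a..b} \<Longrightarrow> y \<in> {c..d} \<Longrightarrow> ((\<lambda>x. u1 x y) has_real_derivative u2 x y) (at x)"
             "continuous_on ({a..b} \<times> {c..d}) (\<lambda>p. u2 (fst p) (snd p))"
  assumes v: "\<And>x y. x \<in> {a..b} \<Longrightarrow> y \<in> {c..d} \<Longrightarrow> ((\<lambda>y. u x y) has_real_derivative v1 x y) (at y)"
             "\<And>x y. x \<in> {a..b} \<Longrightarrow> y \<in> {c..d} \<Longrightarrow> ((\<lambda>y. v1 x y) has_real_derivative v2 x y) (at y)"
             "continuous_on ({a..b} \<times> {c..d}) (\<lambda>p. v2 (fst p) (snd p))"
  assumes cu: "continuous_on ({a..b} \<times> {c..d}) (\<lambda>p. u (fst p) (snd p))"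
  shows "integrable lborel (\<lambda>p. u (fst p) (snd p) * (\<alpha>'' (fst p) * \<beta> (snd p) + \<alpha> (fst p) * \<beta>'' (snd p)))"
    and "(\<integral>p. u (fst p) (snd p) * (\<alpha>'' (fst p) * \<beta> (snd p) + \<alpha> (fst p) * \<beta>'' (snd p)) \<partial>lborel)
       = (\<integral>p. (u2 (fst p) (snd p) + v2 (fst p) (snd p)) * (\<alpha> (fst p) * \<beta> (snd p)) \<partial>lborel)"
proof -
  have za: "x \<notin> {a..b} \<Longrightarrow> \<alpha> x = 0" "x \<notin> {a..b} \<Longrightarrow> \<alpha>'' x = 0" for x using \<alpha> by (force simp: C2_supported_def)+
  have zb: "x \<notin> {c..d} \<Longrightarrow> \<beta> x = 0" "x \<notin> {c..d} \<Longrightarrow> \<beta>'' x = 0" for x using \<beta> by (force simp: C2_supported_def)+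
  have zp: "\<alpha> (fst p) * \<beta> (snd p) = 0" "\<alpha>'' (fst p) * \<beta> (snd p) = 0" "\<alpha> (fst p) * \<beta>'' (snd p) = 0"
    if "p \<notin> {a..b} \<times> {c..d}" for p
    using that za[of "fst p"] zb[of "snd p"] by (cases p; cases "fst p \<in> {a..b}"; simp)+
  note ca = C2_supported_continuous[OF \<alpha>, of UNIV] and cb = C2_supported_continuous[OF \<beta>, of UNIV]
  have i1: "integrable lborel (\<lambda>p. u (fst p) (snd p) * (\<alpha>'' (fst p) * \<beta> (snd p)))"
    by (rule integrable_continuous_box[of a b c d])
       (auto intro!: continuous_intros cu continuous_on_fst_snd ca cb simp: zp)
  have i2: "integrable lborel (\<lambda>p. u (fst p) (snd p) * (\<alpha> (fst p) * \<beta>'' (snd p)))"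
    by (rule integrable_continuous_box[of a b c d])
       (auto intro!: continuous_intros cu continuous_on_fst_snd ca cb simp: zp)
  have i3: "integrable lborel (\<lambda>p. u2 (fst p) (snd p) * (\<alpha> (fst p) * \<beta> (snd p)))"
    by (rule integrable_continuous_box[of a b c d])
       (auto intro!: continuous_intros u continuous_on_fst_snd ca cb simp: zp)
  have i4: "integrable lborel (\<lambda>p. v2 (fst p) (snd p) * (\<alpha> (fst p) * \<beta> (snd p)))"
    by (rule integrable_continuous_box[of a b c d])
       (auto intro!: continuous_intros v continuous_on_fst_snd ca cb simp: zp)
  have "continuous_on {a..b} (\<lambda>x. u2 x y)" if "y \<in> {c..d}" for y
    using continuous_on_compose2[OF u(3), of "{a..b}" "\<lambda>x. (x, y)"] that continuous_on_Pair[OF continuous_on_id continuous_on_const, of "{a..b}" y] by (simp add: image_subset_iff)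
  hence p1: "(\<integral>x. u x y * \<alpha>'' x \<partial>lborel) = (\<integral>x. u2 x y * \<alpha> x \<partial>lborel)" if "y \<in> {c..d}" for y
    using that by (intro integral_parts_C2[OF \<alpha>, where u' = "\<lambda>x. u1 x y"]) (auto intro: u)
  have "continuous_on {c..d} (\<lambda>y. v2 x y)" if "x \<in> {a..b}" for x
    using continuous_on_compose2[OF v(3), of "{c..d}" "\<lambda>y. (x, y)"] that continuous_on_Pair[OF continuous_on_const continuous_on_id, of "{c..d}" x] by (simp add: image_subset_iff)
  hence p2: "(\<integral>y. u x y * \<beta>'' y \<partial>lborel) = (\<integral>y. v2 x y * \<beta> y \<partial>lborel)" if "x \<in> {a..b}" for x
    using that by (intro integral_parts_C2[OF \<beta>, where u' = "\<lambda>y. v1 x y"]) (auto intro: v)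
  have c2: "(\<integral>y. f y * (k * g y) \<partial>lborel) = k * (\<integral>y. f y * g y \<partial>lborel)" for f g :: "real \<Rightarrow> real" and k
    by (subst integral_mult_right_zero[symmetric]) (simp add: mult_ac)
  have c1: "(\<integral>y. f y * (g y * k) \<partial>lborel) = (\<integral>y. f y * g y \<partial>lborel) * k" for f g :: "real \<Rightarrow> real" and k
    by (subst integral_mult_left_zero[symmetric]) (simp add: mult_ac)
  have "(\<integral>p. u (fst p) (snd p) * (\<alpha>'' (fst p) * \<beta> (snd p)) \<partial>lborel)
      = (\<integral>y. (\<integral>x. u x y * \<alpha>'' x \<partial>lborel) * \<beta> y \<partial>lborel)"
    by (subst Fubini_snd[OF i1]) (simp add: c1)
  also have "\<dots> = (\<integral>y. (\<integral>x. u2 x y * \<alpha> x \<partial>lborel) * \<beta> y \<partial>lborel)"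
    by (intro Bochner_Integration.integral_cong refl) (use p1 zb in force)
  also have "\<dots> = (\<integral>p. u2 (fst p) (snd p) * (\<alpha> (fst p) * \<beta> (snd p)) \<partial>lborel)"
    by (subst Fubini_snd[OF i3]) (simp add: c1)
  finally have e1: "(\<integral>p. u (fst p) (snd p) * (\<alpha>'' (fst p) * \<beta> (snd p)) \<partial>lborel) = \<dots>" .
  have "(\<integral>p. u (fst p) (snd p) * (\<alpha> (fst p) * \<beta>'' (snd p)) \<partial>lborel)
      = (\<integral>x. \<alpha> x * (\<integral>y. u x y * \<beta>'' y \<partial>lborel) \<partial>lborel)"
    by (subst Fubini_fst[OF i2]) (simp add: c2)
  also have "\<dots> = (\<integral>x. \<alpha> x * (\<integral>y. v2 x y * \<beta> y \<partial>lborel) \<partial>lborel)"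
    by (intro Bochner_Integration.integral_cong refl) (use p2 za in force)
  also have "\<dots> = (\<integral>p. v2 (fst p) (snd p) * (\<alpha> (fst p) * \<beta> (snd p)) \<partial>lborel)"
    by (subst Fubini_fst[OF i4]) (simp add: c2)
  finally have e2: "(\<integral>p. u (fst p) (snd p) * (\<alpha> (fst p) * \<beta>'' (snd p)) \<partial>lborel) = \<dots>" .
  show "integrable lborel (\<lambda>p. u (fst p) (snd p) * (\<alpha>'' (fst p) * \<beta> (snd p) + \<alpha> (fst p) * \<beta>'' (snd p)))"
    using Bochner_Integration.integrable_add[OF i1 i2] by (simp add: algebra_simps)
  show "(\<integral>p. u (fst p) (snd p) * (\<alpha>'' (fst p) * \<beta> (snd p) + \<alpha> (fst p) * \<beta>'' (snd p)) \<partial>lborel)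
       = (\<integral>p. (u2 (fst p) (snd p) + v2 (fst p) (snd p)) * (\<alpha> (fst p) * \<beta> (snd p)) \<partial>lborel)"
    using Bochner_Integration.integral_add[OF i1 i2] Bochner_Integration.integral_add[OF i3 i4] e1 e2
    by (simp add: algebra_simps)
qed

section \<open>The logarithmic potential of a point\<close>

lemma integrable_fst_mult_snd:
  fixes f g :: "real \<Rightarrow> real"
  assumes "integrable lborel f" "integrable lborel g"
  shows "integrable lborel (\<lambda>p. f (fst p) * g (snd p))"
proof -
  have [measurable]: "f \<in> borel_measurable borel" "g \<in> borel_measurable borel"
    using assms by (auto dest: borel_measurable_integrable)
  have "integrable (lborel \<Otimes>\<^sub>M lborel) (\<lambda>p. f (fst p) * g (snd p))"
  proof (rule lborel_pair.Fubini_integrable)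
    show "AE x in lborel. integrable lborel (\<lambda>y. f (fst (x, y)) * g (snd (x, y)))"
      using assms by simp
    show "integrable lborel (\<lambda>x. LINT y|lborel. norm (f (fst (x, y)) * g (snd (x, y))))"
      using assms by (simp add: abs_mult)
  qed simp
  thus ?thesis by (simp add: lborel_prod)
qed

text \<open>The Laplacian of $\frac12\log(1 + x^2 + y^2)$. Its dilations to scale $\epsilon$ form an approximate
  identity of total mass \<open>log_const\<close>, which is $2\pi$.\<close>

definition log_kernel :: "real \<times> real \<Rightarrow> real" where
  "log_kernel p = 2 / (1 + (fst p)\<^sup>2 + (snd p)\<^sup>2)\<^sup>2"

definition log_const :: real where
  "log_const = (\<integral>p. log_kernel p \<partial>lborel)"

lemma log_kernel_continuous: "continuous_on UNIV log_kernel"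
proof -
  have "(1 + (fst p)\<^sup>2 + (snd p)\<^sup>2)\<^sup>2 \<noteq> 0" for p :: "real \<times> real"
  proof -
    have "1 + (fst p)\<^sup>2 + (snd p)\<^sup>2 > 0" by (intro add_pos_nonneg) auto
    thus ?thesis by simp
  qed
  thus ?thesis unfolding log_kernel_def by (intro continuous_intros) auto
qed

lemma log_kernel_measurable [measurable]: "log_kernel \<in> borel_measurable borel"
  by (rule borel_measurable_continuous_onI[OF log_kernel_continuous])

lemma box_measurable [measurable]: "{a..b} \<times> {c..d} \<in> sets (borel :: (real \<times> real) measure)"
  by (intro borel_closed closed_Times) auto

lemma integrable_indicator_Icc: "integrable lborel (indicator {a..b} :: real \<Rightarrow> real)"
  by (simp add: emeasure_lborel_Icc_eq)

lemma log_kernel_nonneg: "log_kernel p \<ge> 0" by (simp add: log_kernel_def)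

lemma log_kernel_integrable: "integrable lborel log_kernel"
proof -
  have i: "integrable lborel (\<lambda>x::real. inverse (1 + x\<^sup>2))"
    using integrable_inverse_1_plus_square by (simp add: set_integrable_def)
  have "integrable lborel (\<lambda>p::real\<times>real. 2 * (inverse (1 + (fst p)\<^sup>2) * inverse (1 + (snd p)\<^sup>2)))"
    by (intro integrable_mult_right integrable_fst_mult_snd[OF i i])
  thus ?thesis
  proof (rule Bochner_Integration.integrable_bound)
    show "AE p in lborel. norm (log_kernel p) \<le> norm (2 * (inverse (1 + (fst p)\<^sup>2) * inverse (1 + (snd p)\<^sup>2)))"
    proof (intro AE_I2)
      fix p :: "real \<times> real"
      have "(1 + (fst p)\<^sup>2) * (1 + (snd p)\<^sup>2) \<le> (1 + (fst p)\<^sup>2 + (snd p)\<^sup>2)\<^sup>2"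
      proof -
        have "(1 + s + t)\<^sup>2 - (1 + s) * (1 + t) = s + t + s * s + t * t + s * t" for s t :: real
          by (simp add: power2_eq_square algebra_simps)
        from this[of "(fst p)\<^sup>2" "(snd p)\<^sup>2"] show ?thesis
          using mult_nonneg_nonneg[of "(fst p)\<^sup>2" "(snd p)\<^sup>2"]
          by (smt (verit) zero_le_power2 zero_le_square)
      qed
      hence "log_kernel p \<le> 2 / ((1 + (fst p)\<^sup>2) * (1 + (snd p)\<^sup>2))"
        unfolding log_kernel_def by (intro divide_left_mono) (auto intro!: mult_pos_pos add_pos_nonneg zero_less_power)
      thus "norm (log_kernel p) \<le> norm (2 * (inverse (1 + (fst p)\<^sup>2) * inverse (1 + (snd p)\<^sup>2)))"
        using log_kernel_nonneg[of p] by (simp add: divide_inverse)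
    qed
  qed simp
qed

lemma log_const_pos: "log_const > 0"
proof -
  have "(2/9) * measure lborel (cbox (0::real,0::real) (1,1)) = (\<integral>p. (2/9) * indicator (cbox (0::real,0::real) (1,1)) p \<partial>lborel)"
    by simp
  also have "\<dots> \<le> log_const" unfolding log_const_def
  proof (intro integral_mono log_kernel_integrable)
    show "integrable lborel (\<lambda>p. 2 / 9 * indicator (cbox (0::real,0::real) (1,1)) p :: real)"
      by (intro integrable_mult_right integrable_real_indicator emeasure_lborel_cbox_finite) auto
    fix p :: "real \<times> real"
    show "2 / 9 * indicator (cbox (0,0) (1,1)) p \<le> log_kernel p"
    proof (cases "p \<in> cbox (0,0) (1,1)")
      case True
      hence "0 \<le> fst p" "fst p \<le> 1" "0 \<le> snd p" "snd p \<le> 1"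
        by (cases p; simp add: cbox_Pair_eq)+
      hence "(fst p)\<^sup>2 \<le> 1" "(snd p)\<^sup>2 \<le> 1" by (auto intro: power_le_one)
      hence "(1 + (fst p)\<^sup>2 + (snd p)\<^sup>2)\<^sup>2 \<le> 3\<^sup>2" by (intro power_mono) auto
      moreover have "(1 + (fst p)\<^sup>2 + (snd p)\<^sup>2)\<^sup>2 > 0" by (intro zero_less_power add_pos_nonneg) auto
      ultimately have "log_kernel p \<ge> 2 / 9" unfolding log_kernel_def by (intro divide_left_mono) auto
      thus ?thesis using True by simp
    qed (simp add: log_kernel_nonneg)
  qed
  also have "measure lborel (cbox (0::real,0::real) (1,1)) = 1"
    by (subst measure_lborel_cbox_eq) (auto simp: Basis_prod_def)
  finally show ?thesis by simp
qed

lemma integrable_indicator_ln_abs: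
  fixes a b p :: real
  shows "integrable lborel (\<lambda>x. indicator {a..b} x * \<bar>ln \<bar>x - p\<bar>\<bar>)"
proof -
  define J where "J = (\<lambda>x::real. indicator {0<..<1} x * (- ln x))"
  have "set_integrable lborel (einterval 0 1) (\<lambda>x. - ln x :: real)"
  proof (rule interval_integral_FTC_nonneg(1)[where F = "\<lambda>x. x - x * ln x" and A = 0 and B = 1])
    show "((\<lambda>x. x - x * ln x) has_real_derivative - ln x) (at x)" if "0 < ereal x" for x
      using that by (auto intro!: derivative_eq_intros)
    show "isCont (\<lambda>x. - ln x) x" if "0 < ereal x" for x using that by (auto intro!: continuous_intros)
    have "((\<lambda>x::real. x - x * ln x) \<longlongrightarrow> 0) (at_right 0)" by real_asymp
    thus "(((\<lambda>x. x - x * ln x) \<circ> real_of_ereal) \<longlongrightarrow> 0) (at_right 0)"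
      by (simp add: ereal_tendsto_simps1 zero_ereal_def)
    have "((\<lambda>x::real. x - x * ln x) \<longlongrightarrow> 1) (at_left 1)" by real_asymp
    thus "(((\<lambda>x. x - x * ln x) \<circ> real_of_ereal) \<longlongrightarrow> 1) (at_left 1)"
      by (simp add: ereal_tendsto_simps1 one_ereal_def)
  qed (auto simp: zero_ereal_def one_ereal_def)
  moreover have "einterval 0 1 = {0<..<(1::real)}" by (auto simp: einterval_def zero_ereal_def one_ereal_def)
  ultimately have J: "integrable lborel J" by (simp add: J_def set_integrable_def)
  have J1: "integrable lborel (\<lambda>x. J (- p + 1 * x))" by (rule lborel_integrable_real_affine[OF J]) simp
  have J2: "integrable lborel (\<lambda>x. J (p + (-1) * x))" by (rule lborel_integrable_real_affine[OF J]) simp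
  have J3: "integrable lborel (\<lambda>x. (\<bar>a\<bar> + \<bar>b\<bar> + \<bar>p\<bar>) * indicator {a..b} x)"
    by (intro integrable_mult_right integrable_indicator_Icc)
  have J0: "J x \<ge> 0" for x by (auto simp: J_def indicator_def)
  from Bochner_Integration.integrable_add[OF Bochner_Integration.integrable_add[OF J1 J2] J3]
  show ?thesis
  proof (rule Bochner_Integration.integrable_bound)
    show "AE x in lborel. norm (indicator {a..b} x * \<bar>ln \<bar>x - p\<bar>\<bar>) \<le> norm (J (- p + 1 * x) + J (p + (- 1) * x) +
      (\<bar>a\<bar> + \<bar>b\<bar> + \<bar>p\<bar>) * indicator {a..b} x)"
    proof (intro AE_I2)
      fix x
      have "indicator {a..b} x * \<bar>ln \<bar>x - p\<bar>\<bar> \<le> J (- p + 1 * x) + J (p + (- 1) * x) +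
        (\<bar>a\<bar> + \<bar>b\<bar> + \<bar>p\<bar>) * indicator {a..b} x"
      proof (cases "x \<in> {a..b}")
        case False thus ?thesis using J0 by simp
      next
        case True
        consider "x = p" | "0 < \<bar>x - p\<bar>" "\<bar>x - p\<bar> < 1" | "\<bar>x - p\<bar> \<ge> 1" by linarith
        thus ?thesis
        proof cases
          case 1 thus ?thesis using True J0 by simp
        next
          case 2
          have "\<bar>ln \<bar>x - p\<bar>\<bar> = - ln \<bar>x - p\<bar>" using 2 by (simp add: abs_if)
          also have "\<dots> \<le> J (- p + 1 * x) + J (p + (- 1) * x)"
            using 2 J0[of "- p + 1 * x"] J0[of "p + (- 1) * x"]
            by (cases "x > p") (auto simp: J_def indicator_def abs_if)
          finally show ?thesis using True by simp
        next
          case 3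
          have "ln \<bar>x - p\<bar> \<le> \<bar>x - p\<bar> - 1" using 3 by (intro ln_le_minus_one) auto
          moreover have "ln \<bar>x - p\<bar> \<ge> 0" using 3 by simp
          moreover have "\<bar>x - p\<bar> \<le> \<bar>a\<bar> + \<bar>b\<bar> + \<bar>p\<bar>" using True by auto
          ultimately show ?thesis using True J0[of "- p + 1 * x"] J0[of "p + (- 1) * x"] by simp
        qed
      qed
      thus "norm (indicator {a..b} x * \<bar>ln \<bar>x - p\<bar>\<bar>) \<le> norm (J (- p + 1 * x) + J (p + (- 1) * x) +
        (\<bar>a\<bar> + \<bar>b\<bar> + \<bar>p\<bar>) * indicator {a..b} x)" unfolding real_norm_def
        by (subst abs_of_nonneg) (auto intro: order_trans[OF _ abs_ge_self])
    qed
  qed simp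
qed

text \<open>$\log|p - w|$, regularised to be smooth at $w$. Its Laplacian is \<open>log_kernel\<close> rescaled to width
  $\epsilon$ about $w$.\<close>

definition reg_log :: "real \<Rightarrow> complex \<Rightarrow> real \<times> real \<Rightarrow> real" where
  "reg_log \<epsilon> w p = 1/2 * ln ((fst p - Re w)\<^sup>2 + (snd p - Im w)\<^sup>2 + \<epsilon>\<^sup>2)"

lemma reg_log_measurable [measurable]: "reg_log \<epsilon> w \<in> borel_measurable borel"
proof -
  have "(\<lambda>p::real\<times>real. (fst p - Re w)\<^sup>2 + (snd p - Im w)\<^sup>2 + \<epsilon>\<^sup>2) \<in> borel_measurable borel"
    by (intro borel_measurable_continuous_onI continuous_intros)
  thus ?thesis unfolding reg_log_def[abs_def] by simp
qed

lemma reg_log_0: "reg_log 0 w p = ln (norm (Complex (fst p) (snd p) - w))"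
  by (simp add: reg_log_def cmod_def ln_sqrt complex_eq_iff)

lemma AE_fst_neq': "AE p::real\<times>real in lborel. fst p \<noteq> (c::real)"
proof -
  have "AE x in lborel. AE y::real in lborel. x \<noteq> (c::real)"
    using AE_lborel_singleton[of c] by eventually_elim simp
  hence "AE p in lborel \<Otimes>\<^sub>M (lborel :: real measure). fst p \<noteq> c"
    by (intro lborel_pair.AE_pair_measure) measurable
  thus ?thesis unfolding lborel_prod .
qed

text \<open>A majorant that is uniform in $\epsilon$ and depends on the first coordinate alone, so that its
  integrability is a one-dimensional statement.\<close>

lemma reg_log_bound:
  obtains D where "D > 0" "\<And>\<epsilon> p. \<lbrakk>0 \<le> \<epsilon>; \<epsilon> \<le> 1; p \<in> {a..b} \<times> {c..d}; fst p \<noteq> Re w\<rbrakk>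
     \<Longrightarrow> \<bar>reg_log \<epsilon> w p\<bar> \<le> \<bar>ln \<bar>fst p - Re w\<bar>\<bar> + D"
proof -
  define M where "M = (\<bar>a\<bar> + \<bar>b\<bar> + \<bar>Re w\<bar>)\<^sup>2 + (\<bar>c\<bar> + \<bar>d\<bar> + \<bar>Im w\<bar>)\<^sup>2 + 1"
  have M: "M \<ge> 1" by (simp add: M_def)
  have "\<bar>reg_log \<epsilon> w p\<bar> \<le> \<bar>ln \<bar>fst p - Re w\<bar>\<bar> + (ln M + 1)"
    if "0 \<le> \<epsilon>" "\<epsilon> \<le> 1" "p \<in> {a..b} \<times> {c..d}" "fst p \<noteq> Re w" for \<epsilon> p
  proof -
    define Q where "Q = (fst p - Re w)\<^sup>2 + (snd p - Im w)\<^sup>2 + \<epsilon>\<^sup>2"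
    have pb: "a \<le> fst p" "fst p \<le> b" "c \<le> snd p" "snd p \<le> d" using that(3) by (cases p; auto)+
    have "Q \<ge> (fst p - Re w)\<^sup>2" by (simp add: Q_def)
    moreover have p0: "(fst p - Re w)\<^sup>2 > 0" using that(4) by simp
    ultimately have "ln Q \<ge> ln ((fst p - Re w)\<^sup>2)" by (intro ln_mono) linarith+
    also have "ln ((fst p - Re w)\<^sup>2) = 2 * ln \<bar>fst p - Re w\<bar>"
      using that(4) ln_realpow[of "\<bar>fst p - Re w\<bar>" 2] by (simp add: power2_abs)
    finally have l: "1/2 * ln Q \<ge> ln \<bar>fst p - Re w\<bar>" by simp
    have "\<bar>fst p - Re w\<bar> \<le> \<bar>a\<bar> + \<bar>b\<bar> + \<bar>Re w\<bar>" "\<bar>snd p - Im w\<bar> \<le> \<bar>c\<bar> + \<bar>d\<bar> + \<bar>Im w\<bar>"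
      using pb by linarith+
    hence "(fst p - Re w)\<^sup>2 \<le> (\<bar>a\<bar> + \<bar>b\<bar> + \<bar>Re w\<bar>)\<^sup>2" "(snd p - Im w)\<^sup>2 \<le> (\<bar>c\<bar> + \<bar>d\<bar> + \<bar>Im w\<bar>)\<^sup>2"
      by (auto intro!: power2_le_iff_abs_le[THEN iffD2])
    moreover have "\<epsilon>\<^sup>2 \<le> 1" using that by (simp add: power_le_one)
    ultimately have "Q \<le> M" by (simp add: Q_def M_def)
    moreover have "Q > 0" using p0 \<open>Q \<ge> (fst p - Re w)\<^sup>2\<close> by linarith
    ultimately have "ln Q \<le> ln M" by (subst ln_le_cancel_iff) (use M in auto)
    moreover have "ln M \<ge> 0" using M by simp
    ultimately show ?thesis using l unfolding reg_log_def Q_def[symmetric] by (auto simp: abs_le_iff)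
  qed
  thus ?thesis using that[of "ln M + 1"] M by (simp add: add_nonneg_pos)
qed

lemma integrable_log_dominator:
  fixes a b c d r D :: real
  shows
  "integrable lborel (\<lambda>p. indicator ({a..b} \<times> {c..d}) p * (\<bar>ln \<bar>fst p - r\<bar>\<bar> + D) :: real)"
proof -
  have "integrable lborel (\<lambda>p. (indicator {a..b} (fst p) * \<bar>ln \<bar>fst p - r\<bar>\<bar>) * indicator {c..d} (snd p))"

    using integrable_fst_mult_snd[OF integrable_indicator_ln_abs[of a b r] integrable_indicator_Icc[of c d]] by simp
  moreover have "integrable lborel (\<lambda>p. (D * indicator {a..b} (fst p)) * indicator {c..d} (snd p))"

    using integrable_fst_mult_snd[OF integrable_mult_right[OF integrable_indicator_Icc[of a b]] integrable_indicator_Icc[of c d]] by blast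
  ultimately have "integrable lborel (\<lambda>p. (indicator {a..b} (fst p) * \<bar>ln \<bar>fst p - r\<bar>\<bar>) * indicator {c..d} (snd p)
     + (D * indicator {a..b} (fst p)) * indicator {c..d} (snd p))"
    by (rule Bochner_Integration.integrable_add)
  thus ?thesis by (rule Bochner_Integration.integrable_cong[THEN iffD1, rotated 2])
     (auto simp: indicator_def split: if_splits)
qed

lemma integrable_log_box:
  "integrable lborel (\<lambda>p. indicator ({a..b} \<times> {c..d}) p * ln (norm (Complex (fst p) (snd p) - w)))"
proof -
  obtain D where D: "D > 0" "\<And>\<epsilon> p. \<lbrakk>0 \<le> \<epsilon>; \<epsilon> \<le> 1; p \<in> {a..b} \<times> {c..d}; fst p \<noteq> Re w\<rbrakk>
     \<Longrightarrow> \<bar>reg_log \<epsilon> w p\<bar> \<le> \<bar>ln \<bar>fst p - Re w\<bar>\<bar> + D"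
    using reg_log_bound[of a b c d w] by blast
  have "integrable lborel (\<lambda>p. indicator ({a..b} \<times> {c..d}) p * reg_log 0 w p)"
  proof (rule Bochner_Integration.integrable_bound[OF integrable_log_dominator[of a b c d "Re w" D]])
    show "AE p in lborel. norm (indicator ({a..b} \<times> {c..d}) p * reg_log 0 w p)
       \<le> norm (indicator ({a..b} \<times> {c..d}) p * (\<bar>ln \<bar>fst p - Re w\<bar>\<bar> + D) :: real)"
      using AE_fst_neq'[of "Re w"]
    proof eventually_elim
      case (elim p)
      show ?case using D(2)[of 0 p] D(1) elim by (cases "p \<in> {a..b} \<times> {c..d}") auto
    qed
  qed simp
  thus ?thesis by (simp add: reg_log_0)
qed

text \<open>After moving the Laplacian to the regularised logarithm, the substitution $p = w + \epsilon q$ removes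
  $\epsilon$ from the kernel and puts it into the weight, where it can tend to $0$.\<close>

lemma reg_log_Laplacian:
  assumes \<alpha>: "C2_supported a b \<alpha> \<alpha>' \<alpha>''" and \<beta>: "C2_supported c d \<beta> \<beta>' \<beta>''" and e: "\<epsilon> > 0"
  shows "(\<integral>p. reg_log \<epsilon> w p * (\<alpha>'' (fst p) * \<beta> (snd p) + \<alpha> (fst p) * \<beta>'' (snd p)) \<partial>lborel) =
         (\<integral>p. log_kernel p * (\<alpha> (Re w + \<epsilon> * fst p) * \<beta> (Im w + \<epsilon> * snd p)) \<partial>lborel)"
proof -
  define Q where "Q = (\<lambda>x y. (x - Re w)\<^sup>2 + (y - Im w)\<^sup>2 + \<epsilon>\<^sup>2)"
  have Q: "Q x y > 0" for x y unfolding Q_def using e by (intro add_nonneg_pos) auto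
  have Q0: "Q x y \<noteq> 0" for x y using Q[of x y] by simp
  have dx: "((\<lambda>x. Q x y) has_real_derivative 2 * (x - Re w)) (at x)" for x y
    unfolding Q_def by (auto intro!: derivative_eq_intros)
  have dy: "((\<lambda>y. Q x y) has_real_derivative 2 * (y - Im w)) (at y)" for x y
    unfolding Q_def by (auto intro!: derivative_eq_intros)
  have cQ: "continuous_on A (\<lambda>p. Q (fst p) (snd p))" for A
    unfolding Q_def by (intro continuous_intros)
  have G: "(\<integral>p. (1/2 * ln (Q (fst p) (snd p))) * (\<alpha>'' (fst p) * \<beta> (snd p) + \<alpha> (fst p) * \<beta>'' (snd p)) \<partial>lborel)
       = (\<integral>p. ((1 / Q (fst p) (snd p) - 2 * (fst p - Re w)\<^sup>2 / (Q (fst p) (snd p))\<^sup>2) +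
               (1 / Q (fst p) (snd p) - 2 * (snd p - Im w)\<^sup>2 / (Q (fst p) (snd p))\<^sup>2)) * (\<alpha> (fst p) * \<beta> (snd p)) \<partial>lborel)"
  proof (rule Green_smooth(2)[OF \<alpha> \<beta>, where ?u1.0 = "\<lambda>x y. (x - Re w) / Q x y" and ?v1.0 = "\<lambda>x y. (y - Im w) / Q x y"])
    show "((\<lambda>x. 1 / 2 * ln (Q x y)) has_real_derivative (x - Re w) / Q x y) (at x)" for x y
      using Q[of x y] by (auto intro!: derivative_eq_intros dx simp: field_simps)
    show "((\<lambda>y. 1 / 2 * ln (Q x y)) has_real_derivative (y - Im w) / Q x y) (at y)" for x y
      using Q[of x y] by (auto intro!: derivative_eq_intros dy simp: field_simps)
    show "((\<lambda>x. (x - Re w) / Q x y) has_real_derivative 1 / Q x y - 2 * (x - Re w)\<^sup>2 / (Q x y)\<^sup>2) (at x)" for x y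
      using Q0[of x y] by (auto intro!: derivative_eq_intros dx simp: field_simps power2_eq_square)
    show "((\<lambda>y. (y - Im w) / Q x y) has_real_derivative 1 / Q x y - 2 * (y - Im w)\<^sup>2 / (Q x y)\<^sup>2) (at y)" for x y
      using Q0[of x y] by (auto intro!: derivative_eq_intros dy simp: field_simps power2_eq_square)
  qed (auto intro!: continuous_intros cQ simp: Q0 Q order_less_imp_not_eq2)
  define F where "F = (\<lambda>p. 2 * \<epsilon>\<^sup>2 / (Q (fst p) (snd p))\<^sup>2 * (\<alpha> (fst p) * \<beta> (snd p)))"
  have Fe: "((1 / Q (fst p) (snd p) - 2 * (fst p - Re w)\<^sup>2 / (Q (fst p) (snd p))\<^sup>2) +
               (1 / Q (fst p) (snd p) - 2 * (snd p - Im w)\<^sup>2 / (Q (fst p) (snd p))\<^sup>2)) * (\<alpha> (fst p) * \<beta> (snd p)) = F p" for p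
  proof -
    have *: "1 / q - 2 * r / q\<^sup>2 + (1 / q - 2 * s / q\<^sup>2) = 2 * t / q\<^sup>2" if "q = r + s + t" "q \<noteq> 0" for q r s t :: real
      using that(2) by (simp add: field_simps power2_eq_square) (simp add: that(1) algebra_simps)
    have q: "Q (fst p) (snd p) = (fst p - Re w)\<^sup>2 + (snd p - Im w)\<^sup>2 + \<epsilon>\<^sup>2" by (simp add: Q_def)
    show ?thesis unfolding F_def using *[OF q Q0] by (simp only:)
  qed
  note ca = C2_supported_continuous[OF \<alpha>, of UNIV] and cb = C2_supported_continuous[OF \<beta>, of UNIV]
  have iF: "integrable lborel F"
  proof (rule integrable_continuous_box[of a b c d])
    show "continuous_on ({a..b} \<times> {c..d}) F" unfolding F_def
      by (intro continuous_intros cQ continuous_on_fst_snd ca cb) (simp add: Q0)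
    show "F p = 0" if "p \<notin> {a..b} \<times> {c..d}" for p
    proof (cases "fst p \<in> {a..b}")
      case True
      hence "snd p \<notin> {c..d}" using that by (cases p) auto
      hence "\<beta> (snd p) = 0" using \<beta> by (auto simp: C2_supported_def)
      thus ?thesis by (simp add: F_def)
    next
      case False
      hence "\<alpha> (fst p) = 0" using \<alpha> by (auto simp: C2_supported_def)
      thus ?thesis by (simp add: F_def)
    qed
  qed
  define K where "K = (\<lambda>p. log_kernel p * (\<alpha> (Re w + \<epsilon> * fst p) * \<beta> (Im w + \<epsilon> * snd p)))"
  obtain Ca Cb where C: "Ca > 0" "\<And>x. \<bar>\<alpha> x\<bar> \<le> Ca" "Cb > 0" "\<And>x. \<bar>\<beta> x\<bar> \<le> Cb"
    using C2_supported_bounded[OF \<alpha>] C2_supported_bounded[OF \<beta>] by blast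
  have [measurable]: "\<alpha> \<in> borel_measurable borel" "\<beta> \<in> borel_measurable borel"
    using C2_supported_measurable[OF \<alpha>] C2_supported_measurable[OF \<beta>] by auto
  have iK: "integrable lborel K"
  proof (rule Bochner_Integration.integrable_bound[of _ "\<lambda>p. (Ca * Cb) * log_kernel p"])
    show "integrable lborel (\<lambda>p. (Ca * Cb) * log_kernel p)" by (intro integrable_mult_right log_kernel_integrable)
    have "continuous_on UNIV K" unfolding K_def
      by (intro continuous_intros log_kernel_continuous continuous_on_compose2[OF ca(1)] continuous_on_compose2[OF cb(1)]) auto
    thus "K \<in> borel_measurable lborel" by (simp add: borel_measurable_continuous_onI)
    show "AE p in lborel. norm (K p) \<le> norm (Ca * Cb * log_kernel p)"
    proof (rule AE_I2)
      fix p
      have "norm (K p) = log_kernel p * (\<bar>\<alpha> (Re w + \<epsilon> * fst p)\<bar> * \<bar>\<beta> (Im w + \<epsilon> * snd p)\<bar>)"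
        using log_kernel_nonneg[of p] by (simp add: K_def abs_mult)
      also have "\<dots> \<le> log_kernel p * (Ca * Cb)"
        using C log_kernel_nonneg[of p] by (intro mult_left_mono mult_mono) (auto simp: less_imp_le)
      finally show "norm (K p) \<le> norm (Ca * Cb * log_kernel p)" using C log_kernel_nonneg[of p] by (simp add: mult_ac)
    qed
  qed
  have "(\<integral>p. F p \<partial>lborel) = (\<integral>x. (\<integral>y. F (x, y) \<partial>lborel) \<partial>lborel)"
    by (rule Fubini_fst[OF iF])
  also have "\<dots> = \<epsilon> * (\<integral>x. (\<integral>y. F (Re w + \<epsilon> * x, y) \<partial>lborel) \<partial>lborel)"
    by (subst lborel_integral_real_affine[of \<epsilon> _ "Re w"]) (use e in auto)
  also have "\<dots> = \<epsilon> * (\<integral>x. \<epsilon> * (\<integral>y. F (Re w + \<epsilon> * x, Im w + \<epsilon> * y) \<partial>lborel) \<partial>lborel)"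
    by (subst lborel_integral_real_affine[of \<epsilon> _ "Im w"]) (use e in auto)
  also have "\<dots> = (\<integral>x. (\<integral>y. \<epsilon>\<^sup>2 * F (Re w + \<epsilon> * x, Im w + \<epsilon> * y) \<partial>lborel) \<partial>lborel)"
    by (simp add: power2_eq_square mult.assoc)
  also have "\<dots> = (\<integral>x. (\<integral>y. K (x, y) \<partial>lborel) \<partial>lborel)"
  proof -
    have "\<epsilon>\<^sup>2 * F (Re w + \<epsilon> * x, Im w + \<epsilon> * y) = K (x, y)" for x y
    proof -
      have "Q (Re w + \<epsilon> * x) (Im w + \<epsilon> * y) = \<epsilon>\<^sup>2 * (1 + x\<^sup>2 + y\<^sup>2)"
        by (simp add: Q_def power_mult_distrib algebra_simps)
      thus ?thesis using e unfolding F_def K_def log_kernel_def by (simp add: power_mult_distrib power2_eq_square)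
    qed
    thus ?thesis by simp
  qed
  also have "\<dots> = (\<integral>p. K p \<partial>lborel)" by (rule Fubini_fst[OF iK, symmetric])
  finally show ?thesis using G unfolding Fe by (simp add: reg_log_def Q_def K_def)
qed

text \<open>$\log|p - w|$ is, up to the constant, the fundamental solution of the Laplace equation: let
  $\epsilon \to 0$ in \<open>reg_log_Laplacian\<close>, by dominated convergence on both sides.\<close>

lemma log_potential:
  assumes \<alpha>: "C2_supported a b \<alpha> \<alpha>' \<alpha>''" and \<beta>: "C2_supported c d \<beta> \<beta>' \<beta>''"
  shows "integrable lborel (\<lambda>p. ln (norm (Complex (fst p) (snd p) - w)) * (\<alpha>'' (fst p) * \<beta> (snd p) + \<alpha> (fst p) * \<beta>'' (snd p)))"
        "(\<integral>p. ln (norm (Complex (fst p) (snd p) - w)) * (\<alpha>'' (fst p) * \<beta> (snd p) + \<alpha> (fst p) * \<beta>'' (snd p)) \<partial>lborel)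
          = log_const * (\<alpha> (Re w) * \<beta> (Im w))"
proof -
  define \<Delta> where "\<Delta> = (\<lambda>p::real\<times>real. \<alpha>'' (fst p) * \<beta> (snd p) + \<alpha> (fst p) * \<beta>'' (snd p))"
  define e where "e = (\<lambda>n. 1 / real (Suc n))"
  have e: "e n > 0" "e n \<le> 1" for n by (auto simp: e_def)
  have e0: "e \<longlonglongrightarrow> 0" unfolding e_def by (rule LIMSEQ_Suc[OF lim_1_over_n])
  obtain Ca Cb where C: "Ca > 0" "\<And>x. \<bar>\<alpha> x\<bar> \<le> Ca" "\<And>x. \<bar>\<alpha>'' x\<bar> \<le> Ca" "Cb > 0" "\<And>x. \<bar>\<beta> x\<bar> \<le> Cb" "\<And>x. \<bar>\<beta>'' x\<bar> \<le> Cb"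
    using C2_supported_bounded[OF \<alpha>] C2_supported_bounded[OF \<beta>] by blast
  note ca = C2_supported_continuous[OF \<alpha>, of UNIV] and cb = C2_supported_continuous[OF \<beta>, of UNIV]
  have [measurable]: "\<alpha> \<in> borel_measurable borel" "\<beta> \<in> borel_measurable borel" "\<alpha>'' \<in> borel_measurable borel" "\<beta>'' \<in> borel_measurable borel"
    using C2_supported_measurable[OF \<alpha>] C2_supported_measurable[OF \<beta>] by auto
  have [measurable]: "\<Delta> \<in> borel_measurable borel"
    unfolding \<Delta>_def by (intro borel_measurable_continuous_onI continuous_intros continuous_on_fst_snd ca cb)
  have \<Delta>b: "\<bar>\<Delta> p\<bar> \<le> 2 * Ca * Cb" for p
  proof -
    have "\<bar>\<Delta> p\<bar> \<le> \<bar>\<alpha>'' (fst p)\<bar> * \<bar>\<beta> (snd p)\<bar> + \<bar>\<alpha> (fst p)\<bar> * \<bar>\<beta>'' (snd p)\<bar>"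
      unfolding \<Delta>_def by (rule order_trans[OF abs_triangle_ineq]) (simp add: abs_mult)
    also have "\<dots> \<le> Ca * Cb + Ca * Cb" using C by (intro add_mono mult_mono) (auto simp: less_imp_le)
    finally show ?thesis by simp
  qed
  have \<Delta>0: "\<Delta> p = 0" if "p \<notin> {a..b} \<times> {c..d}" for p
  proof (cases "fst p \<in> {a..b}")
    case True
    hence "snd p \<notin> {c..d}" using that by (cases p) auto
    hence "\<beta> (snd p) = 0" "\<beta>'' (snd p) = 0" using \<beta> by (auto simp: C2_supported_def)
    thus ?thesis by (simp add: \<Delta>_def)
  next
    case False
    hence "\<alpha> (fst p) = 0" "\<alpha>'' (fst p) = 0" using \<alpha> by (auto simp: C2_supported_def)
    thus ?thesis by (simp add: \<Delta>_def)
  qed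
  obtain D where D: "D > 0" "\<And>\<epsilon> p. \<lbrakk>0 \<le> \<epsilon>; \<epsilon> \<le> 1; p \<in> {a..b} \<times> {c..d}; fst p \<noteq> Re w\<rbrakk>
     \<Longrightarrow> \<bar>reg_log \<epsilon> w p\<bar> \<le> \<bar>ln \<bar>fst p - Re w\<bar>\<bar> + D"
    using reg_log_bound[of a b c d w] by blast
  define W where "W = (\<lambda>p. (2 * Ca * Cb) * (indicator ({a..b} \<times> {c..d}) p * (\<bar>ln \<bar>fst p - Re w\<bar>\<bar> + D)))"
  have iW: "integrable lborel W" unfolding W_def by (intro integrable_mult_right integrable_log_dominator)
  have lim: "AE p in lborel. (\<lambda>n. reg_log (e n) w p * \<Delta> p) \<longlonglongrightarrow> reg_log 0 w p * \<Delta> p"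
    using AE_fst_neq'[of "Re w"]
  proof eventually_elim
    case (elim p)
    have "(fst p - Re w)\<^sup>2 + (snd p - Im w)\<^sup>2 + 0\<^sup>2 \<noteq> 0" using elim by simp
    thus ?case unfolding reg_log_def by (intro tendsto_intros e0)
  qed
  have bnd: "AE p in lborel. norm (reg_log (e n) w p * \<Delta> p) \<le> W p" for n
    using AE_fst_neq'[of "Re w"]
  proof eventually_elim
    case (elim p)
    show ?case
    proof (cases "p \<in> {a..b} \<times> {c..d}")
      case True
      have "norm (reg_log (e n) w p * \<Delta> p) = \<bar>\<Delta> p\<bar> * \<bar>reg_log (e n) w p\<bar>" by (simp add: abs_mult)
      also have "\<dots> \<le> (2 * Ca * Cb) * (\<bar>ln \<bar>fst p - Re w\<bar>\<bar> + D)"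
        using D(2)[OF _ _ True elim, of "e n"] e[of n] \<Delta>b[of p] C by (intro mult_mono) (auto simp: less_imp_le)
      finally show ?thesis using True by (simp add: W_def)
    next
      case False thus ?thesis using \<Delta>0[OF False] by (simp add: W_def)
    qed
  qed
  have m: "(\<lambda>p. reg_log x w p * \<Delta> p) \<in> borel_measurable lborel" for x by simp
  have "integrable lborel (\<lambda>p. reg_log 0 w p * \<Delta> p)"
    by (rule integrable_dominated_convergence[OF m m iW lim bnd])
  thus "integrable lborel (\<lambda>p. ln (norm (Complex (fst p) (snd p) - w)) * (\<alpha>'' (fst p) * \<beta> (snd p) + \<alpha> (fst p) * \<beta>'' (snd p)))"
    by (simp add: reg_log_0 \<Delta>_def)
  have L1: "(\<lambda>n. \<integral>p. reg_log (e n) w p * \<Delta> p \<partial>lborel) \<longlonglongrightarrow> (\<integral>p. reg_log 0 w p * \<Delta> p \<partial>lborel)"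
    by (rule integral_dominated_convergence[OF m m iW lim bnd])
  define K where "K = (\<lambda>t p. log_kernel p * (\<alpha> (Re w + t * fst p) * \<beta> (Im w + t * snd p)))"
  have mK: "K t \<in> borel_measurable lborel" for t
  proof -
    have "continuous_on UNIV (K t)" unfolding K_def
      by (intro continuous_intros log_kernel_continuous continuous_on_compose2[OF ca(1)] continuous_on_compose2[OF cb(1)]) auto
    thus ?thesis by (simp add: borel_measurable_continuous_onI)
  qed
  have L2: "(\<lambda>n. \<integral>p. K (e n) p \<partial>lborel) \<longlonglongrightarrow> (\<integral>p. K 0 p \<partial>lborel)"
  proof (rule integral_dominated_convergence[OF mK mK])
    show "integrable lborel (\<lambda>p. (Ca * Cb) * log_kernel p)" by (intro integrable_mult_right log_kernel_integrable)
    show "AE p in lborel. (\<lambda>n. K (e n) p) \<longlonglongrightarrow> K 0 p"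
    proof (rule AE_I2)
      fix p
      have "isCont \<alpha> x" "isCont \<beta> x" for x
        using \<alpha> \<beta> by (auto simp: C2_supported_def intro: DERIV_isCont)
      thus "(\<lambda>n. K (e n) p) \<longlonglongrightarrow> K 0 p" unfolding K_def
        by (intro tendsto_intros isCont_tendsto_compose[of _ \<alpha>] isCont_tendsto_compose[of _ \<beta>] e0) auto
    qed
    show "AE p in lborel. norm (K (e n) p) \<le> (Ca * Cb) * log_kernel p" for n
    proof (rule AE_I2)
      fix p
      have "norm (K (e n) p) = log_kernel p * (\<bar>\<alpha> (Re w + e n * fst p)\<bar> * \<bar>\<beta> (Im w + e n * snd p)\<bar>)"
        using log_kernel_nonneg[of p] by (simp add: K_def abs_mult)
      also have "\<dots> \<le> log_kernel p * (Ca * Cb)"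
        using C log_kernel_nonneg[of p] by (intro mult_left_mono mult_mono) (auto simp: less_imp_le)
      finally show "norm (K (e n) p) \<le> Ca * Cb * log_kernel p" by (simp add: mult_ac)
    qed
  qed
  have "(\<integral>p. reg_log (e n) w p * \<Delta> p \<partial>lborel) = (\<integral>p. K (e n) p \<partial>lborel)" for n
    unfolding \<Delta>_def K_def by (rule reg_log_Laplacian[OF \<alpha> \<beta> e(1)])
  with L1 L2 have "(\<integral>p. reg_log 0 w p * \<Delta> p \<partial>lborel) = (\<integral>p. K 0 p \<partial>lborel)"
    by (simp add: LIMSEQ_unique)
  also have "\<dots> = log_const * (\<alpha> (Re w) * \<beta> (Im w))" by (simp add: K_def log_const_def)
  finally show "(\<integral>p. ln (norm (Complex (fst p) (snd p) - w)) * (\<alpha>'' (fst p) * \<beta> (snd p) + \<alpha> (fst p) * \<beta>'' (snd p)) \<partial>lborel)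
          = log_const * (\<alpha> (Re w) * \<beta> (Im w))" by (simp add: reg_log_0 \<Delta>_def)
qed

section \<open>Jensen's formula in weighted form\<close>

lemma DERIV_Re_Complex:
  assumes "(H has_field_derivative D) (at (Complex x y))"
  shows "((\<lambda>x. Re (H (Complex x y))) has_real_derivative Re D) (at x)"
        "((\<lambda>y. Re (H (Complex x y))) has_real_derivative - Im D) (at y)"
        "((\<lambda>y. Im (H (Complex x y))) has_real_derivative Re D) (at y)"
proof -
  have "((\<lambda>x. of_real x + \<i> * of_real y) has_vector_derivative 1) (at x)"
    by (auto intro!: derivative_eq_intros)
  hence "((\<lambda>x. Complex x y) has_vector_derivative 1) (at x)" by (simp add: Complex_eq)
  from field_vector_diff_chain_at[OF this assms]
  have "((\<lambda>x. H (Complex x y)) has_vector_derivative D) (at x)" by (simp add: o_def)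
  from bounded_linear.has_vector_derivative[OF bounded_linear_Re this]
  show "((\<lambda>x. Re (H (Complex x y))) has_real_derivative Re D) (at x)"
    by (simp add: has_real_derivative_iff_has_vector_derivative)
  have "((\<lambda>y. of_real x + \<i> * of_real y) has_vector_derivative \<i>) (at y)"
    by (auto intro!: derivative_eq_intros)
  hence "((\<lambda>y. Complex x y) has_vector_derivative \<i>) (at y)" by (simp add: Complex_eq)
  from field_vector_diff_chain_at[OF this assms]
  have v: "((\<lambda>y. H (Complex x y)) has_vector_derivative \<i> * D) (at y)" by (simp add: o_def)
  from bounded_linear.has_vector_derivative[OF bounded_linear_Re v]
  show "((\<lambda>y. Re (H (Complex x y))) has_real_derivative - Im D) (at y)"
    by (simp add: has_real_derivative_iff_has_vector_derivative)
  from bounded_linear.has_vector_derivative[OF bounded_linear_Im v]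
  show "((\<lambda>y. Im (H (Complex x y))) has_real_derivative Re D) (at y)"
    by (simp add: has_real_derivative_iff_has_vector_derivative)
qed

text \<open>By the Cauchy--Riemann equations $\mathrm{Re}\, H$ is harmonic, so Green's identity gives zero.\<close>

lemma harmonic_orthogonal:
  assumes \<alpha>: "C2_supported a b \<alpha> \<alpha>' \<alpha>''" and \<beta>: "C2_supported c d \<beta> \<beta>' \<beta>''"
  assumes H: "H holomorphic_on A" "open A" and sub: "\<And>x y. x \<in> {a..b} \<Longrightarrow> y \<in> {c..d} \<Longrightarrow> Complex x y \<in> A"
  shows "integrable lborel (\<lambda>p. Re (H (Complex (fst p) (snd p))) * (\<alpha>'' (fst p) * \<beta> (snd p) + \<alpha> (fst p) * \<beta>'' (snd p)))"
        "(\<integral>p. Re (H (Complex (fst p) (snd p))) * (\<alpha>'' (fst p) * \<beta> (snd p) + \<alpha> (fst p) * \<beta>'' (snd p)) \<partial>lborel) = 0"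
proof -
  define H1 where "H1 = deriv H"
  define H2 where "H2 = deriv H1"
  have H1: "H1 holomorphic_on A" unfolding H1_def by (intro holomorphic_deriv H)
  have H2: "H2 holomorphic_on A" unfolding H2_def by (intro holomorphic_deriv H1 H)
  have d0: "(H has_field_derivative H1 z) (at z)" if "z \<in> A" for z
    unfolding H1_def by (rule holomorphic_derivI[OF H that])
  have d1: "(H1 has_field_derivative H2 z) (at z)" if "z \<in> A" for z
    unfolding H2_def by (rule holomorphic_derivI[OF H1 H(2) that])
  have cont: "continuous_on ({a..b} \<times> {c..d}) (\<lambda>p. g (Complex (fst p) (snd p)))" if "g holomorphic_on A" for g
    by (rule continuous_on_compose2[OF holomorphic_on_imp_continuous_on[OF that]])
       (auto intro!: continuous_intros sub)
  note G = Green_smooth[OF \<alpha> \<beta> DERIV_Re_Complex(1)[OF d0[OF sub]] DERIV_Re_Complex(1)[OF d1[OF sub]] _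
     DERIV_Re_Complex(2)[OF d0[OF sub]] DERIV_minus[OF DERIV_Re_Complex(3)[OF d1[OF sub]]]]
  have c: "continuous_on ({a..b} \<times> {c..d}) (\<lambda>p. Re (H2 (Complex (fst p) (snd p))))"
    "continuous_on ({a..b} \<times> {c..d}) (\<lambda>p. - Re (H2 (Complex (fst p) (snd p))))"
    "continuous_on ({a..b} \<times> {c..d}) (\<lambda>p. Re (H (Complex (fst p) (snd p))))"
    by (intro continuous_intros cont H H2)+
  show "integrable lborel (\<lambda>p. Re (H (Complex (fst p) (snd p))) * (\<alpha>'' (fst p) * \<beta> (snd p) + \<alpha> (fst p) * \<beta>'' (snd p)))"
    by (rule G(1)[OF _ _ _ _ c(1) _ _ _ _ c(2,3)])
  show "(\<integral>p. Re (H (Complex (fst p) (snd p))) * (\<alpha>'' (fst p) * \<beta> (snd p) + \<alpha> (fst p) * \<beta>'' (snd p)) \<partial>lborel) = 0"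
    by (subst G(2)[OF _ _ _ _ c(1) _ _ _ _ c(2,3)]) simp_all
qed

lemma entire_finite_zeros_box:
  assumes L: "L holomorphic_on UNIV" and z0: "L z0 \<noteq> 0"
  shows "finite {w. L w = 0 \<and> Re w \<in> {a..b} \<and> Im w \<in> {c..d}}"
proof (cases "\<exists>w. L w = 0")
  case True
  then obtain w where w: "L w = 0" by blast
  have "finite {z \<in> cbox (Complex a c) (Complex b d). L z = 0}"
  proof (rule holomorphic_compact_finite_zeros[OF L])
    show "\<not> L constant_on UNIV" unfolding constant_on_def using w z0 by (metis UNIV_I)
  qed auto
  also have "{z \<in> cbox (Complex a c) (Complex b d). L z = 0} = {w. L w = 0 \<and> Re w \<in> {a..b} \<and> Im w \<in> {c..d}}"
    by (auto simp: in_cbox_complex_iff)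
  finally show ?thesis .
qed auto

lemma entire_frequently_nonzero:
  assumes L: "L holomorphic_on UNIV" and z0: "L z0 \<noteq> 0"
  shows "frequently (\<lambda>z. L z \<noteq> 0) (at z)"
proof (rule eventually_frequently)
  show "eventually (\<lambda>z. L z \<noteq> 0) (at z)"
    using non_zero_neighbour_alt[OF L, of z z0] z0 by auto
qed auto

lemma zorder_entire_nonneg:
  assumes L: "L holomorphic_on UNIV" and z0: "L z0 \<noteq> 0"
  shows "zorder L z \<ge> 0" "zorder L z > 0 \<longleftrightarrow> L z = 0"
  using zorder_ge_0[of L z] zorder_pos_iff'[of L z] entire_frequently_nonzero[OF L z0] L
  by (auto simp: analytic_on_holomorphic)

text \<open>On a rectangle slightly larger than the given one, divide $L$ by the product of $(z-w)^{m_w}$ over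
  its zeros; the quotient has no zeros on a convex set and therefore has a holomorphic logarithm $H$.\<close>

lemma log_norm_factorization:
  assumes L: "L holomorphic_on UNIV" and z0: "L z0 \<noteq> 0" and ab: "a < b" "c < d"
  obtains A H Z where "open A" "\<And>x y. x \<in> {a..b} \<Longrightarrow> y \<in> {c..d} \<Longrightarrow> Complex x y \<in> A" "H holomorphic_on A"
     "finite Z" "Z = {w\<in>A. L w = 0}"
     "\<And>z. z \<in> A \<Longrightarrow> z \<notin> Z \<Longrightarrow> ln (norm (L z)) = Re (H z) + (\<Sum>w\<in>Z. real_of_int (zorder L w) * ln (norm (z - w)))"
proof -
  define A where "A = box (Complex (a-1) (c-1)) (Complex (b+1) (d+1))"
  define Z where "Z = {w\<in>A. L w = 0}"
  have A: "open A" "convex A" "connected A" unfolding A_def by (auto intro: convex_connected convex_box)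
  have "Z \<subseteq> {w. L w = 0 \<and> Re w \<in> {a-1..b+1} \<and> Im w \<in> {c-1..d+1}}"
    by (auto simp: Z_def A_def in_box_complex_iff)
  hence fin: "finite Z" using entire_finite_zeros_box[OF L z0] finite_subset by blast
  define m where "m = (\<lambda>w. nat (zorder L w))"
  have m: "real (m w) = real_of_int (zorder L w)" "int (m w) = zorder L w" for w
    using zorder_entire_nonneg[OF L z0, of w] by (auto simp: m_def)
  have mpos: "m w > 0 \<longleftrightarrow> L w = 0" for w
    using zorder_entire_nonneg[OF L z0, of w] by (auto simp: m_def)
  define P where "P = (\<lambda>z. \<Prod>w\<in>Z. (z - w) ^ m w)"
  have P: "P holomorphic_on UNIV" unfolding P_def by (intro holomorphic_intros)
  have P0: "P z = 0 \<longleftrightarrow> z \<in> Z" for z unfolding P_def using fin mpos by (auto simp: prod_zero_iff Z_def)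
  have zP: "zorder L z = zorder P z" if "z \<in> A" for z
  proof (cases "L z = 0")
    case True
    hence z: "z \<in> Z" using that by (simp add: Z_def)
    have "zorder P z = int (m z)"
    proof (rule zorder_eqI[where S = UNIV and g = "\<lambda>x. \<Prod>w\<in>Z-{z}. (x - w) ^ m w"])
      show "(\<lambda>x. \<Prod>w\<in>Z-{z}. (x - w) ^ m w) holomorphic_on UNIV" by (intro holomorphic_intros)
      show "(\<Prod>w\<in>Z-{z}. (z - w) ^ m w) \<noteq> 0" using fin by (subst prod_zero_iff) auto
      show "P x = (\<Prod>w\<in>Z-{z}. (x - w) ^ m w) * (x - z) powi int (m z)" for x
        unfolding P_def by (subst prod.remove[OF fin z]) (simp add: mult.commute)
    qed auto
    thus ?thesis using m by simp
  next
    case False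
    hence "P z \<noteq> 0" using P0 by (simp add: Z_def)
    hence "zorder P z = 0" using P by (intro zorder_eq_0I) (auto simp: analytic_on_holomorphic)
    moreover have "zorder L z = 0" using L False by (intro zorder_eq_0I) (auto simp: analytic_on_holomorphic)
    ultimately show ?thesis by simp
  qed
  obtain h where h: "h holomorphic_on A" "\<And>z. z \<in> A \<Longrightarrow> h z \<noteq> 0" "\<And>z. z \<in> A \<Longrightarrow> L z = h z * P z"
  proof (rule holomorphic_zorder_factorization[OF _ A(1,3), of L P])
    show "L holomorphic_on A" "P holomorphic_on A" using L P holomorphic_on_subset by blast+
    show "P z = 0 \<longleftrightarrow> L z = 0" if "z \<in> A" for z using P0 that by (auto simp: Z_def)
    show "zorder P z = zorder L z" if "z \<in> A" for z using zP[OF that] by simp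
  qed blast
  have "Complex a c \<in> A" using ab by (auto simp: A_def in_box_complex_iff)
  from holomorphic_logarithm_exists[OF A(2,1) h(1,2) this] obtain H where
    H: "H holomorphic_on A" "\<And>x. x \<in> A \<Longrightarrow> exp (H x) = h x" by metis
  show ?thesis
  proof (rule that[of A H Z])
    show "Complex x y \<in> A" if "x \<in> {a..b}" "y \<in> {c..d}" for x y
      using that by (auto simp: A_def in_box_complex_iff)
    fix z assume z: "z \<in> A" "z \<notin> Z"
    have "ln (norm (L z)) = ln (exp (Re (H z)) * (\<Prod>w\<in>Z. norm (z - w) ^ m w))"
      using h(3)[OF z(1)] H(2)[OF z(1)] by (simp add: norm_mult P_def norm_power prod_norm[symmetric] flip: norm_exp_eq_Re)
    also have "\<dots> = Re (H z) + ln (\<Prod>w\<in>Z. norm (z - w) ^ m w)"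
      using z by (subst ln_mult) (auto simp: prod_zero_iff fin prod_pos)
    also have "ln (\<Prod>w\<in>Z. norm (z - w) ^ m w) = (\<Sum>w\<in>Z. ln (norm (z - w) ^ m w))"
      using z by (intro ln_prod fin) auto
    also have "\<dots> = (\<Sum>w\<in>Z. real_of_int (zorder L w) * ln (norm (z - w)))"
      using z by (intro sum.cong refl) (auto simp: ln_realpow m)
    finally show "ln (norm (L z)) = Re (H z) + (\<Sum>w\<in>Z. real_of_int (zorder L w) * ln (norm (z - w)))" .
  qed (use A H fin Z_def in auto)
qed

lemma AE_Complex_notin_finite:
  assumes "finite Z"
  shows "AE p in lborel. Complex (fst p) (snd p) \<notin> Z"
proof -
  have "finite ((\<lambda>w. (Re w, Im w)) ` Z)" using assms by simp
  hence "AE p in lborel. p \<notin> (\<lambda>w. (Re w, Im w)) ` Z"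
    by (intro AE_not_in finite_imp_null_set_lborel)
  thus ?thesis
  proof eventually_elim
    case (elim p)
    thus ?case using imageI[of "Complex (fst p) (snd p)" Z "\<lambda>w. (Re w, Im w)"] by auto
  qed
qed

lemma entire_log_norm_measurable:
  assumes "L holomorphic_on UNIV"
  shows "(\<lambda>p. L (Complex (fst p) (snd p))) \<in> borel_measurable borel"
  by (rule borel_measurable_continuous_onI, rule continuous_on_compose2[OF holomorphic_on_imp_continuous_on[OF assms]])
     (auto intro!: continuous_intros)

text \<open>Jensen's formula with a smooth weight: by the factorization, $\log|L|$ is a harmonic function plus
  finitely many logarithmic potentials.\<close>

theorem Green_log_norm:
  assumes L: "L holomorphic_on UNIV" and z0: "L z0 \<noteq> 0"
  assumes \<alpha>: "C2_supported a b \<alpha> \<alpha>' \<alpha>''" and \<beta>: "C2_supported c d \<beta> \<beta>' \<beta>''"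
  shows "integrable lborel (\<lambda>p. ln (norm (L (Complex (fst p) (snd p)))) * (\<alpha>'' (fst p) * \<beta> (snd p) + \<alpha> (fst p) * \<beta>'' (snd p)))"
        "(\<integral>p. ln (norm (L (Complex (fst p) (snd p)))) * (\<alpha>'' (fst p) * \<beta> (snd p) + \<alpha> (fst p) * \<beta>'' (snd p)) \<partial>lborel)
          = log_const * (\<Sum>w\<in>{w. L w = 0 \<and> Re w \<in> {a..b} \<and> Im w \<in> {c..d}}. real_of_int (zorder L w) * (\<alpha> (Re w) * \<beta> (Im w)))"
proof -
  define \<Delta> where "\<Delta> = (\<lambda>p::real\<times>real. \<alpha>'' (fst p) * \<beta> (snd p) + \<alpha> (fst p) * \<beta>'' (snd p))"
  have ab: "a < b" "c < d" using \<alpha> \<beta> by (auto simp: C2_supported_def)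
  obtain A H Z where A: "open A" "\<And>x y. x \<in> {a..b} \<Longrightarrow> y \<in> {c..d} \<Longrightarrow> Complex x y \<in> A"
     and H: "H holomorphic_on A" and Z: "finite Z" "Z = {w\<in>A. L w = 0}" and
     f: "\<And>z. z \<in> A \<Longrightarrow> z \<notin> Z \<Longrightarrow> ln (norm (L z)) = Re (H z) + (\<Sum>w\<in>Z. real_of_int (zorder L w) * ln (norm (z - w)))"
    by (rule log_norm_factorization[OF L z0 ab]) (rule that)
  have hh: "integrable lborel (\<lambda>p. Re (H (Complex (fst p) (snd p))) * \<Delta> p)"
      "(\<integral>p. Re (H (Complex (fst p) (snd p))) * \<Delta> p \<partial>lborel) = 0"
    unfolding \<Delta>_def by (rule harmonic_orthogonal[OF \<alpha> \<beta> H A]; assumption)+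
  have lp: "integrable lborel (\<lambda>p. ln (norm (Complex (fst p) (snd p) - w)) * \<Delta> p)"
      "(\<integral>p. ln (norm (Complex (fst p) (snd p) - w)) * \<Delta> p \<partial>lborel) = log_const * (\<alpha> (Re w) * \<beta> (Im w))" for w
    unfolding \<Delta>_def by (rule log_potential[OF \<alpha> \<beta>])+
  have \<Delta>0: "\<Delta> p = 0" if "p \<notin> {a..b} \<times> {c..d}" for p
  proof (cases "fst p \<in> {a..b}")
    case True
    hence "snd p \<notin> {c..d}" using that by (cases p) auto
    hence "\<beta> (snd p) = 0" "\<beta>'' (snd p) = 0" using \<beta> by (auto simp: C2_supported_def)
    thus ?thesis by (simp add: \<Delta>_def)
  next
    case False
    hence "\<alpha> (fst p) = 0" "\<alpha>'' (fst p) = 0" using \<alpha> by (auto simp: C2_supported_def)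
    thus ?thesis by (simp add: \<Delta>_def)
  qed
  define F where "F = (\<lambda>p. Re (H (Complex (fst p) (snd p))) * \<Delta> p +
     (\<Sum>w\<in>Z. real_of_int (zorder L w) * (ln (norm (Complex (fst p) (snd p) - w)) * \<Delta> p)))"
  have iF: "integrable lborel F" unfolding F_def
    by (intro Bochner_Integration.integrable_add Bochner_Integration.integrable_sum integrable_mult_right hh(1) lp(1))
  have ae: "AE p in lborel. F p = ln (norm (L (Complex (fst p) (snd p)))) * \<Delta> p"
    using AE_Complex_notin_finite[OF Z(1)]
  proof eventually_elim
    case (elim p)
    show ?case
    proof (cases "p \<in> {a..b} \<times> {c..d}")
      case True
      hence "Complex (fst p) (snd p) \<in> A" using A(2)[of "fst p" "snd p"] by (cases p) auto
      from f[OF this elim] show ?thesis unfolding F_def by (simp add: distrib_right sum_distrib_right mult.assoc)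
    next
      case False
      thus ?thesis using \<Delta>0 by (simp add: F_def)
    qed
  qed
  have [measurable]: "(\<lambda>p. L (Complex (fst p) (snd p))) \<in> borel_measurable borel"
    by (rule entire_log_norm_measurable[OF L])
  have [measurable]: "\<Delta> \<in> borel_measurable borel"
    unfolding \<Delta>_def by (intro borel_measurable_continuous_onI continuous_intros continuous_on_fst_snd
       C2_supported_continuous[OF \<alpha>] C2_supported_continuous[OF \<beta>])
  have m: "(\<lambda>p. ln (norm (L (Complex (fst p) (snd p)))) * \<Delta> p) \<in> borel_measurable lborel" by simp
  have mF: "F \<in> borel_measurable lborel" using iF by (rule borel_measurable_integrable)
  have ae': "AE p in lborel. ln (norm (L (Complex (fst p) (snd p)))) * \<Delta> p = F p"
    using ae by eventually_elim simp
  from integrable_cong_AE_imp[OF iF m ae]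
  show "integrable lborel (\<lambda>p. ln (norm (L (Complex (fst p) (snd p)))) * (\<alpha>'' (fst p) * \<beta> (snd p) + \<alpha> (fst p) * \<beta>'' (snd p)))"
    unfolding \<Delta>_def .
  have "(\<integral>p. ln (norm (L (Complex (fst p) (snd p)))) * \<Delta> p \<partial>lborel) = (\<integral>p. F p \<partial>lborel)"
    by (rule integral_cong_AE[OF m mF ae'])
  also have "\<dots> = (\<integral>p. Re (H (Complex (fst p) (snd p))) * \<Delta> p \<partial>lborel) +
     (\<Sum>w\<in>Z. real_of_int (zorder L w) * (\<integral>p. ln (norm (Complex (fst p) (snd p) - w)) * \<Delta> p \<partial>lborel))"
    unfolding F_def
    by (subst Bochner_Integration.integral_add, rule hh, intro Bochner_Integration.integrable_sum integrable_mult_right lp(1))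
       (subst Bochner_Integration.integral_sum, intro integrable_mult_right lp(1), simp)
  also have "\<dots> = log_const * (\<Sum>w\<in>Z. real_of_int (zorder L w) * (\<alpha> (Re w) * \<beta> (Im w)))"
    unfolding hh(2) lp(2) by (simp add: sum_distrib_left mult_ac)
  also have "(\<Sum>w\<in>Z. real_of_int (zorder L w) * (\<alpha> (Re w) * \<beta> (Im w))) =
      (\<Sum>w\<in>{w. L w = 0 \<and> Re w \<in> {a..b} \<and> Im w \<in> {c..d}}. real_of_int (zorder L w) * (\<alpha> (Re w) * \<beta> (Im w)))"
  proof (rule sum.mono_neutral_right[OF Z(1)])
    show "{w. L w = 0 \<and> Re w \<in> {a..b} \<and> Im w \<in> {c..d}} \<subseteq> Z"
    proof
      fix w assume "w \<in> {w. L w = 0 \<and> Re w \<in> {a..b} \<and> Im w \<in> {c..d}}"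
      thus "w \<in> Z" unfolding Z(2) using A(2)[of "Re w" "Im w"] by simp
    qed
    show "\<forall>w\<in>Z - {w. L w = 0 \<and> Re w \<in> {a..b} \<and> Im w \<in> {c..d}}. real_of_int (zorder L w) * (\<alpha> (Re w) * \<beta> (Im w)) = 0"
    proof
      fix w assume "w \<in> Z - {w. L w = 0 \<and> Re w \<in> {a..b} \<and> Im w \<in> {c..d}}"
      hence "Re w \<notin> {a..b} \<or> Im w \<notin> {c..d}" by (auto simp: Z(2))
      hence "\<alpha> (Re w) = 0 \<or> \<beta> (Im w) = 0" using \<alpha> \<beta> by (auto simp: C2_supported_def)
      thus "real_of_int (zorder L w) * (\<alpha> (Re w) * \<beta> (Im w)) = 0" by auto
    qed
  qed
  finally show "(\<integral>p. ln (norm (L (Complex (fst p) (snd p)))) * (\<alpha>'' (fst p) * \<beta> (snd p) + \<alpha> (fst p) * \<beta>'' (snd p)) \<partial>lborel)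
          = log_const * (\<Sum>w\<in>{w. L w = 0 \<and> Re w \<in> {a..b} \<and> Im w \<in> {c..d}}. real_of_int (zorder L w) * (\<alpha> (Re w) * \<beta> (Im w)))"
    unfolding \<Delta>_def .
qed

lemma log_norm_integrable_box:
  assumes L: "L holomorphic_on UNIV" and z0: "L z0 \<noteq> 0"
  shows "integrable lborel (\<lambda>p. indicator ({a..b} \<times> {c..d}) p * ln (norm (L (Complex (fst p) (snd p)))))"
proof (cases "a < b \<and> c < d")
  case False
  have "AE p in lborel. p \<notin> {a..b} \<times> {c..d}"
  proof -
    have "{a..b} \<times> {c..d} = cbox (a, c) (b, d)" by (simp add: cbox_Pair_eq)
    moreover have "emeasure lborel (cbox (a, c) (b, d)) = 0"
      using False by (subst emeasure_lborel_cbox_eq) (auto simp: Basis_prod_def)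
    ultimately have "{a..b} \<times> {c..d} \<in> null_sets lborel" by (auto intro!: null_setsI)
    thus ?thesis by (rule AE_not_in)
  qed
  hence ae: "AE p in lborel. (0::real) = indicator ({a..b} \<times> {c..d}) p * ln (norm (L (Complex (fst p) (snd p))))"
    by eventually_elim simp
  have [measurable]: "(\<lambda>p. L (Complex (fst p) (snd p))) \<in> borel_measurable borel"
    by (rule entire_log_norm_measurable[OF L])
  have m: "(\<lambda>p. indicator ({a..b} \<times> {c..d}) p * ln (norm (L (Complex (fst p) (snd p))))) \<in> borel_measurable lborel"
    by simp
  show ?thesis by (rule integrable_cong_AE_imp[OF integrable_zero m ae])
next
  case True
  obtain A H Z where A: "open A" "\<And>x y. x \<in> {a..b} \<Longrightarrow> y \<in> {c..d} \<Longrightarrow> Complex x y \<in> A"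
     and H: "H holomorphic_on A" and Z: "finite Z" "Z = {w\<in>A. L w = 0}" and
     f: "\<And>z. z \<in> A \<Longrightarrow> z \<notin> Z \<Longrightarrow> ln (norm (L z)) = Re (H z) + (\<Sum>w\<in>Z. real_of_int (zorder L w) * ln (norm (z - w)))"
    by (rule log_norm_factorization[OF L z0 conjunct1[OF True] conjunct2[OF True]]) (rule that)
  define F where "F = (\<lambda>p. indicator ({a..b} \<times> {c..d}) p * Re (H (Complex (fst p) (snd p))) +
     (\<Sum>w\<in>Z. real_of_int (zorder L w) * (indicator ({a..b} \<times> {c..d}) p * ln (norm (Complex (fst p) (snd p) - w)))))"
  have "integrable lborel (\<lambda>p. indicator ({a..b} \<times> {c..d}) p *\<^sub>R Re (H (Complex (fst p) (snd p))))"
    by (intro borel_integrable_compact compact_Times compact_Icc continuous_intros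
          continuous_on_compose2[OF holomorphic_on_imp_continuous_on[OF H]]) (auto intro: A)
  hence iF: "integrable lborel F" unfolding F_def
    by (intro Bochner_Integration.integrable_add Bochner_Integration.integrable_sum integrable_mult_right integrable_log_box) simp
  have ae: "AE p in lborel. F p = indicator ({a..b} \<times> {c..d}) p * ln (norm (L (Complex (fst p) (snd p))))"
    using AE_Complex_notin_finite[OF Z(1)]
  proof eventually_elim
    case (elim p)
    show ?case
    proof (cases "p \<in> {a..b} \<times> {c..d}")
      case True
      hence "Complex (fst p) (snd p) \<in> A" using A(2)[of "fst p" "snd p"] by (cases p) auto
      from f[OF this elim] True show ?thesis unfolding F_def by simp
    next
      case False
      thus ?thesis by (simp add: F_def)
    qed
  qed
  have [measurable]: "(\<lambda>p. L (Complex (fst p) (snd p))) \<in> borel_measurable borel"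
    by (rule entire_log_norm_measurable[OF L])
  have m: "(\<lambda>p. indicator ({a..b} \<times> {c..d}) p * ln (norm (L (Complex (fst p) (snd p))))) \<in> borel_measurable lborel"
    by simp
  show ?thesis by (rule integrable_cong_AE_imp[OF iF m ae])
qed

section \<open>Stirling's formula for the modulus\<close>

text \<open>The real part of the partial sums defining the digamma function is compared with
  $\log|z + n| - \log|z|$: the derivative of $\log|z + x|$ is $\mathrm{Re}\,(z+x)^{-1}$, which varies over $[n, n+1]$
  by $O(n^{-2})$, uniformly for $|\mathrm{Re}\, z| \le B$ and $|\mathrm{Im}\, z| \ge 1$.\<close>

lemma Re_Digamma_bound:
  fixes B :: real
  assumes B: "B > 0"
  shows "\<exists>C. \<forall>z. \<bar>Re z\<bar> \<le> B \<longrightarrow> \<bar>Im z\<bar> \<ge> 1 \<longrightarrow> \<bar>Re (Digamma z) - ln \<bar>Im z\<bar>\<bar> \<le> C"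
proof -
  have summ: "summable (\<lambda>n. 1 / (real (Suc n))\<^sup>2)"
    using inverse_power_summable[of 2, where ?'a = real] summable_Suc_iff[of "\<lambda>n. inverse (real n ^ 2)"]
    by (simp add: inverse_eq_divide)
  define S where "S = (\<Sum>n. 1 / (real (Suc n))\<^sup>2)"
  have main: "\<bar>Re (Digamma z) - ln \<bar>Im z\<bar>\<bar> \<le> (B+2)\<^sup>2 * S + ln (1 + B)"
    if zR: "\<bar>Re z\<bar> \<le> B" and zI: "\<bar>Im z\<bar> \<ge> 1" for z
  proof -
    define H where "H = (\<lambda>x::real. ln (norm (z + of_real x)))"
    have nz: "z + of_real x \<noteq> 0" for x
      using zI by (auto simp: complex_eq_iff)
    have nlow: "norm (z + of_real x) \<ge> real (Suc n) / (B+2)"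
      if "real n \<le> x" for x n
    proof (cases "real (Suc n) \<le> B + 2")
      case True
      have "1 \<le> norm (z + of_real x)" using abs_Im_le_cmod[of "z + of_real x"] zI by simp
      moreover have "real (Suc n) / (B+2) \<le> 1" using True B by simp
      ultimately show ?thesis by linarith
    next
      case False
      have "norm (z + of_real x) \<ge> Re (z + of_real x)" by (rule complex_Re_le_cmod)
      moreover have "Re (z + of_real x) \<ge> real n - B" using zR that by simp
      moreover have "real n - B \<ge> real (Suc n) / (B+2)"
      proof -
        have "(B+1) * (B + 2) \<le> (B+1) * real (Suc n)" using False B by (intro mult_left_mono) auto
        thus ?thesis using B by (simp add: field_simps)
      qed
      ultimately show ?thesis by linarith
    qed
    have H': "(H has_real_derivative Re (inverse (z + of_real x))) (at x)" for x
    proof -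
      have eq: "H = (\<lambda>x. 1/2 * ln ((Re z + x)\<^sup>2 + (Im z)\<^sup>2))"
        by (auto simp: H_def cmod_def ln_sqrt fun_eq_iff)
      have pos: "(Re z + x)\<^sup>2 + (Im z)\<^sup>2 > 0" using zI by (intro add_nonneg_pos) auto
      have d: "((\<lambda>x. 1/2 * ln ((Re z + x)\<^sup>2 + (Im z)\<^sup>2)) has_real_derivative
           1/2 * (1 / ((Re z + x)\<^sup>2 + (Im z)\<^sup>2) * (2 * (Re z + x)))) (at x)"
        by (rule DERIV_cmult DERIV_ln_divide[THEN DERIV_chain2] pos)+ (auto intro!: derivative_eq_intros)
      have r: "Re (inverse (z + of_real x)) = (Re z + x) / ((Re z + x)\<^sup>2 + (Im z)\<^sup>2)" by simp
      have "1/2 * (1/q * (2 * r)) = r / q" for q r :: real by simp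
      thus ?thesis unfolding eq r using d by (simp only:)
    qed
    have step: "\<bar>H (real (Suc n)) - H (real n) - Re (inverse (z + of_nat n))\<bar> \<le> (B+2)\<^sup>2 * (1 / (real (Suc n))\<^sup>2)" for n
    proof -
      obtain \<xi> where \<xi>: "real n < \<xi>" "\<xi> < real (Suc n)"
        and e: "H (real (Suc n)) - H (real n) = (real (Suc n) - real n) * Re (inverse (z + of_real \<xi>))"
        using MVT2[of "real n" "real (Suc n)" H "\<lambda>x. Re (inverse (z + of_real x))"] H' by auto
      have "\<bar>H (real (Suc n)) - H (real n) - Re (inverse (z + of_nat n))\<bar>
          = \<bar>Re (inverse (z + of_real \<xi>) - inverse (z + of_real (real n)))\<bar>"
        using e by simp
      also have "\<dots> \<le> norm (inverse (z + of_real \<xi>) - inverse (z + of_real (real n)))"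
        by (rule abs_Re_le_cmod)
      also have "inverse (z + of_real \<xi>) - inverse (z + of_real (real n))
          = of_real (real n - \<xi>) / ((z + of_real \<xi>) * (z + of_real (real n)))"
        using nz[of \<xi>] nz[of "real n"] by (simp add: field_simps)
      also have "norm \<dots> = \<bar>real n - \<xi>\<bar> / (norm (z + of_real \<xi>) * norm (z + of_real (real n)))"
        by (simp only: norm_divide norm_mult norm_of_real)
      also have "\<dots> \<le> 1 / ((real (Suc n) / (B+2)) * (real (Suc n) / (B+2)))"
        using \<xi> B by (intro frac_le mult_mono nlow mult_pos_pos) auto
      also have "\<dots> = (B+2)\<^sup>2 * (1 / (real (Suc n))\<^sup>2)" by (simp add: power2_eq_square)
      finally show ?thesis .
    qed
    have part: "\<bar>H (real m) - H 0 - (\<Sum>n<m. Re (inverse (z + of_nat n)))\<bar> \<le> (B+2)\<^sup>2 * S" for m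
    proof -
      have "H (real m) - H 0 = (\<Sum>n<m. H (real (Suc n)) - H (real n))"
        using sum_lessThan_telescope[of "\<lambda>n. H (real n)" m] by simp
      hence "\<bar>H (real m) - H 0 - (\<Sum>n<m. Re (inverse (z + of_nat n)))\<bar>
          = \<bar>\<Sum>n<m. H (real (Suc n)) - H (real n) - Re (inverse (z + of_nat n))\<bar>"
        by (simp add: sum_subtractf)
      also have "\<dots> \<le> (\<Sum>n<m. (B+2)\<^sup>2 * (1 / (real (Suc n))\<^sup>2))"
        by (rule order_trans[OF sum_abs]) (intro sum_mono step)
      also have "\<dots> = (B+2)\<^sup>2 * (\<Sum>n<m. 1 / (real (Suc n))\<^sup>2)" by (simp add: sum_distrib_left)
      also have "\<dots> \<le> (B+2)\<^sup>2 * S" unfolding S_def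
        by (intro mult_left_mono sum_le_suminf summ) auto
      finally show ?thesis .
    qed
    have "z \<noteq> 0" using nz[of 0] by simp
    from tendsto_Re[OF Digamma_LIMSEQ[OF this]]
    have l1: "(\<lambda>m. ln (real m) - (\<Sum>n<m. Re (inverse (z + of_nat n)))) \<longlonglongrightarrow> Re (Digamma z)"
      by (simp del: inverse_complex.sel)
    have l2: "(\<lambda>m. H (real m) - ln (real m)) \<longlonglongrightarrow> 0"
    proof -
      have "(\<lambda>m. z * of_real (1 / real m) + 1) \<longlonglongrightarrow> z * of_real 0 + 1"
        by (intro tendsto_intros lim_1_over_n)
      hence "(\<lambda>m. ln (norm (z * of_real (1 / real m) + 1))) \<longlonglongrightarrow> ln (norm (z * of_real 0 + 1))"
        by (intro tendsto_intros) auto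
      hence "(\<lambda>m. ln (norm (z * of_real (1 / real m) + 1))) \<longlonglongrightarrow> 0" by simp
      moreover have "\<forall>\<^sub>F m in sequentially. ln (norm (z * of_real (1 / real m) + 1)) = H (real m) - ln (real m)"
        using eventually_gt_at_top[of 0]
      proof eventually_elim
        case (elim m)
        have "z * of_real (1 / real m) + 1 = (z + of_real (real m)) / of_real (real m)"
          using elim by (simp add: field_simps)
        thus ?case using nz[of "real m"] elim unfolding H_def by (simp only: norm_divide norm_of_real) (subst ln_div; simp)
      qed
      ultimately show ?thesis by (rule Lim_transform_eventually)
    qed
    have "(\<lambda>m. H (real m) - H 0 - (\<Sum>n<m. Re (inverse (z + of_nat n)))) \<longlonglongrightarrow> Re (Digamma z) + 0 - H 0"
      using tendsto_diff[OF tendsto_add[OF l1 l2] tendsto_const[of "H 0"]] by (simp add: algebra_simps)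
    hence "\<bar>Re (Digamma z) + 0 - H 0\<bar> \<le> (B+2)\<^sup>2 * S"
      using part by (intro LIMSEQ_le_const2[OF tendsto_rabs]) blast+
    moreover have "\<bar>H 0 - ln \<bar>Im z\<bar>\<bar> \<le> ln (1 + B)"
    proof -
      have "norm z \<le> \<bar>Re z\<bar> + \<bar>Im z\<bar>" by (rule cmod_le)
      also have "\<dots> \<le> B * \<bar>Im z\<bar> + \<bar>Im z\<bar>" using zR zI B
        using mult_left_mono[of 1 "\<bar>Im z\<bar>" B] by linarith
      finally have "norm z \<le> (1 + B) * \<bar>Im z\<bar>" by (simp add: algebra_simps)
      hence "ln (norm z) \<le> ln (1 + B) + ln \<bar>Im z\<bar>"
        using zI B \<open>z \<noteq> 0\<close> by (subst ln_mult_pos[symmetric]) auto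
      moreover have "ln (norm z) \<ge> ln \<bar>Im z\<bar>" using zI abs_Im_le_cmod[of z] by (subst ln_le_cancel_iff) auto
      moreover have "ln (1+B) \<ge> 0" using B by simp
      ultimately show ?thesis by (simp add: H_def)
    qed
    ultimately show ?thesis by linarith
  qed
  thus ?thesis by blast
qed

text \<open>The reflection formula, since $1 - s$ is the complex conjugate of $s$ on this line.\<close>

lemma norm_Gamma_half_line:
  fixes t :: real
  shows "(norm (Gamma (Complex (1/2) t)))\<^sup>2 = pi / cosh (pi * t)"
proof -
  define z where "z = Complex (1/2) t"
  have "1 - z = cnj z" by (simp add: z_def complex_eq_iff)
  have "Gamma z * Gamma (1 - z) = of_real pi / sin (of_real pi * z)"
    by (rule Gamma_reflection_complex)
  also have "of_real pi * z = of_real (pi/2) + \<i> * of_real (pi * t)" by (simp add: z_def complex_eq_iff)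
  also have "sin (of_real (pi/2) + \<i> * of_real (pi * t)) = cos (\<i> * of_real (pi * t))"
    by (simp add: sin_add sin_of_real cos_of_real del: of_real_mult of_real_divide)
  also have "\<dots> = of_real (cosh (pi * t))"
    unfolding cosh_conv_cos[symmetric] by (simp add: cosh_def scaleR_conv_of_real exp_of_real[symmetric])
  also have "Gamma (1 - z) = cnj (Gamma z)" unfolding \<open>1 - z = cnj z\<close> by (simp add: cnj_Gamma)
  finally have "of_real ((norm (Gamma z))\<^sup>2) = (of_real (pi / cosh (pi * t)) :: complex)"
    using complex_norm_square[of "Gamma z"] by simp
  thus ?thesis unfolding z_def of_real_eq_iff .
qed

text \<open>The exact value on the line $\sigma = 1/2$ is carried to other $\sigma$ along horizontal segments,
  since $\partial_\sigma \log|\Gamma| = \mathrm{Re}\,\psi = \log|t| + O(1)$. This avoids the full Stirling series.\<close>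

lemma norm_Gamma_Stirling:
  fixes B :: real
  shows "\<exists>C. \<forall>\<sigma> t. \<bar>\<sigma>\<bar> \<le> B \<longrightarrow> \<bar>t\<bar> \<ge> 1 \<longrightarrow>
           \<bar>ln (norm (Gamma (Complex \<sigma> t))) - ((\<sigma> - 1/2) * ln \<bar>t\<bar> - pi * \<bar>t\<bar> / 2)\<bar> \<le> C"
proof -
  define B' where "B' = max 1 B"
  have B': "B' > 0" "B' \<ge> 1" "B' \<ge> B" by (auto simp: B'_def)
  obtain C where C: "\<And>z. \<bar>Re z\<bar> \<le> B' \<Longrightarrow> \<bar>Im z\<bar> \<ge> 1 \<Longrightarrow> \<bar>Re (Digamma z) - ln \<bar>Im z\<bar>\<bar> \<le> C"
    using Re_Digamma_bound[OF B'(1)] by blast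
  have "C \<ge> 0" using C[of "\<i>"] B' by auto
  have "\<bar>ln (norm (Gamma (Complex \<sigma> t))) - ((\<sigma> - 1/2) * ln \<bar>t\<bar> - pi * \<bar>t\<bar> / 2)\<bar> \<le> (B' + 1) * C + ln pi + ln 2"
    if s: "\<bar>\<sigma>\<bar> \<le> B" and t: "\<bar>t\<bar> \<ge> 1" for \<sigma> t
  proof -
    define g where "g = (\<lambda>x. Re (ln_Gamma (Complex x t)))"
    have np: "Complex x t \<notin> \<real>\<^sub>\<le>\<^sub>0" for x using t by (auto simp: complex_nonpos_Reals_iff)
    have ni: "Complex x t \<notin> \<int>\<^sub>\<le>\<^sub>0" for x using t by (auto elim!: nonpos_Ints_cases simp: complex_eq_iff)
    have g: "g x = ln (norm (Gamma (Complex x t)))" for x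
      using ni[of x] unfolding g_def by (simp add: Gamma_complex_altdef)
    have g': "(g has_real_derivative Re (Digamma (Complex x t))) (at x)" for x
    proof -
      have "((\<lambda>x. ln_Gamma (Complex x t)) has_vector_derivative (1 * Digamma (Complex x t))) (at x)"
      proof (rule field_vector_diff_chain_at[of "\<lambda>x. Complex x t" 1 x ln_Gamma, unfolded o_def])
        have "((\<lambda>x. of_real x + \<i> * of_real t) has_vector_derivative 1) (at x)"
          by (auto intro!: derivative_eq_intros)
        thus "((\<lambda>x. Complex x t) has_vector_derivative 1) (at x)" by (simp add: Complex_eq)
        show "(ln_Gamma has_field_derivative Digamma (Complex x t)) (at (Complex x t))"
          by (rule has_field_derivative_ln_Gamma_complex[OF np])
      qed
      from bounded_linear.has_vector_derivative[OF bounded_linear_Re this]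
      show ?thesis unfolding g_def has_real_derivative_iff_has_vector_derivative by simp
    qed
    have "\<exists>\<xi>. \<bar>\<xi>\<bar> \<le> B' \<and> g \<sigma> - g (1/2) = (\<sigma> - 1/2) * Re (Digamma (Complex \<xi> t))"
    proof (cases "\<sigma> = 1/2")
      case True thus ?thesis using B' by (intro exI[of _ 0]) (simp add: True)
    next
      case False
      then consider "\<sigma> < 1/2" | "\<sigma> > 1/2" by linarith
      thus ?thesis
      proof cases
        case 1
        from MVT2[OF 1 g'] obtain \<xi> where "\<sigma> < \<xi>" "\<xi> < 1/2" "g (1/2) - g \<sigma> = (1/2 - \<sigma>) * Re (Digamma (Complex \<xi> t))"
          by blast
        thus ?thesis using s B' by (intro exI[of _ \<xi>]) (auto simp: algebra_simps)
      next
        case 2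
        from MVT2[OF 2 g'] obtain \<xi> where "1/2 < \<xi>" "\<xi> < \<sigma>" "g \<sigma> - g (1/2) = (\<sigma> - 1/2) * Re (Digamma (Complex \<xi> t))"
          by blast
        thus ?thesis using s B' by (intro exI[of _ \<xi>]) auto
      qed
    qed
    then obtain \<xi> where \<xi>: "\<bar>\<xi>\<bar> \<le> B'" "g \<sigma> - g (1/2) = (\<sigma> - 1/2) * Re (Digamma (Complex \<xi> t))" by blast
    have "g \<sigma> - g (1/2) - (\<sigma> - 1/2) * ln \<bar>t\<bar> = (\<sigma> - 1/2) * (Re (Digamma (Complex \<xi> t)) - ln \<bar>t\<bar>)"
      using \<xi>(2) by (simp add: algebra_simps)
    hence "\<bar>g \<sigma> - g (1/2) - (\<sigma> - 1/2) * ln \<bar>t\<bar>\<bar> \<le> (B' + 1) * C"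
      using C[of "Complex \<xi> t"] \<xi>(1) t s B' by (simp only: abs_mult, intro mult_mono) auto
    moreover have "\<bar>g (1/2) + pi * \<bar>t\<bar> / 2\<bar> \<le> ln pi + ln 2"
    proof -
      have "Gamma (Complex (1/2) t) \<noteq> 0" using ni by (simp add: Gamma_eq_zero_iff)
      hence "2 * g (1/2) = ln ((norm (Gamma (Complex (1/2) t)))\<^sup>2)" by (simp add: g ln_realpow)
      also have "\<dots> = ln pi - ln (cosh (pi * t))" unfolding norm_Gamma_half_line by (subst ln_div) (auto simp: cosh_real_pos)
      finally have e: "2 * g (1/2) = ln pi - ln (cosh (pi * t))" .
      define y where "y = \<bar>pi * t\<bar>"
      have y: "cosh (pi * t) = (exp y + exp (- y)) / 2" "y \<ge> 0"
        by (auto simp: y_def cosh_field_def abs_if)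
      have l1: "ln (cosh (pi * t)) \<le> ln (exp y)"
      proof -
        have "exp (- y) \<le> exp y" using y(2) by simp
        hence "cosh (pi * t) \<le> exp y" unfolding y(1) by (simp add: field_simps)
        moreover have "cosh (pi * t) > 0" by (rule cosh_real_pos)
        ultimately show ?thesis by (subst ln_le_cancel_iff) simp_all
      qed
      have l2: "ln (cosh (pi * t)) \<ge> ln (exp y / 2)"
      proof -
        have "exp y / 2 \<le> cosh (pi * t)" unfolding y(1) by (simp add: field_simps)
        moreover have "cosh (pi * t) > 0" by (rule cosh_real_pos)
        ultimately show ?thesis by (subst ln_le_cancel_iff) simp_all
      qed
      have l3: "ln (exp y / 2) = y - ln 2" by (subst ln_div) auto
      have l4: "y = pi * \<bar>t\<bar>" by (simp add: y_def abs_mult)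
      have l5: "ln pi \<ge> 0" "ln (2::real) \<ge> 0" using pi_gt3 by auto
      have l6: "ln (exp y) = y" by simp
      show ?thesis using e l1 l2 l3 l5 unfolding l4[symmetric] l6 abs_le_iff by linarith
    qed
    ultimately show ?thesis using g[of \<sigma>] by linarith
  qed
  thus ?thesis by blast
qed

section \<open>Mean values of the logarithm to the right of the critical line\<close>

text \<open>An affine rescaling of the difference of two steps: it rises for $0 \le mx + b \le 3$, equals $1$ until
  $mx + b = n$, and falls until $mx + b = n + 3$.\<close>

definition bump :: "real \<Rightarrow> real \<Rightarrow> real \<Rightarrow> real \<Rightarrow> real" where
  "bump m b n x = bspline_step (m * x + b) - bspline_step (m * x + b - n)"

definition bump' :: "real \<Rightarrow> real \<Rightarrow> real \<Rightarrow> real \<Rightarrow> real" where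
  "bump' m b n x = m * (bspline_step' (m * x + b) - bspline_step' (m * x + b - n))"

definition bump'' :: "real \<Rightarrow> real \<Rightarrow> real \<Rightarrow> real \<Rightarrow> real" where
  "bump'' m b n x = m\<^sup>2 * (bspline_step'' (m * x + b) - bspline_step'' (m * x + b - n))"

lemma C2_supported_bump:
  assumes m: "m > 0" and n: "n \<ge> 3"
  shows "C2_supported (- b / m) ((n + 3 - b) / m) (bump m b n) (bump' m b n) (bump'' m b n)"
  unfolding C2_supported_def
proof (intro conjI allI impI)
  show "- b / m < (n + 3 - b) / m" using m n by (intro divide_strict_right_mono) auto
  fix x
  have d: "((\<lambda>x. m * x + b) has_real_derivative m) (at x)" "((\<lambda>x. m * x + b - n) has_real_derivative m) (at x)"
    by (auto intro!: derivative_eq_intros)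
  show "(bump m b n has_real_derivative bump' m b n x) (at x)"
    unfolding bump_def[abs_def] bump'_def
    by (rule DERIV_cong, rule DERIV_diff, rule DERIV_chain2[OF bspline_step_derivs(1) d(1)],
        rule DERIV_chain2[OF bspline_step_derivs(1) d(2)]) (simp add: algebra_simps)
  show "(bump' m b n has_real_derivative bump'' m b n x) (at x)"
    unfolding bump'_def[abs_def] bump''_def
    by (rule DERIV_cong, rule DERIV_cmult, rule DERIV_diff, rule DERIV_chain2[OF bspline_step_derivs(2) d(1)],
        rule DERIV_chain2[OF bspline_step_derivs(2) d(2)]) (simp add: algebra_simps power2_eq_square)
next
  have c: "continuous_on UNIV bspline_step''"
    unfolding bspline_step''_def[abs_def] by (intro continuous_intros)
  have "continuous_on UNIV (\<lambda>x. bspline_step'' (m * x + b))" "continuous_on UNIV (\<lambda>x. bspline_step'' (m * x + b - n))"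
    by (rule continuous_on_compose2[OF c]; auto intro!: continuous_intros)+
  thus "continuous_on UNIV (bump'' m b n)" unfolding bump''_def[abs_def] by (intro continuous_intros)
next
  fix x assume x: "x \<notin> {- b / m<..<(n + 3 - b) / m}"
  hence "m * x + b \<le> 0 \<or> m * x + b - n \<ge> 3" using m by (auto simp: field_simps)
  thus "bump m b n x = 0" "bump' m b n x = 0" "bump'' m b n x = 0" unfolding bump_def bump'_def bump''_def
    using n bspline_step_left[of "m * x + b"] bspline_step_left[of "m * x + b - n"]
      bspline_step_right[of "m * x + b"] bspline_step_right[of "m * x + b - n"] by auto
qed

lemma bump_properties:
  assumes n: "n \<ge> 3"
  shows "0 \<le> bump m b n x" "bump m b n x \<le> 1" "bump'' m b n x \<ge> - 2 * m\<^sup>2 * bump m b n x" "\<bar>bump'' m b n x\<bar> \<le> m\<^sup>2"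
proof -
  define y where "y = m * x + b"
  have "0 \<le> bump m b n x \<and> bump m b n x \<le> 1 \<and> bump'' m b n x \<ge> - 2 * m\<^sup>2 * bump m b n x \<and> \<bar>bump'' m b n x\<bar> \<le> m\<^sup>2"
  proof (cases "y \<le> n")
    case True
    hence e: "bump m b n x = bspline_step y" "bump'' m b n x = m\<^sup>2 * bspline_step'' y"
      using bspline_step_left[of "y - n"] by (simp_all add: bump_def bump''_def y_def)
    have "m\<^sup>2 * (- 2 * bspline_step y) \<le> m\<^sup>2 * bspline_step'' y" by (intro mult_left_mono bspline_step_bounds) auto
    moreover have "\<bar>m\<^sup>2 * bspline_step'' y\<bar> \<le> m\<^sup>2 * 1" unfolding abs_mult by (intro mult_mono bspline_step_bounds) auto
    ultimately show ?thesis unfolding e using bspline_step_bounds[of y] by auto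
  next
    case False
    hence e: "bump m b n x = 1 - bspline_step (y - n)" "bump'' m b n x = - (m\<^sup>2 * bspline_step'' (y - n))"
      using bspline_step_right[of y] n by (simp_all add: bump_def bump''_def y_def)
    have "m\<^sup>2 * bspline_step'' (y - n) \<le> m\<^sup>2 * (2 * (1 - bspline_step (y - n)))" by (intro mult_left_mono bspline_step_bounds) auto
    moreover have "\<bar>m\<^sup>2 * bspline_step'' (y - n)\<bar> \<le> m\<^sup>2 * 1" unfolding abs_mult by (intro mult_mono bspline_step_bounds) auto
    ultimately show ?thesis unfolding e using bspline_step_bounds[of "y - n"] by (auto simp: algebra_simps)
  qed
  thus "0 \<le> bump m b n x" "bump m b n x \<le> 1" "bump'' m b n x \<ge> - 2 * m\<^sup>2 * bump m b n x" "\<bar>bump'' m b n x\<bar> \<le> m\<^sup>2"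
    by auto
qed

lemma bump_plateau: "3 \<le> m * x + b \<Longrightarrow> m * x + b \<le> n \<Longrightarrow> bump m b n x = 1"
  using bspline_step_right[of "m * x + b"] bspline_step_left[of "m * x + b - n"] by (simp add: bump_def)

text \<open>On its first piece the bump is a cubic. It is used with a slope $m$ so small that this piece reaches
  beyond the line to the right of which $L$ has no zeros.\<close>

lemma bump_first:
  assumes "n \<ge> 3" "0 \<le> m * x + b" "m * x + b \<le> 1"
  shows "bump m b n x = (m * x + b) ^ 3 / 6" "bump'' m b n x = m\<^sup>2 * (m * x + b)"
  using bspline_step_first[of "m * x + b"] bspline_step_left[of "m * x + b - n"] assms
  by (auto simp: bump_def bump''_def)

lemma lborel_reflect:
  fixes f :: "real \<times> real \<Rightarrow> real"
  assumes "integrable lborel f"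
  shows "integrable lborel (\<lambda>p. f (t - p))" "(\<integral>p. f (t - p) \<partial>lborel) = (\<integral>p. f p \<partial>lborel)"
proof -
  have [measurable]: "f \<in> borel_measurable borel" using assms by (auto dest: borel_measurable_integrable)
  have "(lborel :: (real \<times> real) measure) = density (distr lborel borel (\<lambda>x. t + (-1) *\<^sub>R x)) (\<lambda>_. ennreal (\<bar>-1\<bar> ^ DIM(real \<times> real)))"
    by (rule lborel_affine) simp
  hence e: "(lborel :: (real \<times> real) measure) = distr lborel borel (\<lambda>x. t - x)"
    by (simp add: density_1)
  have "integrable (distr lborel borel (\<lambda>x. t - x)) f" using assms e by metis
  thus "integrable lborel (\<lambda>p. f (t - p))" by (subst (asm) integrable_distr_eq) auto
  have "(\<integral>p. f p \<partial>lborel) = (\<integral>p. f p \<partial>distr lborel borel (\<lambda>x. t - x))" using e by metis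
  also have "\<dots> = (\<integral>p. f (t - p) \<partial>lborel)" by (subst integral_distr) auto
  finally show "(\<integral>p. f (t - p) \<partial>lborel) = (\<integral>p. f p \<partial>lborel)" by simp
qed

lemma measure_box:
  assumes "a \<le> b" "c \<le> d"
  shows "measure lborel ({a..b} \<times> {c..d} :: (real \<times> real) set) = (b - a) * (d - c)"
        "emeasure lborel ({a..b} \<times> {c..d} :: (real \<times> real) set) < \<infinity>"
proof -
  have e: "{a..b} \<times> {c..d} = cbox (a, c) (b, d)" by (simp add: cbox_Pair_eq)
  show "measure lborel ({a..b} \<times> {c..d} :: (real \<times> real) set) = (b - a) * (d - c)"
    unfolding e using assms by (subst measure_lborel_cbox_eq) (auto simp: Basis_prod_def)
  show "emeasure lborel ({a..b} \<times> {c..d} :: (real \<times> real) set) < \<infinity>"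
    unfolding e by (rule emeasure_lborel_cbox_finite)
qed

lemma integrable_indicator_box: "integrable lborel (indicator ({a..b} \<times> {c..d}) :: real \<times> real \<Rightarrow> real)"
proof -
  have e: "{a..b} \<times> {c..d} = cbox (a, c) (b, d)" by (simp add: cbox_Pair_eq)
  show ?thesis unfolding e by (intro integrable_real_indicator emeasure_lborel_cbox_finite) auto
qed

lemma smallo_TlnT_D:
  fixes f :: "real \<Rightarrow> real"
  assumes "f \<in> o(\<lambda>T. T * ln T)" "\<eta> > 0"
  shows "\<forall>\<^sub>F T in at_top. \<bar>f T\<bar> \<le> \<eta> * (T * ln T)"
  using landau_o.smallD[OF assms] eventually_ge_at_top[of 1]
  by eventually_elim simp

lemma smallo_TlnT_I:
  fixes f :: "real \<Rightarrow> real"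
  assumes "\<And>\<eta>. \<eta> > 0 \<Longrightarrow> \<forall>\<^sub>F T in at_top. \<bar>f T\<bar> \<le> \<eta> * (T * ln T)"
  shows "f \<in> o(\<lambda>T. T * ln T)"
proof (rule landau_o.smallI)
  fix \<eta> :: real assume "\<eta> > 0"
  from assms[OF this] eventually_ge_at_top[of 1]
  show "\<forall>\<^sub>F T in at_top. norm (f T) \<le> \<eta> * norm (T * ln T)" by eventually_elim simp
qed

lemma affine_smallo: "(\<lambda>T. a + b * T :: real) \<in> o(\<lambda>T. T * ln T)"
proof -
  have b: "(\<lambda>T::real. 1 :: real) \<in> o(\<lambda>T. T * ln T)" "(\<lambda>T::real. T) \<in> o(\<lambda>T. T * ln T)" by real_asymp+
  have "(\<lambda>T. a * 1) \<in> o(\<lambda>T. T * ln T)"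
    by (cases "a = 0") (use b(1) landau_o.small.cmult_in_iff[of a "\<lambda>_. 1"] in simp_all)
  moreover have "(\<lambda>T. b * T) \<in> o(\<lambda>T. T * ln T)"
    by (cases "b = 0") (use b(2) in simp_all)
  ultimately show ?thesis using sum_in_smallo(1)[of "\<lambda>T. a * 1" at_top "\<lambda>T. T * ln T" "\<lambda>T. b * T"] by simp
qed

text \<open>The properties of an entire function that force its nontrivial zeros to be uniformly distributed:
  regular behaviour on a right half-plane, a bound for $\log^+|L|$ to the right of the critical line $\mathrm{Re}\, s = c$
  in mean, and the size of $L(s)/L(2c-s)$. The square in \<open>mean\<close> keeps the integrand continuous at zeros; the bound
  is implied by a mean square estimate.\<close>

locale log_framework =
  fixes L :: "complex \<Rightarrow> complex" and c A B1 :: real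
  assumes holo: "L holomorphic_on UNIV"
    and right_nz: "\<And>s. Re s \<ge> A \<Longrightarrow> L s \<noteq> 0"
    and right_bd: "\<And>q. \<exists>C. \<forall>x t. A \<le> x \<longrightarrow> x \<le> q \<longrightarrow> \<bar>ln (norm (L (Complex x t)))\<bar> \<le> C"
    and mean: "\<And>q. (\<lambda>T. \<integral>p. indicator ({c..q} \<times> {-T..T}) p * ln (1 + (norm (L (Complex (fst p) (snd p))))\<^sup>2) \<partial>lborel)
                     \<in> o(\<lambda>T. T * ln T)"
    and func: "\<And>B. \<exists>C. \<forall>x t. c - B \<le> x \<longrightarrow> x \<le> c \<longrightarrow> 1 \<le> \<bar>t\<bar> \<longrightarrow> L (Complex x t) \<noteq> 0 \<longrightarrow>
                  \<bar>ln (norm (L (Complex x t))) - ln (norm (L (Complex (2 * c - x) (- t)))) - 2 * (c - x) * ln \<bar>t\<bar>\<bar> \<le> C"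
    and func0: "\<And>x t. 1 \<le> \<bar>t\<bar> \<Longrightarrow> L (Complex x t) \<noteq> 0 \<Longrightarrow> L (Complex (2 * c - x) (- t)) \<noteq> 0"
    and strip: "\<And>s. L s = 0 \<Longrightarrow> s \<notin> \<int>\<^sub>\<le>\<^sub>0 \<Longrightarrow> \<bar>Re s - c\<bar> < B1"
    and B1_pos: "B1 > 0"
begin

definition G :: "real \<times> real \<Rightarrow> real" where
  "G p = ln (norm (L (Complex (fst p) (snd p))))"

definition H :: "real \<times> real \<Rightarrow> real" where
  "H p = ln (1 + (norm (L (Complex (fst p) (snd p))))\<^sup>2)"

lemma nz: "L (Complex A 0) \<noteq> 0" by (rule right_nz) simp

lemma cont_L: "continuous_on S (\<lambda>p. L (Complex (fst p) (snd p)))"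
  by (rule continuous_on_compose2[OF holomorphic_on_imp_continuous_on[OF holo]]) (auto intro!: continuous_intros)

lemma H_nonneg: "H p \<ge> 0" by (simp add: H_def)

lemma G_le_H: "2 * G p \<le> H p"
proof (cases "L (Complex (fst p) (snd p)) = 0")
  case False
  hence "2 * G p = ln ((norm (L (Complex (fst p) (snd p))))\<^sup>2)" by (simp add: G_def ln_realpow)
  also have "\<dots> \<le> H p" unfolding H_def using False by (subst ln_le_cancel_iff) (auto simp: add_pos_nonneg)
  finally show ?thesis .
qed (simp add: G_def H_nonneg)

lemma cont_H: "continuous_on S H"
proof -
  have "1 + (norm (L (Complex (fst p) (snd p))))\<^sup>2 \<noteq> 0" for p
    using zero_le_power2[of "norm (L (Complex (fst p) (snd p)))"] by linarith
  thus ?thesis unfolding H_def[abs_def] by (intro continuous_intros cont_L) auto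
qed

lemma integrable_H: "integrable lborel (\<lambda>p. indicator ({a..b} \<times> {d..e}) p * H p)"
proof -
  have "integrable lborel (\<lambda>p. indicator ({a..b} \<times> {d..e}) p *\<^sub>R H p)"
    by (intro borel_integrable_compact compact_Times compact_Icc cont_H)
  thus ?thesis by simp
qed

lemma integrable_G: "integrable lborel (\<lambda>p. indicator ({a..b} \<times> {d..e}) p * G p)"
  unfolding G_def by (rule log_norm_integrable_box[OF holo nz])

lemma integrable_abs_G: "integrable lborel (\<lambda>p. indicator ({a..b} \<times> {d..e}) p * \<bar>G p\<bar>)"
proof -
  have "integrable lborel (\<lambda>p. \<bar>indicator ({a..b} \<times> {d..e}) p * G p\<bar>)" by (intro integrable_abs integrable_G)
  thus ?thesis by (simp add: abs_mult)
qed

lemma mean_H: "(\<lambda>T. \<integral>p. indicator ({c..q} \<times> {-T..T}) p * H p \<partial>lborel) \<in> o(\<lambda>T. T * ln T)"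
  unfolding H_def by (rule mean)

text \<open>The functional equation transports \<open>mean\<close> across the critical line, at the cost of a factor
  $|t|^{2(c-\sigma)}$, whose logarithm is at most $2\epsilon\log T$ on a strip of width $\epsilon$; the strip then contributes
  only $O(\epsilon^2\, T\log T)$. This little room to the left of the line is what \<open>mean_abs_G\<close> needs.\<close>

lemma mean_H_left:
  assumes "\<eta> > 0"
  shows "\<exists>\<epsilon>. 0 < \<epsilon> \<and> \<epsilon> \<le> 1 \<and> (\<forall>\<^sub>F T in at_top. (\<integral>p. indicator ({c-\<epsilon>..c} \<times> {-T..T}) p * H p \<partial>lborel) \<le> \<eta> * (T * ln T))"
proof -
  obtain C0 where C0: "\<And>x t. c - 1 \<le> x \<Longrightarrow> x \<le> c \<Longrightarrow> 1 \<le> \<bar>t\<bar> \<Longrightarrow> L (Complex x t) \<noteq> 0 \<Longrightarrow>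
                  \<bar>ln (norm (L (Complex x t))) - ln (norm (L (Complex (2 * c - x) (- t)))) - 2 * (c - x) * ln \<bar>t\<bar>\<bar> \<le> C0"
    using func[of 1] by blast
  define C where "C = max C0 0"
  have C: "C \<ge> 0" "C0 \<le> C" by (auto simp: C_def)
  define \<epsilon> where "\<epsilon> = min 1 (\<eta> / 16)"
  have \<epsilon>: "0 < \<epsilon>" "\<epsilon> \<le> 1" "\<epsilon> \<le> \<eta> / 16" using assms by (auto simp: \<epsilon>_def)
  define K1 where "K1 = (\<integral>p. indicator ({c-1..c} \<times> {-1..1}) p * H p \<partial>lborel)"
  have key: "(\<integral>p. indicator ({c-\<epsilon>..c} \<times> {-T..T}) p * H p \<partial>lborel) \<le>
      K1 + (\<integral>p. indicator ({c..c+\<epsilon>} \<times> {-T..T}) p * H p \<partial>lborel) + (2 * C + 4 * \<epsilon> * ln T) * (\<epsilon> * (2 * T))"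
    if T: "T \<ge> 1" for T
  proof -
    define F where "F = (\<lambda>p. indicator ({c..c+\<epsilon>} \<times> {-T..T}) p * H p)"
    have iF: "integrable lborel F" unfolding F_def by (rule integrable_H)
    note r = lborel_reflect[OF iF, of "(2*c, 0)"]
    have lT: "ln T \<ge> 0" using T by simp
    have "(\<integral>p. indicator ({c-\<epsilon>..c} \<times> {-T..T}) p * H p \<partial>lborel) \<le>
      (\<integral>p. indicator ({c-1..c} \<times> {-1..1}) p * H p + F ((2*c, 0) - p) + (2 * C + 4 * \<epsilon> * ln T) * indicator ({c-\<epsilon>..c} \<times> {-T..T}) p \<partial>lborel)"
    proof (intro integral_mono Bochner_Integration.integrable_add integrable_H r integrable_mult_right integrable_indicator_box)
      fix p :: "real \<times> real"
      obtain x t where p: "p = (x, t)" by (cases p)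
      have F0: "F q \<ge> 0" for q by (simp add: F_def H_nonneg)
      show "indicator ({c-\<epsilon>..c} \<times> {-T..T}) p * H p \<le> indicator ({c-1..c} \<times> {-1..1}) p * H p + F ((2*c, 0) - p) +
          (2 * C + 4 * \<epsilon> * ln T) * indicator ({c-\<epsilon>..c} \<times> {-T..T}) p"
      proof (cases "p \<in> {c-\<epsilon>..c} \<times> {-T..T}")
        case False
        thus ?thesis using F0 by (simp add: H_nonneg)
      next
        case True
        hence x: "c - \<epsilon> \<le> x" "x \<le> c" and t: "- T \<le> t" "t \<le> T" by (auto simp: p)
        have Cn: "2 * C + 4 * \<epsilon> * ln T \<ge> 0" using C \<epsilon> lT by simp
        show ?thesis
        proof (cases "\<bar>t\<bar> \<le> 1")
          case True1: True
          have "p \<in> {c-1..c} \<times> {-1..1}" using x True1 \<epsilon> by (auto simp: p)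
          thus ?thesis using True F0[of "(2*c, 0) - p"] Cn by simp
        next
          case t1: False
          have Fe: "F ((2*c, 0) - p) = ln (1 + (norm (L (Complex (2 * c - x) (- t))))\<^sup>2)"
            using x t by (simp add: F_def p H_def)
          have "H p \<le> F ((2*c, 0) - p) + (2 * C + 4 * \<epsilon> * ln T)"
          proof (cases "L (Complex x t) = 0")
            case True
            thus ?thesis using F0[of "(2*c, 0) - p"] Cn by (simp add: H_def p)
          next
            case nz: False
            define X where "X = norm (L (Complex x t))"
            define Y where "Y = norm (L (Complex (2 * c - x) (- t)))"
            have XY: "X > 0" "Y > 0" using nz func0[of t x] t1 by (auto simp: X_def Y_def)
            have lt: "0 \<le> ln \<bar>t\<bar>" "ln \<bar>t\<bar> \<le> ln T" using t t1 T by auto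
            have "ln X \<le> ln Y + 2 * (c - x) * ln \<bar>t\<bar> + C"
              using C0[of x t] x t1 \<epsilon> nz C unfolding X_def Y_def by linarith
            also have "2 * (c - x) * ln \<bar>t\<bar> \<le> 2 * \<epsilon> * ln T"
              using x lt by (intro mult_mono) auto
            finally have l: "ln X \<le> ln Y + (2 * \<epsilon> * ln T + C)" by simp
            define W where "W = 2 * \<epsilon> * ln T + C"
            have W: "W \<ge> 0" using \<epsilon> lT C by (simp add: W_def)
            have "X \<le> Y * exp W"
            proof -
              have "X = exp (ln X)" using XY by simp
              also have "\<dots> \<le> exp (ln Y + W)" using l by (simp add: W_def)
              also have "\<dots> = Y * exp W" using XY by (simp add: exp_add)
              finally show ?thesis .
            qed
            hence "X\<^sup>2 \<le> (Y * exp W)\<^sup>2" using XY by (intro power_mono) auto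
            moreover have "(Y * exp W)\<^sup>2 = Y\<^sup>2 * exp (2 * W)" by (simp add: power_mult_distrib exp_double)
            moreover have "1 \<le> exp (2 * W)" using W by simp
            ultimately have "1 + X\<^sup>2 \<le> (1 + Y\<^sup>2) * exp (2 * W)" unfolding distrib_right by linarith
            hence "ln (1 + X\<^sup>2) \<le> ln ((1 + Y\<^sup>2) * exp (2 * W))"
              by (intro ln_mono) (auto intro: add_pos_nonneg)
            also have "\<dots> = ln (1 + Y\<^sup>2) + 2 * W"
              by (subst ln_mult) (auto simp: add_pos_nonneg add_nonneg_eq_0_iff)
            finally show ?thesis unfolding Fe by (simp add: H_def p X_def Y_def W_def)
          qed
          thus ?thesis using True mult_nonneg_nonneg[OF indicator_pos_le H_nonneg[of p], of "{c-1..c} \<times> {-1..1}" p]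
            by (simp only: indicator_simps mult_1_right mult_1_left)
        qed
      qed
    qed
    also have "\<dots> = K1 + (\<integral>p. F p \<partial>lborel) + (2 * C + 4 * \<epsilon> * ln T) * (\<epsilon> * (2 * T))"
    proof -
      have "measure lborel ({c-\<epsilon>..c} \<times> {-T..T}) = \<epsilon> * (2 * T)"
        using \<epsilon> T by (subst measure_box) auto
      hence "(\<integral>p. (2 * C + 4 * \<epsilon> * ln T) * indicator ({c-\<epsilon>..c} \<times> {-T..T}) p \<partial>lborel) = (2 * C + 4 * \<epsilon> * ln T) * (\<epsilon> * (2 * T))"
        by simp
      thus ?thesis unfolding K1_def
        by (subst Bochner_Integration.integral_add, (intro Bochner_Integration.integrable_add integrable_H r integrable_mult_right integrable_indicator_box)+,
            subst Bochner_Integration.integral_add, (intro integrable_H r)+) (simp only: r(2))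
    qed
    finally show ?thesis unfolding F_def .
  qed
  have \<eta>4: "\<eta> / 4 > 0" using assms by simp
  note e1 = smallo_TlnT_D[OF mean_H[of "c + \<epsilon>"] \<eta>4]
  note e2 = smallo_TlnT_D[OF affine_smallo[of K1 "4 * C * \<epsilon>"] \<eta>4]
  have "\<forall>\<^sub>F T in at_top. (\<integral>p. indicator ({c-\<epsilon>..c} \<times> {-T..T}) p * H p \<partial>lborel) \<le> \<eta> * (T * ln T)"
    using e1 e2 eventually_ge_at_top[of 1]
  proof eventually_elim
    case (elim T)
    have nn: "T * ln T \<ge> 0" using elim by simp
    have "\<epsilon> * \<epsilon> \<le> (\<eta> / 16) * 1" using \<epsilon> by (intro mult_mono) auto
    hence "8 * (\<epsilon> * \<epsilon>) * (T * ln T) \<le> (\<eta> / 2) * (T * ln T)" using nn by (intro mult_right_mono) auto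
    moreover have "(2 * C + 4 * \<epsilon> * ln T) * (\<epsilon> * (2 * T)) = 4 * C * \<epsilon> * T + 8 * (\<epsilon> * \<epsilon>) * (T * ln T)" by (simp add: algebra_simps)
    ultimately show ?case using key[OF elim(3)] elim(1,2) nn
      unfolding abs_le_iff by linarith
  qed
  thus ?thesis using \<epsilon> by blast
qed

lemma mean_H_double:
  "(\<lambda>T. \<integral>p. indicator ({c..q} \<times> {-(2*T)..2*T}) p * H p \<partial>lborel) \<in> o(\<lambda>T. T * ln T)"
proof -
  have "filterlim (\<lambda>T::real. 2 * T) at_top at_top" by real_asymp
  from landau_o.small.compose[OF mean_H this]
  have "(\<lambda>T. \<integral>p. indicator ({c..q} \<times> {-(2*T)..2*T}) p * H p \<partial>lborel) \<in> o(\<lambda>T. (2 * T) * ln (2 * T))" by simp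
  moreover have "(\<lambda>T::real. (2 * T) * ln (2 * T)) \<in> O(\<lambda>T. T * ln T)" by real_asymp
  ultimately show ?thesis by (rule landau_o.small_big_trans)
qed

text \<open>Only $\log^+|L|$ is bounded from above by hypothesis. For $\log^-|L|$, pair $\log|L|$ with the Laplacian
  of a nonnegative weight $\alpha(\sigma) w(t)$: the result is a sum over zeros with nonnegative terms. As $\alpha$ starts
  as the cube $(\sigma - a)^3$ at $a = c - \epsilon$ and $w$ varies slowly, the Laplacian is positive up to the zero-free region, and
  bounded below by a positive constant for $\sigma \ge c$. Hence $\int \log^-|L|$ is at most a constant times $\int \log^+|L|$ over $\sigma \ge a$ plus $O(T)$. The
  weight has to begin strictly to the left of $c$, because $\alpha''$ vanishes where it begins.\<close>

lemma mean_abs_G: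
  "(\<lambda>T. \<integral>p. indicator ({c..q} \<times> {-T..T}) p * \<bar>G p\<bar> \<partial>lborel) \<in> o(\<lambda>T. T * ln T)"
proof (rule smallo_TlnT_I)
  fix \<eta> :: real assume \<eta>: "\<eta> > 0"
  hence "\<eta> / 64 > 0" by simp
  from mean_H_left[OF this] obtain \<epsilon> where \<epsilon>: "0 < \<epsilon>" "\<epsilon> \<le> 1" and
    el: "\<forall>\<^sub>F T in at_top. (\<integral>p. indicator ({c-\<epsilon>..c} \<times> {-T..T}) p * H p \<partial>lborel) \<le> \<eta> / 64 * (T * ln T)"
    by blast
  define a where "a = c - \<epsilon>"
  \<comment> \<open>The scale \<open>D\<close> makes the cubic piece of \<open>\<alpha>\<close> end exactly at \<open>A1\<close>, inside the zero-free region.\<close>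
  define A1 where "A1 = max (max q A) c + 1"
  have A1: "A1 \<ge> q" "A1 \<ge> A" "A1 \<ge> c + 1" by (auto simp: A1_def)
  define D where "D = A1 - a"
  have D: "D > 0" "D \<ge> 1" "a + D = A1" using A1 \<epsilon> by (auto simp: D_def a_def)
  define \<alpha> where "\<alpha> = bump (1 / D) (- a / D) 3"
  define \<alpha>'' where "\<alpha>'' = bump'' (1 / D) (- a / D) 3"
  define R where "R = a + 6 * D"
  have "C2_supported (- (- a / D) / (1 / D)) ((3 + 3 - (- a / D)) / (1 / D)) \<alpha> (bump' (1 / D) (- a / D) 3) \<alpha>''"
    unfolding \<alpha>_def \<alpha>''_def using D by (intro C2_supported_bump) auto
  moreover have "- (- a / D) / (1 / D) = a" "(3 + 3 - (- a / D)) / (1 / D) = R"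
    using D by (auto simp: R_def field_simps)
  ultimately have C\<alpha>: "C2_supported a R \<alpha> (bump' (1 / D) (- a / D) 3) \<alpha>''" by simp
  obtain C1 where C1: "\<And>x t. A \<le> x \<Longrightarrow> x \<le> R \<Longrightarrow> \<bar>ln (norm (L (Complex x t)))\<bar> \<le> C1"
    using right_bd[of R] by blast
  have C1_0: "C1 \<ge> 0" using C1[of A1 0] A1 D by (auto simp: R_def)
  have key: "(\<integral>p. indicator ({c..q} \<times> {-T..T}) p * \<bar>G p\<bar> \<partial>lborel) \<le>
     (8 * D / \<epsilon>) * (\<integral>p. indicator ({c..A1} \<times> {-(2*T)..2*T}) p * H p \<partial>lborel) +
     8 * (\<integral>p. indicator ({a..c} \<times> {-(2*T)..2*T}) p * H p \<partial>lborel) + (2 * D ^ 3 / \<epsilon>) * (10 * C1 * (5 * D * (4 * T)))"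
    if T: "T \<ge> 4 * D" for T
  proof -
    have T0: "T > 0" "T \<ge> 1" using T D by auto
    define w where "w = bump (3 / T) 6 9"
    define w'' where "w'' = bump'' (3 / T) 6 9"
    have "C2_supported (- 6 / (3 / T)) ((9 + 3 - 6) / (3 / T)) w (bump' (3 / T) 6 9) w''"
      unfolding w_def w''_def using T0 by (intro C2_supported_bump) auto
    hence Cw: "C2_supported (-(2*T)) (2*T) w (bump' (3 / T) 6 9) w''" by simp
    define \<Delta> where "\<Delta> = (\<lambda>p::real\<times>real. \<alpha>'' (fst p) * w (snd p) + \<alpha> (fst p) * w'' (snd p))"
    note Green = Green_log_norm[OF holo nz C\<alpha> Cw]
    have iG\<Delta>: "integrable lborel (\<lambda>p. G p * \<Delta> p)" using Green(1) unfolding G_def \<Delta>_def .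
    have "0 \<le> log_const * (\<Sum>s\<in>{w. L w = 0 \<and> Re w \<in> {a..R} \<and> Im w \<in> {-(2*T)..2*T}}. real_of_int (zorder L s) * (\<alpha> (Re s) * w (Im s)))"
      using log_const_pos zorder_entire_nonneg(1)[OF holo nz]
      by (intro mult_nonneg_nonneg sum_nonneg) (auto simp: \<alpha>_def w_def bump_properties)
    hence G\<Delta>0: "(\<integral>p. G p * \<Delta> p \<partial>lborel) \<ge> 0" using Green(2) unfolding G_def \<Delta>_def by linarith
    have w: "0 \<le> w t" "w t \<le> 1" "w'' t \<ge> - (18 / T\<^sup>2) * w t" "\<bar>w'' t\<bar> \<le> 9 / T\<^sup>2" for t
      using bump_properties[of 9 "3 / T" 6 t] by (auto simp: w_def w''_def power_divide)
    have w1: "w t = 1" if "\<bar>t\<bar> \<le> T" for t unfolding w_def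
      using that T0 by (intro bump_plateau) (auto simp: field_simps abs_le_iff)
    have w0: "w t = 0 \<and> w'' t = 0" if "t \<notin> {-(2*T)..2*T}" for t
      using Cw that by (auto simp: C2_supported_def)
    have \<alpha>0: "\<alpha> x = 0 \<and> \<alpha>'' x = 0" if "x \<notin> {a..R}" for x
      using C\<alpha> that by (auto simp: C2_supported_def)
    have \<alpha>b: "0 \<le> \<alpha> x" "\<alpha> x \<le> 1" "\<bar>\<alpha>'' x\<bar> \<le> 1" for x
    proof -
      have "(1 / D)\<^sup>2 \<le> 1" using D by (simp add: power_divide power_le_one)
      thus "0 \<le> \<alpha> x" "\<alpha> x \<le> 1" "\<bar>\<alpha>'' x\<bar> \<le> 1"
        using bump_properties[of 3 "1 / D" "- a / D" x] by (auto simp: \<alpha>_def \<alpha>''_def)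
    qed
    have DT: "D\<^sup>2 * 16 \<le> T\<^sup>2"
    proof -
      have "(4 * D)\<^sup>2 \<le> T\<^sup>2" using T D by (intro power_mono) auto
      thus ?thesis by (simp add: power_mult_distrib)
    qed
    have \<alpha>1: "\<alpha> x = (x - a) ^ 3 / (6 * D ^ 3)" "\<alpha>'' x = (x - a) / D ^ 3" if "a \<le> x" "x \<le> A1" for x
    proof -
      have e: "1 / D * x + - a / D = (x - a) / D" by (simp add: diff_divide_distrib)
      have r: "0 \<le> (x - a) / D" "(x - a) / D \<le> 1" using that D by (auto simp: D_def)
      from bump_first[of 3 "1 / D" x "- a / D", unfolded e] r
      show "\<alpha> x = (x - a) ^ 3 / (6 * D ^ 3)" "\<alpha>'' x = (x - a) / D ^ 3"
        by (auto simp: \<alpha>_def \<alpha>''_def power_divide power3_eq_cube power2_eq_square)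
    qed
    have \<Delta>1: "\<Delta> (x, t) \<ge> (x - a) / (2 * D ^ 3) * w t" "\<Delta> (x, t) \<le> 2 * (x - a) / D ^ 3"
      if x: "a \<le> x" "x \<le> A1" for x t
    proof -
      have x2: "(x - a)\<^sup>2 \<le> D\<^sup>2" using x D by (intro power_mono) (auto simp: D_def)
      hence x3: "(x - a)\<^sup>2 * 16 \<le> T\<^sup>2" using DT by linarith
      have \<alpha>e: "\<alpha> x = (x - a) / D ^ 3 * ((x - a)\<^sup>2 / 6)" unfolding \<alpha>1[OF x] by (simp add: power3_eq_cube power2_eq_square)
      have \<alpha>''e: "\<alpha>'' x = (x - a) / D ^ 3" by (rule \<alpha>1[OF x])
      have f0: "(x - a) / D ^ 3 \<ge> 0" using x D by simp
      have r: "(x - a)\<^sup>2 / 6 * (18 / T\<^sup>2) \<le> 1/2"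
      proof -
        have "(x - a)\<^sup>2 * 6 \<le> T\<^sup>2" using x3 zero_le_power2[of "x - a"] by linarith
        thus ?thesis using T0 by (simp add: field_simps)
      qed
      have gen: "f * v + f * g * v'' \<ge> f * (v * (1 - g * k))" if "f * g * v'' \<ge> f * g * (- k * v)" for f g k v v'' :: real
        using that by (simp add: algebra_simps)
      have "\<alpha> x * w'' t \<ge> \<alpha> x * (- (18 / T\<^sup>2) * w t)" by (intro mult_left_mono w \<alpha>b)
      hence "\<Delta> (x, t) \<ge> (x - a) / D ^ 3 * (w t * (1 - (x - a)\<^sup>2 / 6 * (18 / T\<^sup>2)))"
        unfolding \<Delta>_def fst_conv snd_conv \<alpha>e \<alpha>''e by (rule gen)
      moreover have "w t * (1 - (x - a)\<^sup>2 / 6 * (18 / T\<^sup>2)) \<ge> w t * (1/2)"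
        using r w by (intro mult_left_mono) auto
      hence "(x - a) / D ^ 3 * (w t * (1 - (x - a)\<^sup>2 / 6 * (18 / T\<^sup>2))) \<ge> (x - a) / D ^ 3 * (w t * (1/2))"
        using f0 by (rule mult_left_mono)
      ultimately show "\<Delta> (x, t) \<ge> (x - a) / (2 * D ^ 3) * w t" by simp
      have "\<alpha> x * w'' t \<le> \<alpha> x * (9 / T\<^sup>2)" using w(4)[of t] by (intro mult_left_mono \<alpha>b) auto
      also have "\<dots> = (x - a) / D ^ 3 * ((x - a)\<^sup>2 / 6 * (9 / T\<^sup>2))" unfolding \<alpha>e by simp
      also have "\<dots> \<le> (x - a) / D ^ 3 * 1" using r f0 by (intro mult_left_mono) auto
      finally have "\<alpha> x * w'' t \<le> (x - a) / D ^ 3" by simp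
      moreover have "\<alpha>'' x * w t \<le> (x - a) / D ^ 3 * 1" unfolding \<alpha>''e using f0 w by (intro mult_left_mono)
      moreover have "2 * (x - a) / D ^ 3 = (x - a) / D ^ 3 + (x - a) / D ^ 3" by (simp flip: add_divide_distrib)
      ultimately show "\<Delta> (x, t) \<le> 2 * (x - a) / D ^ 3" unfolding \<Delta>_def fst_conv snd_conv by linarith
    qed
    have \<Delta>2: "\<bar>\<Delta> p\<bar> \<le> 10" for p
    proof -
      have "\<bar>\<Delta> p\<bar> \<le> \<bar>\<alpha>'' (fst p)\<bar> * \<bar>w (snd p)\<bar> + \<bar>\<alpha> (fst p)\<bar> * \<bar>w'' (snd p)\<bar>"
        unfolding \<Delta>_def by (rule order_trans[OF abs_triangle_ineq]) (simp add: abs_mult)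
      also have "\<dots> \<le> 1 * 1 + 1 * 9"
      proof (intro add_mono mult_mono)
        have "9 / T\<^sup>2 \<le> 9" using T0 by (simp add: divide_le_eq)
        thus "\<bar>w'' (snd p)\<bar> \<le> 9" using w(4)[of "snd p"] by linarith
      qed (use \<alpha>b w in \<open>auto simp: abs_of_nonneg\<close>)
      finally show ?thesis by simp
    qed
    define B1x where "B1x = {c..A1} \<times> {-(2*T)..2*T}"
    define B2x where "B2x = {a..c} \<times> {-(2*T)..2*T}"
    define B3x where "B3x = {A1..R} \<times> {-(2*T)..2*T}"
    have pw: "(\<epsilon> / (2 * D ^ 3)) * (indicator ({c..q} \<times> {-T..T}) p * \<bar>G p\<bar>) \<le>
        (4 / D\<^sup>2) * (indicator B1x p * H p) + (4 * \<epsilon> / D ^ 3) * (indicator B2x p * H p) + 10 * C1 * indicator B3x p * 1 - G p * \<Delta> p" for p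
    proof -
      obtain x t where p: "p = (x, t)" by (cases p)
      have D3: "D ^ 3 > 0" "D\<^sup>2 > 0" using D by auto
      have nn: "(4 / D\<^sup>2) * (indicator B1x p * H p) \<ge> 0" "(4 * \<epsilon> / D ^ 3) * (indicator B2x p * H p) \<ge> 0" "10 * C1 * indicator B3x p * 1 \<ge> 0"
        using D3 \<epsilon> H_nonneg[of p] C1_0 by (auto intro!: mult_nonneg_nonneg)
      consider "t \<notin> {-(2*T)..2*T} \<or> x \<notin> {a..R}" | "t \<in> {-(2*T)..2*T}" "A1 < x" "x \<le> R" | "t \<in> {-(2*T)..2*T}" "a \<le> x" "x \<le> A1" by force
      thus ?thesis
      proof cases
        case 1
        hence "\<Delta> p = 0" using w0[of t] \<alpha>0[of x] by (auto simp: \<Delta>_def p)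
        moreover have "p \<notin> {c..q} \<times> {-T..T}" using 1 T0 A1 D \<epsilon> by (auto simp: p R_def a_def)
        ultimately show ?thesis using nn by simp
      next
        case 2
        have "p \<notin> {c..q} \<times> {-T..T}" using 2 A1 by (auto simp: p)
        moreover have "p \<in> B3x" using 2 by (auto simp: p B3x_def)
        moreover have "\<bar>G p * \<Delta> p\<bar> \<le> C1 * 10" unfolding abs_mult
          using C1[of x t] 2 A1 by (intro mult_mono \<Delta>2) (auto simp: G_def p C1_0)
        ultimately show ?thesis using nn by (simp add: abs_le_iff)
      next
        case 3
        note d = \<Delta>1[OF 3(2,3), of t]
        have \<Delta>nn: "\<Delta> p \<ge> 0" using d(1) w(1)[of t] 3 D3 by (smt (verit) divide_nonneg_pos mult_nonneg_nonneg p)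
        have "(\<epsilon> / (2 * D ^ 3)) * (indicator ({c..q} \<times> {-T..T}) p * \<bar>G p\<bar>) \<le> \<Delta> p * \<bar>G p\<bar>"
        proof (cases "p \<in> {c..q} \<times> {-T..T}")
          case True
          hence "w t = 1" "x \<ge> c" by (auto simp: p w1)
          hence "\<Delta> p \<ge> (x - a) / (2 * D ^ 3)" using d(1) by (simp add: p)
          moreover have "(x - a) / (2 * D ^ 3) \<ge> \<epsilon> / (2 * D ^ 3)"
            using \<open>x \<ge> c\<close> D3 by (intro divide_right_mono) (auto simp: a_def)
          ultimately have "\<epsilon> / (2 * D ^ 3) \<le> \<Delta> p" by linarith
          hence "(\<epsilon> / (2 * D ^ 3)) * \<bar>G p\<bar> \<le> \<Delta> p * \<bar>G p\<bar>" by (rule mult_right_mono) simp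
          moreover have "indicator ({c..q} \<times> {-T..T}) p * \<bar>G p\<bar> = \<bar>G p\<bar>" using True by simp
          ultimately show ?thesis by (simp only:)
        qed (use \<Delta>nn in simp)
        also have "\<bar>G p\<bar> \<le> H p - G p" using G_le_H[of p] H_nonneg[of p] by (simp add: abs_if)
        hence "\<Delta> p * \<bar>G p\<bar> \<le> \<Delta> p * (H p - G p)" using \<Delta>nn by (rule mult_left_mono)
        also have "\<dots> = \<Delta> p * H p - G p * \<Delta> p" by (simp add: algebra_simps)
        also have "\<Delta> p * H p \<le> (4 / D\<^sup>2) * (indicator B1x p * H p) + (4 * \<epsilon> / D ^ 3) * (indicator B2x p * H p)"
        proof (cases "x \<ge> c")
          case True
          hence "p \<in> B1x" using 3 by (auto simp: p B1x_def)
          moreover have "\<Delta> p \<le> 4 / D\<^sup>2"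
          proof -
            have "2 * (x - a) / D ^ 3 \<le> 2 * D / D ^ 3" using 3 D3 by (intro divide_right_mono) (auto simp: D_def)
            also have "\<dots> = 2 / D\<^sup>2" using D by (simp add: power3_eq_cube power2_eq_square)
            also have "\<dots> \<le> 4 / D\<^sup>2" using D3 by (intro divide_right_mono) auto
            finally show ?thesis using d(2) by (simp add: p)
          qed
          ultimately have m: "\<Delta> p * H p \<le> (4 / D\<^sup>2) * H p" and e: "indicator B1x p * H p = H p"
            using mult_right_mono[OF _ H_nonneg[of p]] by (blast, simp)
          show ?thesis unfolding e using m nn(2) by linarith
        next
          case False
          hence "p \<in> B2x" using 3 by (auto simp: p B2x_def)
          moreover have "\<Delta> p \<le> 4 * \<epsilon> / D ^ 3"
          proof -
            have "2 * (x - a) / D ^ 3 \<le> 4 * \<epsilon> / D ^ 3" using False \<epsilon> D3 by (intro divide_right_mono) (auto simp: a_def)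
            thus ?thesis using d(2) by (simp add: p)
          qed
          ultimately have m: "\<Delta> p * H p \<le> (4 * \<epsilon> / D ^ 3) * H p" and e: "indicator B2x p * H p = H p"
            using mult_right_mono[OF _ H_nonneg[of p]] by (blast, simp)
          show ?thesis unfolding e using m nn(1) by linarith
        qed
        finally show ?thesis using nn by linarith
      qed
    qed
    have i: "integrable lborel (\<lambda>p. (4 / D\<^sup>2) * (indicator B1x p * H p))" "integrable lborel (\<lambda>p. (4 * \<epsilon> / D ^ 3) * (indicator B2x p * H p))"
       "integrable lborel (\<lambda>p. 10 * C1 * indicator B3x p * 1)"
      unfolding B1x_def B2x_def B3x_def using integrable_indicator_box[of A1 R "-(2*T)" "2*T"] by (auto intro!: integrable_H)
    have "(\<epsilon> / (2 * D ^ 3)) * (\<integral>p. indicator ({c..q} \<times> {-T..T}) p * \<bar>G p\<bar> \<partial>lborel) =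
       (\<integral>p. (\<epsilon> / (2 * D ^ 3)) * (indicator ({c..q} \<times> {-T..T}) p * \<bar>G p\<bar>) \<partial>lborel)" by simp
    also have "\<dots> \<le> (\<integral>p. (4 / D\<^sup>2) * (indicator B1x p * H p) + (4 * \<epsilon> / D ^ 3) * (indicator B2x p * H p) + 10 * C1 * indicator B3x p * 1 - G p * \<Delta> p \<partial>lborel)"
      by (intro integral_mono pw Bochner_Integration.integrable_add Bochner_Integration.integrable_diff i iG\<Delta> integrable_mult_right integrable_abs_G)
    also have "\<dots> = (4 / D\<^sup>2) * (\<integral>p. indicator B1x p * H p \<partial>lborel) + (4 * \<epsilon> / D ^ 3) * (\<integral>p. indicator B2x p * H p \<partial>lborel)
        + 10 * C1 * measure lborel B3x - (\<integral>p. G p * \<Delta> p \<partial>lborel)"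
    proof -
      have "(\<integral>p. 10 * C1 * indicator B3x p * 1 \<partial>lborel) = 10 * C1 * measure lborel B3x" by simp
      thus ?thesis
        by (simp only: Bochner_Integration.integral_diff[OF Bochner_Integration.integrable_add[OF Bochner_Integration.integrable_add[OF i(1,2)] i(3)] iG\<Delta>]
            Bochner_Integration.integral_add[OF Bochner_Integration.integrable_add[OF i(1,2)] i(3)]
            Bochner_Integration.integral_add[OF i(1,2)] integral_mult_right_zero)
    qed
    also have "measure lborel B3x = 5 * D * (4 * T)" unfolding B3x_def
      using D T0 by (subst measure_box) (auto simp: R_def)
    finally have fin: "(\<epsilon> / (2 * D ^ 3)) * (\<integral>p. indicator ({c..q} \<times> {-T..T}) p * \<bar>G p\<bar> \<partial>lborel) \<le>
       (4 / D\<^sup>2) * (\<integral>p. indicator B1x p * H p \<partial>lborel) + (4 * \<epsilon> / D ^ 3) * (\<integral>p. indicator B2x p * H p \<partial>lborel)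
        + 10 * C1 * (5 * D * (4 * T))" using G\<Delta>0 by linarith
    have "(2 * D ^ 3 / \<epsilon>) * ((\<epsilon> / (2 * D ^ 3)) * (\<integral>p. indicator ({c..q} \<times> {-T..T}) p * \<bar>G p\<bar> \<partial>lborel)) \<le>
       (2 * D ^ 3 / \<epsilon>) * ((4 / D\<^sup>2) * (\<integral>p. indicator B1x p * H p \<partial>lborel) + (4 * \<epsilon> / D ^ 3) * (\<integral>p. indicator B2x p * H p \<partial>lborel)
        + 10 * C1 * (5 * D * (4 * T)))"
      by (rule mult_left_mono[OF fin]) (use D \<epsilon> in auto)
    moreover have "(2 * D ^ 3 / \<epsilon>) * ((\<epsilon> / (2 * D ^ 3)) * X) = X" for X using D \<epsilon> by simp
    moreover have "(2 * D ^ 3 / \<epsilon>) * ((4 / D\<^sup>2) * X + (4 * \<epsilon> / D ^ 3) * Y + Z) = (8 * D / \<epsilon>) * X + 8 * Y + (2 * D ^ 3 / \<epsilon>) * Z" for X Y Z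
      using D \<epsilon> by (simp add: field_simps power2_eq_square power3_eq_cube)
    ultimately show ?thesis unfolding B1x_def B2x_def by (simp only:)
  qed
  have f2: "filterlim (\<lambda>T::real. 2 * T) at_top at_top" by real_asymp
  have el2: "\<forall>\<^sub>F T in at_top. (\<integral>p. indicator ({a..c} \<times> {-(2*T)..2*T}) p * H p \<partial>lborel) \<le> \<eta> / 64 * ((2 * T) * ln (2 * T))"
    using eventually_compose_filterlim[OF el f2] unfolding a_def by simp
  have "(8 * D / \<epsilon>) * x \<le> \<eta> / 4 * y" if "x \<le> (\<eta> * \<epsilon> / (32 * D)) * y" for x y :: real
    using mult_left_mono[OF that, of "8 * D / \<epsilon>"] D \<epsilon> by simp
  moreover have "\<eta> * \<epsilon> / (32 * D) > 0" using \<eta> D \<epsilon> by simp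
  note e1 = smallo_TlnT_D[OF mean_H_double[of A1] this]
  have \<eta>4: "\<eta> / 4 > 0" using \<eta> by simp
  note e3 = smallo_TlnT_D[OF affine_smallo[of 0 "(2 * D ^ 3 / \<epsilon>) * (10 * C1 * (5 * D * 4))"] \<eta>4]
  show "\<forall>\<^sub>F T in at_top. \<bar>\<integral>p. indicator ({c..q} \<times> {-T..T}) p * \<bar>G p\<bar> \<partial>lborel\<bar> \<le> \<eta> * (T * ln T)"
    using e1 el2 e3 eventually_ge_at_top[of "4 * D"] eventually_ge_at_top[of 2]
  proof eventually_elim
    case (elim T)
    have nn: "(\<integral>p. indicator ({c..q} \<times> {-T..T}) p * \<bar>G p\<bar> \<partial>lborel) \<ge> 0"
      by (intro integral_nonneg_AE AE_I2) auto
    have "ln (2 * T) \<le> 2 * ln T"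
    proof -
      have "ln (2 * T) \<le> ln (T * T)" using elim(5) by (intro ln_mono) auto
      thus ?thesis using elim(5) by (simp add: ln_mult)
    qed
    hence "(2 * T) * ln (2 * T) \<le> (2 * T) * (2 * ln T)" using elim(5) by (intro mult_left_mono) auto
    hence "\<eta> / 64 * ((2 * T) * ln (2 * T)) \<le> \<eta> / 64 * (4 * (T * ln T))" using \<eta> by (intro mult_left_mono) auto
    hence x2: "8 * (\<integral>p. indicator ({a..c} \<times> {-(2*T)..2*T}) p * H p \<partial>lborel) \<le> \<eta> / 2 * (T * ln T)" using elim(2) by linarith
    have x1: "(8 * D / \<epsilon>) * (\<integral>p. indicator ({c..A1} \<times> {-(2*T)..2*T}) p * H p \<partial>lborel) \<le> \<eta> / 4 * (T * ln T)"
      using elim(1) by (intro calculation) linarith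
    have x3: "(2 * D ^ 3 / \<epsilon>) * (10 * C1 * (5 * D * (4 * T))) \<le> \<eta> / 4 * (T * ln T)"
    proof -
      have eq: "(2 * D ^ 3 / \<epsilon>) * (10 * C1 * (5 * D * (4 * T))) = 0 + (2 * D ^ 3 / \<epsilon>) * (10 * C1 * (5 * D * 4)) * T" by simp
      show ?thesis using elim(3) unfolding eq abs_le_iff by blast
    qed
    have "\<eta> / 4 * y + \<eta> / 2 * y + \<eta> / 4 * y = \<eta> * y" for y by simp
    thus ?case using key[OF elim(4)] x1 x2 x3 nn by (smt (verit))
  qed
qed

end

section \<open>Weighted sums over the nontrivial zeros\<close>

lemma integral_fst_mult_snd:
  fixes f g :: "real \<Rightarrow> real"
  assumes "integrable lborel f" "integrable lborel g"
  shows "(\<integral>p. f (fst p) * g (snd p) \<partial>lborel) = (\<integral>x. f x \<partial>lborel) * (\<integral>y. g y \<partial>lborel)"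
  by (subst Fubini_fst[OF integrable_fst_mult_snd[OF assms]]) simp

context log_framework
begin

lemma reflected_G:
  "integrable lborel (\<lambda>p. indicator ({c-B..c} \<times> {-T..T}) p * \<bar>G ((2*c, 0) - p)\<bar>)"
  "(\<integral>p. indicator ({c-B..c} \<times> {-T..T}) p * \<bar>G ((2*c, 0) - p)\<bar> \<partial>lborel) =
   (\<integral>p. indicator ({c..c+B} \<times> {-T..T}) p * \<bar>G p\<bar> \<partial>lborel)"
proof -
  note r = lborel_reflect[OF integrable_abs_G[of c "c + B" "-T" T], of "(2*c, 0)"]
  have e: "indicator ({c..c+B} \<times> {-T..T}) ((2*c, 0) - p) = (indicator ({c-B..c} \<times> {-T..T}) p :: real)" for p
    by (cases p) (auto simp: indicator_def)
  show "integrable lborel (\<lambda>p. indicator ({c-B..c} \<times> {-T..T}) p * \<bar>G ((2*c, 0) - p)\<bar>)"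
    "(\<integral>p. indicator ({c-B..c} \<times> {-T..T}) p * \<bar>G ((2*c, 0) - p)\<bar> \<partial>lborel) =
     (\<integral>p. indicator ({c..c+B} \<times> {-T..T}) p * \<bar>G p\<bar> \<partial>lborel)"
    using r unfolding e by simp_all
qed

text \<open>For $\sigma < c$ replace $\log|L(s)|$ by $\log|L(2c - s)|$, which is negligible in mean by
  \<open>mean_abs_G\<close>, plus $2(c-\sigma)\log|t|$. The difference between $\log|t|$ and $\log T$ is integrated
  by scaling: $\int_{-T}^{T} |\log|t/T||\, dt$ is a constant times $T$.\<close>

lemma log_main_term:
  assumes B: "B > 0"
  shows "(\<lambda>T. \<integral>p. indicator ({c-B..c+B} \<times> {-T..T}) p * \<bar>G p - 2 * max (c - fst p) 0 * ln T\<bar> \<partial>lborel) \<in> o(\<lambda>T. T * ln T)"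
proof -
  obtain C0 where C0: "\<And>x t. c - B \<le> x \<Longrightarrow> x \<le> c \<Longrightarrow> 1 \<le> \<bar>t\<bar> \<Longrightarrow> L (Complex x t) \<noteq> 0 \<Longrightarrow>
                  \<bar>ln (norm (L (Complex x t))) - ln (norm (L (Complex (2 * c - x) (- t)))) - 2 * (c - x) * ln \<bar>t\<bar>\<bar> \<le> C0"
    using func[of B] by blast
  define C where "C = max C0 0"
  have C: "C \<ge> 0" "C0 \<le> C" by (auto simp: C_def)
  define K1 where "K1 = (\<integral>p. indicator ({c-B..c} \<times> {-1..1}) p * \<bar>G p\<bar> \<partial>lborel)"
  define j where "j = (\<lambda>u::real. indicator {-1..1} u * \<bar>ln \<bar>u\<bar>\<bar>)"
  have j: "integrable lborel j" unfolding j_def using integrable_indicator_ln_abs[of "-1" 1 0] by simp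
  define J0 where "J0 = (\<integral>u. j u \<partial>lborel)"
  define E where "E = (\<lambda>T. \<integral>p. indicator ({c-B..c+B} \<times> {-T..T}) p * \<bar>G p - 2 * max (c - fst p) 0 * ln T\<bar> \<partial>lborel)"
  have key: "\<bar>E T\<bar> \<le> 2 * (\<integral>p. indicator ({c..c+B} \<times> {-T..T}) p * \<bar>G p\<bar> \<partial>lborel) +
       (K1 + (2 * B * C + 2 * B * (B * J0)) * T + 4 * B\<^sup>2 * ln T)" if T: "T \<ge> 1" for T
  proof -
    define F where "F = (\<lambda>p. indicator ({c..c+B} \<times> {-T..T}) p * \<bar>G p\<bar>)"
    define F' where "F' = (\<lambda>p. indicator ({c-B..c} \<times> {-T..T}) p * \<bar>G ((2*c, 0) - p)\<bar>)"
    define P1 where "P1 = (\<lambda>p. indicator ({c-B..c} \<times> {-1..1}) p * \<bar>G p\<bar>)"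
    define P2 where "P2 = (\<lambda>p::real\<times>real. (2 * B * ln T) * indicator ({c-B..c} \<times> {-1..1}) p)"
    define P3 where "P3 = (\<lambda>p::real\<times>real. C * indicator ({c-B..c} \<times> {-T..T}) p)"
    define P4 where "P4 = (\<lambda>p::real\<times>real. (2 * B * indicator {c-B..c} (fst p)) * j (0 + (1/T) * snd p))"
    have jT: "integrable lborel (\<lambda>t. j (0 + (1/T) * t))"
      using T by (intro lborel_integrable_real_affine[OF j]) auto
    have jI: "(\<integral>t. j (0 + (1/T) * t) \<partial>lborel) = T * J0"
      using lborel_integral_real_affine[of "1/T" j 0] T by (simp add: J0_def field_simps)
    have iB: "integrable lborel (\<lambda>x. 2 * B * indicator {c-B..c} x)" by (intro integrable_mult_right integrable_indicator_Icc)
    have i: "integrable lborel F" "integrable lborel F'" "integrable lborel P1" "integrable lborel P2" "integrable lborel P3" "integrable lborel P4"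
      unfolding F_def F'_def P1_def P2_def P3_def P4_def
      by (intro integrable_abs_G reflected_G integrable_mult_right integrable_indicator_box
          integrable_fst_mult_snd[OF iB jT])+
    have lT: "ln T \<ge> 0" using T by simp
    have nn: "F p \<ge> 0" "F' p \<ge> 0" "P1 p \<ge> 0" "P2 p \<ge> 0" "P3 p \<ge> 0" "P4 p \<ge> 0" for p
      using B C lT by (auto simp: F_def F'_def P1_def P2_def P3_def P4_def j_def)
    have tri3: "\<bar>g - m\<bar> \<le> \<bar>g'\<bar> + C + v" if "\<bar>g - g' - k\<bar> \<le> C" "\<bar>m - k\<bar> \<le> v" for g g' m k C v :: real
      using that by linarith
    have tri2: "\<bar>g - m\<bar> \<le> \<bar>g\<bar> + v" if "\<bar>m\<bar> \<le> v" for g m v :: real using that by linarith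
    have le: "AE p in lborel. indicator ({c-B..c+B} \<times> {-T..T}) p * \<bar>G p - 2 * max (c - fst p) 0 * ln T\<bar> \<le>
        F p + F' p + P1 p + P2 p + P3 p + P4 p"
      using AE_Complex_notin_finite[OF entire_finite_zeros_box[OF holo nz, of "c-B" c "-T" T]]
    proof eventually_elim
      case (elim p)
      obtain x t where p: "p = (x, t)" by (cases p)
      show ?case
      proof (cases "p \<in> {c-B..c+B} \<times> {-T..T}")
        case False thus ?thesis using nn[of p] by simp
      next
        case True
        hence xt: "c - B \<le> x" "x \<le> c + B" "-T \<le> t" "t \<le> T" by (auto simp: p)
        have ind: "indicator ({c-B..c+B} \<times> {-T..T}) p = (1::real)" using True by simp
        consider "x \<ge> c" | "x < c" "\<bar>t\<bar> \<le> 1" | "x < c" "\<bar>t\<bar> > 1" by linarith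
        thus ?thesis
        proof cases
          case 1
          have "F p = \<bar>G p\<bar>" using 1 xt by (simp add: F_def p)
          thus ?thesis using nn[of p] 1 unfolding ind unfolding p by simp
        next
          case 2
          have "P1 p = \<bar>G p\<bar>" "P2 p = 2 * B * ln T" using 2 xt by (auto simp: P1_def P2_def p abs_le_iff)
          moreover have "\<bar>2 * max (c - x) 0 * ln T\<bar> \<le> 2 * B * ln T"
            using 2 xt lT by (auto simp: abs_mult intro!: mult_right_mono)
          from tri2[OF this] have "\<bar>G p - 2 * max (c - x) 0 * ln T\<bar> \<le> \<bar>G p\<bar> + 2 * B * ln T" .
          ultimately show ?thesis using nn[of p] unfolding ind unfolding p fst_conv by simp
        next
          case 3
          have "L (Complex x t) \<noteq> 0" using elim xt 3 by (auto simp: p)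
          from C0[OF xt(1) _ _ this] 3 have c1: "\<bar>G (x, t) - G ((2*c, 0) - (x, t)) - 2 * (c - x) * ln \<bar>t\<bar>\<bar> \<le> C"
            using C by (simp add: G_def)
          have e: "F' p = \<bar>G ((2*c, 0) - (x, t))\<bar>" "P3 p = C" using 3 xt by (auto simp: F'_def P3_def p)
          have tT: "0 < \<bar>t\<bar>" "\<bar>t\<bar> \<le> T" using 3 xt by auto
          have j1: "j (0 + (1/T) * t) = ln T - ln \<bar>t\<bar>"
          proof -
            have "ln \<bar>t / T\<bar> = ln \<bar>t\<bar> - ln T" using tT T by (simp add: abs_divide ln_div)
            moreover have "ln \<bar>t\<bar> \<le> ln T" using tT T by simp
            moreover have "-1 \<le> t / T" "t / T \<le> 1" using xt T by (auto simp: field_simps)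
            ultimately show ?thesis by (simp add: j_def)
          qed
          have "P4 p = 2 * B * (ln T - ln \<bar>t\<bar>)" using 3 xt j1 by (simp add: P4_def p)
          moreover have "\<bar>2 * max (c - x) 0 * ln T - 2 * (c - x) * ln \<bar>t\<bar>\<bar> \<le> 2 * B * (ln T - ln \<bar>t\<bar>)"
          proof -
            have "2 * (c - x) * (ln T - ln \<bar>t\<bar>) \<le> 2 * B * (ln T - ln \<bar>t\<bar>)"
              using xt tT T by (intro mult_right_mono) auto
            moreover have "2 * (c - x) * (ln T - ln \<bar>t\<bar>) \<ge> 0" using 3 tT T by simp
            moreover have "2 * max (c - x) 0 * ln T - 2 * (c - x) * ln \<bar>t\<bar> = 2 * (c - x) * (ln T - ln \<bar>t\<bar>)"
              using 3 by (simp add: algebra_simps)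
            ultimately show ?thesis by simp
          qed
          from tri3[OF c1 this] have "\<bar>G (x, t) - 2 * max (c - x) 0 * ln T\<bar> \<le> \<bar>G ((2*c, 0) - (x, t))\<bar> + C + 2 * B * (ln T - ln \<bar>t\<bar>)" .
          ultimately show ?thesis using nn(1,3,4)[of p] e unfolding ind unfolding p fst_conv by simp
        qed
      qed
    qed
    have "E T \<le> (\<integral>p. F p + F' p + P1 p + P2 p + P3 p + P4 p \<partial>lborel)"
    proof (unfold E_def, rule integral_mono_AE)
      have [measurable]: "(\<lambda>p. L (Complex (fst p) (snd p))) \<in> borel_measurable borel"
        by (rule entire_log_norm_measurable[OF holo])
      have [measurable]: "G \<in> borel_measurable borel" unfolding G_def[abs_def] by simp
      have [measurable]: "(\<lambda>p::real\<times>real. 2 * max (c - fst p) 0 * ln T) \<in> borel_measurable borel"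
        by (intro borel_measurable_continuous_onI continuous_intros)
      show "integrable lborel (\<lambda>p. F p + F' p + P1 p + P2 p + P3 p + P4 p)" by (intro Bochner_Integration.integrable_add i)
      from this show "integrable lborel (\<lambda>p. indicator ({c-B..c+B} \<times> {-T..T}) p * \<bar>G p - 2 * max (c - fst p) 0 * ln T\<bar>)"
      proof (rule Bochner_Integration.integrable_bound)
        show "AE p in lborel. norm (indicator ({c-B..c+B} \<times> {-T..T}) p * \<bar>G p - 2 * max (c - fst p) 0 * ln T\<bar>)
            \<le> norm (F p + F' p + P1 p + P2 p + P3 p + P4 p)"
          using le by eventually_elim (simp add: abs_mult)
      qed simp
    qed (rule le)
    also have "\<dots> = (\<integral>p. F p \<partial>lborel) + (\<integral>p. F' p \<partial>lborel) + (\<integral>p. P1 p \<partial>lborel) + (\<integral>p. P2 p \<partial>lborel) + (\<integral>p. P3 p \<partial>lborel) + (\<integral>p. P4 p \<partial>lborel)"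
      using i by simp
    also have "(\<integral>p. P1 p \<partial>lborel) = K1" by (simp add: P1_def K1_def)
    also have "(\<integral>p. P2 p \<partial>lborel) = 4 * B\<^sup>2 * ln T" unfolding P2_def using B
      by (simp add: measure_box power2_eq_square)
    also have "(\<integral>p. P3 p \<partial>lborel) = 2 * B * C * T" unfolding P3_def using B T
      by (simp add: measure_box)
    also have "(\<integral>p. P4 p \<partial>lborel) = (2 * B * B) * (T * J0)" unfolding P4_def
      by (subst integral_fst_mult_snd[OF iB jT], subst jI) (use B in simp)
    also have "(\<integral>p. F' p \<partial>lborel) = (\<integral>p. F p \<partial>lborel)" unfolding F'_def F_def by (rule reflected_G)
    finally have "E T \<le> 2 * (\<integral>p. F p \<partial>lborel) + (K1 + (2 * B * C + 2 * B * (B * J0)) * T + 4 * B\<^sup>2 * ln T)"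
      by (simp add: algebra_simps)
    moreover have "E T \<ge> 0" unfolding E_def by (intro integral_nonneg_AE AE_I2) auto
    ultimately show ?thesis unfolding F_def by simp
  qed
  have b: "(\<lambda>T::real. ln T) \<in> o(\<lambda>T. T * ln T)" by real_asymp
  have s1: "(\<lambda>T. 4 * B\<^sup>2 * ln T) \<in> o(\<lambda>T. T * ln T)"
    using b B by simp
  have s2: "(\<lambda>T. 2 * (\<integral>p. indicator ({c..c+B} \<times> {-T..T}) p * \<bar>G p\<bar> \<partial>lborel)) \<in> o(\<lambda>T. T * ln T)"
    using mean_abs_G[of "c + B"] by simp
  have "(\<lambda>T. 2 * (\<integral>p. indicator ({c..c+B} \<times> {-T..T}) p * \<bar>G p\<bar> \<partial>lborel) +
       (K1 + (2 * B * C + 2 * B * (B * J0)) * T + 4 * B\<^sup>2 * ln T)) \<in> o(\<lambda>T. T * ln T)"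
    by (intro sum_in_smallo s1 s2 affine_smallo)
  moreover have "E \<in> O(\<lambda>T. 2 * (\<integral>p. indicator ({c..c+B} \<times> {-T..T}) p * \<bar>G p\<bar> \<partial>lborel) +
       (K1 + (2 * B * C + 2 * B * (B * J0)) * T + 4 * B\<^sup>2 * ln T))"
    by (rule bigoI[where c = 1], rule eventually_mono[OF eventually_ge_at_top[of 1]]) (use key in fastforce)
  ultimately show ?thesis unfolding E_def using landau_o.big_small_trans by blast
qed

text \<open>A weight in $\sigma$ that is $1$ for $|\sigma - c| \le B_1$, where all nontrivial zeros lie, and is
  supported in $|\sigma - c| \le B_1 + 1$.\<close>

definition cutoff where "cutoff = bump 3 (3 - 3 * (c - B1)) (3 + 6 * B1)"
definition cutoff' where "cutoff' = bump' 3 (3 - 3 * (c - B1)) (3 + 6 * B1)"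
definition cutoff'' where "cutoff'' = bump'' 3 (3 - 3 * (c - B1)) (3 + 6 * B1)"

lemma C2_supported_cutoff: "C2_supported (c - (B1 + 1)) (c + (B1 + 1)) cutoff cutoff' cutoff''"
proof -
  have "C2_supported (- (3 - 3 * (c - B1)) / 3) (((3 + 6 * B1) + 3 - (3 - 3 * (c - B1))) / 3) cutoff cutoff' cutoff''"
    unfolding cutoff_def cutoff'_def cutoff''_def using B1_pos by (intro C2_supported_bump) auto
  moreover have "- (3 - 3 * (c - B1)) / 3 = c - (B1 + 1)" "((3 + 6 * B1) + 3 - (3 - 3 * (c - B1))) / 3 = c + (B1 + 1)" by auto
  ultimately show ?thesis by (simp only:)
qed

lemma cutoff_props: "0 \<le> cutoff x" "cutoff x \<le> 1" "\<bar>cutoff'' x\<bar> \<le> 9" "\<bar>x - c\<bar> \<le> B1 \<Longrightarrow> cutoff x = 1"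
proof -
  show "0 \<le> cutoff x" "cutoff x \<le> 1" "\<bar>cutoff'' x\<bar> \<le> 9"
    using bump_properties[of "3 + 6 * B1" 3 "3 - 3 * (c - B1)" x] B1_pos by (auto simp: cutoff_def cutoff''_def)
  show "cutoff x = 1" if "\<bar>x - c\<bar> \<le> B1"
    unfolding cutoff_def using that by (intro bump_plateau) auto
qed

lemma integrable_C2:
  assumes "C2_supported a b f f' f''" "continuous_on UNIV g"
  shows "integrable lborel (\<lambda>x. g x * f x)" "integrable lborel (\<lambda>x. g x * f'' x)"
proof -
  have z: "f x = 0" "f'' x = 0" if "x \<notin> {a..b}" for x using assms that by (auto simp: C2_supported_def)
  have c: "continuous_on {a..b} g" using assms(2) continuous_on_subset by blast
  have "integrable lborel (\<lambda>x. indicator {a..b} x *\<^sub>R (g x * f x))" "integrable lborel (\<lambda>x. indicator {a..b} x *\<^sub>R (g x * f'' x))"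
    by (intro borel_integrable_compact compact_Icc continuous_intros c C2_supported_continuous[OF assms(1)])+
  moreover have "(\<lambda>x. indicator {a..b} x *\<^sub>R (g x * f x)) = (\<lambda>x. g x * f x)"
    by (rule indicator_scaleR_absorb) (use z in simp)
  moreover have "(\<lambda>x. indicator {a..b} x *\<^sub>R (g x * f'' x)) = (\<lambda>x. g x * f'' x)"
    by (rule indicator_scaleR_absorb) (use z in simp)
  ultimately show "integrable lborel (\<lambda>x. g x * f x)" "integrable lborel (\<lambda>x. g x * f'' x)" by simp_all
qed

text \<open>The second derivative of $\max(c - \sigma, 0)$ is the point mass at $c$, where the cut-off is $1$.\<close>

lemma integral_kink_cutoff: "(\<integral>x. max (c - x) 0 * cutoff'' x \<partial>lborel) = 1"
proof -
  define a where "a = c - (B1 + 1)"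
  have a: "a < c" using B1_pos by (simp add: a_def)
  have z: "cutoff x = 0" "cutoff' x = 0" "cutoff'' x = 0" if "x \<le> a" for x
    using C2_supported_cutoff that by (auto simp: C2_supported_def a_def)
  have d: "(cutoff has_real_derivative cutoff' x) (at x)" "(cutoff' has_real_derivative cutoff'' x) (at x)" for x
    using C2_supported_cutoff by (auto simp: C2_supported_def)
  have "(\<integral>x. indicator {a..c} x *\<^sub>R ((c - x) * cutoff'' x) \<partial>lborel) = ((c - c) * cutoff' c + cutoff c) - ((c - a) * cutoff' a + cutoff a)"
  proof (rule integral_FTC_atLeastAtMost)
    show "continuous_on {a..c} (\<lambda>x. (c - x) * cutoff'' x)"
      by (intro continuous_intros C2_supported_continuous[OF C2_supported_cutoff])
    fix x
    have "((\<lambda>x. (c - x) * cutoff' x + cutoff x) has_real_derivative (c - x) * cutoff'' x) (at x)"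
      by (auto intro!: derivative_eq_intros d)
    thus "((\<lambda>x. (c - x) * cutoff' x + cutoff x) has_vector_derivative (c - x) * cutoff'' x) (at x within {a..c})"
      unfolding has_real_derivative_iff_has_vector_derivative by (rule has_vector_derivative_at_within)
  qed (use a in simp)
  also have "\<dots> = 1" using z[of a] cutoff_props(4)[of c] B1_pos by simp
  also have "(\<lambda>x. indicator {a..c} x *\<^sub>R ((c - x) * cutoff'' x)) = (\<lambda>x. max (c - x) 0 * cutoff'' x)"
  proof
    fix x show "indicator {a..c} x *\<^sub>R ((c - x) * cutoff'' x) = max (c - x) 0 * cutoff'' x"
      using z(3)[of x] by (cases "x \<le> a"; cases "x \<le> c") (auto simp: max_def)
  qed
  finally show ?thesis .
qed

text \<open>In Green's identity replace $\log|L|$ by its main term. Its product with $\alpha\, b''$ integrates to zero in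
  $t$, and its product with $\alpha'' b$ contributes $2\log T\int b$ by \<open>integral_kink_cutoff\<close>.\<close>

lemma weighted_zero_sum:
  assumes \<beta>: "\<And>T. T \<ge> 1 \<Longrightarrow> C2_supported (-T) T (\<beta> T) (\<beta>' T) (\<beta>'' T)"
      and K: "\<And>T t. T \<ge> 1 \<Longrightarrow> \<bar>\<beta> T t\<bar> \<le> K" "\<And>T t. T \<ge> 1 \<Longrightarrow> \<bar>\<beta>'' T t\<bar> \<le> K"
  shows "(\<lambda>T. log_const * (\<Sum>w\<in>{w. L w = 0 \<and> Re w \<in> {c - (B1 + 1)..c + (B1 + 1)} \<and> Im w \<in> {-T..T}}. real_of_int (zorder L w) * (cutoff (Re w) * \<beta> T (Im w)))
              - 2 * ln T * (\<integral>t. \<beta> T t \<partial>lborel)) \<in> o(\<lambda>T. T * ln T)"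
proof -
  define B where "B = B1 + 1"
  have B: "B > 0" using B1_pos by (simp add: B_def)
  have K0: "K \<ge> 0" using K(1)[of 1 0] by simp
  note Ca = C2_supported_cutoff[folded B_def]
  define Y where "Y = (\<lambda>T. log_const * (\<Sum>w\<in>{w. L w = 0 \<and> Re w \<in> {c - B..c + B} \<and> Im w \<in> {-T..T}}. real_of_int (zorder L w) * (cutoff (Re w) * \<beta> T (Im w)))
              - 2 * ln T * (\<integral>t. \<beta> T t \<partial>lborel))"
  have key: "\<bar>Y T\<bar> \<le> (10 * K) * (\<integral>p. indicator ({c-B..c+B} \<times> {-T..T}) p * \<bar>G p - 2 * max (c - fst p) 0 * ln T\<bar> \<partial>lborel)"
    if T: "T \<ge> 1" for T
  proof -
    define \<Delta> where "\<Delta> = (\<lambda>p::real\<times>real. cutoff'' (fst p) * \<beta> T (snd p) + cutoff (fst p) * \<beta>'' T (snd p))"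
    define M where "M = (\<lambda>p::real\<times>real. 2 * max (c - fst p) 0 * ln T)"
    note Green = Green_log_norm[OF holo nz Ca \<beta>[OF T]]
    have i1: "integrable lborel (\<lambda>p. G p * \<Delta> p)" using Green(1) unfolding G_def \<Delta>_def .
    have g2: "(\<integral>p. G p * \<Delta> p \<partial>lborel) = log_const * (\<Sum>w\<in>{w. L w = 0 \<and> Re w \<in> {c - B..c + B} \<and> Im w \<in> {-T..T}}. real_of_int (zorder L w) * (cutoff (Re w) * \<beta> T (Im w)))"
      using Green(2) unfolding G_def \<Delta>_def .
    have cm: "continuous_on UNIV (\<lambda>x. max (c - x) 0)" by (intro continuous_intros)
    note im = integrable_C2[OF Ca cm]
    have ib: "integrable lborel (\<beta> T)" "integrable lborel (\<beta>'' T)"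
      using integrable_C2[OF \<beta>[OF T], of "\<lambda>_. 1"] by (auto simp: continuous_on_const)
    have b0: "(\<integral>t. \<beta>'' T t \<partial>lborel) = 0"
      using integral_parts_C2[OF \<beta>[OF T], of "\<lambda>_. 1" "\<lambda>_. 0" "\<lambda>_. 0"] by simp
    have Me: "M p * \<Delta> p = (2 * ln T) * ((max (c - fst p) 0 * cutoff'' (fst p)) * \<beta> T (snd p)) + (2 * ln T) * ((max (c - fst p) 0 * cutoff (fst p)) * \<beta>'' T (snd p))" for p
      by (simp add: M_def \<Delta>_def algebra_simps)
    have i2: "integrable lborel (\<lambda>p. M p * \<Delta> p)" unfolding Me
      by (intro Bochner_Integration.integrable_add integrable_mult_right integrable_fst_mult_snd[OF im(2) ib(1)] integrable_fst_mult_snd[OF im(1) ib(2)])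
    have m2: "(\<integral>p. M p * \<Delta> p \<partial>lborel) = 2 * ln T * (\<integral>t. \<beta> T t \<partial>lborel)" unfolding Me
      by (subst Bochner_Integration.integral_add, (intro integrable_mult_right integrable_fst_mult_snd[OF im(2) ib(1)] integrable_fst_mult_snd[OF im(1) ib(2)])+,
          simp only: integral_mult_right_zero integral_fst_mult_snd[OF im(2) ib(1)] integral_fst_mult_snd[OF im(1) ib(2)] b0 integral_kink_cutoff)
    have Y: "Y T = (\<integral>p. G p * \<Delta> p - M p * \<Delta> p \<partial>lborel)"
      unfolding Y_def by (subst Bochner_Integration.integral_diff[OF i1 i2]) (simp only: g2 m2)
    have \<Delta>0: "\<Delta> p = 0" if "p \<notin> {c-B..c+B} \<times> {-T..T}" for p
    proof (cases "fst p \<in> {c-B..c+B}")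
      case True
      hence "snd p \<notin> {-T..T}" using that by (cases p) auto
      hence "\<beta> T (snd p) = 0" "\<beta>'' T (snd p) = 0" using \<beta>[OF T] by (auto simp: C2_supported_def)
      thus ?thesis by (simp add: \<Delta>_def)
    next
      case False
      hence "cutoff (fst p) = 0" "cutoff'' (fst p) = 0" using Ca by (auto simp: C2_supported_def)
      thus ?thesis by (simp add: \<Delta>_def)
    qed
    have \<Delta>b: "\<bar>\<Delta> p\<bar> \<le> 10 * K" for p
    proof -
      have "\<bar>\<Delta> p\<bar> \<le> \<bar>cutoff'' (fst p)\<bar> * \<bar>\<beta> T (snd p)\<bar> + \<bar>cutoff (fst p)\<bar> * \<bar>\<beta>'' T (snd p)\<bar>"
        unfolding \<Delta>_def by (rule order_trans[OF abs_triangle_ineq]) (simp add: abs_mult)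
      also have "\<dots> \<le> 9 * K + 1 * K"
        using cutoff_props(1-3)[of "fst p"] K[OF T] by (intro add_mono mult_mono) auto
      finally show ?thesis by simp
    qed
    have iE: "integrable lborel (\<lambda>p. indicator ({c-B..c+B} \<times> {-T..T}) p * \<bar>G p - M p\<bar>)"
    proof -
      have "continuous_on S M" for S unfolding M_def by (intro continuous_intros)
      hence "integrable lborel (\<lambda>p. indicator ({c-B..c+B} \<times> {-T..T}) p *\<^sub>R M p)"
        by (intro borel_integrable_compact compact_Times compact_Icc)
      from integrable_abs[OF Bochner_Integration.integrable_diff[OF integrable_G[of "c-B" "c+B" "-T" T] this]]
      show ?thesis by (simp add: abs_mult flip: right_diff_distrib)
    qed
    have "\<bar>Y T\<bar> \<le> (\<integral>p. \<bar>G p * \<Delta> p - M p * \<Delta> p\<bar> \<partial>lborel)" unfolding Y by (rule integral_abs_bound)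
    also have "\<dots> \<le> (\<integral>p. (10 * K) * (indicator ({c-B..c+B} \<times> {-T..T}) p * \<bar>G p - M p\<bar>) \<partial>lborel)"
    proof (intro integral_mono integrable_abs Bochner_Integration.integrable_diff i1 i2 integrable_mult_right iE)
      fix p
      show "\<bar>G p * \<Delta> p - M p * \<Delta> p\<bar> \<le> (10 * K) * (indicator ({c-B..c+B} \<times> {-T..T}) p * \<bar>G p - M p\<bar>)"
      proof (cases "p \<in> {c-B..c+B} \<times> {-T..T}")
        case True
        have "\<bar>G p * \<Delta> p - M p * \<Delta> p\<bar> = \<bar>\<Delta> p\<bar> * \<bar>G p - M p\<bar>" by (simp add: abs_mult[symmetric] algebra_simps)
        also have "\<dots> \<le> (10 * K) * \<bar>G p - M p\<bar>" by (intro mult_right_mono \<Delta>b) auto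
        finally show ?thesis using True by simp
      next
        case False
        thus ?thesis using \<Delta>0[OF False] K0 by simp
      qed
    qed
    finally show ?thesis unfolding M_def by simp
  qed
  have "Y \<in> O(\<lambda>T. \<integral>p. indicator ({c-B..c+B} \<times> {-T..T}) p * \<bar>G p - 2 * max (c - fst p) 0 * ln T\<bar> \<partial>lborel)"
  proof (rule bigoI[where c = "10 * K"], rule eventually_mono[OF eventually_ge_at_top[of 1]])
    fix T :: real assume "T \<ge> 1"
    have "(\<integral>p. indicator ({c-B..c+B} \<times> {-T..T}) p * \<bar>G p - 2 * max (c - fst p) 0 * ln T\<bar> \<partial>lborel) \<ge> 0"
      by (intro integral_nonneg_AE AE_I2) auto
    thus "norm (Y T) \<le> 10 * K * norm (\<integral>p. indicator ({c-B..c+B} \<times> {-T..T}) p * \<bar>G p - 2 * max (c - fst p) 0 * ln T\<bar> \<partial>lborel)"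
      using key[OF \<open>T \<ge> 1\<close>] by simp
  qed
  from landau_o.big_small_trans[OF this log_main_term[OF B]] show ?thesis unfolding Y_def B_def .
qed

definition nt_zeros :: "real \<Rightarrow> complex set" where
  "nt_zeros T = {w. L w = 0 \<and> w \<notin> \<int>\<^sub>\<le>\<^sub>0 \<and> \<bar>Im w\<bar> \<le> T}"

lemma finite_nt_zeros: "finite (nt_zeros T)"
proof -
  have "nt_zeros T \<subseteq> {w. L w = 0 \<and> Re w \<in> {c - B1..c + B1} \<and> Im w \<in> {-T..T}}"
    using strip by (force simp: nt_zeros_def abs_le_iff abs_less_iff)
  thus ?thesis using entire_finite_zeros_box[OF holo nz] finite_subset by blast
qed

text \<open>The sum in \<open>weighted_zero_sum\<close> runs over all zeros near the critical strip. The zeros it has in excess are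
  nonpositive integers, finitely many and with a bounded contribution.\<close>

theorem nontrivial_zero_sum:
  assumes \<beta>: "\<And>T. T \<ge> 1 \<Longrightarrow> C2_supported (-T) T (\<beta> T) (\<beta>' T) (\<beta>'' T)"
      and K: "\<And>T t. T \<ge> 1 \<Longrightarrow> \<bar>\<beta> T t\<bar> \<le> K" "\<And>T t. T \<ge> 1 \<Longrightarrow> \<bar>\<beta>'' T t\<bar> \<le> K"
  shows "(\<lambda>T. log_const * (\<Sum>w\<in>nt_zeros T. real_of_int (zorder L w) * \<beta> T (Im w))
              - 2 * ln T * (\<integral>t. \<beta> T t \<partial>lborel)) \<in> o(\<lambda>T. T * ln T)"
proof -
  define B where "B = B1 + 1"
  define Z where "Z = (\<lambda>T. {w. L w = 0 \<and> Re w \<in> {c - B..c + B} \<and> Im w \<in> {-T..T}})"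
  define N where "N = {w. L w = 0 \<and> Re w \<in> {c - B..c + B} \<and> Im w \<in> {-0..0} \<and> w \<in> \<int>\<^sub>\<le>\<^sub>0}"
  have finZ: "finite (Z T)" for T unfolding Z_def by (rule entire_finite_zeros_box[OF holo nz])
  have finN: "finite N" by (rule finite_subset[OF _ finZ[of 0]]) (auto simp: N_def Z_def)
  define X where "X = (\<lambda>T. \<Sum>w\<in>N. real_of_int (zorder L w) * (cutoff (Re w) * \<beta> T (Im w)))"
  define W where "W = (\<Sum>w\<in>N. real_of_int (zorder L w))"
  have K0: "K \<ge> 0" using K(1)[of 1 0] by simp
  have split: "(\<Sum>w\<in>Z T. real_of_int (zorder L w) * (cutoff (Re w) * \<beta> T (Im w))) =
      (\<Sum>w\<in>nt_zeros T. real_of_int (zorder L w) * \<beta> T (Im w)) + X T" if T: "T \<ge> 1" for T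
  proof -
    have e: "Z T = nt_zeros T \<union> N"
    proof (intro equalityI subsetI)
      fix w assume w: "w \<in> Z T"
      show "w \<in> nt_zeros T \<union> N"
      proof (cases "w \<in> \<int>\<^sub>\<le>\<^sub>0")
        case True
        hence "Im w = 0" by (auto elim!: nonpos_Ints_cases)
        thus ?thesis using True w by (simp add: Z_def N_def)
      qed (use w in \<open>auto simp: Z_def nt_zeros_def\<close>)
    next
      fix w assume "w \<in> nt_zeros T \<union> N"
      thus "w \<in> Z T"
      proof
        assume w: "w \<in> nt_zeros T"
        hence "\<bar>Re w - c\<bar> < B1" using strip by (auto simp: nt_zeros_def)
        thus ?thesis using w by (auto simp: Z_def nt_zeros_def B_def)
      qed (use T in \<open>auto simp: Z_def N_def\<close>)
    qed
    have d: "nt_zeros T \<inter> N = {}" by (auto simp: nt_zeros_def N_def)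
    have "cutoff (Re w) = 1" if "w \<in> nt_zeros T" for w
    proof -
      have "\<bar>Re w - c\<bar> < B1" using strip that by (auto simp: nt_zeros_def)
      thus ?thesis by (intro cutoff_props(4)) auto
    qed
    thus ?thesis unfolding e X_def by (subst sum.union_disjoint[OF finite_nt_zeros finN d]) simp
  qed
  have "(\<lambda>T. log_const * X T) \<in> o(\<lambda>T. T * ln T)"
  proof -
    have "(\<lambda>T. log_const * X T) \<in> O(\<lambda>T. 1)"
    proof (rule bigoI[where c = "log_const * (W * K)"], rule eventually_mono[OF eventually_ge_at_top[of 1]])
      fix T :: real assume T: "T \<ge> 1"
      have "\<bar>X T\<bar> \<le> (\<Sum>w\<in>N. real_of_int (zorder L w) * K)" unfolding X_def
      proof (rule order_trans[OF sum_abs sum_mono])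
        fix w
        have "\<bar>cutoff (Re w) * \<beta> T (Im w)\<bar> \<le> 1 * K" unfolding abs_mult
          using cutoff_props(1,2)[of "Re w"] K(1)[OF T] by (intro mult_mono) auto
        thus "\<bar>real_of_int (zorder L w) * (cutoff (Re w) * \<beta> T (Im w))\<bar> \<le> real_of_int (zorder L w) * K"
          using zorder_entire_nonneg(1)[OF holo nz, of w] by (subst abs_mult) (auto intro!: mult_mono)
      qed
      thus "norm (log_const * X T) \<le> log_const * (W * K) * norm (1::real)"
        using log_const_pos by (simp add: abs_mult W_def sum_distrib_right)
    qed
    moreover have "(\<lambda>_::real. 1::real) \<in> o(\<lambda>T. T * ln T)" by real_asymp
    ultimately show ?thesis by (rule landau_o.big_small_trans)
  qed
  from sum_in_smallo(2)[OF weighted_zero_sum[OF \<beta> K] this]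
  have s: "(\<lambda>T. log_const * (\<Sum>w\<in>Z T. real_of_int (zorder L w) * (cutoff (Re w) * \<beta> T (Im w)))
              - 2 * ln T * (\<integral>t. \<beta> T t \<partial>lborel) - log_const * X T) \<in> o(\<lambda>T. T * ln T)"
    unfolding Z_def B_def by simp
  show ?thesis
    by (rule landau_o.small.in_cong[THEN iffD1, OF _ s], rule eventually_mono[OF eventually_ge_at_top[of 1]])
       (simp add: split ring_distribs)
qed

end

section \<open>Weyl's criterion and uniform distribution of the zeros\<close>

inductive trig_poly :: "(real \<Rightarrow> complex) \<Rightarrow> bool" where
  mono: "trig_poly (\<lambda>x. a * cis (2 * pi * of_int k * x))"
| add: "trig_poly f \<Longrightarrow> trig_poly g \<Longrightarrow> trig_poly (\<lambda>x. f x + g x)"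

lemma trig_poly_mult:
  assumes "trig_poly f" "trig_poly g"
  shows "trig_poly (\<lambda>x. f x * g x)"
  using assms
proof (induction f arbitrary: g)
  case (mono a k)
  show ?case using mono.prems
  proof induction
    case (mono b l)
    have "(\<lambda>x. a * cis (2 * pi * of_int k * x) * (b * cis (2 * pi * of_int l * x))) = (\<lambda>x. (a * b) * cis (2 * pi * of_int (k + l) * x))"
      by (auto simp: fun_eq_iff cis_mult algebra_simps)
    thus ?case using trig_poly.mono[of "a * b" "k + l"] by (simp only:)
  next
    case (add f g)
    thus ?case using trig_poly.add by (simp add: distrib_left)
  qed
next
  case (add f h)
  thus ?case using trig_poly.add by (simp add: distrib_right)
qed

text \<open>Real polynomial functions on the plane restrict to trigonometric polynomials on the unit circle, so
  that Stone--Weierstrass in the plane yields trigonometric approximation.\<close>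

lemma trig_poly_of_real_polynomial:
  fixes p :: "complex \<Rightarrow> real"
  assumes "real_polynomial_function p"
  shows "trig_poly (\<lambda>x. of_real (p (cis (2 * pi * x))))"
  using assms
proof induction
  case (linear f)
  have f: "f (cis y) = f 1 * cos y + f \<i> * sin y" for y
  proof -
    have "cis y = cos y *\<^sub>R 1 + sin y *\<^sub>R \<i>" by (simp add: complex_eq_iff)
    thus ?thesis using linear_add[OF bounded_linear.linear[OF linear]] linear_scale[OF bounded_linear.linear[OF linear]] by simp
  qed
  have "complex_of_real (f (cis (2 * pi * x))) =
    ((of_real (f 1) - \<i> * of_real (f \<i>)) / 2) * cis (2 * pi * of_int 1 * x) + ((of_real (f 1) + \<i> * of_real (f \<i>)) / 2) * cis (2 * pi * of_int (-1) * x)" for x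
    unfolding f by (simp add: complex_eq_iff field_simps)
  thus ?case using trig_poly.add[OF trig_poly.mono[of _ 1] trig_poly.mono[of _ "-1"]] by (simp only:)
next
  case (const c)
  have "(\<lambda>x. complex_of_real c) = (\<lambda>x. of_real c * cis (2 * pi * of_int 0 * x))" by simp
  thus ?case using trig_poly.mono[of "of_real c" 0] by (simp only:)
next
  case (add f g)
  thus ?case using trig_poly.add by simp
next
  case (mult f g)
  thus ?case using trig_poly_mult by simp
qed

lemma integral_cis:
  "integral {0..1} (\<lambda>x. a * cis (2 * pi * of_int k * x)) = (if k = 0 then a else 0)"
proof (cases "k = 0")
  case False
  define \<omega> where "\<omega> = 2 * pi * of_int k"
  have \<omega>: "\<omega> \<noteq> 0" using False by (simp add: \<omega>_def)
  have "((\<lambda>x. a * cis (\<omega> * x)) has_integral (a / (\<i> * of_real \<omega>) * cis (\<omega> * 1) - a / (\<i> * of_real \<omega>) * cis (\<omega> * 0))) {0..1}"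
  proof (rule fundamental_theorem_of_calculus)
    fix x :: real
    have "((\<lambda>x. a / (\<i> * of_real \<omega>) * exp (\<i> * of_real \<omega> * of_real x)) has_vector_derivative a / (\<i> * of_real \<omega>) * (\<i> * of_real \<omega> * exp (\<i> * of_real \<omega> * of_real x))) (at x within {0..1})"
      by (rule has_vector_derivative_mult_right, rule has_vector_derivative_real_field)
         (auto intro!: derivative_eq_intros)
    thus "((\<lambda>x. a / (\<i> * of_real \<omega>) * cis (\<omega> * x)) has_vector_derivative a * cis (\<omega> * x)) (at x within {0..1})"
      using \<omega> by (simp add: cis_conv_exp mult_ac)
  qed simp
  moreover have "cis \<omega> = 1" unfolding \<omega>_def using cis_multiple_2pi[of "of_int k"] by simp
  ultimately have "((\<lambda>x. a * cis (\<omega> * x)) has_integral 0) {0..1}" by simp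
  from integral_unique[OF this] False show ?thesis by (simp add: \<omega>_def mult_ac)
qed simp

lemma trig_poly_average:
  assumes W: "\<And>k. k \<noteq> 0 \<Longrightarrow> (\<lambda>N. (\<Sum>n<N. cis (2 * pi * of_int k * \<gamma> n)) / of_nat N) \<longlonglongrightarrow> 0"
  assumes "trig_poly h"
  shows "continuous_on UNIV h \<and> (\<lambda>N. (\<Sum>n<N. h (\<gamma> n)) / of_nat N) \<longlonglongrightarrow> integral {0..1} h"
  using assms(2)
proof induction
  case (mono a k)
  have c: "continuous_on UNIV (\<lambda>x. a * cis (2 * pi * of_int k * x))"
    by (intro continuous_intros)
  have "(\<lambda>N. (\<Sum>n<N. a * cis (2 * pi * of_int k * \<gamma> n)) / of_nat N) \<longlonglongrightarrow> (if k = 0 then a else 0)"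
  proof (cases "k = 0")
    case True
    have "\<forall>\<^sub>F N in sequentially. a = (\<Sum>n<N. a * cis (2 * pi * of_int k * \<gamma> n)) / of_nat N"
      using eventually_gt_at_top[of 0] by eventually_elim (simp add: True)
    from Lim_transform_eventually[OF tendsto_const this] True show ?thesis by simp
  next
    case False
    from tendsto_mult[OF tendsto_const[of a] W[OF False]] False
    show ?thesis by (simp add: sum_distrib_left)
  qed
  thus ?case using c integral_cis by simp
next
  case (add f g)
  have i: "f integrable_on {0..1}" "g integrable_on {0..1}"
    using add.IH by (auto intro!: integrable_continuous_real intro: continuous_on_subset)
  have "(\<lambda>N. (\<Sum>n<N. f (\<gamma> n)) / of_nat N + (\<Sum>n<N. g (\<gamma> n)) / of_nat N) \<longlonglongrightarrow> integral {0..1} f + integral {0..1} g"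
    using add.IH by (intro tendsto_add) auto
  thus ?case using add.IH integral_add[OF i] by (auto intro!: continuous_intros simp: sum.distrib add_divide_distrib)
qed

lemma continuous_average:
  assumes W: "\<And>k. k \<noteq> 0 \<Longrightarrow> (\<lambda>N. (\<Sum>n<N. cis (2 * pi * of_int k * \<gamma> n)) / of_nat N) \<longlonglongrightarrow> 0"
  assumes g: "continuous_on UNIV (g :: complex \<Rightarrow> real)"
  shows "(\<lambda>N. (\<Sum>n<N. g (cis (2 * pi * \<gamma> n))) / real N) \<longlonglongrightarrow> integral {0..1} (\<lambda>x. g (cis (2 * pi * x)))"
proof (rule LIMSEQ_I)
  fix r :: real assume r: "r > 0"
  define e where "e = r / 4"
  have e: "e > 0" using r by (simp add: e_def)
  obtain p where p: "real_polynomial_function p" "\<And>z. z \<in> sphere 0 1 \<Longrightarrow> \<bar>g z - p z\<bar> < e"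
    using Stone_Weierstrass_real_polynomial_function[OF compact_sphere[of 0 1] continuous_on_subset[OF g] e] by blast
  define h where "h = (\<lambda>x. p (cis (2 * pi * x)))"
  have cis: "cis y \<in> sphere 0 1" for y by simp
  have hb: "\<bar>g (cis (2 * pi * x)) - h x\<bar> \<le> e" for x using p(2)[OF cis[of "2 * pi * x"]] by (simp add: h_def)
  have t: "trig_poly (\<lambda>x. of_real (h x))" unfolding h_def by (rule trig_poly_of_real_polynomial[OF p(1)])
  note a = trig_poly_average[OF W t]
  have ch: "continuous_on UNIV h"
    using conjunct1[OF a] continuous_on_Re by force
  have ih: "h integrable_on {0..1}" using ch by (intro integrable_continuous_real) (auto intro: continuous_on_subset)
  have ig: "(\<lambda>x. g (cis (2 * pi * x))) integrable_on {0..1}"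
    by (intro integrable_continuous_real continuous_on_compose2[OF g] continuous_intros) auto
  have "integral {0..1} (\<lambda>x. complex_of_real (h x)) = of_real (integral {0..1} h)"
    using integral_linear[OF ih bounded_linear_of_real] by (simp add: o_def)
  with conjunct2[OF a] have "(\<lambda>N. complex_of_real ((\<Sum>n<N. h (\<gamma> n)) / real N)) \<longlonglongrightarrow> of_real (integral {0..1} h)" by simp
  hence "(\<lambda>N. (\<Sum>n<N. h (\<gamma> n)) / real N) \<longlonglongrightarrow> integral {0..1} h" by (simp only: tendsto_of_real_iff)
  from LIMSEQ_D[OF this e] obtain N0 where N0: "\<And>N. N \<ge> N0 \<Longrightarrow> \<bar>(\<Sum>n<N. h (\<gamma> n)) / real N - integral {0..1} h\<bar> < e"
    by auto
  have id: "\<bar>integral {0..1} (\<lambda>x. g (cis (2 * pi * x))) - integral {0..1} h\<bar> \<le> e"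
  proof -
    have "norm (integral {0..1} (\<lambda>x. g (cis (2 * pi * x)) - h x)) \<le> integral {0..1::real} (\<lambda>x. e)"
      by (intro integral_norm_bound_integral integrable_diff ig ih integrable_const_ivl) (use hb in simp)
    thus ?thesis using integral_diff[OF ig ih] by simp
  qed
  show "\<exists>N0. \<forall>N\<ge>N0. norm ((\<Sum>n<N. g (cis (2 * pi * \<gamma> n))) / real N - integral {0..1} (\<lambda>x. g (cis (2 * pi * x)))) < r"
  proof (intro exI[of _ "max N0 1"] allI impI)
    fix N assume N: "N \<ge> max N0 1"
    have "\<bar>(\<Sum>n<N. g (cis (2 * pi * \<gamma> n))) / real N - (\<Sum>n<N. h (\<gamma> n)) / real N\<bar> = \<bar>\<Sum>n<N. g (cis (2 * pi * \<gamma> n)) - h (\<gamma> n)\<bar> / real N"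
      by (simp add: sum_subtractf diff_divide_distrib[symmetric] abs_divide)
    also have "\<dots> \<le> (\<Sum>n<N. e) / real N"
      by (intro divide_right_mono order_trans[OF sum_abs] sum_mono hb) auto
    also have "\<dots> = e" using N by simp
    finally have "\<bar>(\<Sum>n<N. g (cis (2 * pi * \<gamma> n))) / real N - (\<Sum>n<N. h (\<gamma> n)) / real N\<bar> \<le> e" .
    moreover have "\<bar>(\<Sum>n<N. h (\<gamma> n)) / real N - integral {0..1} h\<bar> < e" using N0 N by simp
    ultimately have "\<bar>(\<Sum>n<N. g (cis (2 * pi * \<gamma> n))) / real N - integral {0..1} (\<lambda>x. g (cis (2 * pi * x)))\<bar> < 4 * e"
      using id e by linarith
    thus "norm ((\<Sum>n<N. g (cis (2 * pi * \<gamma> n))) / real N - integral {0..1} (\<lambda>x. g (cis (2 * pi * x)))) < r"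
      by (simp add: e_def)
  qed
qed

lemma cis_2pi_eq_iff: "cis (2 * pi * x) = cis (2 * pi * y) \<longleftrightarrow> x - y \<in> \<int>"
proof -
  have "cis (2 * pi * x) = cis (2 * pi * y) \<longleftrightarrow> exp (\<i> * of_real (2 * pi * x)) = exp (\<i> * of_real (2 * pi * y))"
    by (simp add: cis_conv_exp)
  also have "\<dots> \<longleftrightarrow> (\<exists>n::int. \<i> * of_real (2 * pi * x) = \<i> * of_real (2 * pi * y) + of_real (of_int (2 * n) * pi) * \<i>)"
    by (rule exp_eq)
  also have "\<dots> \<longleftrightarrow> (\<exists>n::int. x - y = of_int n)"
  proof (rule ex_cong1)
    fix n :: int
    have "\<i> * of_real (2 * pi * x) = \<i> * of_real (2 * pi * y) + of_real (of_int (2 * n) * pi) * \<i> \<longleftrightarrow>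
       \<i> * (of_real (2 * pi) * of_real (x - y - of_int n)) = 0" by (simp add: algebra_simps)
    also have "\<dots> \<longleftrightarrow> x - y - of_int n = 0" by (simp del: of_real_diff)
    also have "\<dots> \<longleftrightarrow> x - y = of_int n" by auto
    finally show "\<i> * of_real (2 * pi * x) = \<i> * of_real (2 * pi * y) + of_real (of_int (2 * n) * pi) * \<i> \<longleftrightarrow> x - y = of_int n" .
  qed
  also have "\<dots> \<longleftrightarrow> x - y \<in> \<int>" by (auto simp: Ints_def)
  finally show ?thesis .
qed

text \<open>The indicator of the arc is majorised by continuous functions $\max(0, 1 - m\, d(z, K))$ that decrease to
  it.\<close>

lemma frequency_upper_bound:
  assumes W: "\<And>k. k \<noteq> 0 \<Longrightarrow> (\<lambda>N. (\<Sum>n<N. cis (2 * pi * of_int k * \<gamma> n)) / of_nat N) \<longlonglongrightarrow> 0"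
  assumes ab: "0 \<le> a" "a \<le> b" "b \<le> 1" and e: "e > 0"
  shows "\<forall>\<^sub>F N in sequentially. real (card {n. n < N \<and> a \<le> frac (\<gamma> n) \<and> frac (\<gamma> n) < b}) / real N \<le> b - a + e"
proof (cases "a = b")
  case True
  hence em: "{n. n < N \<and> a \<le> frac (\<gamma> n) \<and> frac (\<gamma> n) < b} = {}" for N by auto
  show ?thesis unfolding em using e True by simp
next
  case False
  define K where "K = (\<lambda>x. cis (2 * pi * x)) ` {a..b}"
  have K: "compact K" "K \<noteq> {}" unfolding K_def using ab
    by (auto intro!: compact_continuous_image continuous_intros)
  hence Kc: "closed K" by (simp add: compact_imp_closed)
  define u where "u = (\<lambda>m z. max 0 (1 - real m * infdist z K))"
  have cu: "continuous_on UNIV (u m)" for m unfolding u_def by (intro continuous_intros)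
  have ub: "0 \<le> u m z" "u m z \<le> 1" for m z
    using infdist_nonneg[of z K] by (auto simp: u_def)
  have u1: "u m z = 1" if "z \<in> K" for m z using that by (simp add: u_def)
  have lim: "(\<lambda>m. u m z) \<longlonglongrightarrow> indicator K z" for z
  proof (cases "z \<in> K")
    case False
    hence p: "infdist z K > 0" using K Kc by (simp add: infdist_pos_not_in_closed)
    have "\<forall>\<^sub>F m in sequentially. real m \<ge> 1 / infdist z K"
      using filterlim_real_sequentially by (auto simp: filterlim_at_top)
    hence "\<forall>\<^sub>F m in sequentially. 0 = u m z"
      by eventually_elim (use p in \<open>simp add: u_def field_simps\<close>)
    from Lim_transform_eventually[OF tendsto_const this] False show ?thesis by simp
  qed (use u1 in simp)
  define I where "I = (\<lambda>m. integral {0..1} (\<lambda>x. u m (cis (2 * pi * x))))"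
  have iu: "(\<lambda>x. u m (cis (2 * pi * x))) integrable_on {0..1}" for m
    by (intro integrable_continuous_real continuous_on_compose2[OF cu] continuous_intros) auto
  have "I \<longlonglongrightarrow> integral {0..1} (\<lambda>x. indicator K (cis (2 * pi * x)))"
    unfolding I_def by (rule dominated_convergence(2)[OF iu integrable_const_ivl[of 1]]) (use ub lim in \<open>auto simp: abs_le_iff intro: order_trans\<close>)
  also have "integral {0..1} (\<lambda>x. indicator K (cis (2 * pi * x))) = integral {0..1} (\<lambda>x. indicator {a..b} x :: real)"
  proof (rule integral_spike[of "{0,1}"])
    fix x :: real assume x: "x \<in> {0..1} - {0, 1}"
    have "cis (2 * pi * x) \<in> K \<longleftrightarrow> x \<in> {a..b}"
    proof
      assume "cis (2 * pi * x) \<in> K"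
      then obtain y where y: "y \<in> {a..b}" "cis (2 * pi * x) = cis (2 * pi * y)" by (auto simp: K_def)
      then obtain n :: int where n: "x - y = of_int n" unfolding cis_2pi_eq_iff by (auto elim: Ints_cases)
      have "\<bar>x - y\<bar> < 1" using x y ab by auto
      hence "n = 0" unfolding n by linarith
      thus "x \<in> {a..b}" using n y by simp
    qed (auto simp: K_def)
    thus "indicator {a..b} x = (indicator K (cis (2 * pi * x)) :: real)" by (auto simp: indicator_def)
  qed auto
  also have "integral {0..1} (\<lambda>x. indicator {a..b} x :: real) = b - a"
  proof -
    have "((\<lambda>x. indicator {a..b} x :: real) has_integral (b - a)) {0..1}"
      using has_integral_restrict[of "{a..b}" "{0..1}" "\<lambda>_. 1::real" "b - a"] has_integral_const_real[of "1::real" a b] ab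
      by (auto simp: indicator_def of_bool_def)
    thus ?thesis by (rule integral_unique)
  qed
  finally have "I \<longlonglongrightarrow> b - a" .
  hence "\<forall>\<^sub>F m in sequentially. I m < b - a + e / 2" using e by (intro order_tendstoD(2)) auto
  then obtain m where m: "I m < b - a + e / 2" by (auto simp: eventually_sequentially)
  have "\<forall>\<^sub>F N in sequentially. (\<Sum>n<N. u m (cis (2 * pi * \<gamma> n))) / real N < I m + e / 2"
    using continuous_average[OF W cu[of m]] e unfolding I_def by (intro order_tendstoD(2)) auto
  thus ?thesis
  proof eventually_elim
    case (elim N)
    define S where "S = {n. n < N \<and> a \<le> frac (\<gamma> n) \<and> frac (\<gamma> n) < b}"
    have S: "S \<subseteq> {..<N}" by (auto simp: S_def)
    have "real (card S) = (\<Sum>n\<in>S. u m (cis (2 * pi * \<gamma> n)))"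
    proof -
      have "u m (cis (2 * pi * \<gamma> n)) = 1" if "n \<in> S" for n
      proof (rule u1)
        have "cis (2 * pi * \<gamma> n) = cis (2 * pi * frac (\<gamma> n))" unfolding cis_2pi_eq_iff by (simp add: frac_def)
        thus "cis (2 * pi * \<gamma> n) \<in> K" using that by (auto simp: K_def S_def)
      qed
      thus ?thesis by simp
    qed
    also have "\<dots> \<le> (\<Sum>n<N. u m (cis (2 * pi * \<gamma> n)))" by (rule sum_mono2) (use S ub in auto)
    finally have "real (card S) / real N \<le> (\<Sum>n<N. u m (cis (2 * pi * \<gamma> n))) / real N" by (intro divide_right_mono) auto
    thus ?case using elim m unfolding S_def by linarith
  qed
qed

text \<open>Only upper bounds for frequencies are needed: the lower bound for $[a,b)$ follows from upper bounds for
  the two complementary intervals.\<close>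

theorem Weyl_criterion:
  assumes W: "\<And>k. k \<noteq> 0 \<Longrightarrow> (\<lambda>N. (\<Sum>n<N. cis (2 * pi * of_int k * \<gamma> n)) / of_nat N) \<longlonglongrightarrow> 0"
  shows "uniformly_distributed_mod_1 \<gamma>"
  unfolding uniformly_distributed_mod_1_def
proof (intro allI impI LIMSEQ_I)
  fix a b r :: real assume ab: "0 \<le> a" "a < b" "b \<le> 1" and r: "r > 0"
  define F where "F = (\<lambda>a b N. real (card {n. n < N \<and> a \<le> frac (\<gamma> n) \<and> frac (\<gamma> n) < b}) / real N)"
  have e: "r / 4 > 0" using r by simp
  have "\<forall>\<^sub>F N in sequentially. F a b N \<le> b - a + r / 4" "\<forall>\<^sub>F N in sequentially. F 0 a N \<le> a - 0 + r / 4" "\<forall>\<^sub>F N in sequentially. F b 1 N \<le> 1 - b + r / 4"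
    unfolding F_def by (rule frequency_upper_bound[OF W _ _ _ e]; use ab in simp)+
  hence "\<forall>\<^sub>F N in sequentially. \<bar>F a b N - (b - a)\<bar> < r" using eventually_gt_at_top[of 0]
  proof eventually_elim
    case (elim N)
    let ?S = "\<lambda>a b. {n. n < N \<and> a \<le> frac (\<gamma> n) \<and> frac (\<gamma> n) < b}"
    have "{..<N} = ?S 0 a \<union> (?S a b \<union> ?S b 1)" using ab frac_lt_1 frac_ge_0 by force
    hence "N = card (?S 0 a \<union> (?S a b \<union> ?S b 1))" by (metis card_lessThan)
    also have "\<dots> = card (?S 0 a) + card (?S a b \<union> ?S b 1)" using ab by (intro card_Un_disjoint) auto
    also have "card (?S a b \<union> ?S b 1) = card (?S a b) + card (?S b 1)" using ab by (intro card_Un_disjoint) auto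
    finally have eq: "real (card (?S 0 a)) + (real (card (?S a b)) + real (card (?S b 1))) = real N" by linarith
    have "1 = F 0 a N + (F a b N + F b 1 N)"
      unfolding F_def add_divide_distrib[symmetric] eq using elim(4) by simp
    thus ?case using elim r by linarith
  qed
  thus "\<exists>no. \<forall>N\<ge>no. norm (real (card {n. n < N \<and> a \<le> frac (\<gamma> n) \<and> frac (\<gamma> n) < b}) / real N - (b - a)) < r"
    unfolding F_def eventually_sequentially by simp
qed

lemma monotone_enumeration:
  fixes f :: "'a \<Rightarrow> real"
  assumes inf: "infinite P" and fin: "\<And>T. finite {x\<in>P. f x \<le> T}"
  obtains e :: "nat \<Rightarrow> 'a" where "bij_betw e UNIV P" "mono (\<lambda>n. f (e n))"
proof -
  define S where "S = (\<lambda>A. SOME x. x \<in> P - A \<and> (\<forall>y\<in>P - A. f x \<le> f y))"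
  have S: "S A \<in> P - A \<and> (\<forall>y\<in>P - A. f (S A) \<le> f y)" if "finite A" for A
  proof -
    have "infinite (P - A)" using inf that by simp
    then obtain y0 where y0: "y0 \<in> P - A" by (metis finite.emptyI all_not_in_conv)
    define Q where "Q = {x\<in>P - A. f x \<le> f y0}"
    have Q: "finite Q" "Q \<noteq> {}" using fin[of "f y0"] y0 by (auto simp: Q_def intro: rev_finite_subset)
    obtain x where x: "x \<in> Q" "\<And>y. y \<in> Q \<Longrightarrow> f x \<le> f y"
      using arg_min_if_finite[OF Q, of f] arg_min_least[OF Q] by metis
    have "f x \<le> f y" if "y \<in> P - A" for y
      using x that by (cases "f y \<le> f y0") (auto simp: Q_def)
    hence "\<exists>x. x \<in> P - A \<and> (\<forall>y\<in>P - A. f x \<le> f y)" using x(1) by (auto simp: Q_def)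
    from someI_ex[OF this] show ?thesis unfolding S_def .
  qed
  define A where "A = rec_nat {} (\<lambda>_ B. insert (S B) B)"
  have A0: "A 0 = {}" and AS: "A (Suc n) = insert (S (A n)) (A n)" for n by (simp_all add: A_def)
  have finA: "finite (A n)" for n by (induction n) (simp_all add: A0 AS)
  define e where "e = (\<lambda>n. S (A n))"
  have Amono: "A m \<subseteq> A n" if "m \<le> n" for m n using that by (induction rule: dec_induct) (auto simp: AS)
  have eA: "e m \<in> A n" if "m < n" for m n using Amono[of "Suc m" n] that by (auto simp: AS e_def)
  have e: "e n \<in> P" "e n \<notin> A n" "\<And>y. y \<in> P - A n \<Longrightarrow> f (e n) \<le> f y" for n using S[OF finA[of n]] by (auto simp: e_def)
  have inj: "inj e"
  proof (rule linorder_injI)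
    fix m n :: nat assume "m < n"
    thus "e m \<noteq> e n" using eA e(2) by metis
  qed
  have "range e = P"
  proof (intro equalityI subsetI)
    fix x assume x: "x \<in> P"
    show "x \<in> range e"
    proof (rule ccontr)
      assume nx: "x \<notin> range e"
      have An: "A n = e ` {..<n}" for n by (induction n) (auto simp: A0 AS e_def lessThan_Suc)
      have "f (e n) \<le> f x" for n using e(3)[of x n] x nx by (auto simp: An)
      hence "range e \<subseteq> {y\<in>P. f y \<le> f x}" using e(1) by auto
      hence "finite (range e)" using fin finite_subset by blast
      thus False using inj range_inj_infinite by blast
    qed
  qed (use e(1) in auto)
  moreover have "mono (\<lambda>n. f (e n))"
  proof (rule monoI)
    fix m n :: nat assume "m \<le> n"
    hence "e n \<in> P - A m" using e(1,2)[of n] Amono[of m n] by blast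
    thus "f (e m) \<le> f (e n)" by (rule e(3))
  qed
  ultimately show ?thesis using inj that by (auto simp: bij_betw_def)
qed


text \<open>Fix $N$, put $t = |\gamma_N|$ and $T = qt$. The weight at scale $T$ is $1$ on the first $N$ terms, and the
  total weight at scale $t$ is at most $N$. So $|\sum_{n<N} e_n|$ is at most the smoothed sum at scale $T$ plus the total
  weight of the further terms, and the latter is at most $A(T) - A(t) \approx (q - 1) N$. Finally let $q \to 1$.\<close>

lemma average_from_smoothed:
  fixes \<gamma> e :: "nat \<Rightarrow> real" and w :: "real \<Rightarrow> real \<Rightarrow> real" and \<kappa> :: "real \<Rightarrow> real"
  assumes mono: "mono (\<lambda>n. \<bar>\<gamma> n\<bar>)" and fin: "\<And>T. finite {n. \<bar>\<gamma> n\<bar> \<le> T}"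
  assumes w: "\<And>q x. q > 1 \<Longrightarrow> 0 \<le> w q x" "\<And>q x. q > 1 \<Longrightarrow> w q x \<le> 1"
     "\<And>q x. q > 1 \<Longrightarrow> \<bar>x\<bar> \<le> 1 / q \<Longrightarrow> w q x = 1" "\<And>q x. q > 1 \<Longrightarrow> \<bar>x\<bar> \<ge> 1 \<Longrightarrow> w q x = 0"
  assumes e: "\<And>n. \<bar>e n\<bar> \<le> 1"
  assumes \<kappa>: "\<And>q. q > 1 \<Longrightarrow> \<kappa> q > 0"
  assumes A: "\<And>q. q > 1 \<Longrightarrow> ((\<lambda>T. (\<Sum>n\<in>{n. \<bar>\<gamma> n\<bar> \<le> T}. w q (\<gamma> n / T)) / (T * ln T)) \<longlongrightarrow> \<kappa> q) at_top"
  assumes S: "\<And>q. q > 1 \<Longrightarrow> ((\<lambda>T. (\<Sum>n\<in>{n. \<bar>\<gamma> n\<bar> \<le> T}. w q (\<gamma> n / T) * e n) / (T * ln T)) \<longlongrightarrow> 0) at_top"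
  shows "(\<lambda>N. (\<Sum>n<N. e n) / real N) \<longlonglongrightarrow> 0"
proof (rule LIMSEQ_I)
  fix r :: real assume r: "r > 0"
  \<comment> \<open>The limiting proportion of excess weight is $q - 1 = r/2$.\<close>
  define q where "q = 1 + r / 2"
  have q: "q > 1" using r by (simp add: q_def)
  define M where "M = (\<lambda>T. {n. \<bar>\<gamma> n\<bar> \<le> T})"
  define Af where "Af = (\<lambda>T. \<Sum>n\<in>M T. w q (\<gamma> n / T))"
  define Sf where "Sf = (\<lambda>T. \<Sum>n\<in>M T. w q (\<gamma> n / T) * e n)"
  define g where "g = (\<lambda>T::real. T * ln T)"
  have finM: "finite (M T)" for T unfolding M_def by (rule fin)
  have Al: "((\<lambda>T. Af T / g T) \<longlongrightarrow> \<kappa> q) at_top" unfolding Af_def M_def g_def by (rule A[OF q])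
  have Sl: "((\<lambda>T. Sf T / g T) \<longlongrightarrow> 0) at_top" unfolding Sf_def M_def g_def by (rule S[OF q])
  have fq: "filterlim (\<lambda>T. q * T) at_top at_top" using q by real_asymp
  have gl: "((\<lambda>T. g (q * T) / g T) \<longlongrightarrow> q) at_top" unfolding g_def using q by real_asymp
  note Alq = filterlim_compose[OF Al fq] and Slq = filterlim_compose[OF Sl fq]
  have "((\<lambda>T. (\<bar>Sf (q * T) / g (q * T)\<bar> + Af (q * T) / g (q * T)) / (Af T / g T) * (g (q * T) / g T)) \<longlongrightarrow> (\<bar>0\<bar> + \<kappa> q) / \<kappa> q * q) at_top"
    using \<kappa>[OF q] by (intro tendsto_intros Alq Slq Al gl) auto
  moreover have "\<forall>\<^sub>F T in at_top. (\<bar>Sf (q * T) / g (q * T)\<bar> + Af (q * T) / g (q * T)) / (Af T / g T) * (g (q * T) / g T) = (\<bar>Sf (q * T)\<bar> + Af (q * T)) / Af T"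
    using eventually_gt_at_top[of 1]
  proof eventually_elim
    case (elim T)
    have "q * T > 1" using q elim by (simp add: less_1_mult)
    hence "g (q * T) > 0" "g T > 0" using elim by (auto simp: g_def)
    thus ?case by (simp add: abs_divide add_divide_distrib[symmetric])
  qed
  ultimately have "((\<lambda>T. (\<bar>Sf (q * T)\<bar> + Af (q * T)) / Af T) \<longlongrightarrow> q) at_top"
    using \<kappa>[OF q] by (auto dest: Lim_transform_eventually)
  hence e1: "\<forall>\<^sub>F T in at_top. (\<bar>Sf (q * T)\<bar> + Af (q * T)) / Af T < 1 + r"
    using r by (intro order_tendstoD(2)) (auto simp: q_def)
  have e2: "\<forall>\<^sub>F T in at_top. Af T > 0"
    using order_tendstoD(1)[OF Al \<kappa>[OF q]] eventually_gt_at_top[of 1]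
  proof eventually_elim
    case (elim T)
    have "g T > 0" using elim by (simp add: g_def)
    thus ?case using elim by (simp add: zero_less_divide_iff)
  qed
  have tl: "filterlim (\<lambda>N. \<bar>\<gamma> N\<bar>) at_top sequentially"
    unfolding filterlim_at_top
  proof
    fix Z :: real
    from fin[of Z] obtain N0 where "\<And>n. n \<in> {n. \<bar>\<gamma> n\<bar> \<le> Z} \<Longrightarrow> n < N0"
      unfolding finite_nat_set_iff_bounded by blast
    thus "\<forall>\<^sub>F n in sequentially. Z \<le> \<bar>\<gamma> n\<bar>"
      unfolding eventually_sequentially by (intro exI[of _ N0] allI impI) (force simp: not_le[symmetric])
  qed
  have ev: "\<forall>\<^sub>F N in sequentially. \<bar>\<Sum>n<N. e n\<bar> / real N < r"
    using eventually_compose_filterlim[OF e1 tl] eventually_compose_filterlim[OF e2 tl] eventually_compose_filterlim[OF eventually_gt_at_top[of 0] tl]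
  proof eventually_elim
    case (elim N)
    define t where "t = \<bar>\<gamma> N\<bar>"
    define T where "T = q * t"
    have t: "t > 0" using elim by (simp add: t_def)
    have T: "T > 0" "t / T = 1 / q" "t \<le> T" using t q by (auto simp: T_def)
    have le: "\<bar>\<gamma> n\<bar> \<le> t" if "n < N" for n using monoD[OF mono, of n N] that by (simp add: t_def)
    have ge: "\<bar>\<gamma> n\<bar> \<ge> t" if "n \<ge> N" for n using monoD[OF mono that] by (simp add: t_def)
    have sub: "{..<N} \<subseteq> M T" using le T(3) by (force simp: M_def)
    have w1: "w q (\<gamma> n / T) = 1" if "n < N" for n
    proof (rule w(3)[OF q])
      have "\<bar>\<gamma> n / T\<bar> = \<bar>\<gamma> n\<bar> / T" using T by (simp add: abs_divide)
      also have "\<dots> \<le> t / T" using le[OF that] T by (intro divide_right_mono) auto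
      finally show "\<bar>\<gamma> n / T\<bar> \<le> 1 / q" using T by simp
    qed
    have s1: "Af T = real N + (\<Sum>n\<in>M T - {..<N}. w q (\<gamma> n / T))"
      unfolding Af_def by (subst sum.subset_diff[OF sub finM]) (simp add: w1)
    have s2: "Sf T = (\<Sum>n<N. e n) + (\<Sum>n\<in>M T - {..<N}. w q (\<gamma> n / T) * e n)"
      unfolding Sf_def by (subst sum.subset_diff[OF sub finM]) (simp add: w1)
    have "\<bar>\<Sum>n\<in>M T - {..<N}. w q (\<gamma> n / T) * e n\<bar> \<le> (\<Sum>n\<in>M T - {..<N}. w q (\<gamma> n / T))"
    proof (rule order_trans[OF sum_abs sum_mono])
      fix n
      have "w q (\<gamma> n / T) * \<bar>e n\<bar> \<le> w q (\<gamma> n / T) * 1" by (intro mult_left_mono e w q)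
      thus "\<bar>w q (\<gamma> n / T) * e n\<bar> \<le> w q (\<gamma> n / T)" using w(1)[OF q, of "\<gamma> n / T"] by (simp add: abs_mult)
    qed
    hence up: "\<bar>\<Sum>n<N. e n\<bar> \<le> \<bar>Sf T\<bar> + Af T - real N" using s1 s2 by linarith
    have "Af t = (\<Sum>n\<in>M t \<inter> {..<N}. w q (\<gamma> n / t))" unfolding Af_def
    proof (rule sum.mono_neutral_right[OF finM])
      show "\<forall>n\<in>M t - M t \<inter> {..<N}. w q (\<gamma> n / t) = 0"
      proof
        fix n assume "n \<in> M t - M t \<inter> {..<N}"
        hence "\<bar>\<gamma> n\<bar> \<ge> t" using ge[of n] by auto
        hence "\<bar>\<gamma> n / t\<bar> \<ge> 1" using t by (simp add: abs_divide)
        thus "w q (\<gamma> n / t) = 0" by (rule w(4)[OF q])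
      qed
    qed auto
    also have "\<dots> \<le> (\<Sum>n\<in>M t \<inter> {..<N}. 1)" by (intro sum_mono w q)
    also have "\<dots> \<le> real N" using card_mono[of "{..<N}" "M t \<inter> {..<N}"] by simp
    finally have AN: "Af t \<le> real N" .
    have At: "Af t > 0" using elim by (simp add: t_def)
    have "Af T \<ge> 0" unfolding Af_def by (intro sum_nonneg w q)
    have "\<bar>\<Sum>n<N. e n\<bar> / real N \<le> (\<bar>Sf T\<bar> + Af T - real N) / real N" by (intro divide_right_mono up) auto
    also have "\<dots> = (\<bar>Sf T\<bar> + Af T) / real N - 1" using AN At by (simp add: diff_divide_distrib)
    also have "(\<bar>Sf T\<bar> + Af T) / real N \<le> (\<bar>Sf T\<bar> + Af T) / Af t"
      using AN At \<open>Af T \<ge> 0\<close> by (intro divide_left_mono) auto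
    also have "\<dots> < 1 + r" using elim unfolding T_def t_def by simp
    finally show ?case by simp
  qed
  thus "\<exists>no. \<forall>N\<ge>no. norm ((\<Sum>n<N. e n) / real N - 0) < r"
    by (simp add: eventually_sequentially abs_divide)
qed

context log_framework
begin

text \<open>$1$ on $[-1/q, 1/q]$ and $0$ outside $[-1, 1]$; the slope $3q/(q-1)$ makes the step of length $3$ fit in between.\<close>

definition plateau :: "real \<Rightarrow> real \<Rightarrow> real" where
  "plateau q = bump (3 * q / (q - 1)) (3 * q / (q - 1)) (2 * (3 * q / (q - 1)) - 3)"

lemma plateau_slope: "q > (1::real) \<Longrightarrow> 3 * q / (q - 1) \<ge> 3" by (simp add: field_simps)

lemma plateau_props:
  assumes q: "q > 1"
  shows "0 \<le> plateau q x" "plateau q x \<le> 1" "\<bar>x\<bar> \<le> 1 / q \<Longrightarrow> plateau q x = 1" "\<bar>x\<bar> \<ge> 1 \<Longrightarrow> plateau q x = 0"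
    "C2_supported (-1) 1 (plateau q) (bump' (3 * q / (q - 1)) (3 * q / (q - 1)) (2 * (3 * q / (q - 1)) - 3))
        (bump'' (3 * q / (q - 1)) (3 * q / (q - 1)) (2 * (3 * q / (q - 1)) - 3))"
proof -
  define m where "m = 3 * q / (q - 1)"
  have m: "m \<ge> 3" using plateau_slope[OF q] by (simp add: m_def)
  have p: "plateau q = bump m m (2 * m - 3)" by (simp add: plateau_def m_def)
  show "0 \<le> plateau q x" "plateau q x \<le> 1" unfolding p using m by (auto intro!: bump_properties)
  have mq: "m / q = m - 3" using q by (simp add: m_def field_simps)
  show "plateau q x = 1" if x: "\<bar>x\<bar> \<le> 1 / q"
  proof -
    have "m * \<bar>x\<bar> \<le> m * (1 / q)" using x m by (intro mult_left_mono) auto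
    hence "\<bar>m * x\<bar> \<le> m - 3" using mq m by (simp add: abs_mult)
    thus ?thesis unfolding p by (intro bump_plateau) auto
  qed
  have "C2_supported (- m / m) ((2 * m - 3 + 3 - m) / m) (bump m m (2 * m - 3)) (bump' m m (2 * m - 3)) (bump'' m m (2 * m - 3))"
    using m by (intro C2_supported_bump) auto
  moreover have "- m / m = -1" "(2 * m - 3 + 3 - m) / m = 1" using m by (auto simp: field_simps)
  ultimately have c: "C2_supported (-1) 1 (bump m m (2 * m - 3)) (bump' m m (2 * m - 3)) (bump'' m m (2 * m - 3))" by simp
  thus "C2_supported (-1) 1 (plateau q) (bump' (3 * q / (q - 1)) (3 * q / (q - 1)) (2 * (3 * q / (q - 1)) - 3))
        (bump'' (3 * q / (q - 1)) (3 * q / (q - 1)) (2 * (3 * q / (q - 1)) - 3))" unfolding p m_def .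
  show "plateau q x = 0" if "\<bar>x\<bar> \<ge> 1"
    using c that unfolding p C2_supported_def by (auto simp: abs_if split: if_splits)
qed

lemma C2_supported_scaled:
  assumes f: "C2_supported (-1) 1 f f' f''" and T: "T > 0"
  shows "C2_supported (-T) T (\<lambda>t. f (t / T)) (\<lambda>t. f' (t / T) / T) (\<lambda>t. f'' (t / T) / T\<^sup>2)"
  unfolding C2_supported_def
proof (intro conjI allI impI)
  fix t
  have d: "((\<lambda>t. t / T) has_real_derivative 1 / T) (at t)" using T by (auto intro!: derivative_eq_intros)
  have f1: "(f has_real_derivative f' x) (at x)" "(f' has_real_derivative f'' x) (at x)" for x
    using f by (auto simp: C2_supported_def)
  show "((\<lambda>t. f (t / T)) has_real_derivative f' (t / T) / T) (at t)"
    using DERIV_chain2[OF f1(1) d] by simp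
  show "((\<lambda>t. f' (t / T) / T) has_real_derivative f'' (t / T) / T\<^sup>2) (at t)"
    using DERIV_cdivide[OF DERIV_chain2[OF f1(2) d], of T] by (simp add: power2_eq_square)
next
  have "continuous_on UNIV (\<lambda>t. f'' (t / T))"
    by (rule continuous_on_compose2[OF C2_supported_continuous(3)[OF f, of UNIV]]) (use T in \<open>auto intro!: continuous_intros\<close>)
  thus "continuous_on UNIV (\<lambda>t. f'' (t / T) / T\<^sup>2)" using T by (intro continuous_intros) auto
next
  fix t assume "t \<notin> {-T<..<T}"
  hence "t / T \<notin> {-1<..<1}" using T by (auto simp: field_simps)
  thus "f (t / T) = 0" "f' (t / T) / T = 0" "f'' (t / T) / T\<^sup>2 = 0" using f by (auto simp: C2_supported_def)
qed (use T in auto)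

lemma C2_supported_mult_cos:
  assumes f: "C2_supported a b f f' f''"
  shows "C2_supported a b (\<lambda>t. f t * cos (\<omega> * t + \<phi>)) (\<lambda>t. f' t * cos (\<omega> * t + \<phi>) - \<omega> * (f t * sin (\<omega> * t + \<phi>)))
     (\<lambda>t. f'' t * cos (\<omega> * t + \<phi>) - 2 * \<omega> * (f' t * sin (\<omega> * t + \<phi>)) - \<omega>\<^sup>2 * (f t * cos (\<omega> * t + \<phi>)))"
  unfolding C2_supported_def
proof (intro conjI allI impI)
  fix t
  have f1: "(f has_real_derivative f' x) (at x)" "(f' has_real_derivative f'' x) (at x)" for x
    using f by (auto simp: C2_supported_def)
  show "((\<lambda>t. f t * cos (\<omega> * t + \<phi>)) has_real_derivative f' t * cos (\<omega> * t + \<phi>) - \<omega> * (f t * sin (\<omega> * t + \<phi>))) (at t)"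
    by (auto intro!: derivative_eq_intros f1 simp: algebra_simps)
  show "((\<lambda>t. f' t * cos (\<omega> * t + \<phi>) - \<omega> * (f t * sin (\<omega> * t + \<phi>))) has_real_derivative
     f'' t * cos (\<omega> * t + \<phi>) - 2 * \<omega> * (f' t * sin (\<omega> * t + \<phi>)) - \<omega>\<^sup>2 * (f t * cos (\<omega> * t + \<phi>))) (at t)"
    by (auto intro!: derivative_eq_intros f1 simp: algebra_simps power2_eq_square)
next
  show "continuous_on UNIV (\<lambda>t. f'' t * cos (\<omega> * t + \<phi>) - 2 * \<omega> * (f' t * sin (\<omega> * t + \<phi>)) - \<omega>\<^sup>2 * (f t * cos (\<omega> * t + \<phi>)))"
    by (intro continuous_intros C2_supported_continuous[OF f])
qed (use f in \<open>auto simp: C2_supported_def\<close>)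

lemma plateau_zero_count:
  assumes q: "q > 1"
  shows "((\<lambda>T. (\<Sum>w\<in>nt_zeros T. real_of_int (zorder L w) * plateau q (Im w / T)) / (T * ln T)) \<longlongrightarrow> 2 * (\<integral>x. plateau q x \<partial>lborel) / log_const) at_top"
    and "(\<integral>x. plateau q x \<partial>lborel) > 0"
proof -
  note C = plateau_props(5)[OF q]
  obtain K where K: "K > 0" "\<And>x. \<bar>plateau q x\<bar> \<le> K" "\<And>x. \<bar>bump'' (3 * q / (q - 1)) (3 * q / (q - 1)) (2 * (3 * q / (q - 1)) - 3) x\<bar> \<le> K"
    using C2_supported_bounded[OF C] by blast
  define I where "I = (\<integral>x. plateau q x \<partial>lborel)"
  have i: "integrable lborel (plateau q)" using integrable_C2(1)[OF C, of "\<lambda>_. 1"] by (simp add: continuous_on_const)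
  have "(\<integral>x. indicator {-(1/q)..1/q} x \<partial>lborel) \<le> I" unfolding I_def
  proof (intro integral_mono integrable_indicator_Icc i)
    fix x show "indicator {-(1/q)..1/q} x \<le> plateau q x"
      using plateau_props(1,3)[OF q, of x] by (cases "x \<in> {-(1/q)..1/q}") (auto simp: abs_le_iff)
  qed
  moreover have "(\<integral>x. indicator {-(1/q)..1/q} x \<partial>lborel) = 2 / q" using q by simp
  moreover have "2 / q > 0" using q by simp
  ultimately have I: "I > 0" by linarith
  thus "(\<integral>x. plateau q x \<partial>lborel) > 0" by (simp add: I_def)
  have "(\<lambda>T. log_const * (\<Sum>w\<in>nt_zeros T. real_of_int (zorder L w) * plateau q (Im w / T)) - 2 * ln T * (\<integral>t. plateau q (t / T) \<partial>lborel)) \<in> o(\<lambda>T. T * ln T)"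
  proof (rule nontrivial_zero_sum)
    fix T :: real and t assume T: "T \<ge> 1"
    show "C2_supported (-T) T (\<lambda>t. plateau q (t / T)) (\<lambda>t. bump' (3 * q / (q - 1)) (3 * q / (q - 1)) (2 * (3 * q / (q - 1)) - 3) (t / T) / T)
        (\<lambda>t. bump'' (3 * q / (q - 1)) (3 * q / (q - 1)) (2 * (3 * q / (q - 1)) - 3) (t / T) / T\<^sup>2)"
      by (rule C2_supported_scaled[OF C]) (use T in simp)
    show "\<bar>plateau q (t / T)\<bar> \<le> K" by (rule K)
    have "\<bar>bump'' (3 * q / (q - 1)) (3 * q / (q - 1)) (2 * (3 * q / (q - 1)) - 3) (t / T)\<bar> / T\<^sup>2 \<le> K / 1"
      using T K by (intro frac_le) auto
    thus "\<bar>bump'' (3 * q / (q - 1)) (3 * q / (q - 1)) (2 * (3 * q / (q - 1)) - 3) (t / T) / T\<^sup>2\<bar> \<le> K" by (simp add: abs_divide)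
  qed
  from smalloD_tendsto[OF this]
  have "((\<lambda>T. (log_const * (\<Sum>w\<in>nt_zeros T. real_of_int (zorder L w) * plateau q (Im w / T)) - 2 * ln T * (\<integral>t. plateau q (t / T) \<partial>lborel)) / (T * ln T)) \<longlongrightarrow> 0) at_top" .
  hence "((\<lambda>T. ((log_const * (\<Sum>w\<in>nt_zeros T. real_of_int (zorder L w) * plateau q (Im w / T)) - 2 * ln T * (\<integral>t. plateau q (t / T) \<partial>lborel)) / (T * ln T) + 2 * I) / log_const) \<longlongrightarrow> (0 + 2 * I) / log_const) at_top"
    using log_const_pos by (intro tendsto_intros) auto
  moreover have "\<forall>\<^sub>F T in at_top. ((log_const * (\<Sum>w\<in>nt_zeros T. real_of_int (zorder L w) * plateau q (Im w / T)) - 2 * ln T * (\<integral>t. plateau q (t / T) \<partial>lborel)) / (T * ln T) + 2 * I) / log_const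
      = (\<Sum>w\<in>nt_zeros T. real_of_int (zorder L w) * plateau q (Im w / T)) / (T * ln T)"
    using eventually_gt_at_top[of 1]
  proof eventually_elim
    case (elim T)
    have "(\<integral>t. plateau q (0 + (1 / T) * t) \<partial>lborel) = T * I"
      using lborel_integral_real_affine[of "1 / T" "plateau q" 0] elim by (simp add: I_def field_simps)
    hence e: "(\<integral>t. plateau q (t / T) \<partial>lborel) = T * I" by simp
    have "T * ln T > 0" using elim by simp
    have gen: "((l * S - 2 * x * (T * I)) / (T * x) + 2 * I) / l = S / (T * x)" if "l > 0" "x > 0" "T > 0" for l S x T I :: real
      using that by (simp add: field_simps)
    show ?case unfolding e by (rule gen) (use log_const_pos elim in auto)
  qed
  ultimately show "((\<lambda>T. (\<Sum>w\<in>nt_zeros T. real_of_int (zorder L w) * plateau q (Im w / T)) / (T * ln T)) \<longlongrightarrow> 2 * (\<integral>x. plateau q x \<partial>lborel) / log_const) at_top"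
    unfolding I_def by (auto dest: Lim_transform_eventually)
qed

text \<open>Integrating $b(t/T)\cos(\omega t + \phi)$ by parts shows that the main term of \<open>nontrivial_zero_sum\<close> is
  $O(\log T)$ here.\<close>

lemma plateau_zero_oscillation:
  assumes q: "q > 1" and \<omega>: "\<omega> \<noteq> 0"
  shows "((\<lambda>T. (\<Sum>w\<in>nt_zeros T. real_of_int (zorder L w) * (plateau q (Im w / T) * cos (\<omega> * Im w + \<phi>))) / (T * ln T)) \<longlongrightarrow> 0) at_top"
proof -
  define g where "g = plateau q"
  define g' where "g' = bump' (3 * q / (q - 1)) (3 * q / (q - 1)) (2 * (3 * q / (q - 1)) - 3)"
  define g'' where "g'' = bump'' (3 * q / (q - 1)) (3 * q / (q - 1)) (2 * (3 * q / (q - 1)) - 3)"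
  have C: "C2_supported (-1) 1 g g' g''" unfolding g_def g'_def g''_def by (rule plateau_props(5)[OF q])
  obtain K where K: "K > 0" "\<And>x. \<bar>g x\<bar> \<le> K" "\<And>x. \<bar>g' x\<bar> \<le> K" "\<And>x. \<bar>g'' x\<bar> \<le> K"
    using C2_supported_bounded[OF C] by blast
  define K' where "K' = K + 2 * \<bar>\<omega>\<bar> * K + \<omega>\<^sup>2 * K"
  have s: "(\<lambda>T. log_const * (\<Sum>w\<in>nt_zeros T. real_of_int (zorder L w) * (g (Im w / T) * cos (\<omega> * Im w + \<phi>))) - 2 * ln T * (\<integral>t. g (t / T) * cos (\<omega> * t + \<phi>) \<partial>lborel)) \<in> o(\<lambda>T. T * ln T)"
  proof (rule nontrivial_zero_sum)
    fix T :: real and t assume T: "T \<ge> 1"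
    show "C2_supported (-T) T (\<lambda>t. g (t / T) * cos (\<omega> * t + \<phi>)) (\<lambda>t. g' (t / T) / T * cos (\<omega> * t + \<phi>) - \<omega> * (g (t / T) * sin (\<omega> * t + \<phi>)))
     (\<lambda>t. g'' (t / T) / T\<^sup>2 * cos (\<omega> * t + \<phi>) - 2 * \<omega> * (g' (t / T) / T * sin (\<omega> * t + \<phi>)) - \<omega>\<^sup>2 * (g (t / T) * cos (\<omega> * t + \<phi>)))"
      by (intro C2_supported_mult_cos C2_supported_scaled[OF C]) (use T in simp)
    have K0: "0 \<le> 2 * \<bar>\<omega>\<bar> * K" "0 \<le> \<omega>\<^sup>2 * K" using K by auto
    have c: "\<bar>x * cos y\<bar> \<le> \<bar>x\<bar>" "\<bar>x * sin y\<bar> \<le> \<bar>x\<bar>" for x y :: real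
      by (auto simp: abs_mult mult_left_le)
    show "\<bar>g (t / T) * cos (\<omega> * t + \<phi>)\<bar> \<le> K'"
      using c(1)[of "g (t / T)" "\<omega> * t + \<phi>"] K(2)[of "t / T"] K0 unfolding K'_def by linarith
    have d: "\<bar>g'' (t / T) / T\<^sup>2\<bar> \<le> K" "\<bar>g' (t / T) / T\<bar> \<le> K"
    proof -
      have "\<bar>g'' (t / T)\<bar> / T\<^sup>2 \<le> K / 1" "\<bar>g' (t / T)\<bar> / T \<le> K / 1"
        by (rule frac_le; use T K in \<open>simp add: one_le_power less_imp_le\<close>)+
      thus "\<bar>g'' (t / T) / T\<^sup>2\<bar> \<le> K" "\<bar>g' (t / T) / T\<bar> \<le> K" using T by (simp_all add: abs_divide)
    qed
    have "\<bar>2 * \<omega> * (g' (t / T) / T * sin (\<omega> * t + \<phi>))\<bar> \<le> 2 * \<bar>\<omega>\<bar> * K"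
    proof -
      have "\<bar>2 * \<omega> * X\<bar> \<le> 2 * \<bar>\<omega>\<bar> * K" if "\<bar>X\<bar> \<le> K" for X
        using that by (simp add: abs_mult mult_left_mono)
      thus ?thesis using order_trans[OF c(2) d(2), of "\<omega> * t + \<phi>"] by blast
    qed
    moreover have "\<bar>\<omega>\<^sup>2 * (g (t / T) * cos (\<omega> * t + \<phi>))\<bar> \<le> \<omega>\<^sup>2 * K"
      using order_trans[OF c(1) K(2), of "t / T" "\<omega> * t + \<phi>"] by (subst abs_mult) (auto intro!: mult_mono)
    moreover have "\<bar>g'' (t / T) / T\<^sup>2 * cos (\<omega> * t + \<phi>)\<bar> \<le> K"
      using order_trans[OF c(1) d(1)] .
    ultimately show "\<bar>g'' (t / T) / T\<^sup>2 * cos (\<omega> * t + \<phi>) - 2 * \<omega> * (g' (t / T) / T * sin (\<omega> * t + \<phi>)) - \<omega>\<^sup>2 * (g (t / T) * cos (\<omega> * t + \<phi>))\<bar> \<le> K'"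
      unfolding K'_def by linarith
  qed
  have ib: "\<bar>\<integral>t. g (t / T) * cos (\<omega> * t + \<phi>) \<partial>lborel\<bar> \<le> 2 * K / \<omega>\<^sup>2" if T: "T \<ge> 1" for T
  proof -
    define u where "u = (\<lambda>t. - cos (\<omega> * t + \<phi>) / \<omega>\<^sup>2)"
    have CT: "C2_supported (-T) T (\<lambda>t. g (t / T)) (\<lambda>t. g' (t / T) / T) (\<lambda>t. g'' (t / T) / T\<^sup>2)"
      by (rule C2_supported_scaled[OF C]) (use T in simp)
    have "(\<integral>t. u t * (g'' (t / T) / T\<^sup>2) \<partial>lborel) = (\<integral>t. cos (\<omega> * t + \<phi>) * g (t / T) \<partial>lborel)"
    proof (rule integral_parts_C2[OF CT])
      show "(u has_real_derivative sin (\<omega> * x + \<phi>) / \<omega>) (at x)" for x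
        unfolding u_def using \<omega> by (auto intro!: derivative_eq_intros simp: power2_eq_square)
      show "((\<lambda>x. sin (\<omega> * x + \<phi>) / \<omega>) has_real_derivative cos (\<omega> * x + \<phi>)) (at x)" for x
        using \<omega> by (auto intro!: derivative_eq_intros)
    qed (intro continuous_intros)
    hence "\<bar>\<integral>t. g (t / T) * cos (\<omega> * t + \<phi>) \<partial>lborel\<bar> = \<bar>\<integral>t. u t * (g'' (t / T) / T\<^sup>2) \<partial>lborel\<bar>" by (simp add: mult.commute)
    also have "\<dots> \<le> (\<integral>t. \<bar>u t * (g'' (t / T) / T\<^sup>2)\<bar> \<partial>lborel)" by (rule integral_abs_bound)
    also have "\<dots> \<le> (\<integral>t. (K / (\<omega>\<^sup>2 * T\<^sup>2)) * indicator {-T..T} t \<partial>lborel)"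
    proof (rule integral_mono)
      have cu: "continuous_on UNIV u" unfolding u_def using \<omega> by (intro continuous_intros) auto
      show "integrable lborel (\<lambda>t. \<bar>u t * (g'' (t / T) / T\<^sup>2)\<bar>)"
        using integrable_C2(2)[OF CT cu] by (rule integrable_abs)
      show "integrable lborel (\<lambda>t. (K / (\<omega>\<^sup>2 * T\<^sup>2)) * indicator {-T..T} t)" by (intro integrable_mult_right integrable_indicator_Icc)
      fix t
      show "\<bar>u t * (g'' (t / T) / T\<^sup>2)\<bar> \<le> (K / (\<omega>\<^sup>2 * T\<^sup>2)) * indicator {-T..T} t"
      proof (cases "t \<in> {-T..T}")
        case True
        have "\<bar>u t * (g'' (t / T) / T\<^sup>2)\<bar> = (\<bar>cos (\<omega> * t + \<phi>)\<bar> * \<bar>g'' (t / T)\<bar>) / (\<omega>\<^sup>2 * T\<^sup>2)" by (simp add: u_def abs_mult abs_divide)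
        also have "\<dots> \<le> (1 * K) / (\<omega>\<^sup>2 * T\<^sup>2)" by (intro divide_right_mono mult_mono K) auto
        finally show ?thesis using True by simp
      next
        case False
        hence z: "g'' (t / T) / T\<^sup>2 = 0" using CT by (auto simp: C2_supported_def)
        show ?thesis unfolding z using False by simp
      qed
    qed
    also have "\<dots> = (2 * K / \<omega>\<^sup>2) * (1 / T)" using T by (simp add: power2_eq_square mult_ac)
    also have "\<dots> \<le> (2 * K / \<omega>\<^sup>2) * 1" using T K by (intro mult_left_mono) auto
    finally show ?thesis by simp
  qed
  have "(\<lambda>T. 2 * ln T * (\<integral>t. g (t / T) * cos (\<omega> * t + \<phi>) \<partial>lborel)) \<in> O(\<lambda>T. ln T)"
  proof (rule bigoI[where c = "2 * (2 * K / \<omega>\<^sup>2)"], rule eventually_mono[OF eventually_ge_at_top[of 1]])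
    fix T :: real assume T: "T \<ge> 1"
    have "\<bar>ln T\<bar> * \<bar>\<integral>t. g (t / T) * cos (\<omega> * t + \<phi>) \<partial>lborel\<bar> \<le> \<bar>ln T\<bar> * (2 * K / \<omega>\<^sup>2)"
      by (intro mult_left_mono ib T) auto
    hence m: "2 * (\<bar>ln T\<bar> * \<bar>\<integral>t. g (t / T) * cos (\<omega> * t + \<phi>) \<partial>lborel\<bar>) \<le> 2 * (\<bar>ln T\<bar> * (2 * K / \<omega>\<^sup>2))" by linarith
    have "norm (2 * x * y) = 2 * (\<bar>x\<bar> * \<bar>y\<bar>)" "2 * k * norm x = 2 * (\<bar>x\<bar> * k)" for x y k :: real by (simp_all add: abs_mult)
    with m show "norm (2 * ln T * (\<integral>t. g (t / T) * cos (\<omega> * t + \<phi>) \<partial>lborel)) \<le> 2 * (2 * K / \<omega>\<^sup>2) * norm (ln T)"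
      by (simp only:)
  qed
  moreover have "(\<lambda>T::real. ln T) \<in> o(\<lambda>T. T * ln T)" by real_asymp
  ultimately have "(\<lambda>T. 2 * ln T * (\<integral>t. g (t / T) * cos (\<omega> * t + \<phi>) \<partial>lborel)) \<in> o(\<lambda>T. T * ln T)"
    by (rule landau_o.big_small_trans)
  from sum_in_smallo(1)[OF s this]
  have "(\<lambda>T. log_const * (\<Sum>w\<in>nt_zeros T. real_of_int (zorder L w) * (g (Im w / T) * cos (\<omega> * Im w + \<phi>)))) \<in> o(\<lambda>T. T * ln T)" by simp
  hence "(\<lambda>T. \<Sum>w\<in>nt_zeros T. real_of_int (zorder L w) * (g (Im w / T) * cos (\<omega> * Im w + \<phi>))) \<in> o(\<lambda>T. T * ln T)"
    using log_const_pos by simp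
  from smalloD_tendsto[OF this] show ?thesis unfolding g_def .
qed

lemma nt_zeros_zorder: "w \<in> nt_zeros T \<Longrightarrow> zorder L w > 0"
  using zorder_entire_nonneg(2)[OF holo nz] by (auto simp: nt_zeros_def)

lemma nt_zeros_nontrivial: "w \<in> nt_zeros T \<longleftrightarrow> w \<in> nontrivial_zeros L \<and> \<bar>Im w\<bar> \<le> T"
  by (auto simp: nt_zeros_def nontrivial_zeros_def)

text \<open>Sums over an enumeration with repetitions become sums over zeros weighted by multiplicity.\<close>

lemma listing_finite_and_sum:
  assumes "lists_nontrivial_zeros L \<rho>"
  shows "finite {n. \<bar>Im (\<rho> n)\<bar> \<le> T}"
    and "(\<Sum>n\<in>{n. \<bar>Im (\<rho> n)\<bar> \<le> T}. g (\<rho> n)) = (\<Sum>w\<in>nt_zeros T. real_of_int (zorder L w) * g w)"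
proof -
  have r: "\<rho> n \<in> nontrivial_zeros L" for n using assms by (auto simp: lists_nontrivial_zeros_def)
  have c: "finite {n. \<rho> n = z}" "int (card {n. \<rho> n = z}) = zorder L z" if "z \<in> nontrivial_zeros L" for z
    using assms that by (auto simp: lists_nontrivial_zeros_def)
  have e: "{n. \<bar>Im (\<rho> n)\<bar> \<le> T} = (\<Union>w\<in>nt_zeros T. {n. \<rho> n = w})"
    using r by (auto simp: nt_zeros_nontrivial)
  show "finite {n. \<bar>Im (\<rho> n)\<bar> \<le> T}" unfolding e
    by (intro finite_UN_I finite_nt_zeros c) (simp add: nt_zeros_nontrivial)
  have "(\<Sum>n\<in>{n. \<bar>Im (\<rho> n)\<bar> \<le> T}. g (\<rho> n)) = (\<Sum>w\<in>nt_zeros T. \<Sum>n\<in>{n. \<rho> n = w}. g (\<rho> n))"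
    unfolding e by (rule sum.UNION_disjoint) (use finite_nt_zeros c in \<open>auto simp: nt_zeros_nontrivial\<close>)
  also have "\<dots> = (\<Sum>w\<in>nt_zeros T. real_of_int (zorder L w) * g w)"
  proof (rule sum.cong[OF refl])
    fix w assume "w \<in> nt_zeros T"
    hence "int (card {n. \<rho> n = w}) = zorder L w" using c by (simp add: nt_zeros_nontrivial)
    hence "real (card {n. \<rho> n = w}) = real_of_int (zorder L w)" by (metis of_int_of_nat_eq)
    thus "(\<Sum>n\<in>{n. \<rho> n = w}. g (\<rho> n)) = real_of_int (zorder L w) * g w" by simp
  qed
  finally show "(\<Sum>n\<in>{n. \<bar>Im (\<rho> n)\<bar> \<le> T}. g (\<rho> n)) = (\<Sum>w\<in>nt_zeros T. real_of_int (zorder L w) * g w)" .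
qed

theorem nontrivial_zeros_uniformly_distributed:
  assumes \<rho>: "lists_nontrivial_zeros L \<rho>"
  shows "uniformly_distributed_mod_1 (\<lambda>n. Im (\<rho> n))"
proof (rule Weyl_criterion)
  fix k :: int assume k: "k \<noteq> 0"
  have avg: "(\<lambda>N. (\<Sum>n<N. cos (2 * pi * of_int k * Im (\<rho> n) + \<phi>)) / real N) \<longlonglongrightarrow> 0" for \<phi>
  proof (rule average_from_smoothed[where w = plateau and \<kappa> = "\<lambda>q. 2 * (\<integral>x. plateau q x \<partial>lborel) / log_const" and \<gamma> = "\<lambda>n. Im (\<rho> n)"])
    show "mono (\<lambda>n. \<bar>Im (\<rho> n)\<bar>)" using \<rho> by (simp add: lists_nontrivial_zeros_def)
    show "finite {n. \<bar>Im (\<rho> n)\<bar> \<le> T}" for T by (rule listing_finite_and_sum(1)[OF \<rho>])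
    fix q :: real assume q: "q > 1"
    show "0 < 2 * (\<integral>x. plateau q x \<partial>lborel) / log_const" using plateau_zero_count(2)[OF q] log_const_pos by simp
    show "((\<lambda>T. (\<Sum>n\<in>{n. \<bar>Im (\<rho> n)\<bar> \<le> T}. plateau q (Im (\<rho> n) / T)) / (T * ln T)) \<longlongrightarrow> 2 * (\<integral>x. plateau q x \<partial>lborel) / log_const) at_top"
      using plateau_zero_count(1)[OF q] by (subst listing_finite_and_sum(2)[OF \<rho>, where g = "\<lambda>z. plateau q (Im z / _)"])
    show "((\<lambda>T. (\<Sum>n\<in>{n. \<bar>Im (\<rho> n)\<bar> \<le> T}. plateau q (Im (\<rho> n) / T) * cos (2 * pi * of_int k * Im (\<rho> n) + \<phi>)) / (T * ln T)) \<longlongrightarrow> 0) at_top"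
      using plateau_zero_oscillation[OF q, of "2 * pi * of_int k" \<phi>] k
      by (subst listing_finite_and_sum(2)[OF \<rho>, where g = "\<lambda>z. plateau q (Im z / _) * cos (2 * pi * of_int k * Im z + \<phi>)"]) simp
  qed (use plateau_props in auto)
  have "cos (x + (- (pi / 2))) = sin x" for x :: real by (simp add: cos_diff)
  hence s: "(\<lambda>N. (\<Sum>n<N. sin (2 * pi * of_int k * Im (\<rho> n))) / real N) \<longlonglongrightarrow> 0" using avg[of "- (pi / 2)"] by simp
  have c: "(\<lambda>N. (\<Sum>n<N. cos (2 * pi * of_int k * Im (\<rho> n))) / real N) \<longlonglongrightarrow> 0" using avg[of 0] by simp
  have e: "(\<Sum>n<N. cis (2 * pi * of_int k * Im (\<rho> n))) / of_nat N =
      Complex ((\<Sum>n<N. cos (2 * pi * of_int k * Im (\<rho> n))) / real N) ((\<Sum>n<N. sin (2 * pi * of_int k * Im (\<rho> n))) / real N)" for N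
    by (simp add: complex_eq_iff)
  show "(\<lambda>N. (\<Sum>n<N. cis (2 * pi * of_int k * Im (\<rho> n))) / of_nat N) \<longlonglongrightarrow> 0"
    unfolding e using tendsto_Complex[OF c s] by (simp add: zero_complex.code)
qed

text \<open>A zero of multiplicity $m$ is replaced by $m$ labelled copies, which are then enumerated in order of
  $|\mathrm{Im}|$. There are infinitely many zeros because their number up to $T$ grows like $T\log T$.\<close>

theorem exists_nontrivial_zero_listing: "\<exists>\<rho>. lists_nontrivial_zeros L \<rho>"
proof -
  \<comment> \<open>The second component labels the copies of a multiple zero.\<close>
  define P where "P = {p. fst p \<in> nontrivial_zeros L \<and> snd p < nat (zorder L (fst p))}"
  define Im1 where "Im1 = (\<lambda>p::complex\<times>nat. \<bar>Im (fst p)\<bar>)"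
  have zpos: "zorder L z > 0" if "z \<in> nontrivial_zeros L" for z
    using nt_zeros_zorder[of z "\<bar>Im z\<bar>"] that by (simp add: nt_zeros_nontrivial)
  have fin: "finite {p\<in>P. Im1 p \<le> T}" for T
  proof -
    have "{p\<in>P. Im1 p \<le> T} \<subseteq> (SIGMA w:nt_zeros T. {..<nat (zorder L w)})"
      by (auto simp: P_def Im1_def nt_zeros_nontrivial)
    moreover have "finite (SIGMA w:nt_zeros T. {..<nat (zorder L w)})" using finite_nt_zeros by auto
    ultimately show ?thesis by (rule finite_subset)
  qed
  have inf: "infinite P"
  proof
    assume "finite P"
    hence "finite (fst ` P)" by simp
    moreover have "nontrivial_zeros L \<subseteq> fst ` P"
    proof
      fix z assume "z \<in> nontrivial_zeros L"
      hence "(z, 0) \<in> P" using zpos by (simp add: P_def)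
      thus "z \<in> fst ` P" by force
    qed
    ultimately have fz: "finite (nontrivial_zeros L)" using finite_subset by blast
    define X where "X = (\<Sum>w\<in>nontrivial_zeros L. real_of_int (zorder L w))"
    have q: "(2::real) > 1" by simp
    have up: "(\<Sum>w\<in>nt_zeros T. real_of_int (zorder L w) * plateau 2 (Im w / T)) \<le> X" for T
    proof -
      have "(\<Sum>w\<in>nt_zeros T. real_of_int (zorder L w) * plateau 2 (Im w / T)) \<le> (\<Sum>w\<in>nt_zeros T. real_of_int (zorder L w) * 1)"
        using plateau_props(2)[OF q] nt_zeros_zorder by (intro sum_mono mult_left_mono) (auto simp: less_imp_le)
      also have "\<dots> \<le> X" unfolding X_def using fz zpos
        by (simp, intro sum_mono2) (auto simp: nt_zeros_nontrivial less_imp_le)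
      finally show ?thesis .
    qed
    have "((\<lambda>T. X / (T * ln T)) \<longlongrightarrow> 0) at_top" by real_asymp
    moreover have "\<forall>\<^sub>F T in at_top. (\<Sum>w\<in>nt_zeros T. real_of_int (zorder L w) * plateau 2 (Im w / T)) / (T * ln T) \<le> X / (T * ln T)"
      using eventually_ge_at_top[of 1] by eventually_elim (intro divide_right_mono up, simp)
    ultimately have "2 * (\<integral>x. plateau 2 x \<partial>lborel) / log_const \<le> 0"
      using tendsto_le[OF _ _ plateau_zero_count(1)[OF q]] by force
    moreover have "2 * (\<integral>x. plateau 2 x \<partial>lborel) / log_const > 0" using plateau_zero_count(2)[OF q] log_const_pos by simp
    ultimately show False by linarith
  qed
  obtain e :: "nat \<Rightarrow> complex \<times> nat" where e: "bij_betw e UNIV P" "mono (\<lambda>n. Im1 (e n))" using monotone_enumeration[OF inf fin] by blast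
  have "lists_nontrivial_zeros L (\<lambda>n. fst (e n))" unfolding lists_nontrivial_zeros_def
  proof (intro conjI ballI)
    have eP: "e n \<in> P" for n using e(1) by (auto simp: bij_betw_def)
    show "range (\<lambda>n. fst (e n)) \<subseteq> nontrivial_zeros L" using eP by (auto simp: P_def)
    show "mono (\<lambda>n. \<bar>Im (fst (e n))\<bar>)" using e(2) by (simp add: Im1_def)
    fix z assume z: "z \<in> nontrivial_zeros L"
    have "bij_betw e {n. fst (e n) = z} ({z} \<times> {..<nat (zorder L z)})"
    proof (rule bij_betw_subset[OF e(1), THEN bij_betw_cong[THEN iffD1, rotated]])
      show "e ` {n. fst (e n) = z} = {z} \<times> {..<nat (zorder L z)}"
      proof (intro equalityI subsetI)
        fix p assume "p \<in> e ` {n. fst (e n) = z}"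
        then obtain n where "p = e n" "fst (e n) = z" by blast
        thus "p \<in> {z} \<times> {..<nat (zorder L z)}" using eP[of n] by (auto simp: P_def mem_Times_iff)
      next
        fix p assume p: "p \<in> {z} \<times> {..<nat (zorder L z)}"
        hence "p \<in> P" using z by (auto simp: P_def)
        then obtain n where "p = e n" using e(1) by (metis bij_betw_imp_surj_on imageE)
        thus "p \<in> e ` {n. fst (e n) = z}" using p by auto
      qed
    qed auto
    from bij_betw_finite[OF this] bij_betw_same_card[OF this]
    show "finite {n. fst (e n) = z}" "int (card {n. fst (e n) = z}) = zorder L z"
      using zpos[OF z] by (simp_all add: card_cartesian_product)
  qed
  thus ?thesis by blast
qed

end

section \<open>A Plancherel inequality\<close>

lemma integral_Gaussian_cis:
  assumes T: "T > 0"
  shows "integrable lborel (\<lambda>t. std_normal_density (t / T) / T)"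
    "(\<integral>t. of_real (std_normal_density (t / T) / T) * cis (t * x) \<partial>lborel) = of_real (exp (- (T * x)\<^sup>2 / 2))"
proof -
  have i: "integrable lborel std_normal_density" by (rule integrable_normal_density) simp
  have "integrable lborel (\<lambda>t. std_normal_density (0 + (1/T) * t))" by (rule lborel_integrable_real_affine[OF i]) (use T in auto)
  thus "integrable lborel (\<lambda>t. std_normal_density (t / T) / T)" by simp
  have "complex_of_real (exp (- (T * x)\<^sup>2 / 2)) = char std_normal_distribution (T * x)"
    by (simp add: char_std_normal_distribution)
  also have "\<dots> = (\<integral>y. std_normal_density y *\<^sub>R iexp (T * x * y) \<partial>lborel)"
    unfolding char_def by (subst integral_density) auto
  also have "\<dots> = (1 / T) *\<^sub>R (\<integral>t. std_normal_density (0 + (1 / T) * t) *\<^sub>R iexp (T * x * (0 + (1 / T) * t)) \<partial>lborel)"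
    using lborel_integral_real_affine[of "1/T" "\<lambda>y. std_normal_density y *\<^sub>R iexp (T * x * y)" 0] T by simp
  also have "\<dots> = (\<integral>t. (1 / T) *\<^sub>R (std_normal_density (0 + (1 / T) * t) *\<^sub>R iexp (T * x * (0 + (1 / T) * t))) \<partial>lborel)"
    by (rule integral_scaleR_right[symmetric])
  also have "\<dots> = (\<integral>t. of_real (std_normal_density (t / T) / T) * cis (t * x) \<partial>lborel)"
    using T by (intro Bochner_Integration.integral_cong refl) (simp add: cis_conv_exp scaleR_conv_of_real mult_ac)
  finally show "(\<integral>t. of_real (std_normal_density (t / T) / T) * cis (t * x) \<partial>lborel) = of_real (exp (- (T * x)\<^sup>2 / 2))" by simp
qed

lemma integral_Gaussian_translate:
  assumes T: "T > 0"
  shows "integrable lborel (\<lambda>v. exp (- (T * (u - v))\<^sup>2 / 2))" "(\<integral>v. exp (- (T * (u - v))\<^sup>2 / 2) \<partial>lborel) = sqrt (2 * pi) / T"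
proof -
  define E where "E = (\<lambda>y::real. exp (- y\<^sup>2 / 2))"
  have i: "integrable lborel std_normal_density" by (rule integrable_normal_density) simp
  have e: "E y = sqrt (2 * pi) * std_normal_density y" for y by (simp add: E_def std_normal_density_def)
  have iE: "integrable lborel E" unfolding e[abs_def] using i by (simp add: e[abs_def])
  have vE: "(\<integral>y. E y \<partial>lborel) = sqrt (2 * pi)" unfolding e by simp
  have "integrable lborel (\<lambda>v. E (T * u + (- T) * v))" by (rule lborel_integrable_real_affine[OF iE]) (use T in auto)
  thus "integrable lborel (\<lambda>v. exp (- (T * (u - v))\<^sup>2 / 2))" by (simp add: E_def algebra_simps)
  have "(\<integral>y. E y \<partial>lborel) = \<bar>-T\<bar> *\<^sub>R (\<integral>v. E (T * u + (- T) * v) \<partial>lborel)"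
    by (rule lborel_integral_real_affine) (use T in auto)
  hence "(\<integral>v. E (T * u + (- T) * v) \<partial>lborel) = sqrt (2 * pi) / T" using T vE by (simp add: field_simps)
  thus "(\<integral>v. exp (- (T * (u - v))\<^sup>2 / 2) \<partial>lborel) = sqrt (2 * pi) / T" by (simp add: E_def algebra_simps)
qed

lemma integrable_lborel_pair_bound:
  fixes F :: "real \<Rightarrow> real \<Rightarrow> complex"
  assumes "integrable lborel f" "integrable lborel g"
    and "(\<lambda>p. F (fst p) (snd p)) \<in> borel_measurable borel"
    and "\<And>x y. norm (F x y) \<le> f x * g y"
  shows "integrable (lborel \<Otimes>\<^sub>M lborel) (case_prod F)"
proof -
  have "integrable lborel (\<lambda>p. F (fst p) (snd p))"
    by (rule Bochner_Integration.integrable_bound[OF integrable_fst_mult_snd[OF assms(1,2)]])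
       (use assms in \<open>auto intro!: AE_I2 order_trans[OF assms(4)]\<close>)
  thus ?thesis by (simp add: lborel_prod case_prod_beta')
qed

lemma fst_snd_measurable:
  assumes "f \<in> borel_measurable (borel :: real measure)"
  shows "(\<lambda>p::real\<times>real. f (fst p)) \<in> borel_measurable borel" "(\<lambda>p::real\<times>real. f (snd p)) \<in> borel_measurable borel"
  using assms by (simp_all flip: borel_prod)

text \<open>Plancherel's inequality up to a constant, for integrable and square integrable functions. A Gaussian
  majorises the indicator of $[-T, T]$ up to a constant factor; its Fourier transform is again a Gaussian, of bounded total
  mass, and Schur's test applies to the resulting kernel $k(u - v)$.\<close>

theorem Plancherel_bound:
  fixes g :: "real \<Rightarrow> complex"
  assumes ig: "integrable lborel g" and ig2: "integrable lborel (\<lambda>u. (norm (g u))\<^sup>2)" and T: "T > 0"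
  shows "integrable lborel (\<lambda>t. indicator {-T..T} t * (norm (\<integral>u. g u * cis (t * u) \<partial>lborel))\<^sup>2)"
    "(\<integral>t. indicator {-T..T} t * (norm (\<integral>u. g u * cis (t * u) \<partial>lborel))\<^sup>2 \<partial>lborel) \<le> 12 * (\<integral>u. (norm (g u))\<^sup>2 \<partial>lborel)"
proof -
  define gh where "gh = (\<lambda>t. \<integral>u. g u * cis (t * u) \<partial>lborel)"
  define \<rho> where "\<rho> = (\<lambda>t. std_normal_density (t / T) / T)"
  define k where "k = (\<lambda>x. exp (- (T * x)\<^sup>2 / 2))"
  define M where "M = (\<integral>u. norm (g u) \<partial>lborel)"
  have gm [measurable]: "g \<in> borel_measurable borel" using ig by (auto dest: borel_measurable_integrable)
  have \<rho>i: "integrable lborel \<rho>" unfolding \<rho>_def by (rule integral_Gaussian_cis(1)[OF T])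
  have \<rho>m [measurable]: "\<rho> \<in> borel_measurable borel" using \<rho>i by (auto dest: borel_measurable_integrable)
  have gk: "(\<integral>t. of_real (\<rho> t) * cis (t * x) \<partial>lborel) = of_real (k x)" for x
    unfolding \<rho>_def k_def by (rule integral_Gaussian_cis(2)[OF T])
  have \<rho>c: "(\<lambda>t. complex_of_real (\<rho> t)) \<in> borel_measurable borel" by measurable
  have \<rho>0: "\<rho> t \<ge> 0" for t using T by (simp add: \<rho>_def)
  have cm: "(\<lambda>p::real\<times>real. cis (fst p * snd p)) \<in> borel_measurable borel"
    by (intro borel_measurable_continuous_onI continuous_intros)
  have ghm [measurable]: "gh \<in> borel_measurable borel"
  proof -
    have "(\<lambda>p. g (snd p) * cis (fst p * snd p)) \<in> borel_measurable borel"
      by (intro borel_measurable_times cm fst_snd_measurable gm)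
    hence "(\<lambda>(t, u). g u * cis (t * u)) \<in> borel_measurable (lborel \<Otimes>\<^sub>M lborel)"
      by (simp add: lborel_prod case_prod_beta')
    hence "gh \<in> borel_measurable lborel" unfolding gh_def
      by (rule lborel.borel_measurable_lebesgue_integral)
    thus ?thesis by simp
  qed
  have ghb: "norm (gh t) \<le> M" for t
  proof -
    have "norm (gh t) \<le> (\<integral>u. norm (g u * cis (t * u)) \<partial>lborel)" unfolding gh_def by (rule integral_norm_bound)
    thus ?thesis by (simp add: M_def norm_mult)
  qed
  have M0: "M \<ge> 0" unfolding M_def by (intro integral_nonneg_AE AE_I2) auto
  have ign: "integrable lborel (\<lambda>u. norm (g u))" using ig by (rule integrable_norm)
  have i\<rho>gh: "integrable lborel (\<lambda>t. \<rho> t * (norm (gh t))\<^sup>2)"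
  proof (rule Bochner_Integration.integrable_bound[OF integrable_mult_right[OF \<rho>i, of "M\<^sup>2"]])
    show "AE t in lborel. norm (\<rho> t * (norm (gh t))\<^sup>2) \<le> norm (M\<^sup>2 * \<rho> t)"
    proof (rule AE_I2)
      fix t
      have "(norm (gh t))\<^sup>2 \<le> M\<^sup>2" using ghb by (intro power_mono) auto
      thus "norm (\<rho> t * (norm (gh t))\<^sup>2) \<le> norm (M\<^sup>2 * \<rho> t)" using \<rho>0[of t] by (simp add: abs_mult mult.commute mult_left_mono)
    qed
  qed simp
  define P where "P = (\<integral>t. \<rho> t * (norm (gh t))\<^sup>2 \<partial>lborel)"
  have inner: "(\<integral>t. of_real (\<rho> t) * cnj (gh t) * cis (t * u) \<partial>lborel) = (\<integral>v. cnj (g v) * of_real (k (u - v)) \<partial>lborel)" for u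
  proof -
    define F where "F = (\<lambda>t v. of_real (\<rho> t) * (cnj (g v) * cis (t * (u - v))))"
    have c2: "(\<lambda>p::real\<times>real. cis (fst p * (u - snd p))) \<in> borel_measurable borel"
      by (intro borel_measurable_continuous_onI continuous_intros)
    have "(\<lambda>x. cnj (g x)) \<in> borel_measurable borel"
      using borel_measurable_continuous_onI[OF continuous_on_cnj[OF continuous_on_id]] measurable_compose[OF gm] by fastforce
    hence "(\<lambda>p. F (fst p) (snd p)) \<in> borel_measurable borel" unfolding F_def
      by (intro borel_measurable_times c2 fst_snd_measurable[of "\<lambda>v. cnj (g v)"] fst_snd_measurable[of "\<lambda>t. of_real (\<rho> t)"] \<rho>c)
    hence iF: "integrable (lborel \<Otimes>\<^sub>M lborel) (case_prod F)"
      by (intro integrable_lborel_pair_bound[OF \<rho>i ign]) (use \<rho>0 in \<open>auto simp: F_def norm_mult\<close>)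
    have "(\<integral>t. of_real (\<rho> t) * cnj (gh t) * cis (t * u) \<partial>lborel) = (\<integral>t. (\<integral>v. F t v \<partial>lborel) \<partial>lborel)"
    proof (rule Bochner_Integration.integral_cong[OF refl])
      fix t
      have "cnj (gh t) = (\<integral>v. cnj (g v * cis (t * v)) \<partial>lborel)" unfolding gh_def by (rule Bochner_Integration.integral_cnj[symmetric])
      hence "of_real (\<rho> t) * cnj (gh t) * cis (t * u) = (\<integral>v. of_real (\<rho> t) * cis (t * u) * cnj (g v * cis (t * v)) \<partial>lborel)"
        by (simp only: integral_mult_right_zero) (simp only: mult_ac)
      also have "\<dots> = (\<integral>v. F t v \<partial>lborel)"
      proof (rule Bochner_Integration.integral_cong[OF refl])
        fix v
        have "cis (t * (u - v)) = cis (t * u) * cis (- (t * v))" by (simp add: cis_mult algebra_simps)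
        thus "of_real (\<rho> t) * cis (t * u) * cnj (g v * cis (t * v)) = F t v" by (simp add: F_def cis_cnj mult_ac)
      qed
      finally show "of_real (\<rho> t) * cnj (gh t) * cis (t * u) = (\<integral>v. F t v \<partial>lborel)" .
    qed
    also have "\<dots> = (\<integral>v. (\<integral>t. F t v \<partial>lborel) \<partial>lborel)" by (rule lborel_pair.Fubini_integral[OF iF, symmetric])
    also have "\<dots> = (\<integral>v. cnj (g v) * of_real (k (u - v)) \<partial>lborel)"
    proof (rule Bochner_Integration.integral_cong[OF refl])
      fix v
      have "(\<integral>t. F t v \<partial>lborel) = (\<integral>t. cnj (g v) * (of_real (\<rho> t) * cis (t * (u - v))) \<partial>lborel)"
        by (simp add: F_def mult_ac)
      also have "\<dots> = cnj (g v) * (\<integral>t. of_real (\<rho> t) * cis (t * (u - v)) \<partial>lborel)" by simp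
      finally show "(\<integral>t. F t v \<partial>lborel) = cnj (g v) * of_real (k (u - v))"
        by (simp only: gk)
    qed
    finally show ?thesis .
  qed
  have Pe: "complex_of_real P = (\<integral>u. g u * (\<integral>v. cnj (g v) * of_real (k (u - v)) \<partial>lborel) \<partial>lborel)"
  proof -
    define F where "F = (\<lambda>t u. (of_real (\<rho> t) * cnj (gh t)) * (g u * cis (t * u)))"
    have "(\<lambda>x. cnj (gh x)) \<in> borel_measurable borel"
      using borel_measurable_continuous_onI[OF continuous_on_cnj[OF continuous_on_id]] measurable_compose[OF ghm] by fastforce
    hence "(\<lambda>p. F (fst p) (snd p)) \<in> borel_measurable borel" unfolding F_def
      by (intro borel_measurable_times cm fst_snd_measurable[of "\<lambda>v. cnj (gh v)"] fst_snd_measurable[of "\<lambda>t. of_real (\<rho> t)"] fst_snd_measurable[of g] gm \<rho>c)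
    hence iF: "integrable (lborel \<Otimes>\<^sub>M lborel) (case_prod F)"
    proof (rule integrable_lborel_pair_bound[OF integrable_mult_right[OF \<rho>i, of M] ign])
      fix t u
      have "\<rho> t * norm (gh t) * norm (g u) \<le> \<rho> t * M * norm (g u)" using \<rho>0 ghb by (intro mult_right_mono mult_left_mono) auto
      thus "norm (F t u) \<le> M * \<rho> t * norm (g u)" using \<rho>0[of t] by (simp add: F_def norm_mult mult_ac)
    qed
    have "complex_of_real P = (\<integral>t. complex_of_real (\<rho> t * (norm (gh t))\<^sup>2) \<partial>lborel)" unfolding P_def by (rule integral_of_real[symmetric, OF i\<rho>gh])
    also have "\<dots> = (\<integral>t. (\<integral>u. F t u \<partial>lborel) \<partial>lborel)"
    proof (rule Bochner_Integration.integral_cong[OF refl])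
      fix t
      have "(\<integral>u. F t u \<partial>lborel) = (of_real (\<rho> t) * cnj (gh t)) * gh t" unfolding F_def gh_def by simp
      thus "complex_of_real (\<rho> t * (norm (gh t))\<^sup>2) = (\<integral>u. F t u \<partial>lborel)"
        using complex_norm_square[of "gh t"] by (simp only: of_real_mult) (simp only: mult_ac)
    qed
    also have "\<dots> = (\<integral>u. (\<integral>t. F t u \<partial>lborel) \<partial>lborel)" by (rule lborel_pair.Fubini_integral[OF iF, symmetric])
    also have "\<dots> = (\<integral>u. g u * (\<integral>v. cnj (g v) * of_real (k (u - v)) \<partial>lborel) \<partial>lborel)"
    proof (rule Bochner_Integration.integral_cong[OF refl])
      fix u
      have "(\<integral>t. F t u \<partial>lborel) = (\<integral>t. g u * (of_real (\<rho> t) * cnj (gh t) * cis (t * u)) \<partial>lborel)" by (simp add: F_def mult_ac)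
      thus "(\<integral>t. F t u \<partial>lborel) = g u * (\<integral>v. cnj (g v) * of_real (k (u - v)) \<partial>lborel)" by (simp add: inner)
    qed
    finally show ?thesis .
  qed
  define a where "\<And>u. a u = norm (g u)"
  have am [measurable]: "a \<in> borel_measurable borel" unfolding a_def by simp
  have a0: "a u \<ge> 0" for u by (simp add: a_def)
  have k0: "k x \<ge> 0" "k x \<le> 1" for x by (auto simp: k_def)
  have km: "(\<lambda>p::real\<times>real. k (fst p - snd p)) \<in> borel_measurable borel"
    unfolding k_def by (intro borel_measurable_continuous_onI continuous_intros) auto
  have iak: "integrable lborel (\<lambda>p. a (fst p) * a (snd p) * k (fst p - snd p))"
  proof (rule Bochner_Integration.integrable_bound[OF integrable_fst_mult_snd[OF ign ign, folded a_def]])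
    show "(\<lambda>p. a (fst p) * a (snd p) * k (fst p - snd p)) \<in> borel_measurable lborel"
      using km fst_snd_measurable[OF am] by simp
    show "AE p in lborel. norm (a (fst p) * a (snd p) * k (fst p - snd p)) \<le> norm (a (fst p) * a (snd p))"
    proof (rule AE_I2)
      fix p :: "real \<times> real"
      have "a (fst p) * a (snd p) * k (fst p - snd p) \<le> a (fst p) * a (snd p) * 1" using k0 a0 by (intro mult_left_mono) auto
      thus "norm (a (fst p) * a (snd p) * k (fst p - snd p)) \<le> norm (a (fst p) * a (snd p))"
        using a0 k0 by (simp add: abs_mult)
    qed
  qed
  have ks: "k (u - v) = k (v - u)" for u v by (simp add: k_def power2_commute[of u v] power_mult_distrib)
  have ikv: "integrable lborel (\<lambda>v. k (u - v))" "(\<integral>v. k (u - v) \<partial>lborel) = sqrt (2 * pi) / T" for u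
    unfolding k_def by (rule integral_Gaussian_translate[OF T])+
  have i1: "integrable lborel (\<lambda>p. (a (fst p))\<^sup>2 * k (fst p - snd p))"
  proof -
    have "integrable (lborel \<Otimes>\<^sub>M lborel) (\<lambda>p. (a (fst p))\<^sup>2 * k (fst p - snd p))"
    proof (rule lborel_pair.Fubini_integrable)
      show "(\<lambda>p. (a (fst p))\<^sup>2 * k (fst p - snd p)) \<in> borel_measurable (lborel \<Otimes>\<^sub>M lborel)"
        unfolding lborel_prod using km fst_snd_measurable[OF am] by simp
      show "AE x in lborel. integrable lborel (\<lambda>y. (a (fst (x, y)))\<^sup>2 * k (fst (x, y) - snd (x, y)))"
        using ikv(1) by simp
      have "integrable lborel (\<lambda>x. (a x)\<^sup>2 * (sqrt (2 * pi) / T))" using ig2 by (intro integrable_mult_left) (simp add: a_def)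
      thus "integrable lborel (\<lambda>x. LINT y|lborel. norm ((a (fst (x, y)))\<^sup>2 * k (fst (x, y) - snd (x, y))))"
        using k0 ikv by (simp add: abs_mult)
    qed
    thus ?thesis by (simp add: lborel_prod)
  qed
  have v1: "(\<integral>p. (a (fst p))\<^sup>2 * k (fst p - snd p) \<partial>lborel) = (\<integral>u. (a u)\<^sup>2 \<partial>lborel) * (sqrt (2 * pi) / T)"
    by (subst Fubini_fst[OF i1]) (simp add: ikv(2))
  have i2: "integrable lborel (\<lambda>p. (a (snd p))\<^sup>2 * k (fst p - snd p))"
    and v2: "(\<integral>p. (a (snd p))\<^sup>2 * k (fst p - snd p) \<partial>lborel) = (\<integral>p. (a (fst p))\<^sup>2 * k (fst p - snd p) \<partial>lborel)"
  proof -
    have i1': "integrable (lborel \<Otimes>\<^sub>M lborel) (\<lambda>p. (a (fst p))\<^sup>2 * k (fst p - snd p))" using i1 by (simp add: lborel_prod)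
    from lborel_pair.integrable_product_swap[OF i1'] ks
    show i2: "integrable lborel (\<lambda>p. (a (snd p))\<^sup>2 * k (fst p - snd p))"
      by (simp add: lborel_prod case_prod_beta')
    show "(\<integral>p. (a (snd p))\<^sup>2 * k (fst p - snd p) \<partial>lborel) = (\<integral>p. (a (fst p))\<^sup>2 * k (fst p - snd p) \<partial>lborel)"
      using lborel_pair.integral_product_swap[OF borel_measurable_integrable[OF i1']] ks
      by (simp add: lborel_prod case_prod_beta')
  qed
  have "P = norm (complex_of_real P)"
  proof -
    have "P \<ge> 0" unfolding P_def using \<rho>0 by (intro integral_nonneg_AE AE_I2) auto
    thus ?thesis by simp
  qed
  also have "\<dots> \<le> (\<integral>u. norm (g u * (\<integral>v. cnj (g v) * of_real (k (u - v)) \<partial>lborel)) \<partial>lborel)"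
    unfolding Pe by (rule integral_norm_bound)
  also have "\<dots> \<le> (\<integral>u. (\<integral>v. a u * a v * k (u - v) \<partial>lborel) \<partial>lborel)"
  proof (rule integral_mono')
    show "integrable lborel (\<lambda>u. \<integral>v. a u * a v * k (u - v) \<partial>lborel)"
      using lborel_pair.integrable_fst[of "\<lambda>u v. a u * a v * k (u - v)"] iak by (simp add: lborel_prod case_prod_beta')
    fix u
    have "norm (\<integral>v. cnj (g v) * of_real (k (u - v)) \<partial>lborel) \<le> (\<integral>v. norm (cnj (g v) * of_real (k (u - v))) \<partial>lborel)" by (rule integral_norm_bound)
    also have "\<dots> = (\<integral>v. a v * k (u - v) \<partial>lborel)" using k0 by (simp add: norm_mult a_def)
    finally have "a u * norm (\<integral>v. cnj (g v) * of_real (k (u - v)) \<partial>lborel) \<le> a u * (\<integral>v. a v * k (u - v) \<partial>lborel)"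
      using a0 by (rule mult_left_mono)
    thus "norm (g u * (\<integral>v. cnj (g v) * of_real (k (u - v)) \<partial>lborel)) \<le> (\<integral>v. a u * a v * k (u - v) \<partial>lborel)"
      by (simp add: norm_mult a_def mult.assoc)
    show "0 \<le> (\<integral>v. a u * a v * k (u - v) \<partial>lborel)" using a0 k0 by (intro integral_nonneg_AE AE_I2) auto
  qed
  also have "\<dots> = (\<integral>p. a (fst p) * a (snd p) * k (fst p - snd p) \<partial>lborel)"
    by (subst Fubini_fst[OF iak]) simp
  also have "\<dots> \<le> (\<integral>p. (1/2) * ((a (fst p))\<^sup>2 * k (fst p - snd p)) + (1/2) * ((a (snd p))\<^sup>2 * k (fst p - snd p)) \<partial>lborel)"
  proof (intro integral_mono iak Bochner_Integration.integrable_add integrable_mult_right i1 i2)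
    fix p :: "real \<times> real"
    have "2 * (a (fst p) * a (snd p)) \<le> (a (fst p))\<^sup>2 + (a (snd p))\<^sup>2" using sum_squares_bound[of "a (fst p)" "a (snd p)"] by (simp add: mult.assoc)
    hence "2 * (a (fst p) * a (snd p)) * k (fst p - snd p) \<le> ((a (fst p))\<^sup>2 + (a (snd p))\<^sup>2) * k (fst p - snd p)" using k0 by (intro mult_right_mono) auto
    thus "a (fst p) * a (snd p) * k (fst p - snd p) \<le> (1/2) * ((a (fst p))\<^sup>2 * k (fst p - snd p)) + (1/2) * ((a (snd p))\<^sup>2 * k (fst p - snd p))"
      by (simp add: algebra_simps)
  qed
  also have "\<dots> = (\<integral>u. (a u)\<^sup>2 \<partial>lborel) * (sqrt (2 * pi) / T)"
    by (subst Bochner_Integration.integral_add, (intro integrable_mult_right i1 i2)+) (simp add: v1 v2)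
  finally have PB: "P \<le> (\<integral>u. (a u)\<^sup>2 \<partial>lborel) * (sqrt (2 * pi) / T)" .
  define \<rho>T where "\<rho>T = exp (-1/2) / (sqrt (2 * pi) * T)"
  have \<rho>T: "\<rho>T > 0" using T by (simp add: \<rho>T_def)
  have low: "indicator {-T..T} t * (norm (gh t))\<^sup>2 \<le> (1 / \<rho>T) * (\<rho> t * (norm (gh t))\<^sup>2)" for t
  proof (cases "t \<in> {-T..T}")
    case True
    hence "\<bar>t / T\<bar> \<le> 1" using T by (auto simp: abs_divide abs_le_iff)
    hence "(t / T)\<^sup>2 \<le> 1" by (simp add: abs_square_le_1)
    hence "exp (-1/2) \<le> exp (- (t / T)\<^sup>2 / 2)" by simp
    hence "\<rho>T \<le> \<rho> t" unfolding \<rho>T_def \<rho>_def std_normal_density_def using T by (simp add: divide_right_mono)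
    hence "1 \<le> (1 / \<rho>T) * \<rho> t" using \<rho>T by (simp add: field_simps)
    hence "1 * (norm (gh t))\<^sup>2 \<le> (1 / \<rho>T) * \<rho> t * (norm (gh t))\<^sup>2" by (intro mult_right_mono) auto
    thus ?thesis using True by simp
  next
    case False
    thus ?thesis using \<rho>0 \<rho>T by simp
  qed
  have iI: "integrable lborel (\<lambda>t. indicator {-T..T} t * (norm (gh t))\<^sup>2)"
  proof (rule Bochner_Integration.integrable_bound[OF integrable_mult_right[OF i\<rho>gh, of "1 / \<rho>T"]])
    show "AE t in lborel. norm (indicator {-T..T} t * (norm (gh t))\<^sup>2) \<le> norm ((1 / \<rho>T) * (\<rho> t * (norm (gh t))\<^sup>2))"
      using low \<rho>0 \<rho>T by (auto intro!: AE_I2 simp: abs_mult)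
  qed simp
  thus "integrable lborel (\<lambda>t. indicator {-T..T} t * (norm (\<integral>u. g u * cis (t * u) \<partial>lborel))\<^sup>2)" unfolding gh_def .
  have "(\<integral>t. indicator {-T..T} t * (norm (gh t))\<^sup>2 \<partial>lborel) \<le> (\<integral>t. (1 / \<rho>T) * (\<rho> t * (norm (gh t))\<^sup>2) \<partial>lborel)"
    by (intro integral_mono iI integrable_mult_right i\<rho>gh low)
  also have "\<dots> = (1 / \<rho>T) * P" by (simp add: P_def)
  also have "\<dots> \<le> (1 / \<rho>T) * ((\<integral>u. (a u)\<^sup>2 \<partial>lborel) * (sqrt (2 * pi) / T))" using \<rho>T by (intro mult_left_mono PB) auto
  also have "\<dots> = (2 * pi * exp (1/2)) * (\<integral>u. (a u)\<^sup>2 \<partial>lborel)"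
  proof -
    have "1 / \<rho>T * (sqrt (2 * pi) / T) = 2 * pi * exp (1/2)" using T by (simp add: \<rho>T_def exp_minus field_simps)
    thus ?thesis by (metis mult.assoc mult.commute)
  qed
  also have "\<dots> \<le> 12 * (\<integral>u. (a u)\<^sup>2 \<partial>lborel)"
  proof (rule mult_right_mono)
    have "exp (1/2 :: real) \<le> 1 + 1/2 + (1/2)\<^sup>2" by (rule exp_bound) auto
    hence "exp (1/2 :: real) \<le> 7/4" by (simp add: power2_eq_square)
    moreover have "pi \<le> 22/7" using pi_approx by simp
    ultimately have "pi * exp (1/2) \<le> 22/7 * (7/4)" by (intro mult_mono) auto
    thus "2 * pi * exp (1/2) \<le> 12" by simp
  qed simp
  finally show "(\<integral>t. indicator {-T..T} t * (norm (\<integral>u. g u * cis (t * u) \<partial>lborel))\<^sup>2 \<partial>lborel) \<le> 12 * (\<integral>u. (norm (g u))\<^sup>2 \<partial>lborel)"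
    unfolding gh_def a_def .
qed

section \<open>Mellin transforms along tilted lines\<close>

lemma exp_neg_le_inverse: "exp (- 2 * \<bar>x\<bar>) \<le> inverse (1 + x\<^sup>2)" for x :: real
proof -
  have "1 + 2 * \<bar>x\<bar> + (2 * \<bar>x\<bar>)\<^sup>2 / 2 \<le> exp (2 * \<bar>x\<bar>)" by (rule exp_lower_Taylor_quadratic) simp
  hence "1 + x\<^sup>2 \<le> exp (2 * \<bar>x\<bar>)" by (simp add: power_mult_distrib) (smt (verit) zero_le_power2 abs_ge_zero)
  moreover have "1 + x\<^sup>2 > 0" by (intro add_pos_nonneg) auto
  ultimately have "inverse (exp (2 * \<bar>x\<bar>)) \<le> inverse (1 + x\<^sup>2)" by (intro le_imp_inverse_le) auto
  thus ?thesis by (simp add: exp_minus)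
qed

lemma integrable_inverse_1_square: "integrable lborel (\<lambda>x::real. inverse (1 + x\<^sup>2))"
  using integrable_inverse_1_plus_square by (simp add: set_integrable_def)

lemma integrable_exp_neg2: "integrable lborel (\<lambda>x::real. exp (- 2 * \<bar>x\<bar>))"
proof (rule Bochner_Integration.integrable_bound[OF integrable_inverse_1_square])
  have "1 + x\<^sup>2 > 0" for x :: real by (intro add_pos_nonneg) auto
  thus "AE x in lborel. norm (exp (- 2 * \<bar>x\<bar>)) \<le> norm (inverse (1 + x\<^sup>2) :: real)"
    using exp_neg_le_inverse by (intro AE_I2) (simp add: less_imp_le)
qed simp

lemma integral_truncation_limit:
  fixes g :: "real \<Rightarrow> complex"
  assumes g: "integrable lborel g"
  shows "(\<lambda>n. \<integral>u. indicator {-real n..real n} u *\<^sub>R g u \<partial>lborel) \<longlonglongrightarrow> (\<integral>u. g u \<partial>lborel)"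
proof (rule integral_dominated_convergence[OF _ _ integrable_norm[OF g]])
  have [measurable]: "g \<in> borel_measurable borel" using g by (auto dest: borel_measurable_integrable)
  show "g \<in> borel_measurable lborel" "\<And>n. (\<lambda>u. indicator {-real n..real n} u *\<^sub>R g u) \<in> borel_measurable lborel" by simp_all
  show "AE u in lborel. (\<lambda>n. indicator {-real n..real n} u *\<^sub>R g u) \<longlonglongrightarrow> g u"
  proof (rule AE_I2)
    fix u :: real
    have "\<forall>\<^sub>F n in sequentially. real n \<ge> \<bar>u\<bar>"
      using filterlim_real_sequentially by (auto simp: filterlim_at_top)
    hence "\<forall>\<^sub>F n in sequentially. g u = indicator {-real n..real n} u *\<^sub>R g u"
      by eventually_elim (auto simp: indicator_def abs_le_iff)
    from Lim_transform_eventually[OF tendsto_const this] show "(\<lambda>n. indicator {-real n..real n} u *\<^sub>R g u) \<longlonglongrightarrow> g u" .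
  qed
  show "AE u in lborel. norm (indicator {-real n..real n} u *\<^sub>R g u) \<le> norm (g u)" for n
    by (intro AE_I2) (auto simp: indicator_def)
qed

lemma sin_ge_half: "0 \<le> x \<Longrightarrow> x \<le> 1 \<Longrightarrow> sin x \<ge> x / 2" for x :: real
proof (cases "x = 0")
  case False
  assume x: "0 \<le> x" "x \<le> 1"
  obtain \<xi> where \<xi>: "0 < \<xi>" "\<xi> < x" "sin x - sin 0 = (x - 0) * cos \<xi>"
    using MVT2[of 0 x sin cos] x False by (auto intro: DERIV_sin)
  have "cos (pi / 3) \<le> cos \<xi>" using \<xi> x pi_gt3 by (intro cos_monotone_0_pi_le) auto
  hence "x * (1/2) \<le> x * cos \<xi>" using x by (intro mult_left_mono) (auto simp: cos_60)
  thus ?thesis using \<xi> by simp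
qed simp

text \<open>Functions on the strip $|\mathrm{Im}\, w| < \pi/2$ whose two-sided Laplace transform is a completed
  $L$-function. The estimate \<open>decay\<close> says that $\Phi$ is at most $(\cos\theta)^{-\kappa/2}$ and decays faster than any
  exponential once $|u|$ exceeds $\log(1/\cos\theta)$; for $\Phi$ coming from a cusp form $f$ this is the point where
  the argument of $f$, or its image under the Fricke involution, has imaginary part of size $1$.\<close>

locale strip_function =
  fixes \<Phi> :: "complex \<Rightarrow> complex" and \<kappa> :: real and \<epsilon> :: complex
  assumes kappa_pos: "\<kappa> > 0"
    and Phi_holo: "\<Phi> holomorphic_on {w. \<bar>Im w\<bar> < pi / 2}"
    and decay: "\<And>A. \<exists>K. \<forall>u \<theta>. \<bar>\<theta>\<bar> < pi / 2 \<longrightarrow>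
        norm (\<Phi> (Complex u \<theta>)) \<le> K * (cos \<theta> powr (- \<kappa> / 2) * exp (- A * max 0 (\<bar>u\<bar> + ln (cos \<theta>))))"
    and symm: "\<And>w. \<bar>Im w\<bar> < pi / 2 \<Longrightarrow> \<Phi> (- w) = \<epsilon> * \<Phi> w"
    and eps: "norm \<epsilon> = 1"
begin

definition Lam :: "complex \<Rightarrow> complex" where
  "Lam s = (\<integral>u. \<Phi> (of_real u) * exp ((s - of_real (\<kappa> / 2)) * of_real u) \<partial>lborel)"

lemma strip_open: "open {w. \<bar>Im w\<bar> < pi / 2}" "convex {w. \<bar>Im w\<bar> < pi / 2}"
proof -
  have e: "{w. \<bar>Im w\<bar> < pi / 2} = {w. Im w < pi / 2} \<inter> {w. Im w > - (pi / 2)}" by auto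
  show "open {w. \<bar>Im w\<bar> < pi / 2}" unfolding e by (intro open_Int open_halfspace_Im_lt open_halfspace_Im_gt)
  show "convex {w. \<bar>Im w\<bar> < pi / 2}" unfolding e by (intro convex_Int convex_halfspace_Im_lt convex_halfspace_Im_gt)
qed

lemma cos_strip: "\<bar>\<theta>\<bar> < pi / 2 \<Longrightarrow> cos \<theta> > 0" "cos \<theta> \<le> 1"
  by (auto intro!: cos_gt_zero_pi simp: abs_less_iff)

lemma exp_decay:
  assumes "0 \<le> \<theta>0" "\<theta>0 < pi / 2" "A \<ge> 0"
  shows "\<exists>K\<ge>0. \<forall>u \<theta>. \<bar>\<theta>\<bar> \<le> \<theta>0 \<longrightarrow> norm (\<Phi> (Complex u \<theta>)) \<le> K * exp (- A * \<bar>u\<bar>)"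
proof -
  obtain K where K: "\<And>u \<theta>. \<bar>\<theta>\<bar> < pi / 2 \<Longrightarrow> norm (\<Phi> (Complex u \<theta>)) \<le> K * (cos \<theta> powr (- \<kappa> / 2) * exp (- A * max 0 (\<bar>u\<bar> + ln (cos \<theta>))))"
    using decay[of A] by blast
  define c where "c = cos \<theta>0"
  have c: "c > 0" using assms cos_strip(1)[of \<theta>0] by (simp add: c_def)
  define K' where "K' = \<bar>K\<bar> * (c powr (- \<kappa> / 2) * exp (- A * ln c))"
  have "norm (\<Phi> (Complex u \<theta>)) \<le> K' * exp (- A * \<bar>u\<bar>)" if th: "\<bar>\<theta>\<bar> \<le> \<theta>0" for u \<theta>
  proof -
    have th2: "\<bar>\<theta>\<bar> < pi / 2" using th assms by simp
    have cth: "c \<le> cos \<theta>"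
    proof -
      have "cos \<theta>0 \<le> cos \<bar>\<theta>\<bar>" using th assms by (intro cos_monotone_0_pi_le) auto
      thus ?thesis by (simp add: c_def)
    qed
    have "norm (\<Phi> (Complex u \<theta>)) \<le> K * (cos \<theta> powr (- \<kappa> / 2) * exp (- A * max 0 (\<bar>u\<bar> + ln (cos \<theta>))))" by (rule K[OF th2])
    also have "\<dots> \<le> \<bar>K\<bar> * (c powr (- \<kappa> / 2) * (exp (- A * ln c) * exp (- A * \<bar>u\<bar>)))"
    proof (intro mult_mono)
      show "cos \<theta> powr (- \<kappa> / 2) \<le> c powr (- \<kappa> / 2)" using c cth kappa_pos by (intro powr_mono2') auto
      have "ln c \<le> ln (cos \<theta>)" using c cth by (intro ln_mono) auto
      hence "A * (ln c + \<bar>u\<bar>) \<le> A * max 0 (\<bar>u\<bar> + ln (cos \<theta>))" using assms by (intro mult_left_mono) auto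
      thus "exp (- A * max 0 (\<bar>u\<bar> + ln (cos \<theta>))) \<le> exp (- A * ln c) * exp (- A * \<bar>u\<bar>)"
        unfolding exp_add[symmetric] exp_le_cancel_iff by (simp add: algebra_simps)
    qed auto
    finally show ?thesis by (simp add: K'_def mult_ac)
  qed
  moreover have "K' \<ge> 0" by (simp add: K'_def)
  ultimately show ?thesis by blast
qed

lemma norm_exp_bound:
  assumes "\<bar>\<theta>\<bar> < pi / 2"
  shows "norm (exp (z * Complex u \<theta>)) \<le> exp (norm z * 2) * exp (norm z * \<bar>u\<bar>)"
proof -
  have "norm (exp (z * Complex u \<theta>)) = exp (Re (z * Complex u \<theta>))" by (rule norm_exp_eq_Re)
  also have "Re (z * Complex u \<theta>) \<le> norm (z * Complex u \<theta>)" by (rule complex_Re_le_cmod)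
  also have "\<dots> = norm z * norm (Complex u \<theta>)" by (rule norm_mult)
  also have "\<dots> \<le> norm z * (\<bar>u\<bar> + 2)"
  proof (rule mult_left_mono)
    have "norm (Complex u \<theta>) \<le> \<bar>u\<bar> + \<bar>\<theta>\<bar>" using cmod_le[of "Complex u \<theta>"] by simp
    also have "\<bar>\<theta>\<bar> \<le> 2" using assms pi_less_4 by simp
    finally show "norm (Complex u \<theta>) \<le> \<bar>u\<bar> + 2" by simp
  qed simp
  finally have "norm (exp (z * Complex u \<theta>)) \<le> exp (norm z * (\<bar>u\<bar> + 2))" by simp
  thus ?thesis by (simp add: exp_add[symmetric] algebra_simps)
qed

lemma integrand_bound:
  assumes "0 \<le> \<theta>0" "\<theta>0 < pi / 2"
  shows "\<exists>K\<ge>0. \<forall>u \<theta> z. \<bar>\<theta>\<bar> \<le> \<theta>0 \<longrightarrow> norm z \<le> R \<longrightarrow> norm (\<Phi> (Complex u \<theta>) * exp (z * Complex u \<theta>)) \<le> K * exp (- 4 * \<bar>u\<bar>)"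
proof -
  define R' where "R' = max R 0"
  obtain K where K: "K \<ge> 0" "\<And>u \<theta>. \<bar>\<theta>\<bar> \<le> \<theta>0 \<Longrightarrow> norm (\<Phi> (Complex u \<theta>)) \<le> K * exp (- (R' + 4) * \<bar>u\<bar>)"
    using exp_decay[OF assms, of "R' + 4"] by (auto simp: R'_def)
  have "norm (\<Phi> (Complex u \<theta>) * exp (z * Complex u \<theta>)) \<le> (K * exp (R' * 2)) * exp (- 4 * \<bar>u\<bar>)"
    if "\<bar>\<theta>\<bar> \<le> \<theta>0" "norm z \<le> R" for u \<theta> z
  proof -
    have "norm (exp (z * Complex u \<theta>)) \<le> exp (norm z * 2) * exp (norm z * \<bar>u\<bar>)" using that assms by (intro norm_exp_bound) auto
    also have "\<dots> \<le> exp (R' * 2) * exp (R' * \<bar>u\<bar>)" using that by (intro mult_mono) (auto simp: R'_def intro!: mult_right_mono)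
    finally have "norm (\<Phi> (Complex u \<theta>)) * norm (exp (z * Complex u \<theta>)) \<le> (K * exp (- (R' + 4) * \<bar>u\<bar>)) * (exp (R' * 2) * exp (R' * \<bar>u\<bar>))"
      using K(1) by (intro mult_mono K(2) that) auto
    also have "\<dots> = (K * exp (R' * 2)) * (exp (- (R' + 4) * \<bar>u\<bar>) * exp (R' * \<bar>u\<bar>))" by simp
    also have "exp (- (R' + 4) * \<bar>u\<bar>) * exp (R' * \<bar>u\<bar>) = exp (- 4 * \<bar>u\<bar>)" by (simp add: exp_add[symmetric] algebra_simps)
    finally show ?thesis by (simp add: norm_mult)
  qed
  moreover have "K * exp (R' * 2) \<ge> 0" using K by simp
  ultimately show ?thesis by blast
qed

lemma Phi_line_continuous: "\<bar>\<theta>\<bar> < pi / 2 \<Longrightarrow> continuous_on A (\<lambda>u. \<Phi> (Complex u \<theta>))"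
  by (rule continuous_on_compose2[OF holomorphic_on_imp_continuous_on[OF Phi_holo]]) (auto intro!: continuous_intros)

lemma exp4_le: "K \<ge> 0 \<Longrightarrow> K * exp (- 4 * \<bar>u\<bar>) \<le> K * exp (- 2 * \<bar>u\<bar>)" for u :: real
  by (intro mult_left_mono) auto

lemma integrand_integrable:
  assumes "\<bar>\<theta>\<bar> < pi / 2"
  shows "integrable lborel (\<lambda>u. \<Phi> (Complex u \<theta>) * exp (z * Complex u \<theta>))"
proof -
  obtain K where K: "K \<ge> 0" "\<And>u. norm (\<Phi> (Complex u \<theta>) * exp (z * Complex u \<theta>)) \<le> K * exp (- 4 * \<bar>u\<bar>)"
    using integrand_bound[of "\<bar>\<theta>\<bar>" "norm z"] assms by auto
  show ?thesis
  proof (rule Bochner_Integration.integrable_bound[OF integrable_mult_right[OF integrable_exp_neg2, of K]])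
    have "continuous_on UNIV (\<lambda>u. \<Phi> (Complex u \<theta>) * exp (z * Complex u \<theta>))"
      by (intro continuous_intros Phi_line_continuous assms)
    thus "(\<lambda>u. \<Phi> (Complex u \<theta>) * exp (z * Complex u \<theta>)) \<in> borel_measurable lborel" by (simp add: borel_measurable_continuous_onI)
    show "AE u in lborel. norm (\<Phi> (Complex u \<theta>) * exp (z * Complex u \<theta>)) \<le> norm (K * exp (- 2 * \<bar>u\<bar>))"
      using order_trans[OF K(2) exp4_le[OF K(1)]] K(1) by (intro AE_I2) simp
  qed
qed

text \<open>Cauchy's theorem on the rectangle with vertices $\pm n$ and $\pm n + i\theta$; the vertical sides tend to zero.\<close>

lemma contour_shift:
  assumes th: "\<bar>\<theta>\<bar> < pi / 2"
  shows "(\<integral>u. \<Phi> (Complex u \<theta>) * exp (z * Complex u \<theta>) \<partial>lborel) = (\<integral>u. \<Phi> (of_real u) * exp (z * of_real u) \<partial>lborel)"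
proof -
  define F where "F = (\<lambda>w. \<Phi> w * exp (z * w))"
  define S where "S = {w. \<bar>Im w\<bar> < pi / 2}"
  have F: "F holomorphic_on S" unfolding F_def S_def by (intro holomorphic_intros Phi_holo)
  obtain P where P: "\<And>w. w \<in> S \<Longrightarrow> (P has_field_derivative F w) (at w)"
    using holomorphic_convex_primitive'[OF strip_open(2,1)[folded S_def] F] at_within_open[OF _ strip_open(1)[folded S_def]] by metis
  have FTC: "(\<integral>u. indicator {-R..R} u *\<^sub>R F (Complex u y) \<partial>lborel) = P (Complex R y) - P (Complex (-R) y)"
    if y: "\<bar>y\<bar> < pi / 2" and R: "R \<ge> 0" for R y
  proof (rule integral_FTC_atLeastAtMost)
    show "continuous_on {-R..R} (\<lambda>u. F (Complex u y))" unfolding F_def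
      by (intro continuous_intros Phi_line_continuous y)
    fix u
    have "((\<lambda>x. of_real x + \<i> * of_real y) has_vector_derivative 1) (at u)" by (auto intro!: derivative_eq_intros)
    hence "((\<lambda>x. Complex x y) has_vector_derivative 1) (at u)" by (simp add: Complex_eq)
    from field_vector_diff_chain_at[OF this P] y
    have "((\<lambda>u. P (Complex u y)) has_vector_derivative F (Complex u y)) (at u)" by (simp add: o_def S_def)
    thus "((\<lambda>u. P (Complex u y)) has_vector_derivative F (Complex u y)) (at u within {-R..R})" by (rule has_vector_derivative_at_within)
  qed (use R in simp)
  obtain K where K: "K \<ge> 0" "\<And>u y. \<bar>y\<bar> \<le> \<bar>\<theta>\<bar> \<Longrightarrow> norm (F (Complex u y)) \<le> K * exp (- 4 * \<bar>u\<bar>)"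
    using integrand_bound[of "\<bar>\<theta>\<bar>" "norm z"] th unfolding F_def by auto
  have vert: "norm (P (Complex R \<theta>) - P (Complex R 0)) \<le> K * exp (- 4 * \<bar>R\<bar>) * 2" for R
  proof -
    have seg: "Re w = R \<and> \<bar>Im w\<bar> \<le> \<bar>\<theta>\<bar>" if "w \<in> closed_segment (Complex R \<theta>) (Complex R 0)" for w
    proof -
      from that obtain u where u: "0 \<le> u" "u \<le> 1" "w = (1 - u) *\<^sub>R Complex R \<theta> + u *\<^sub>R Complex R 0"
        unfolding closed_segment_def by blast
      have "Re w = R" by (simp add: u(3) algebra_simps)
      moreover have "\<bar>Im w\<bar> = (1 - u) * \<bar>\<theta>\<bar>" using u(1,2) by (simp add: u(3) abs_mult)
      moreover have "(1 - u) * \<bar>\<theta>\<bar> \<le> \<bar>\<theta>\<bar>" using u(1,2) by (intro mult_left_le_one_le) auto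
      ultimately show ?thesis by simp
    qed
    have "norm (P (Complex R \<theta>) - P (Complex R 0)) \<le> (K * exp (- 4 * \<bar>R\<bar>)) * norm (Complex R \<theta> - Complex R 0)"
    proof (rule field_differentiable_bound[of "closed_segment (Complex R \<theta>) (Complex R 0)"])
      fix w assume w: "w \<in> closed_segment (Complex R \<theta>) (Complex R 0)"
      show "(P has_field_derivative F w) (at w within closed_segment (Complex R \<theta>) (Complex R 0))"
        by (rule has_field_derivative_at_within, rule P) (use seg[OF w] th in \<open>simp add: S_def\<close>)
      have "w = Complex R (Im w)" using seg[OF w] by (simp add: complex_eq_iff)
      thus "norm (F w) \<le> K * exp (- 4 * \<bar>R\<bar>)" using K(2)[of "Im w" R] seg[OF w] by simp
    qed auto
    also have "norm (Complex R \<theta> - Complex R 0) = \<bar>\<theta>\<bar>" by (simp add: cmod_def)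
    also have "K * exp (- 4 * \<bar>R\<bar>) * \<bar>\<theta>\<bar> \<le> K * exp (- 4 * \<bar>R\<bar>) * 2" using K th pi_less_4 by (intro mult_left_mono) auto
    finally show ?thesis .
  qed
  define I where "I = (\<lambda>y n. \<integral>u. indicator {-real n..real n} u *\<^sub>R F (Complex u y) \<partial>lborel)"
  have d: "norm (I \<theta> n - I 0 n) \<le> (4 * K) * exp (- 4 * real n)" for n
  proof -
    have "I \<theta> n - I 0 n = (P (Complex (real n) \<theta>) - P (Complex (real n) 0)) - (P (Complex (- real n) \<theta>) - P (Complex (- real n) 0))"
      unfolding I_def using FTC[OF th, of "real n"] FTC[of 0 "real n"] by simp
    also have "norm \<dots> \<le> K * exp (- 4 * \<bar>real n\<bar>) * 2 + K * exp (- 4 * \<bar>- real n\<bar>) * 2"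
      by (rule order_trans[OF norm_triangle_ineq4]) (intro add_mono vert)
    finally show ?thesis by simp
  qed
  have "(\<lambda>n. (4 * K) * exp (- 4 * real n)) \<longlonglongrightarrow> (4 * K) * 0" by (intro tendsto_mult tendsto_const) real_asymp
  hence t0: "(\<lambda>n. (4 * K) * exp (- 4 * real n)) \<longlonglongrightarrow> 0" by simp
  have z: "(\<lambda>n. I \<theta> n - I 0 n) \<longlonglongrightarrow> 0"
    by (rule Lim_null_comparison[OF always_eventually t0]) (use d in blast)
  have i: "integrable lborel (\<lambda>u. F (Complex u y))" if "\<bar>y\<bar> < pi / 2" for y
    unfolding F_def by (rule integrand_integrable[OF that])
  have "(\<lambda>n. I \<theta> n - I 0 n) \<longlonglongrightarrow> (\<integral>u. F (Complex u \<theta>) \<partial>lborel) - (\<integral>u. F (Complex u 0) \<partial>lborel)"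
    unfolding I_def by (intro tendsto_diff integral_truncation_limit i) (use th in auto)
  from LIMSEQ_unique[OF z this] have "(\<integral>u. F (Complex u \<theta>) \<partial>lborel) = (\<integral>u. F (Complex u 0) \<partial>lborel)" by simp
  thus ?thesis unfolding F_def by (simp add: Complex_eq)
qed

lemma Lam_functional_equation: "Lam (of_real \<kappa> - s) = \<epsilon> * Lam s"
proof -
  have "Lam (of_real \<kappa> - s) = (\<integral>u. \<Phi> (of_real (0 + (-1) * u)) * exp ((of_real \<kappa> - s - of_real (\<kappa> / 2)) * of_real (0 + (-1) * u)) \<partial>lborel)"
    unfolding Lam_def by (subst lborel_integral_real_affine[of "-1" _ 0]) auto
  also have "\<dots> = (\<integral>u. \<epsilon> * (\<Phi> (of_real u) * exp ((s - of_real (\<kappa> / 2)) * of_real u)) \<partial>lborel)"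
  proof (rule Bochner_Integration.integral_cong[OF refl])
    fix u :: real
    have "\<Phi> (- of_real u) = \<epsilon> * \<Phi> (of_real u)" by (rule symm) simp
    moreover have "(of_real \<kappa> - s - of_real (\<kappa> / 2)) * (- of_real u) = (s - of_real (\<kappa> / 2)) * of_real u"
      by (simp add: algebra_simps)
    ultimately show "\<Phi> (of_real (0 + (-1) * u)) * exp ((of_real \<kappa> - s - of_real (\<kappa> / 2)) * of_real (0 + (-1) * u)) =
        \<epsilon> * (\<Phi> (of_real u) * exp ((s - of_real (\<kappa> / 2)) * of_real u))" by simp
  qed
  also have "\<dots> = \<epsilon> * Lam s" by (simp add: Lam_def)
  finally show ?thesis .
qed

lemma Lam_entire: "Lam holomorphic_on UNIV"
proof (rule holomorphic_uniform_sequence[OF open_UNIV])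
  define f where "f = (\<lambda>s u. \<Phi> (of_real u) * exp ((s - of_real (\<kappa> / 2)) * of_real u))"
  have cP: "continuous_on A (\<lambda>u. \<Phi> (of_real u))" for A
    using Phi_line_continuous[of 0 A] by (simp add: Complex_eq)
  define Ln where "Ln = (\<lambda>n s. integral (cbox (- real n) (real n)) (f s))"
  show "Ln n holomorphic_on UNIV" for n
    unfolding Ln_def
  proof (rule leibniz_rule_holomorphic)
    fix s :: complex and t :: real
    show "((\<lambda>s. f s t) has_field_derivative \<Phi> (of_real t) * (exp ((s - of_real (\<kappa> / 2)) * of_real t) * of_real t)) (at s within UNIV)"
      unfolding f_def by (auto intro!: derivative_eq_intros)
    show "f s integrable_on cbox (- real n) (real n)" unfolding f_def
      by (intro integrable_continuous continuous_intros cP)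
  next
    have "continuous_on (UNIV \<times> cbox (- real n) (real n)) (\<lambda>p. \<Phi> (of_real (snd p)) * (exp ((fst p - of_real (\<kappa> / 2)) * of_real (snd p)) * of_real (snd p)))"
      by (intro continuous_intros continuous_on_compose2[OF cP[of UNIV], of _ snd]) auto
    thus "continuous_on (UNIV \<times> cbox (- real n) (real n)) (\<lambda>(s, t). \<Phi> (of_real t) * (exp ((s - of_real (\<kappa> / 2)) * of_real t) * of_real t))"
      by (simp add: case_prod_beta')
  qed auto
  fix x :: complex
  define R where "R = norm x + 1 + \<kappa>"
  obtain K where K: "K \<ge> 0" "\<And>u z. norm z \<le> R \<Longrightarrow> norm (\<Phi> (Complex u 0) * exp (z * Complex u 0)) \<le> K * exp (- 4 * \<bar>u\<bar>)"
    using integrand_bound[of 0 R] by auto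
  define J where "J = (\<integral>u. exp (- 2 * \<bar>u :: real\<bar>) \<partial>lborel)"
  have fb: "norm (f s u) \<le> K * exp (- 4 * \<bar>u\<bar>)" if "s \<in> cball x 1" for s u
  proof -
    have "norm (s - of_real (\<kappa> / 2)) \<le> norm s + \<kappa> / 2" using kappa_pos norm_triangle_ineq4[of s "of_real (\<kappa> / 2)"] by simp
    also have "norm s \<le> norm x + 1" using that norm_triangle_sub[of s x] by (simp add: dist_norm norm_minus_commute)
    finally have "norm (s - of_real (\<kappa> / 2)) \<le> R" using kappa_pos by (simp add: R_def)
    from K(2)[OF this, of u] show ?thesis by (simp add: f_def Complex_eq)
  qed
  have fi: "integrable lborel (f s)" for s
    using integrand_integrable[of 0 "s - of_real (\<kappa> / 2)"] by (simp add: f_def Complex_eq)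
  have diff: "norm (Ln n s - Lam s) \<le> K * J * exp (- 2 * real n)" if s: "s \<in> cball x 1" for s n
  proof -
    have si: "set_integrable lborel {- real n..real n} (f s)"
      by (rule set_integrable_subset[of lborel UNIV]) (use fi[of s] in \<open>simp_all add: set_integrable_def\<close>)
    have "Ln n s = (\<integral>u. indicator {-real n..real n} u *\<^sub>R f s u \<partial>lborel)"
      using set_borel_integral_eq_integral(2)[OF si] by (simp add: Ln_def set_lebesgue_integral_def)
    hence "Ln n s - Lam s = (\<integral>u. indicator {-real n..real n} u *\<^sub>R f s u - f s u \<partial>lborel)"
      unfolding Lam_def f_def[symmetric] using si fi
      by (subst Bochner_Integration.integral_diff) (auto simp: set_integrable_def f_def)
    also have "norm \<dots> \<le> (\<integral>u. (K * exp (- 2 * real n)) * exp (- 2 * \<bar>u\<bar>) \<partial>lborel)"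
    proof (rule Bochner_Integration.integral_norm_bound_integral)
      show "integrable lborel (\<lambda>u. indicator {-real n..real n} u *\<^sub>R f s u - f s u)"
        using si fi by (intro Bochner_Integration.integrable_diff) (auto simp: set_integrable_def)
      show "integrable lborel (\<lambda>u. (K * exp (- 2 * real n)) * exp (- 2 * \<bar>u\<bar>))" by (intro integrable_mult_right integrable_exp_neg2)
      fix u :: real
      show "norm (indicator {-real n..real n} u *\<^sub>R f s u - f s u) \<le> (K * exp (- 2 * real n)) * exp (- 2 * \<bar>u\<bar>)"
      proof (cases "u \<in> {-real n..real n}")
        case False
        hence "real n \<le> \<bar>u\<bar>" by auto
        hence "exp (- 4 * \<bar>u\<bar>) \<le> exp (- 2 * real n) * exp (- 2 * \<bar>u\<bar>)" by (simp add: exp_add[symmetric])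
        hence "K * exp (- 4 * \<bar>u\<bar>) \<le> K * (exp (- 2 * real n) * exp (- 2 * \<bar>u\<bar>))" using K(1) by (rule mult_left_mono)
        thus ?thesis using fb[OF s, of u] False by (simp add: mult.assoc)
      qed (use K in simp)
    qed
    also have "\<dots> = K * J * exp (- 2 * real n)" by (simp add: J_def)
    finally show ?thesis .
  qed
  have "uniform_limit (cball x 1) Ln Lam sequentially"
  proof (rule uniform_limitI)
    fix e :: real assume e: "e > 0"
    have "(\<lambda>n. (K * J) * exp (- 2 * real n)) \<longlonglongrightarrow> (K * J) * 0" by (intro tendsto_mult tendsto_const) real_asymp
    hence "\<forall>\<^sub>F n in sequentially. (K * J) * exp (- 2 * real n) < e" using e by (intro order_tendstoD(2)) auto
    thus "\<forall>\<^sub>F n in sequentially. \<forall>s\<in>cball x 1. dist (Ln n s) (Lam s) < e"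
    proof eventually_elim
      case (elim n)
      show ?case
      proof
        fix s assume "s \<in> cball x 1"
        from le_less_trans[OF diff[OF this] elim] show "dist (Ln n s) (Lam s) < e" by (simp add: dist_norm)
      qed
    qed
  qed
  thus "\<exists>d>0. cball x d \<subseteq> UNIV \<and> uniform_limit (cball x d) Ln Lam sequentially" by (intro exI[of _ 1]) auto
qed

text \<open>On the line $\mathrm{Im}\, w = \theta$ the transform $\Lambda(\sigma + it)$ appears multiplied by $e^{t\theta}$. Plancherel
  reduces the claim to the square integral of $\Phi(u + i\theta) e^{(\sigma - \kappa/2) u}$, which is essentially supported on
  $|u| \le \log(1/\cos\theta)$ and bounded there by $(\cos\theta)^{-\sigma}$.\<close>

lemma Lam_mean_square_tilted:
  assumes q: "q \<ge> \<kappa> / 2"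
  shows "\<exists>C\<ge>0. \<forall>\<sigma> \<theta> T. \<kappa> / 2 \<le> \<sigma> \<longrightarrow> \<sigma> \<le> q \<longrightarrow> \<bar>\<theta>\<bar> < pi / 2 \<longrightarrow> T > 0 \<longrightarrow>
     integrable lborel (\<lambda>t. indicator {-T..T} t * (norm (Lam (Complex \<sigma> t)) * exp (t * \<theta>))\<^sup>2) \<and>
     (\<integral>t. indicator {-T..T} t * (norm (Lam (Complex \<sigma> t)) * exp (t * \<theta>))\<^sup>2 \<partial>lborel) \<le> C * (cos \<theta> powr (- 2 * \<sigma>) * (1 - ln (cos \<theta>)))"
proof -
  have q0: "q \<ge> 0" using q kappa_pos by simp
  obtain K where K: "\<And>u \<theta>. \<bar>\<theta>\<bar> < pi / 2 \<Longrightarrow> norm (\<Phi> (Complex u \<theta>)) \<le> K * (cos \<theta> powr (- \<kappa> / 2) * exp (- (q + 1) * max 0 (\<bar>u\<bar> + ln (cos \<theta>))))"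
    using decay[of "q + 1"] by blast
  define J where "J = (\<integral>x. inverse (1 + (x::real)\<^sup>2) \<partial>lborel)"
  have "1 + x\<^sup>2 > 0" for x :: real by (intro add_pos_nonneg) auto
  hence inv0: "inverse (1 + x\<^sup>2) \<ge> 0" for x :: real by (simp add: less_imp_le)
  hence J0: "J \<ge> 0" unfolding J_def by (intro integral_nonneg_AE AE_I2) auto
  define C where "C = 12 * K\<^sup>2 * (2 + 2 * J)"
  have C: "C \<ge> 0" using J0 by (simp add: C_def)
  have "integrable lborel (\<lambda>t. indicator {-T..T} t * (norm (Lam (Complex \<sigma> t)) * exp (t * \<theta>))\<^sup>2) \<and>
     (\<integral>t. indicator {-T..T} t * (norm (Lam (Complex \<sigma> t)) * exp (t * \<theta>))\<^sup>2 \<partial>lborel) \<le> C * (cos \<theta> powr (- 2 * \<sigma>) * (1 - ln (cos \<theta>)))"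
    if s: "\<kappa> / 2 \<le> \<sigma>" "\<sigma> \<le> q" and th: "\<bar>\<theta>\<bar> < pi / 2" and T: "T > 0" for \<sigma> \<theta> T
  proof -
    define \<sigma>' where "\<sigma>' = \<sigma> - \<kappa> / 2"
    have s': "0 \<le> \<sigma>'" "\<sigma>' \<le> q" using s kappa_pos by (auto simp: \<sigma>'_def)
    \<comment> \<open>The integrand is of full size for $|u| \le l$; beyond, quadratic decay is all that is kept.\<close>
    define l where "l = - ln (cos \<theta>)"
    have c: "cos \<theta> > 0" "cos \<theta> \<le> 1" using cos_strip th by auto
    have l0: "l \<ge> 0" using c by (simp add: l_def)
    define g where "g = (\<lambda>u. \<Phi> (Complex u \<theta>) * exp (of_real (\<sigma>' * u)))"
    have cg: "continuous_on UNIV g" unfolding g_def by (intro continuous_intros Phi_line_continuous th)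
    hence gm: "g \<in> borel_measurable lborel" by (simp add: borel_measurable_continuous_onI)
    have ig: "integrable lborel g"
    proof -
      have "norm (g u) = norm (\<Phi> (Complex u \<theta>) * exp (of_real \<sigma>' * Complex u \<theta>))" for u
        by (simp add: g_def norm_mult norm_exp_eq_Re)
      thus ?thesis
        by (intro Bochner_Integration.integrable_bound[OF integrand_integrable[OF th, of "of_real \<sigma>'"] gm]) auto
    qed
    define E where "E = (\<lambda>u. indicator {-l..l} u + inverse (1 + (- l + 1 * u)\<^sup>2) + inverse (1 + (l + 1 * u)\<^sup>2))"
    have i1: "integrable lborel (\<lambda>u. inverse (1 + (r + 1 * u)\<^sup>2))" for r :: real
      by (rule lborel_integrable_real_affine[OF integrable_inverse_1_square, of 1 r]) simp
    have v1: "(\<integral>u. inverse (1 + (r + 1 * u)\<^sup>2) \<partial>lborel) = J" for r :: real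
      using lborel_integral_real_affine[of 1 "\<lambda>x::real. inverse (1 + x\<^sup>2)" r] by (simp add: J_def)
    have iE: "integrable lborel E" unfolding E_def by (intro Bochner_Integration.integrable_add i1 integrable_indicator_Icc)
    have vE: "(\<integral>u. E u \<partial>lborel) = 2 * l + 2 * J" unfolding E_def
      using l0 by (subst Bochner_Integration.integral_add, (intro Bochner_Integration.integrable_add i1 integrable_indicator_Icc)+,
          subst Bochner_Integration.integral_add, (intro i1 integrable_indicator_Icc)+, simp only: v1) simp
    have gE: "(norm (g u))\<^sup>2 \<le> K\<^sup>2 * cos \<theta> powr (- 2 * \<sigma>) * E u" for u
    proof -
      define m where "m = max 0 (\<bar>u\<bar> - l)"
      have m: "m \<ge> 0" "\<bar>u\<bar> \<le> m + l" by (auto simp: m_def)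
      have "norm (g u) = norm (\<Phi> (Complex u \<theta>)) * exp (\<sigma>' * u)" by (simp add: g_def norm_mult norm_exp_eq_Re)
      also have "\<dots> \<le> \<bar>K\<bar> * (cos \<theta> powr (- \<kappa> / 2) * exp (- (q + 1) * m)) * exp (\<sigma>' * \<bar>u\<bar>)"
      proof (intro mult_mono)
        have "norm (\<Phi> (Complex u \<theta>)) \<le> K * (cos \<theta> powr (- \<kappa> / 2) * exp (- (q + 1) * m))" using K[OF th, of u] by (simp add: m_def l_def)
        also have "\<dots> \<le> \<bar>K\<bar> * (cos \<theta> powr (- \<kappa> / 2) * exp (- (q + 1) * m))" by (intro mult_right_mono) auto
        finally show "norm (\<Phi> (Complex u \<theta>)) \<le> \<bar>K\<bar> * (cos \<theta> powr (- \<kappa> / 2) * exp (- (q + 1) * m))" .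
        show "exp (\<sigma>' * u) \<le> exp (\<sigma>' * \<bar>u\<bar>)" using s' by (simp add: mult_left_mono)
      qed auto
      also have "exp (\<sigma>' * \<bar>u\<bar>) \<le> exp (\<sigma>' * (m + l))" using m s' by (simp add: mult_left_mono)
      finally have "norm (g u) \<le> \<bar>K\<bar> * (cos \<theta> powr (- \<kappa> / 2) * exp (- (q + 1) * m)) * exp (\<sigma>' * (m + l))"
        by (simp add: mult_left_mono)
      also have "\<dots> = \<bar>K\<bar> * (cos \<theta> powr (- \<kappa> / 2) * exp (\<sigma>' * l)) * (exp (- (q + 1) * m) * exp (\<sigma>' * m))"
        by (simp add: distrib_left exp_add)
      also have "cos \<theta> powr (- \<kappa> / 2) * exp (\<sigma>' * l) = cos \<theta> powr (- \<sigma>)"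
        using c by (simp add: powr_def l_def \<sigma>'_def exp_add[symmetric] algebra_simps)
      also have "exp (- (q + 1) * m) * exp (\<sigma>' * m) \<le> exp (- m)"
      proof -
        have "\<sigma>' * m \<le> q * m" using s' m by (intro mult_right_mono) auto
        thus ?thesis by (simp add: exp_add[symmetric] algebra_simps)
      qed
      finally have "norm (g u) \<le> \<bar>K\<bar> * cos \<theta> powr (- \<sigma>) * exp (- m)" by (simp add: mult_left_mono)
      hence "(norm (g u))\<^sup>2 \<le> (\<bar>K\<bar> * cos \<theta> powr (- \<sigma>) * exp (- m))\<^sup>2" by (intro power_mono) auto
      also have "\<dots> = K\<^sup>2 * (cos \<theta> powr (- \<sigma>))\<^sup>2 * (exp (- m))\<^sup>2" by (simp add: power_mult_distrib)
      also have "(cos \<theta> powr (- \<sigma>))\<^sup>2 = cos \<theta> powr (- 2 * \<sigma>)" using c by (simp add: power2_eq_square powr_add[symmetric])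
      also have "(exp (- m))\<^sup>2 = exp (- 2 * m)" by (simp add: power2_eq_square exp_add[symmetric])
      also have "exp (- 2 * m) \<le> E u"
      proof -
        consider "\<bar>u\<bar> \<le> l" | "u > l" | "u < - l" by linarith
        thus ?thesis
        proof cases
          case 1
          hence "exp (- 2 * m) = 1" "indicator {-l..l} u = (1::real)" by (auto simp: m_def abs_le_iff)
          thus ?thesis using inv0[of "- l + 1 * u"] inv0[of "l + 1 * u"] unfolding E_def by linarith
        next
          case 2
          hence "m = \<bar>- l + 1 * u\<bar>" using l0 by (simp add: m_def)
          hence "exp (- 2 * m) \<le> inverse (1 + (- l + 1 * u)\<^sup>2)" using exp_neg_le_inverse[of "- l + 1 * u"] by simp
          thus ?thesis unfolding E_def by (rule add_increasing2[OF inv0 add_increasing[OF indicator_pos_le]])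
        next
          case 3
          hence "m = \<bar>l + 1 * u\<bar>" using l0 by (simp add: m_def)
          hence "exp (- 2 * m) \<le> inverse (1 + (l + 1 * u)\<^sup>2)" using exp_neg_le_inverse[of "l + 1 * u"] by simp
          thus ?thesis unfolding E_def by (rule add_increasing[OF add_nonneg_nonneg[OF indicator_pos_le inv0]])
        qed
      qed
      finally show ?thesis by (simp add: mult_left_mono)
    qed
    have iE': "integrable lborel (\<lambda>u. K\<^sup>2 * cos \<theta> powr (- 2 * \<sigma>) * E u)" by (intro integrable_mult_right iE)
    have E0: "E u \<ge> 0" for u using inv0[of "- l + 1 * u"] inv0[of "l + 1 * u"] by (simp add: E_def)
    have ig2: "integrable lborel (\<lambda>u. (norm (g u))\<^sup>2)"
      using gm gE E0 by (intro Bochner_Integration.integrable_bound[OF iE']) auto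
    have gh: "(norm (\<integral>u. g u * cis (t * u) \<partial>lborel))\<^sup>2 = (norm (Lam (Complex \<sigma> t)) * exp (t * \<theta>))\<^sup>2" for t
    proof -
      define z where "z = Complex \<sigma>' t"
      have "Lam (Complex \<sigma> t) = (\<integral>u. \<Phi> (of_real u) * exp (z * of_real u) \<partial>lborel)"
      proof -
        have "Complex \<sigma> t - of_real (\<kappa> / 2) = z" by (simp add: z_def \<sigma>'_def complex_eq_iff)
        thus ?thesis by (simp only: Lam_def)
      qed
      also have "\<dots> = (\<integral>u. \<Phi> (Complex u \<theta>) * exp (z * Complex u \<theta>) \<partial>lborel)" by (rule contour_shift[OF th, symmetric])
      also have "\<dots> = (\<integral>u. exp (\<i> * z * of_real \<theta>) * (g u * cis (t * u)) \<partial>lborel)"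
      proof (rule Bochner_Integration.integral_cong[OF refl])
        fix u
        have "z * Complex u \<theta> = \<i> * z * of_real \<theta> + (of_real (\<sigma>' * u) + \<i> * of_real (t * u))"
          by (simp add: z_def complex_eq_iff algebra_simps)
        thus "\<Phi> (Complex u \<theta>) * exp (z * Complex u \<theta>) = exp (\<i> * z * of_real \<theta>) * (g u * cis (t * u))"
          by (simp only: exp_add g_def cis_conv_exp) (simp only: mult_ac)
      qed
      also have "\<dots> = exp (\<i> * z * of_real \<theta>) * (\<integral>u. g u * cis (t * u) \<partial>lborel)" by simp
      finally have "norm (Lam (Complex \<sigma> t)) = norm (exp (\<i> * z * of_real \<theta>)) * norm (\<integral>u. g u * cis (t * u) \<partial>lborel)" by (simp only: norm_mult)
      also have "norm (exp (\<i> * z * of_real \<theta>)) = exp (- (t * \<theta>))" by (simp add: norm_exp_eq_Re z_def)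
      finally have "norm (Lam (Complex \<sigma> t)) * exp (t * \<theta>) = norm (\<integral>u. g u * cis (t * u) \<partial>lborel)"
        by (simp add: exp_minus)
      thus ?thesis by simp
    qed
    note PB = Plancherel_bound[OF ig ig2 T, unfolded gh]
    have "(\<integral>u. (norm (g u))\<^sup>2 \<partial>lborel) \<le> (\<integral>u. K\<^sup>2 * cos \<theta> powr (- 2 * \<sigma>) * E u \<partial>lborel)"
      by (intro integral_mono ig2 iE' gE)
    also have "\<dots> = K\<^sup>2 * cos \<theta> powr (- 2 * \<sigma>) * (2 * l + 2 * J)" by (simp add: vE)
    also have "\<dots> \<le> K\<^sup>2 * cos \<theta> powr (- 2 * \<sigma>) * ((2 + 2 * J) * (1 + l))"
      using J0 l0 by (intro mult_left_mono) (auto simp: algebra_simps)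
    finally have "12 * (\<integral>u. (norm (g u))\<^sup>2 \<partial>lborel) \<le> C * (cos \<theta> powr (- 2 * \<sigma>) * (1 - ln (cos \<theta>)))"
      by (simp add: C_def l_def mult_ac)
    with PB show ?thesis by (auto intro: order_trans)
  qed
  thus ?thesis using C by blast
qed

text \<open>Take $\theta = \pm(\pi/2 - 1/T)$, for the two signs of $t$: then $\cos\theta \approx 1/T$, and
  $e^{2|t\theta|}$ differs from $e^{\pi|t|}$ by a factor of at most $e^2$ for $|t| \le T$.\<close>

lemma Lam_mean_square:
  assumes q: "q \<ge> \<kappa> / 2"
  shows "\<exists>C\<ge>0. \<forall>\<sigma> T. \<kappa> / 2 \<le> \<sigma> \<longrightarrow> \<sigma> \<le> q \<longrightarrow> T \<ge> 1 \<longrightarrow>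
     integrable lborel (\<lambda>t. indicator {-T..T} t * ((norm (Lam (Complex \<sigma> t)))\<^sup>2 * exp (pi * \<bar>t\<bar>))) \<and>
     (\<integral>t. indicator {-T..T} t * ((norm (Lam (Complex \<sigma> t)))\<^sup>2 * exp (pi * \<bar>t\<bar>)) \<partial>lborel) \<le> C * (T powr (2 * \<sigma>) * (1 + ln T))"
proof -
  obtain C where C: "C \<ge> 0" "\<And>\<sigma> \<theta> T. \<kappa> / 2 \<le> \<sigma> \<Longrightarrow> \<sigma> \<le> q \<Longrightarrow> \<bar>\<theta>\<bar> < pi / 2 \<Longrightarrow> T > 0 \<Longrightarrow>
     integrable lborel (\<lambda>t. indicator {-T..T} t * (norm (Lam (Complex \<sigma> t)) * exp (t * \<theta>))\<^sup>2)"
     "\<And>\<sigma> \<theta> T. \<kappa> / 2 \<le> \<sigma> \<Longrightarrow> \<sigma> \<le> q \<Longrightarrow> \<bar>\<theta>\<bar> < pi / 2 \<Longrightarrow> T > 0 \<Longrightarrow>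
     (\<integral>t. indicator {-T..T} t * (norm (Lam (Complex \<sigma> t)) * exp (t * \<theta>))\<^sup>2 \<partial>lborel) \<le> C * (cos \<theta> powr (- 2 * \<sigma>) * (1 - ln (cos \<theta>)))"
    using Lam_mean_square_tilted[OF q] by blast
  define C' where "C' = 2 * exp 2 * C * (2 powr (2 * q) * 2)"
  have "integrable lborel (\<lambda>t. indicator {-T..T} t * ((norm (Lam (Complex \<sigma> t)))\<^sup>2 * exp (pi * \<bar>t\<bar>))) \<and>
     (\<integral>t. indicator {-T..T} t * ((norm (Lam (Complex \<sigma> t)))\<^sup>2 * exp (pi * \<bar>t\<bar>)) \<partial>lborel) \<le> C' * (T powr (2 * \<sigma>) * (1 + ln T))"
    if s: "\<kappa> / 2 \<le> \<sigma>" "\<sigma> \<le> q" and T: "T \<ge> 1" for \<sigma> T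
  proof -
    \<comment> \<open>Closer to $\pi/2$ the bound for $\Phi$ deteriorates; further away $e^{t\theta}$ loses against $e^{\pi|t|/2}$.\<close>
    define \<theta> where "\<theta> = pi / 2 - 1 / T"
    have T1: "0 < 1 / T" "1 / T \<le> 1" using T by auto
    have "\<theta> < pi / 2" "- \<theta> < pi / 2" using T1 pi_gt3 unfolding \<theta>_def by linarith+
    hence th: "\<bar>\<theta>\<bar> < pi / 2" "\<bar>- \<theta>\<bar> < pi / 2" by auto
    have T0: "T > 0" using T by simp
    have s0: "\<sigma> > 0" using s kappa_pos by simp
    have ce: "cos \<theta> = sin (1 / T)" by (simp add: \<theta>_def cos_diff)
    have cl: "cos \<theta> \<ge> 1 / (2 * T)" using sin_ge_half[of "1 / T"] T1 unfolding ce by simp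
    have c0: "cos \<theta> > 0" by (rule cos_strip(1)[OF th(1)])
    define B where "B = C * (2 powr (2 * q) * T powr (2 * \<sigma>) * (2 * (1 + ln T)))"
    have b: "C * (cos \<theta> powr (- 2 * \<sigma>) * (1 - ln (cos \<theta>))) \<le> B"
      unfolding B_def
    proof (intro mult_left_mono mult_mono C)
      have "cos \<theta> powr (- 2 * \<sigma>) \<le> (1 / (2 * T)) powr (- 2 * \<sigma>)" using cl T s0 by (intro powr_mono2') auto
      also have "\<dots> = (2 * T) powr (2 * \<sigma>)" using T by (simp add: powr_divide powr_minus_divide)
      also have "\<dots> = 2 powr (2 * \<sigma>) * T powr (2 * \<sigma>)" using T by (simp add: powr_mult)
      also have "\<dots> \<le> 2 powr (2 * q) * T powr (2 * \<sigma>)" using s by (intro mult_right_mono powr_mono) auto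
      finally show "cos \<theta> powr (- 2 * \<sigma>) \<le> 2 powr (2 * q) * T powr (2 * \<sigma>)" .
      have "- ln (cos \<theta>) \<le> - ln (1 / (2 * T))" using cl c0 T0 by (simp add: ln_mono)
      also have "- ln (1 / (2 * T)) = ln 2 + ln T" using T0 by (simp add: ln_div ln_mult)
      also have "\<dots> \<le> 1 + ln T" using ln_2_less_1 by simp
      finally have "- ln (cos \<theta>) \<le> 1 + ln T" .
      hence "1 - ln (cos \<theta>) \<le> 1 + (1 + ln T)" by simp
      also have "\<dots> \<le> 2 * (1 + ln T)" using T by simp
      finally show "1 - ln (cos \<theta>) \<le> 2 * (1 + ln T)" .
      have "ln (cos \<theta>) \<le> 0" using c0 cos_strip(2)[of \<theta>] by simp
      thus "0 \<le> 1 - ln (cos \<theta>)" by simp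
    qed auto
    define f where "f = (\<lambda>\<theta> t. indicator {-T..T} t * (norm (Lam (Complex \<sigma> t)) * exp (t * \<theta>))\<^sup>2)"
    have fi: "integrable lborel (f \<theta>)" "integrable lborel (f (- \<theta>))"
      unfolding f_def by (intro C(2) s th T0)+
    have fb: "(\<integral>t. f \<theta> t \<partial>lborel) \<le> B" "(\<integral>t. f (- \<theta>) t \<partial>lborel) \<le> B"
      unfolding f_def using C(3)[OF s th(1) T0] C(3)[OF s th(2) T0] b by auto
    have f0: "f x t \<ge> 0" for x t by (simp add: f_def)
    have le: "indicator {-T..T} t * ((norm (Lam (Complex \<sigma> t)))\<^sup>2 * exp (pi * \<bar>t\<bar>)) \<le> exp 2 * f \<theta> t + exp 2 * f (- \<theta>) t" for t
    proof (cases "t \<in> {-T..T}")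
      case True
      define N where "N = (norm (Lam (Complex \<sigma> t)))\<^sup>2"
      have N0: "N \<ge> 0" by (simp add: N_def)
      have fe: "f \<theta> t = N * exp (2 * (t * \<theta>))" "f (- \<theta>) t = N * exp (2 * (t * (- \<theta>)))"
        using True by (simp_all add: f_def N_def power_mult_distrib power2_eq_square exp_add[symmetric])
      have "pi * \<bar>t\<bar> = 2 * (\<bar>t\<bar> * \<theta>) + 2 * (\<bar>t\<bar> / T)" by (simp add: \<theta>_def algebra_simps)
      also have "\<bar>t\<bar> / T \<le> 1" using True T0 by (auto simp: abs_le_iff)
      finally have "pi * \<bar>t\<bar> \<le> 2 + 2 * (\<bar>t\<bar> * \<theta>)" by simp
      hence "exp (pi * \<bar>t\<bar>) \<le> exp 2 * exp (2 * (\<bar>t\<bar> * \<theta>))" unfolding exp_add[symmetric] by simp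
      also have "exp (2 * (\<bar>t\<bar> * \<theta>)) \<le> exp (2 * (t * \<theta>)) + exp (2 * (t * (- \<theta>)))"
        by (cases "t \<ge> 0") auto
      finally have "exp (pi * \<bar>t\<bar>) \<le> exp 2 * (exp (2 * (t * \<theta>)) + exp (2 * (t * (- \<theta>))))" by simp
      hence "N * exp (pi * \<bar>t\<bar>) \<le> N * (exp 2 * (exp (2 * (t * \<theta>)) + exp (2 * (t * (- \<theta>)))))" using N0 by (rule mult_left_mono)
      thus ?thesis using True unfolding fe by (simp add: N_def algebra_simps)
    qed (use f0 in simp)
    have iR: "integrable lborel (\<lambda>t. exp 2 * f \<theta> t + exp 2 * f (- \<theta>) t)" by (intro Bochner_Integration.integrable_add integrable_mult_right fi)
    have cL: "continuous_on UNIV (\<lambda>t. Lam (Complex \<sigma> t))"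
      by (rule continuous_on_compose2[OF holomorphic_on_imp_continuous_on[OF Lam_entire]]) (auto intro!: continuous_intros)
    hence [measurable]: "(\<lambda>t. Lam (Complex \<sigma> t)) \<in> borel_measurable borel" by (rule borel_measurable_continuous_onI)
    have iL: "integrable lborel (\<lambda>t. indicator {-T..T} t * ((norm (Lam (Complex \<sigma> t)))\<^sup>2 * exp (pi * \<bar>t\<bar>)))"
    proof (rule Bochner_Integration.integrable_bound[OF iR])
      show "AE t in lborel. norm (indicator {-T..T} t * ((norm (Lam (Complex \<sigma> t)))\<^sup>2 * exp (pi * \<bar>t\<bar>))) \<le> norm (exp 2 * f \<theta> t + exp 2 * f (- \<theta>) t)"
        using le f0 by (intro AE_I2) (simp add: abs_mult)
    qed simp
    have "(\<integral>t. indicator {-T..T} t * ((norm (Lam (Complex \<sigma> t)))\<^sup>2 * exp (pi * \<bar>t\<bar>)) \<partial>lborel) \<le> (\<integral>t. exp 2 * f \<theta> t + exp 2 * f (- \<theta>) t \<partial>lborel)"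
      by (intro integral_mono iL iR le)
    also have "\<dots> = exp 2 * (\<integral>t. f \<theta> t \<partial>lborel) + exp 2 * (\<integral>t. f (- \<theta>) t \<partial>lborel)" using fi by simp
    also have "\<dots> \<le> exp 2 * B + exp 2 * B" by (intro add_mono mult_left_mono fb) auto
    also have "\<dots> = C' * (T powr (2 * \<sigma>) * (1 + ln T))" by (simp add: B_def C'_def algebra_simps)
    finally show ?thesis using iL by blast
  qed
  moreover have "C' \<ge> 0" using C(1) by (simp add: C'_def)
  ultimately show ?thesis by blast
qed

end

section \<open>Growth of cusp forms\<close>

lemma periodic_int:
  assumes per: "\<And>z. z \<in> upper_half_plane \<Longrightarrow> g (z + of_real p) = g z" and z: "z \<in> upper_half_plane"
  shows "g (z + of_int n * of_real p) = g z"
proof -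
  have nat: "g (z + of_nat m * of_real p) = g z" if "z \<in> upper_half_plane" for m z
  proof (induction m)
    case (Suc m)
    have "z + of_nat m * of_real p \<in> upper_half_plane" using that by (simp add: upper_half_plane_def)
    from per[OF this] Suc show ?case by (simp add: algebra_simps)
  qed simp
  show ?thesis
  proof (cases "n \<ge> 0")
    case True
    thus ?thesis using nat[OF z, of "nat n"] by simp
  next
    case False
    define z' where "z' = z + of_int n * of_real p"
    have "z' \<in> upper_half_plane" using z by (simp add: z'_def upper_half_plane_def)
    from nat[OF this, of "nat (- n)"] False show ?thesis by (simp add: z'_def algebra_simps)
  qed
qed

text \<open>The function of $q = e^{2\pi i z/p}$ is well defined by periodicity and holomorphic because of local branches
  of the logarithm; the singularity at $q = 0$ is removable since the function tends to $0$ there.\<close>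

lemma periodic_q_expansion:
  assumes g: "g holomorphic_on upper_half_plane" and p: "p > 0"
    and per: "\<And>z. z \<in> upper_half_plane \<Longrightarrow> g (z + of_real p) = g z"
    and lim: "(g \<longlongrightarrow> 0) (filtercomap Im at_top)"
  obtains P where "P holomorphic_on ball 0 1" "P 0 = 0"
    "\<And>z. z \<in> upper_half_plane \<Longrightarrow> g z = P (exp (2 * of_real pi * \<i> * z / of_real p))"
proof -
  define sc where "sc = (\<lambda>w. of_real p / (2 * of_real pi * \<i>) * w)"
  define P where "P = (\<lambda>q. if q = 0 then 0 else g (sc (Ln q)))"
  have Im_sc: "Im (sc w) = - p / (2 * pi) * Re w" for w
    by (simp add: sc_def Im_divide Re_divide power2_eq_square field_simps)
  have Pexp: "P (exp w) = g (sc w)" if "Re w < 0" for w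
  proof -
    have "exp (Ln (exp w)) = exp w" by (rule exp_Ln) simp
    then obtain n :: int where n: "Ln (exp w) = w + of_real (of_int (2 * n) * pi) * \<i>" unfolding exp_eq by auto
    have "sc (Ln (exp w)) = sc w + of_int n * of_real p"
    proof -
      have "of_real p / (2 * of_real pi * \<i>) * (of_real (of_int (2 * n) * pi) * \<i>) = of_int n * of_real p" by (simp add: mult_ac)
      thus ?thesis unfolding n sc_def distrib_left by simp
    qed
    moreover have "Im (sc w) > 0" using that p unfolding Im_sc by (simp add: mult_pos_neg mult_neg_neg divide_less_0_iff)
    hence "sc w \<in> upper_half_plane" by (simp add: upper_half_plane_def)
    ultimately show ?thesis using periodic_int[of g p, OF per] by (simp add: P_def)
  qed
  have holo: "P holomorphic_on ball 0 1 - {0}"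
  proof (rule holomorphic_on_subset[of _ "\<Union>q0\<in>ball 0 1 - {0}. ball q0 (norm q0) \<inter> (ball 0 1 - {0})"])
    show "P holomorphic_on (\<Union>q0\<in>ball 0 1 - {0}. ball q0 (norm q0) \<inter> (ball 0 1 - {0}))"
    proof (rule holomorphic_on_UN_open)
      fix q0 :: complex assume q0: "q0 \<in> ball 0 1 - {0}"
      define B where "B = ball q0 (norm q0) \<inter> (ball 0 1 - {0})"
      define lg where "lg = (\<lambda>q. Ln (q / q0) + Ln q0)"
      have nr: "q / q0 \<notin> \<real>\<^sub>\<le>\<^sub>0" if "q \<in> B" for q
      proof
        assume "q / q0 \<in> \<real>\<^sub>\<le>\<^sub>0"
        then obtain r where r: "r \<le> 0" "q / q0 = of_real r" by (auto elim: nonpos_Reals_cases)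
        hence "q - q0 = of_real (r - 1) * q0" using q0 by (simp add: field_simps)
        hence "norm (q - q0) = \<bar>r - 1\<bar> * norm q0" by (simp only: norm_mult norm_of_real)
        also have "\<dots> \<ge> 1 * norm q0" using r by (intro mult_right_mono) auto
        finally show False using that by (simp add: B_def dist_norm norm_minus_commute)
      qed
      have lg: "exp (lg q) = q" "Re (lg q) < 0" if "q \<in> B" for q
      proof -
        have q: "q \<noteq> 0" "norm q < 1" using that by (auto simp: B_def)
        show e: "exp (lg q) = q" using q q0 by (simp add: lg_def exp_add)
        have "norm q = exp (Re (lg q))" using e norm_exp_eq_Re by metis
        thus "Re (lg q) < 0" using q by simp
      qed
      have "(\<lambda>q. g (sc (lg q))) holomorphic_on B"
      proof (rule holomorphic_on_compose_gen[of "\<lambda>q. sc (lg q)" B g upper_half_plane, unfolded o_def])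
        show "(\<lambda>q. sc (lg q)) holomorphic_on B" unfolding sc_def lg_def using nr q0
          by (intro holomorphic_intros) auto
        show "(\<lambda>q. sc (lg q)) ` B \<subseteq> upper_half_plane"
          using lg(2) p by (auto simp: upper_half_plane_def Im_sc mult_pos_neg mult_neg_neg divide_less_0_iff)
      qed (rule g)
      moreover have "P q = g (sc (lg q))" if "q \<in> B" for q
        using Pexp[OF lg(2)[OF that]] lg(1)[OF that] by simp
      ultimately show "P holomorphic_on ball q0 (norm q0) \<inter> (ball 0 1 - {0})"
        unfolding B_def[symmetric] by (auto elim: holomorphic_transform)
    qed (intro open_Int open_ball open_delete)
  qed auto
  have "P \<midarrow>0\<rightarrow> 0"
  proof -
    have "filterlim (\<lambda>q. Im (sc (Ln q))) at_top (at 0)"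
    proof -
      have "filterlim (\<lambda>q::complex. - p / (2 * pi) * ln (norm q)) at_top (at 0)"
      proof -
        have "filterlim (\<lambda>q::complex. norm q) (at_right 0) (at 0)"
          by (auto simp: filterlim_at eventually_at_filter intro!: tendsto_norm_zero tendsto_ident_at)
        moreover have "filterlim (\<lambda>x::real. - p / (2 * pi) * ln x) at_top (at_right 0)" using p by real_asymp
        ultimately show ?thesis by (rule filterlim_compose[rotated])
      qed
      thus ?thesis by (rule filterlim_cong[THEN iffD1, rotated 3]) (auto simp: Im_sc eventually_at_filter Re_Ln)
    qed
    hence "filterlim (\<lambda>q. sc (Ln q)) (filtercomap Im at_top) (at 0)" by (simp add: filterlim_filtercomap_iff o_def)
    from filterlim_compose[OF lim this]
    show ?thesis by (rule Lim_transform_eventually) (auto simp: P_def eventually_at_filter)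
  qed
  hence c0: "isCont P 0" by (simp add: isCont_def P_def)
  have "continuous_on (ball 0 1) P"
  proof (rule continuous_at_imp_continuous_on, rule ballI)
    fix x :: complex assume x: "x \<in> ball 0 1"
    show "isCont P x"
    proof (cases "x = 0")
      case False
      thus ?thesis using holomorphic_on_imp_continuous_on[OF holo] x
        by (subst (asm) continuous_on_eq_continuous_at) (auto intro: open_delete)
    qed (use c0 in simp)
  qed
  hence "P holomorphic_on ball 0 1"
    by (rule no_isolated_singularity[OF _ holo]) auto
  moreover have "g z = P (exp (2 * of_real pi * \<i> * z / of_real p))" if "z \<in> upper_half_plane" for z
  proof -
    define w where "w = 2 * of_real pi * \<i> * z / of_real p"
    have "Re w = - (2 * pi * Im z / p)" by (simp add: w_def)
    hence "Re w < 0" using that p by (simp add: upper_half_plane_def)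
    moreover have "sc w = z" using p by (simp add: sc_def w_def field_simps)
    ultimately show ?thesis using Pexp[of w] by (simp add: w_def)
  qed
  ultimately show ?thesis using that[of P] by (simp add: P_def)
qed

lemma q_series_decay:
  assumes P: "P holomorphic_on ball 0 1" "P 0 = 0" and r: "r < 1"
  shows "\<exists>C\<ge>0. \<forall>q. norm q \<le> r \<longrightarrow> norm (P q) \<le> C * norm q"
proof -
  define R where "R = max r (1/2)"
  have R: "0 < R" "R < 1" "r \<le> R" using r by (auto simp: R_def)
  define h where "h = (\<lambda>q. if q = 0 then deriv P 0 else (P q - P 0) / (q - 0))"
  have "h holomorphic_on ball 0 1" unfolding h_def by (rule pole_lemma_open[OF P(1) open_ball])
  hence "continuous_on (cball 0 R) h" using R by (auto intro: holomorphic_on_imp_continuous_on continuous_on_subset)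
  hence "bounded (h ` cball 0 R)" by (intro compact_imp_bounded compact_continuous_image) auto
  then obtain C where C: "\<And>q. q \<in> cball 0 R \<Longrightarrow> norm (h q) \<le> C" unfolding bounded_iff by blast
  have "norm (P q) \<le> C * norm q" if "norm q \<le> r" for q
  proof -
    have "P q = h q * q" using P(2) by (simp add: h_def)
    hence "norm (P q) = norm (h q) * norm q" by (simp add: norm_mult)
    also have "\<dots> \<le> C * norm q" using C[of q] that R by (intro mult_right_mono) auto
    finally show ?thesis .
  qed
  moreover have "C \<ge> 0" using order_trans[OF norm_ge_zero C[of 0]] R by simp
  ultimately show ?thesis by blast
qed

lemma power_exp_bounded:
  fixes b B :: real
  assumes "b > 0"
  shows "\<exists>K\<ge>0. \<forall>x\<ge>1/2. x powr B * exp (- b * x) \<le> K"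
proof -
  define h where "h = (\<lambda>x. x powr B * exp (- b * x))"
  have "(h \<longlongrightarrow> 0) at_top" unfolding h_def using assms by real_asymp
  hence "\<forall>\<^sub>F x in at_top. h x < 1" by (rule order_tendstoD(2)) simp
  then obtain X where X: "\<And>x. x \<ge> X \<Longrightarrow> h x < 1" by (auto simp: eventually_at_top_linorder)
  have "continuous_on {1/2..max X 1} h" unfolding h_def by (intro continuous_intros) auto
  hence "bounded (h ` {1/2..max X 1})" by (intro compact_imp_bounded compact_continuous_image) auto
  then obtain K where K: "\<And>x. x \<in> {1/2..max X 1} \<Longrightarrow> norm (h x) \<le> K" unfolding bounded_iff by blast
  have "h x \<le> max K 1" if "x \<ge> 1/2" for x
  proof (cases "x \<ge> X")
    case True thus ?thesis using X[of x] by simp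
  next
    case False
    hence "\<bar>h x\<bar> \<le> K" using K[of x] that by simp
    thus ?thesis by simp
  qed
  thus ?thesis unfolding h_def by (intro exI[of _ "max K 1"]) auto
qed

lemma Im_moebius:
  fixes a b c d :: int
  assumes det: "a * d - b * c = 1" and z: "Im z > 0"
  shows "of_int c * z + of_int d \<noteq> 0"
    "Im ((of_int a * z + of_int b) / (of_int c * z + of_int d)) = Im z / (norm (of_int c * z + of_int d))\<^sup>2"
proof -
  have nz: "of_int c * z + of_int d \<noteq> 0"
  proof
    assume "of_int c * z + of_int d = 0"
    hence "Im (of_int c * z + of_int d) = 0" "Re (of_int c * z + of_int d) = 0" by simp_all
    hence "c = 0" "d = 0" using z by auto
    thus False using det by simp
  qed
  thus "of_int c * z + of_int d \<noteq> 0" .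
  have "Im ((of_int a * z + of_int b) / (of_int c * z + of_int d)) =
     ((of_int a * Im z) * (of_int c * Re z + of_int d) - (of_int a * Re z + of_int b) * (of_int c * Im z)) / (norm (of_int c * z + of_int d))\<^sup>2"
    by (simp add: Im_divide cmod_power2)
  also have "(of_int a * Im z) * (of_int c * Re z + of_int d) - (of_int a * Re z + of_int b) * (of_int c * Im z) = of_int (a * d - b * c) * Im z"
    by (simp add: algebra_simps)
  finally show "Im ((of_int a * z + of_int b) / (of_int c * z + of_int d)) = Im z / (norm (of_int c * z + of_int d))\<^sup>2"
    using det by simp
qed

text \<open>Choose the bottom row $(c, d)$, coprime, with $|cz + d|$ minimal, and translate so that $|\mathrm{Re}\, w| \le 1/2$.
  Minimality forces $|w| \ge 1$, hence $(\mathrm{Im}\, w)^2 \ge 3/4$; the weaker bound $1/2$ suffices.\<close>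

lemma reduction_SL2Z:
  assumes z: "Im z > 0"
  obtains a b c d :: int where "a * d - b * c = 1" "Im ((of_int a * z + of_int b) / (of_int c * z + of_int d)) \<ge> 1/2"
proof -
  \<comment> \<open>Rows of norm at most $1$ are finite in number and include $(0, 1)$.\<close>
  define N where "N = (\<lambda>p::int\<times>int. norm (of_int (fst p) * z + of_int (snd p)))"
  define S where "S = {p::int\<times>int. coprime (fst p) (snd p) \<and> N p \<le> 1}"
  have fin: "finite S"
  proof -
    define X where "X = \<lceil>1 / Im z\<rceil>"
    define Y where "Y = \<lceil>1 + of_int X * norm z\<rceil>"
    have "S \<subseteq> {-X..X} \<times> {-Y..Y}"
    proof
      fix p assume "p \<in> S"
      then obtain c d where p: "p = (c, d)" and n: "norm (of_int c * z + of_int d) \<le> 1" by (cases p) (auto simp: S_def N_def)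
      have "\<bar>of_int c * Im z\<bar> \<le> 1" using abs_Im_le_cmod[of "of_int c * z + of_int d"] n by simp
      hence "\<bar>real_of_int c\<bar> \<le> 1 / Im z" using z by (simp add: abs_mult field_simps)
      hence c: "\<bar>c\<bar> \<le> X" unfolding X_def by linarith
      have "norm (of_int d :: complex) \<le> norm (of_int c * z + of_int d) + norm (of_int c * z)"
        using norm_triangle_ineq4[of "of_int c * z + of_int d" "of_int c * z"] by simp
      hence "\<bar>real_of_int d\<bar> \<le> 1 + \<bar>real_of_int c\<bar> * norm z" using n by (simp add: norm_mult)
      also have "\<dots> \<le> 1 + of_int X * norm z" using c by (intro add_left_mono mult_right_mono) (auto simp flip: of_int_abs)
      finally have "\<bar>d\<bar> \<le> Y" unfolding Y_def by linarith
      thus "p \<in> {-X..X} \<times> {-Y..Y}" using c by (auto simp: p)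
    qed
    thus ?thesis by (rule finite_subset) simp
  qed
  have "(0, 1) \<in> S" by (simp add: S_def N_def)
  hence ne: "S \<noteq> {}" by blast
  define p where "p = arg_min_on N S"
  have pS: "p \<in> S" unfolding p_def by (rule arg_min_if_finite(1)[OF fin ne])
  have pmin: "N p \<le> N r" if "coprime (fst r) (snd r)" for r
  proof (cases "N r \<le> 1")
    case True
    hence "r \<in> S" using that by (simp add: S_def)
    from arg_min_least[OF fin ne this, of N] show ?thesis unfolding p_def .
  next
    case False thus ?thesis using pS by (simp add: S_def)
  qed
  obtain c d where pcd: "p = (c, d)" by (cases p)
  have cop: "coprime c d" using pS by (simp add: S_def pcd)
  obtain a0 b0 where ab0: "a0 * d - b0 * c = 1"
  proof -
    obtain u v where "u * c + v * d = 1" using cop bezout_int[of c d] by (auto simp: coprime_iff_gcd_eq_1)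
    thus ?thesis using that[of v "-u"] by (simp add: algebra_simps)
  qed
  define w0 where "w0 = (of_int a0 * z + of_int b0) / (of_int c * z + of_int d)"
  define n where "n = round (Re w0)"
  define a where "a = a0 - n * c"
  define b where "b = b0 - n * d"
  have det: "a * d - b * c = 1" using ab0 by (simp add: a_def b_def algebra_simps)
  define w where "w = (of_int a * z + of_int b) / (of_int c * z + of_int d)"
  have nz: "of_int c * z + of_int d \<noteq> 0" by (rule Im_moebius(1)[OF det z])
  have "w = w0 - of_int n" using nz by (simp add: w_def w0_def a_def b_def field_simps)
  hence Rew: "\<bar>Re w\<bar> \<le> 1/2" using of_int_round_abs_le[of "Re w0"] by (simp add: n_def abs_minus_commute)
  have Imw: "Im w > 0" unfolding w_def Im_moebius(2)[OF det z] using z nz by simp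
  have "norm w \<ge> 1"
  proof (rule ccontr)
    assume "\<not> norm w \<ge> 1"
    have "coprime a b"
    proof (rule coprimeI)
      fix l assume "l dvd a" "l dvd b"
      hence "l dvd a * d - b * c" by simp
      thus "is_unit l" using det by simp
    qed
    from pmin[of "(a, b)"] this have "N p \<le> N (a, b)" by simp
    moreover have "N (a, b) = norm w * N p" using nz by (simp add: N_def pcd w_def norm_divide)
    moreover have "N p > 0" using nz by (simp add: N_def pcd)
    moreover have "norm w * N p < 1 * N p" using \<open>\<not> norm w \<ge> 1\<close> \<open>N p > 0\<close> by (intro mult_strict_right_mono) auto
    ultimately show False by simp
  qed
  hence "1 \<le> (norm w)\<^sup>2" by simp
  hence "1 \<le> (Re w)\<^sup>2 + (Im w)\<^sup>2" by (simp add: cmod_power2)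
  moreover have "(Re w)\<^sup>2 \<le> (1/2)\<^sup>2" using Rew by (subst power2_le_iff_abs_le) auto
  ultimately have "(1/2)\<^sup>2 \<le> (Im w)\<^sup>2" by (simp add: power2_eq_square)
  hence "Im w \<ge> 1/2" by (rule power2_le_imp_le) (use Imw in simp)
  thus ?thesis using that[OF det] by (simp add: w_def)
qed

text \<open>Eighth powers remove the choice of the square root; \<open>shimura_symbol_8\<close> and \<open>theta_eps_8\<close> remove the
  remaining parts of the multiplier.\<close>

lemma half_pow_8: "half_pow z (int m) ^ 8 = z ^ (4 * m)" "half_pow z (- int m) ^ 8 = inverse (z ^ (4 * m))"
proof -
  have e: "(csqrt z ^ m) ^ 8 = z ^ (4 * m)"
  proof -
    have "(csqrt z ^ m) ^ 8 = csqrt z ^ (2 * (4 * m))" by (simp add: power_mult[symmetric] mult.commute)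
    also have "\<dots> = ((csqrt z)\<^sup>2) ^ (4 * m)" by (rule power_mult)
    finally show ?thesis by simp
  qed
  show "half_pow z (int m) ^ 8 = z ^ (4 * m)" using e by (simp add: half_pow_def)
  show "half_pow z (- int m) ^ 8 = inverse (z ^ (4 * m))" using e
    by (simp add: half_pow_def power_int_minus power_inverse del: power_mult)
qed

lemma shimura_symbol_8:
  assumes "a * d - b * c = (1::int)"
  shows "(of_int (shimura_symbol c d) :: complex) ^ 8 = 1"
proof -
  have np: "Legendre c p = 1 \<or> Legendre c p = -1" if "p \<in># prime_factorization \<bar>d\<bar>" for p
  proof -
    have "p dvd \<bar>d\<bar>" "prime p" using that by (auto simp: in_prime_factors_iff)
    hence pd: "p dvd d" by simp
    have "\<not> p dvd c"
    proof
      assume "p dvd c"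
      hence "p dvd a * d - b * c" using pd by simp
      thus False using assms \<open>prime p\<close> by (simp add: not_prime_unit)
    qed
    hence "\<not> [c = 0] (mod p)" by (simp add: cong_0_iff)
    thus ?thesis by (auto simp: Legendre_def)
  qed
  define M where "M = prime_factorization \<bar>d\<bar>"
  have "(\<Prod>p\<in>#M. Legendre c p) = 1 \<or> (\<Prod>p\<in>#M. Legendre c p) = -1"
    using np unfolding M_def[symmetric]
  proof (induction M)
    case (add x M)
    hence "Legendre c x = 1 \<or> Legendre c x = -1" "(\<Prod>p\<in>#M. Legendre c p) = 1 \<or> (\<Prod>p\<in>#M. Legendre c p) = -1" by auto
    thus ?case by (elim disjE) simp_all
  qed simp
  hence "shimura_symbol c d = 1 \<or> shimura_symbol c d = -1" by (auto simp: shimura_symbol_def M_def)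
  thus ?thesis by auto
qed

lemma theta_eps_8: "(theta_eps d powi n) ^ 8 = 1"
proof -
  have "theta_eps d ^ 8 = 1" by (simp add: theta_eps_def power_numeral_even)
  have "(theta_eps d powi n) ^ 8 = (theta_eps d ^ 8) powi n"
    by (metis power_int_mult power_int_of_nat mult.commute)
  thus ?thesis using \<open>theta_eps d ^ 8 = 1\<close> by simp
qed

locale cusp_form =
  fixes k :: nat and f :: "complex \<Rightarrow> complex"
  assumes cusp: "f \<in> cusp_forms k"
begin

definition N where "N = 4 * (2 * k + 1)"

text \<open>The eighth power of $f$ is a modular form of integral weight $N$ with trivial multiplier; this is its
  image under the matrix with rows $(a, b)$ and $(c, d)$.\<close>

definition slash :: "int \<Rightarrow> int \<Rightarrow> int \<Rightarrow> int \<Rightarrow> complex \<Rightarrow> complex" where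
  "slash a b c d z = inverse ((of_int c * z + of_int d) ^ N) * f ((of_int a * z + of_int b) / (of_int c * z + of_int d)) ^ 8"

lemma f_holo: "f holomorphic_on upper_half_plane"
  using cusp by (simp add: cusp_forms_def)

lemma f8_modular:
  assumes "a * d - b * c = 1" "4 dvd c" "z \<in> upper_half_plane"
  shows "f ((of_int a * z + of_int b) / (of_int c * z + of_int d)) ^ 8 = (of_int c * z + of_int d) ^ N * f z ^ 8"
proof -
  have e: "2 * int k + 1 = int (2 * k + 1)" by simp
  have "f ((of_int a * z + of_int b) / (of_int c * z + of_int d)) =
            of_int (shimura_symbol c d) ^ (2 * k + 1) * theta_eps d powi (- (2 * int k + 1)) *
            half_pow (of_int c * z + of_int d) (2 * int k + 1) * f z"
    using cusp assms unfolding cusp_forms_def by blast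
  hence "f ((of_int a * z + of_int b) / (of_int c * z + of_int d)) ^ 8 =
     (of_int (shimura_symbol c d) ^ (2 * k + 1)) ^ 8 * (theta_eps d powi (- (2 * int k + 1))) ^ 8 *
            half_pow (of_int c * z + of_int d) (2 * int k + 1) ^ 8 * f z ^ 8"
    by (simp only: power_mult_distrib)
  also have "(of_int (shimura_symbol c d) ^ (2 * k + 1)) ^ 8 = (1 :: complex)"
    using shimura_symbol_8[OF assms(1)] by (metis power_commuting_commutes power_mult mult.commute power_one)
  also have "(theta_eps d powi (- (2 * int k + 1))) ^ 8 = 1" by (rule theta_eps_8)
  also have "half_pow (of_int c * z + of_int d) (2 * int k + 1) ^ 8 = (of_int c * z + of_int d) ^ N"
    unfolding e half_pow_8 N_def by simp
  finally show ?thesis by simp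
qed

lemma slash_tendsto_0:
  assumes "a * d - b * c = 1"
  shows "(slash a b c d \<longlongrightarrow> 0) (filtercomap Im at_top)"
proof -
  have e: "- (2 * int k + 1) = - int (2 * k + 1)" by simp
  have "((\<lambda>z. half_pow (of_int c * z + of_int d) (- (2 * int k + 1)) *
             f ((of_int a * z + of_int b) / (of_int c * z + of_int d))) \<longlongrightarrow> 0) (filtercomap Im at_top)"
    using cusp assms unfolding cusp_forms_def by blast
  from tendsto_power[OF this, of 8] show ?thesis
    unfolding slash_def[abs_def] e power_mult_distrib half_pow_8 N_def[symmetric] by (simp add: N_def)
qed

lemma slash_holo:
  assumes "a * d - b * c = 1"
  shows "slash a b c d holomorphic_on upper_half_plane"
proof -
  have nz: "of_int c * z + of_int d \<noteq> 0" if "z \<in> upper_half_plane" for z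
    using Im_moebius(1)[OF assms] that by (simp add: upper_half_plane_def)
  have "(\<lambda>z. f ((of_int a * z + of_int b) / (of_int c * z + of_int d))) holomorphic_on upper_half_plane"
  proof (rule holomorphic_on_compose_gen[of "\<lambda>z. (of_int a * z + of_int b) / (of_int c * z + of_int d)" _ f upper_half_plane, unfolded o_def])
    show "(\<lambda>z. (of_int a * z + of_int b) / (of_int c * z + of_int d)) holomorphic_on upper_half_plane"
      using nz by (intro holomorphic_intros) auto
    show "(\<lambda>z. (of_int a * z + of_int b) / (of_int c * z + of_int d)) ` upper_half_plane \<subseteq> upper_half_plane"
      using nz by (auto simp: upper_half_plane_def Im_moebius(2)[OF assms])
  qed (rule f_holo)
  thus ?thesis unfolding slash_def[abs_def] using nz by (intro holomorphic_intros) auto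
qed

text \<open>Two matrices congruent modulo $4$ differ by a left factor in $\Gamma(4) \subseteq \Gamma_0(4)$, under which
  $f^8$ is invariant. Thus only finitely many functions occur.\<close>

lemma slash_cong_mod_4:
  assumes det: "a * d - b * c = 1" "a' * d' - b' * c' = 1"
    and cong: "4 dvd a' - a" "4 dvd b' - b" "4 dvd c' - c" "4 dvd d' - d" and z: "z \<in> upper_half_plane"
  shows "slash a' b' c' d' z = slash a b c d z"
proof -
  define A where "A = a' * d - b' * c"
  define B where "B = b' * a - a' * b"
  define C where "C = c' * d - d' * c"
  define D where "D = d' * a - c' * b"
  have "A * D - B * C = (a' * d' - b' * c') * (a * d - b * c)" by (simp add: A_def B_def C_def D_def algebra_simps)
  hence detD: "A * D - B * C = 1" using det by simp
  have "C = (c' - c) * d - (d' - d) * c" by (simp add: C_def algebra_simps)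
  hence C4: "4 dvd C" using cong by simp
  have iz: "Im z > 0" using z by (simp add: upper_half_plane_def)
  define J where "J = of_int c * z + of_int d"
  define J' where "J' = of_int c' * z + of_int d'"
  have J: "J \<noteq> 0" "J' \<noteq> 0" unfolding J_def J'_def using Im_moebius(1)[OF det(1) iz] Im_moebius(1)[OF det(2) iz] by auto
  define w where "w = (of_int a * z + of_int b) / J"
  have w: "w \<in> upper_half_plane" unfolding w_def J_def upper_half_plane_def using Im_moebius[OF det(1) iz] iz by simp
  have c1: "(of_int C * w + of_int D) * J = J'"
  proof -
    have "(of_int C * w + of_int D) * J = of_int C * (of_int a * z + of_int b) + of_int D * (of_int c * z + of_int d)"
      using J by (simp add: w_def J_def distrib_right)
    also have "\<dots> = of_int (C * a + D * c) * z + of_int (C * b + D * d)" by (simp add: algebra_simps)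
    also have "C * a + D * c = c' * (a * d - b * c)" by (simp add: C_def D_def algebra_simps)
    also have "C * b + D * d = d' * (a * d - b * c)" by (simp add: C_def D_def algebra_simps)
    finally show ?thesis using det by (simp add: J'_def)
  qed
  have c2: "(of_int A * w + of_int B) * J = of_int a' * z + of_int b'"
  proof -
    have "(of_int A * w + of_int B) * J = of_int A * (of_int a * z + of_int b) + of_int B * (of_int c * z + of_int d)"
      using J by (simp add: w_def J_def distrib_right)
    also have "\<dots> = of_int (A * a + B * c) * z + of_int (A * b + B * d)" by (simp add: algebra_simps)
    also have "A * a + B * c = a' * (a * d - b * c)" by (simp add: A_def B_def algebra_simps)
    also have "A * b + B * d = b' * (a * d - b * c)" by (simp add: A_def B_def algebra_simps)
    finally show ?thesis using det by simp
  qed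
  have CD: "of_int C * w + of_int D \<noteq> 0" using c1 J by auto
  have "(of_int A * w + of_int B) / (of_int C * w + of_int D) = (of_int a' * z + of_int b') / J'"
    using J CD by (simp add: c1[symmetric] c2[symmetric])
  hence "f ((of_int a' * z + of_int b') / J') ^ 8 = (of_int C * w + of_int D) ^ N * f w ^ 8"
    using f8_modular[OF detD C4 w] by simp
  moreover have "of_int C * w + of_int D = J' / J" using c1 J by (simp add: field_simps)
  ultimately have "f ((of_int a' * z + of_int b') / J') ^ 8 = (J' / J) ^ N * f w ^ 8" by simp
  thus ?thesis using J unfolding slash_def J_def[symmetric] J'_def[symmetric] w_def[symmetric]
    by (simp add: power_divide field_simps)
qed

lemma slash_periodic:
  assumes det: "a * d - b * c = 1" and z: "z \<in> upper_half_plane"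
  shows "slash a b c d (z + of_real 4) = slash a b c d z"
proof -
  have "slash a (b + 4 * a) c (d + 4 * c) z = slash a b c d z"
    by (rule slash_cong_mod_4) (use det z in \<open>auto simp: algebra_simps\<close>)
  moreover have "slash a (b + 4 * a) c (d + 4 * c) z = slash a b c d (z + of_real 4)"
    by (simp add: slash_def algebra_simps)
  ultimately show ?thesis by simp
qed

text \<open>Every transform of $f^8$ is periodic with period $4$ and vanishes at infinity, so it decays exponentially.\<close>

lemma slash_bounded:
  assumes det: "a * d - b * c = 1"
  shows "\<exists>C\<ge>0. \<forall>z. Im z \<ge> 1/2 \<longrightarrow> norm (slash a b c d z) * Im z ^ (2 * (2 * k + 1)) \<le> C"
proof -
  obtain P where P: "P holomorphic_on ball 0 1" "P 0 = 0"
    "\<And>z. z \<in> upper_half_plane \<Longrightarrow> slash a b c d z = P (exp (2 * of_real pi * \<i> * z / of_real 4))"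
    using periodic_q_expansion[OF slash_holo[OF det] _ slash_periodic[OF det] slash_tendsto_0[OF det]] by auto
  define r where "r = exp (- pi / 4)"
  have "r < 1" by (simp add: r_def)
  from q_series_decay[OF P(1,2) this] obtain C where C: "C \<ge> 0" "\<And>q. norm q \<le> r \<Longrightarrow> norm (P q) \<le> C * norm q" by blast
  have "pi / 2 > (0::real)" by simp
  from power_exp_bounded[OF this, of "real (2 * (2 * k + 1))"] obtain K where
    K: "K \<ge> 0" "\<And>x. x \<ge> 1/2 \<Longrightarrow> x powr real (2 * (2 * k + 1)) * exp (- (pi / 2) * x) \<le> K" by blast
  have "norm (slash a b c d z) * Im z ^ (2 * (2 * k + 1)) \<le> C * K" if z: "Im z \<ge> 1/2" for z
  proof -
    define q where "q = exp (2 * of_real pi * \<i> * z / of_real 4)"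
    have nq: "norm q = exp (- (pi / 2) * Im z)" by (simp add: q_def norm_exp_eq_Re)
    have "norm q \<le> r" unfolding nq r_def using z by simp
    hence "norm (P q) \<le> C * norm q" by (rule C(2))
    moreover have "slash a b c d z = P q" unfolding q_def using z by (intro P(3)) (simp add: upper_half_plane_def)
    ultimately have "norm (slash a b c d z) * Im z ^ (2 * (2 * k + 1)) \<le> (C * norm q) * Im z ^ (2 * (2 * k + 1))"
      using z by (intro mult_right_mono) auto
    also have "(C * norm q) * Im z ^ (2 * (2 * k + 1)) = C * (Im z powr real (2 * (2 * k + 1)) * exp (- (pi / 2) * Im z))"
    proof -
      have "Im z ^ (2 * (2 * k + 1)) = Im z powr real (2 * (2 * k + 1))" using z by (subst powr_realpow) auto
      thus ?thesis unfolding nq by (simp only: mult_ac)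
    qed
    also have "\<dots> \<le> C * K" using C(1) K(2)[OF z] by (intro mult_left_mono)
    finally show ?thesis .
  qed
  thus ?thesis using C(1) K(1) by (intro exI[of _ "C * K"]) auto
qed

lemma slash_bounded_uniform:
  "\<exists>C\<ge>0. \<forall>a b c d z. a * d - b * c = 1 \<longrightarrow> Im z \<ge> 1/2 \<longrightarrow> norm (slash a b c d z) * Im z ^ (2 * (2 * k + 1)) \<le> C"
proof -
  \<comment> \<open>A transform depends on its matrix modulo $4$ only, so a maximum over residues is a uniform bound.\<close>
  define R where "R = {0..3::int} \<times> {0..3::int} \<times> {0..3::int} \<times> {0..3::int}"
  define res where "res = (\<lambda>(a::int, b::int, c::int, d::int). (a mod 4, b mod 4, c mod 4, d mod 4))"
  have "\<exists>C. \<forall>r. C r \<ge> 0 \<and> (\<forall>a b c d z. res (a, b, c, d) = r \<longrightarrow> a * d - b * c = 1 \<longrightarrow> Im z \<ge> 1/2 \<longrightarrow> norm (slash a b c d z) * Im z ^ (2 * (2 * k + 1)) \<le> C r)"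
  proof (rule choice, rule allI)
    fix r
    show "\<exists>C. C \<ge> 0 \<and> (\<forall>a b c d z. res (a, b, c, d) = r \<longrightarrow> a * d - b * c = 1 \<longrightarrow> Im z \<ge> 1/2 \<longrightarrow> norm (slash a b c d z) * Im z ^ (2 * (2 * k + 1)) \<le> C)"
    proof (cases "\<exists>a b c d. res (a, b, c, d) = r \<and> a * d - b * c = 1")
      case True
      then obtain a0 b0 c0 d0 where r0: "res (a0, b0, c0, d0) = r" "a0 * d0 - b0 * c0 = 1" by blast
      obtain C where C: "C \<ge> 0" "\<And>z. Im z \<ge> 1/2 \<Longrightarrow> norm (slash a0 b0 c0 d0 z) * Im z ^ (2 * (2 * k + 1)) \<le> C"
        using slash_bounded[OF r0(2)] by blast
      have "norm (slash a b c d z) * Im z ^ (2 * (2 * k + 1)) \<le> C"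
        if "res (a, b, c, d) = r" "a * d - b * c = 1" "Im z \<ge> 1/2" for a b c d z
      proof -
        have "slash a b c d z = slash a0 b0 c0 d0 z"
        proof (rule slash_cong_mod_4[OF r0(2) that(2)])
          have "res (a, b, c, d) = res (a0, b0, c0, d0)" using that(1) r0(1) by simp
          hence "a mod 4 = a0 mod 4" "b mod 4 = b0 mod 4" "c mod 4 = c0 mod 4" "d mod 4 = d0 mod 4"
            unfolding res_def by simp_all
          thus "4 dvd a - a0" "4 dvd b - b0" "4 dvd c - c0" "4 dvd d - d0"
            by (simp_all only: mod_eq_dvd_iff)
          show "z \<in> upper_half_plane" using that(3) by (simp add: upper_half_plane_def)
        qed
        thus ?thesis using C(2)[OF that(3)] by simp
      qed
      thus ?thesis using C(1) by blast
    next
      case False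
      thus ?thesis by (intro exI[of _ 0]) auto
    qed
  qed
  then obtain C where C: "\<And>r. C r \<ge> 0" "\<And>a b c d z. a * d - b * c = 1 \<Longrightarrow> Im z \<ge> 1/2 \<Longrightarrow> norm (slash a b c d z) * Im z ^ (2 * (2 * k + 1)) \<le> C (res (a, b, c, d))"
    by blast
  have fR: "finite R" by (simp add: R_def)
  have inR: "res (a, b, c, d) \<in> R" for a b c d by (auto simp: res_def R_def)
  have "C (res (a, b, c, d)) \<le> (\<Sum>r\<in>R. C r)" for a b c d
    using fR inR C(1) by (intro member_le_sum) auto
  hence "norm (slash a b c d z) * Im z ^ (2 * (2 * k + 1)) \<le> (\<Sum>r\<in>R. C r)"
    if "a * d - b * c = 1" "Im z \<ge> 1/2" for a b c d z using order_trans[OF C(2)[OF that]] by blast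
  moreover have "(\<Sum>r\<in>R. C r) \<ge> 0" using C(1) by (intro sum_nonneg)
  ultimately show ?thesis by blast
qed

text \<open>Since $\mathrm{Im}\, z$ scales by $|cz+d|^{-2}$, moving $z$ by $\mathrm{SL}_2(\mathbb{Z})$ turns
  $|f(z)|^8 (\mathrm{Im}\, z)^{N/2}$ into the same expression for a transform of $f^8$, at a point with imaginary part
  at least $1/2$, where it is bounded.\<close>

lemma f_growth:
  "\<exists>C\<ge>0. \<forall>z. Im z > 0 \<longrightarrow> norm (f z) \<le> C * Im z powr (- (real k + 1/2) / 2)"
proof -
  obtain C where C: "C \<ge> 0" "\<And>a b c d z. a * d - b * c = 1 \<Longrightarrow> Im z \<ge> 1/2 \<Longrightarrow> norm (slash a b c d z) * Im z ^ (2 * (2 * k + 1)) \<le> C"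
  proof -
    from slash_bounded_uniform obtain C where c: "C \<ge> 0"
      and C: "\<forall>a b c d z. a * d - b * c = 1 \<longrightarrow> Im z \<ge> 1/2 \<longrightarrow> norm (slash a b c d z) * Im z ^ (2 * (2 * k + 1)) \<le> C"
      by (elim exE conjE)
    show ?thesis by (rule that[OF c]) (rule C[rule_format])
  qed
  have b8: "norm (f z) ^ 8 * Im z ^ (2 * (2 * k + 1)) \<le> C" if z: "Im z > 0" for z
  proof -
    obtain a b c d :: int where det: "a * d - b * c = 1" and w1: "Im ((of_int a * z + of_int b) / (of_int c * z + of_int d)) \<ge> 1/2"
      by (rule reduction_SL2Z[OF z]) (rule that)
    define J where "J = of_int c * z + of_int d"
    have J: "J \<noteq> 0" unfolding J_def by (rule Im_moebius(1)[OF det z])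
    define w where "w = (of_int a * z + of_int b) / J"
    have w1: "Im w \<ge> 1/2" using w1 by (simp add: w_def J_def)
    \<comment> \<open>The inverse matrix carries \<open>w\<close> back to \<open>z\<close>; its automorphy factor is the reciprocal of \<open>J\<close>.\<close>
    have det': "d * a - (-b) * (-c) = 1" using det by (simp add: mult.commute)
    have wJ: "w * J = of_int a * z + of_int b" using J by (simp add: w_def)
    have j1: "(of_int (-c) * w + of_int a) * J = 1"
    proof -
      have "(of_int (-c) * w + of_int a) * J = of_int (-c) * (w * J) + of_int a * J" by (simp only: distrib_right mult.assoc)
      also have "\<dots> = of_int (a * d - b * c)" unfolding wJ by (simp add: J_def algebra_simps)
      finally show ?thesis using det by simp
    qed
    have j2: "(of_int d * w + of_int (-b)) * J = z"
    proof -
      have "(of_int d * w + of_int (-b)) * J = of_int d * (w * J) + of_int (-b) * J" by (simp only: distrib_right mult.assoc)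
      also have "\<dots> = of_int (a * d - b * c) * z" unfolding wJ by (simp add: J_def algebra_simps)
      finally show ?thesis using det by simp
    qed
    define J' where "J' = of_int (-c) * w + of_int a"
    have J': "J' \<noteq> 0" "J' * J = 1" using j1 by (auto simp: J'_def)
    have ze: "(of_int d * w + of_int (-b)) / J' = z"
    proof -
      have "(of_int d * w + of_int (-b)) / J' = ((of_int d * w + of_int (-b)) * J) / (J' * J)" using J by simp
      thus ?thesis using j2 J' by simp
    qed
    have s: "slash d (-b) (-c) a w = inverse (J' ^ N) * f z ^ 8"
      unfolding slash_def J'_def[symmetric] ze ..
    have Iw: "Im w = Im z / (norm J)\<^sup>2" unfolding w_def J_def by (rule Im_moebius(2)[OF det z])
    have nJ: "norm J' * norm J = 1" using J'(2) by (metis norm_mult norm_one)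
    hence nJ': "inverse (norm J') = norm J" using J'(1) by (simp add: field_simps)
    have "norm (slash d (-b) (-c) a w) * Im w ^ (2 * (2 * k + 1)) = (norm J ^ N * norm (f z) ^ 8) * (Im z / (norm J)\<^sup>2) ^ (2 * (2 * k + 1))"
      unfolding s Iw by (simp add: norm_mult norm_inverse norm_power nJ' flip: power_inverse)
    also have "\<dots> = norm (f z) ^ 8 * Im z ^ (2 * (2 * k + 1))"
    proof -
      have "((norm J)\<^sup>2) ^ (2 * (2 * k + 1)) = norm J ^ N" unfolding power_mult[symmetric] by (rule arg_cong[where f="\<lambda>n. norm J ^ n"]) (simp add: N_def)
      thus ?thesis using J by (simp add: power_divide)
    qed
    finally show ?thesis using C(2)[OF det' w1] by simp
  qed
  define C' where "C' = C powr (1/8)"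
  have "norm (f z) \<le> C' * Im z powr (- (real k + 1/2) / 2)" if z: "Im z > 0" for z
  proof -
    define y where "y = Im z powr ((real k + 1/2) / 2)"
    have y: "y > 0" using z by (simp add: y_def)
    have "y ^ 8 = Im z powr (real (2 * (2 * k + 1)))"
    proof -
      have "y ^ 8 = y powr real 8" using y by (intro powr_realpow[symmetric])
      also have "\<dots> = Im z powr ((real k + 1/2) / 2 * real 8)" unfolding y_def by (rule powr_powr)
      also have "(real k + 1/2) / 2 * real 8 = real (2 * (2 * k + 1))" by simp
      finally show ?thesis .
    qed
    also have "\<dots> = Im z ^ (2 * (2 * k + 1))" by (rule powr_realpow[OF z])
    finally have "(norm (f z) * y) ^ 8 \<le> C" using b8[OF z] by (simp add: power_mult_distrib)
    also have "C \<le> C' ^ 8"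
    proof (cases "C = 0")
      case False
      have "C' ^ 8 = C' powr real 8" using False C(1) by (intro powr_realpow[symmetric]) (simp add: C'_def)
      also have "\<dots> = C" unfolding C'_def powr_powr using C(1) by simp
      finally have "C' ^ 8 = C" .
      thus ?thesis by simp
    qed simp
    finally have "norm (f z) * y \<le> C'" by (rule power_le_imp_le_base[of _ 7, simplified]) (auto simp: C'_def)
    hence "norm (f z) \<le> C' / y" using y by (simp only: pos_le_divide_eq)
    also have "C' / y = C' * Im z powr (- (real k + 1/2) / 2)"
      unfolding minus_divide_left[symmetric] powr_minus y_def[symmetric] by (rule divide_inverse)
    finally show ?thesis .
  qed
  moreover have "C' \<ge> 0" by (simp add: C'_def)
  ultimately show ?thesis by blast
qed

end

section \<open>Fourier coefficients and the Fricke involution\<close>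

lemma csqrt_exp:
  assumes "\<bar>Im w\<bar> < pi"
  shows "csqrt (exp w) = exp (w / 2)"
proof (rule csqrt_unique)
  have "exp (w / 2) ^ 2 = exp (w / 2 + w / 2)" by (simp only: exp_add power2_eq_square)
  thus "(exp (w / 2))\<^sup>2 = exp w" by simp
  have "cos (Im (w / 2)) > 0" using assms by (intro cos_gt_zero_pi) auto
  thus "0 < Re (exp (w / 2)) \<or> Re (exp (w / 2)) = 0 \<and> 0 \<le> Im (exp (w / 2))" by (simp add: Re_exp)
qed

lemma half_pow_exp:
  assumes "\<bar>Im w\<bar> < pi"
  shows "half_pow (exp w) m = exp (of_int m * (w / 2))"
  unfolding half_pow_def csqrt_exp[OF assms] by (rule exp_power_int)

context cusp_form
begin

definition \<kappa> :: real where "\<kappa> = real k + 1/2"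

lemma kappa_pos: "\<kappa> > 0" by (simp add: \<kappa>_def)

lemma f_periodic:
  assumes "z \<in> upper_half_plane"
  shows "f (z + of_real 1) = f z"
proof -
  have m: "\<forall>a b c d :: int. a * d - b * c = 1 \<longrightarrow> 4 dvd c \<longrightarrow>
       (\<forall>z\<in>upper_half_plane.
          f ((of_int a * z + of_int b) / (of_int c * z + of_int d)) =
            of_int (shimura_symbol c d) ^ (2 * k + 1) * theta_eps d powi (- (2 * int k + 1)) *
            half_pow (of_int c * z + of_int d) (2 * int k + 1) * f z)"
    using cusp unfolding cusp_forms_def by blast
  have s: "shimura_symbol 0 1 = 1" by (simp add: shimura_symbol_def)
  have e: "theta_eps 1 = 1" by (simp add: theta_eps_def)
  have h: "half_pow 1 n = 1" for n by (simp add: half_pow_def)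
  show ?thesis using m[rule_format, of 1 1 1 0 z] assms by (simp add: s e h)
qed

lemma f_tendsto: "(f \<longlongrightarrow> 0) (filtercomap Im at_top)"
proof -
  have m: "\<forall>a b c d :: int. a * d - b * c = 1 \<longrightarrow>
       ((\<lambda>z. half_pow (of_int c * z + of_int d) (- (2 * int k + 1)) *
             f ((of_int a * z + of_int b) / (of_int c * z + of_int d))) \<longlongrightarrow> 0)
         (filtercomap Im at_top)"
    using cusp unfolding cusp_forms_def by blast
  have h: "half_pow 1 n = 1" for n by (simp add: half_pow_def)
  show ?thesis using m[rule_format, of 1 1 0 0] by (simp add: h)
qed

lemma q_expansion:
  obtains P where "P holomorphic_on ball 0 1" "P 0 = 0"
    "\<And>z. z \<in> upper_half_plane \<Longrightarrow> f z = P (exp (2 * of_real pi * \<i> * z))"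
proof -
  obtain P where P: "P holomorphic_on ball 0 1" "P 0 = 0"
    "\<And>z. z \<in> upper_half_plane \<Longrightarrow> f z = P (exp (2 * of_real pi * \<i> * z / of_real 1))"
    by (rule periodic_q_expansion[OF f_holo _ f_periodic f_tendsto]) (simp, assumption, rule that)
  show ?thesis by (rule that[OF P(1,2)]) (use P(3) in simp)
qed

text \<open>The segment from $i$ to $1 + i$ is mapped by $z \mapsto e^{2\pi i z}$ to a circle about $0$, so the
  coefficient integral is Cauchy's integral formula for derivatives.\<close>

lemma fourier_coeff_eq:
  assumes P: "P holomorphic_on ball 0 1"
    "\<And>z. z \<in> upper_half_plane \<Longrightarrow> f z = P (exp (2 * of_real pi * \<i> * z))"
  shows "fourier_coeff f n = (deriv ^^ n) P 0 / fact n"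
proof -
  define r where "r = exp (- 2 * pi)"
  have r: "0 < r" "r < 1" by (simp_all add: r_def)
  have hP: "P holomorphic_on cball 0 r" using P(1) by (rule holomorphic_on_subset) (use r in auto)
  have "((\<lambda>u. P u / (u - 0) ^ Suc n) has_contour_integral (2 * of_real pi * \<i>) / fact n * (deriv ^^ n) P 0) (circlepath 0 r)"
    unfolding of_real_numeral[symmetric, where ?'a = complex] of_real_mult[symmetric]
    by (rule Cauchy_has_contour_integral_higher_derivative_circlepath)
      (use hP r in \<open>auto intro: holomorphic_on_imp_continuous_on elim: holomorphic_on_subset\<close>)
  hence "((\<lambda>x. P (circlepath 0 r x) / (circlepath 0 r x - 0) ^ Suc n * vector_derivative (circlepath 0 r) (at x within {0..1}))
      has_integral (2 * of_real pi * \<i>) / fact n * (deriv ^^ n) P 0) {0..1}"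
    unfolding has_contour_integral_def .
  hence hi: "((\<lambda>x. (2 * of_real pi * \<i>) * (f (Complex x 1) * exp (- (2 * of_real pi * \<i> * of_nat n * Complex x 1))))
      has_integral (2 * of_real pi * \<i>) / fact n * (deriv ^^ n) P 0) {0..1}"
  proof (rule has_integral_eq[rotated])
    fix x :: real assume x: "x \<in> {0..1}"
    define u where "u = exp (2 * of_real pi * \<i> * Complex x 1)"
    have "2 * of_real pi * \<i> * Complex x 1 = of_real (- 2 * pi) + 2 * of_real pi * \<i> * of_real x"
      by (simp add: complex_eq_iff)
    hence u: "circlepath 0 r x = u"
      unfolding u_def circlepath r_def by (simp only: exp_add exp_of_real add_0)
    have vd: "vector_derivative (circlepath 0 r) (at x within {0..1}) = 2 * of_real pi * \<i> * u"
      using x by (subst vector_derivative_circlepath01) (auto simp: u[symmetric] circlepath)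
    have u0: "u \<noteq> 0" by (simp add: u_def)
    have "exp (- (2 * of_real pi * \<i> * of_nat n * Complex x 1)) = inverse (u ^ n)"
      unfolding u_def exp_of_nat_mult[symmetric] exp_minus[symmetric] by (simp add: mult_ac)
    moreover have "f (Complex x 1) = P u" unfolding u_def by (rule P(2)) (simp add: upper_half_plane_def)
    ultimately show "P (circlepath 0 r x) / (circlepath 0 r x - 0) ^ Suc n * vector_derivative (circlepath 0 r) (at x within {0..1}) =
      (2 * of_real pi * \<i>) * (f (Complex x 1) * exp (- (2 * of_real pi * \<i> * of_nat n * Complex x 1)))"
      unfolding u vd using u0 by (simp add: field_simps)
  qed
  hence "((\<lambda>x. f (Complex x 1) * exp (- (2 * of_real pi * \<i> * of_nat n * Complex x 1)))
      has_integral (deriv ^^ n) P 0 / fact n) {0..1}"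
  proof -
    have c: "inverse (2 * of_real pi * \<i>) * ((2 * of_real pi * \<i>) * X) = X"
      "inverse (2 * of_real pi * \<i>) * ((2 * of_real pi * \<i>) / Z * X) = X / Z" for X Z :: complex
      by (simp_all only: mult.assoc[symmetric] times_divide_eq_left[symmetric]) (simp_all add: mult.assoc field_simps)
    show ?thesis using has_integral_mult_right[OF hi, of "inverse (2 * of_real pi * \<i>)"] unfolding c .
  qed
  thus ?thesis unfolding fourier_coeff_def by (rule integral_unique)
qed

lemma fourier_sums:
  assumes "z \<in> upper_half_plane"
  shows "(\<lambda>n. fourier_coeff f n * exp (2 * of_real pi * \<i> * z) ^ n) sums f z"
proof -
  obtain P where P: "P holomorphic_on ball 0 1" "P 0 = 0"
    "\<And>z. z \<in> upper_half_plane \<Longrightarrow> f z = P (exp (2 * of_real pi * \<i> * z))"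
    by (rule q_expansion) (rule that)
  have "norm (exp (2 * of_real pi * \<i> * z)) < 1"
    using assms by (simp add: norm_exp_eq_Re upper_half_plane_def)
  hence "(\<lambda>n. (deriv ^^ n) P 0 / fact n * (exp (2 * of_real pi * \<i> * z) - 0) ^ n) sums P (exp (2 * of_real pi * \<i> * z))"
    by (intro holomorphic_power_series[OF P(1)]) simp
  thus ?thesis using fourier_coeff_eq[OF P(1,3)] P(3)[OF assms] by simp
qed

lemma fourier_coeff_0: "fourier_coeff f 0 = 0"
proof -
  obtain P where P: "P holomorphic_on ball 0 1" "P 0 = 0"
    "\<And>z. z \<in> upper_half_plane \<Longrightarrow> f z = P (exp (2 * of_real pi * \<i> * z))"
    by (rule q_expansion) (rule that)
  show ?thesis using fourier_coeff_eq[OF P(1,3), of 0] P(2) by simp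
qed

text \<open>The trivial (Hecke) bound: Cauchy's inequality on the circle that corresponds to $\mathrm{Im}\, z = 1/n$.\<close>

lemma fourier_coeff_bound:
  "\<exists>C\<ge>0. \<forall>n\<ge>1. norm (fourier_coeff f n) \<le> C * real n powr (\<kappa> / 2)"
proof -
  obtain P where P: "P holomorphic_on ball 0 1" "P 0 = 0"
    "\<And>z. z \<in> upper_half_plane \<Longrightarrow> f z = P (exp (2 * of_real pi * \<i> * z))"
    by (rule q_expansion) (rule that)
  obtain C where C: "C \<ge> 0" "\<And>z. Im z > 0 \<Longrightarrow> norm (f z) \<le> C * Im z powr (- \<kappa> / 2)"
    using f_growth unfolding \<kappa>_def by blast
  have "norm (fourier_coeff f n) \<le> (C * exp (2 * pi)) * real n powr (\<kappa> / 2)" if n: "n \<ge> 1" for n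
  proof -
    define r where "r = exp (- 2 * pi / real n)"
    have r: "0 < r" "r < 1" using n by (simp_all add: r_def)
    have hP: "P holomorphic_on cball 0 r" using P(1) by (rule holomorphic_on_subset) (use r in auto)
    have "norm ((deriv ^^ n) P 0) \<le> fact n * (C * real n powr (\<kappa> / 2)) / r ^ n"
    proof (rule Cauchy_inequality)
      show "P holomorphic_on ball 0 r" using hP by (rule holomorphic_on_subset) auto
      show "continuous_on (cball 0 r) P" using hP by (rule holomorphic_on_imp_continuous_on)
      show "0 < r" by (rule r)
      fix q :: complex assume "norm (0 - q) = r"
      hence q: "norm q = r" by simp
      define z where "z = Ln q / (2 * of_real pi * \<i>)"
      have q0: "q \<noteq> 0" using q r by auto
      have "Im z = - Re (Ln q) / (2 * pi)" by (simp add: z_def Im_divide power2_eq_square)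
      also have "\<dots> = 1 / real n" using q0 q by (simp add: r_def)
      finally have z: "Im z = 1 / real n" .
      have zu: "Im z > 0" using n by (simp add: z)
      have "P q = f z" using P(3)[of z] zu q0 by (simp add: z_def upper_half_plane_def)
      also have "norm (f z) \<le> C * Im z powr (- \<kappa> / 2)" by (rule C(2)[OF zu])
      also have "Im z powr (- \<kappa> / 2) = real n powr (\<kappa> / 2)"
        unfolding z using n by (simp add: powr_divide powr_minus_divide)
      finally show "norm (P q) \<le> C * real n powr (\<kappa> / 2)" .
    qed
    also have "r ^ n = exp (- 2 * pi)" using n by (simp add: r_def exp_of_nat_mult[symmetric])
    finally have "norm ((deriv ^^ n) P 0) \<le> fact n * ((C * exp (2 * pi)) * real n powr (\<kappa> / 2))"
      by (simp add: exp_minus field_simps)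
    moreover have "norm (fourier_coeff f n) = norm ((deriv ^^ n) P 0) / fact n"
      using fourier_coeff_eq[OF P(1,3), of n] by (simp add: norm_divide)
    ultimately show ?thesis by (simp add: divide_le_eq mult.commute)
  qed
  thus ?thesis using C(1) by (intro exI[of _ "C * exp (2 * pi)"]) auto
qed

lemma f_decay:
  "\<exists>C\<ge>0. \<forall>z. Im z \<ge> 1/2 \<longrightarrow> norm (f z) \<le> C * exp (- 2 * pi * Im z)"
proof -
  obtain P where P: "P holomorphic_on ball 0 1" "P 0 = 0"
    "\<And>z. z \<in> upper_half_plane \<Longrightarrow> f z = P (exp (2 * of_real pi * \<i> * z))"
    by (rule q_expansion) (rule that)
  have "exp (- pi) < 1" by simp
  from q_series_decay[OF P(1,2) this] obtain C where C: "C \<ge> 0" "\<And>q. norm q \<le> exp (- pi) \<Longrightarrow> norm (P q) \<le> C * norm q" by blast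
  have "norm (f z) \<le> C * exp (- 2 * pi * Im z)" if z: "Im z \<ge> 1/2" for z
  proof -
    have n: "norm (exp (2 * of_real pi * \<i> * z)) = exp (- 2 * pi * Im z)" by (simp add: norm_exp_eq_Re)
    have "norm (exp (2 * of_real pi * \<i> * z)) \<le> exp (- pi)" unfolding n using z by simp
    from C(2)[OF this] show ?thesis unfolding n using P(3)[of z] z by (simp add: upper_half_plane_def)
  qed
  thus ?thesis using C(1) by blast
qed

text \<open>With $z = i e^w/2$ the Fricke involution $z \mapsto -1/(4z)$ becomes $w \mapsto -w$.\<close>

definition \<Phi> :: "complex \<Rightarrow> complex" where
  "\<Phi> w = exp (of_real (\<kappa> / 2) * w) * f (\<i> * exp w / 2)"

lemma Im_i_exp: "Im (\<i> * exp w / 2) = exp (Re w) * cos (Im w) / 2"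
  by (simp add: Re_exp)

lemma i_exp_upper:
  assumes "\<bar>Im w\<bar> < pi / 2"
  shows "\<i> * exp w / 2 \<in> upper_half_plane"
  unfolding upper_half_plane_def mem_Collect_eq Im_i_exp using assms by (simp add: cos_gt_zero_pi abs_less_iff)

lemma Phi_holomorphic: "\<Phi> holomorphic_on {w. \<bar>Im w\<bar> < pi / 2}"
proof -
  have "(\<lambda>w. f (\<i> * exp w / 2)) holomorphic_on {w. \<bar>Im w\<bar> < pi / 2}"
  proof (rule holomorphic_on_compose_gen[of "\<lambda>w. \<i> * exp w / 2" _ f upper_half_plane, unfolded o_def])
    show "(\<lambda>w. \<i> * exp w / 2) holomorphic_on {w. \<bar>Im w\<bar> < pi / 2}" by (intro holomorphic_intros) auto
    show "(\<lambda>w. \<i> * exp w / 2) ` {w. \<bar>Im w\<bar> < pi / 2} \<subseteq> upper_half_plane" using i_exp_upper by auto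
  qed (rule f_holo)
  thus ?thesis unfolding \<Phi>_def[abs_def] by (intro holomorphic_intros)
qed

text \<open>With $X = e^u\cos\theta = 2\,\mathrm{Im}\, z$ one has $e^{\kappa u/2} = X^{\kappa/2} (\cos\theta)^{-\kappa/2}$. For $X \le 1$ the
  growth bound for $f$ absorbs $X^{\kappa/2}$; for $X > 1$ the exponential decay of $f$ does.\<close>

lemma Phi_decay_right:
  "\<exists>K. \<forall>u \<theta>. u \<ge> 0 \<longrightarrow> \<bar>\<theta>\<bar> < pi / 2 \<longrightarrow>
     norm (\<Phi> (Complex u \<theta>)) \<le> K * (cos \<theta> powr (- \<kappa> / 2) * exp (- A * max 0 (\<bar>u\<bar> + ln (cos \<theta>))))"
proof -
  obtain C where C: "C \<ge> 0" "\<And>z. Im z > 0 \<Longrightarrow> norm (f z) \<le> C * Im z powr (- \<kappa> / 2)"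
    using f_growth unfolding \<kappa>_def by blast
  obtain C' where C': "C' \<ge> 0" "\<And>z. Im z \<ge> 1/2 \<Longrightarrow> norm (f z) \<le> C' * exp (- 2 * pi * Im z)"
    using f_decay by blast
  have "pi > (0::real)" by simp
  from power_exp_bounded[OF this, of "\<kappa> / 2 + A"] obtain K where
    K: "K \<ge> 0" "\<And>x. x \<ge> 1/2 \<Longrightarrow> x powr (\<kappa> / 2 + A) * exp (- pi * x) \<le> K" by blast
  define M where "M = max (C * 2 powr (\<kappa> / 2)) (C' * K)"
  have "norm (\<Phi> (Complex u \<theta>)) \<le> M * (cos \<theta> powr (- \<kappa> / 2) * exp (- A * max 0 (\<bar>u\<bar> + ln (cos \<theta>))))"
    if u: "u \<ge> 0" and t: "\<bar>\<theta>\<bar> < pi / 2" for u \<theta>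
  proof -
    define c where "c = cos \<theta>"
    have c: "c > 0" using t by (auto simp: c_def intro!: cos_gt_zero_pi)
    define X where "X = exp u * c"
    have X: "X > 0" using c by (simp add: X_def)
    define z where "z = \<i> * exp (Complex u \<theta>) / 2"
    have Iz: "Im z = X / 2" unfolding z_def Im_i_exp X_def c_def by simp
    have lX: "\<bar>u\<bar> + ln c = ln X" using u c by (simp add: X_def ln_mult)
    have "exp (\<kappa> / 2 * u) = (X / c) powr (\<kappa> / 2)" using c by (simp add: X_def powr_def)
    also have "\<dots> = X powr (\<kappa> / 2) * c powr (- \<kappa> / 2)" using c X by (simp add: powr_divide powr_minus_divide)
    finally have "norm (\<Phi> (Complex u \<theta>)) = (X powr (\<kappa> / 2) * norm (f z)) * c powr (- \<kappa> / 2)"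
      by (simp add: \<Phi>_def norm_mult norm_exp_eq_Re z_def)
    moreover have "X powr (\<kappa> / 2) * norm (f z) \<le> M * exp (- A * max 0 (ln X))"
    proof (cases "X \<le> 1")
      case True
      have "X powr (\<kappa> / 2) * norm (f z) \<le> X powr (\<kappa> / 2) * (C * (X / 2) powr (- \<kappa> / 2))"
        using C(2)[of z] X unfolding Iz by (intro mult_left_mono) auto
      also have "\<dots> = C * 2 powr (\<kappa> / 2)" using X by (simp add: powr_divide powr_minus_divide)
      also have "\<dots> \<le> M" by (simp add: M_def)
      finally show ?thesis using True X by simp
    next
      case False
      have e: "exp (- A * ln X) = X powr (- A)" using X by (simp add: powr_def)
      have "X powr (\<kappa> / 2) * norm (f z) \<le> X powr (\<kappa> / 2) * (C' * exp (- pi * X))"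
        using C'(2)[of z] False unfolding Iz by (intro mult_left_mono) auto
      also have "\<dots> = C' * ((X powr (\<kappa> / 2 + A) * exp (- pi * X)) * X powr (- A))"
      proof -
        have "X powr (\<kappa> / 2) = X powr (\<kappa> / 2 + A) * X powr (- A)" by (simp add: powr_add[symmetric])
        thus ?thesis by (simp only: mult_ac)
      qed
      also have "\<dots> \<le> C' * (K * X powr (- A))" using C'(1) K(2)[of X] False
        by (intro mult_left_mono mult_right_mono) auto
      also have "\<dots> = (C' * K) * X powr (- A)" by simp
      also have "\<dots> \<le> M * X powr (- A)" by (intro mult_right_mono) (auto simp: M_def)
      finally show ?thesis using False e by simp
    qed
    ultimately have "norm (\<Phi> (Complex u \<theta>)) \<le> (M * exp (- A * max 0 (ln X))) * c powr (- \<kappa> / 2)"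
      by (simp only: mult_right_mono powr_ge_zero)
    thus ?thesis unfolding c_def[symmetric] lX by (simp only: mult_ac)
  qed
  thus ?thesis by blast
qed

end

locale fricke_form = cusp_form +
  assumes eigen: "eigenvector_of (fricke_op k) f"
begin

definition \<epsilon> where "\<epsilon> = (SOME c. \<forall>z\<in>upper_half_plane. fricke_op k f z = c * f z)"

lemma fricke_eigen: "z \<in> upper_half_plane \<Longrightarrow> fricke_op k f z = \<epsilon> * f z"
  using someI_ex[of "\<lambda>c. \<forall>z\<in>upper_half_plane. fricke_op k f z = c * f z"] eigen
  unfolding eigenvector_of_def \<epsilon>_def by blast

lemma Phi_symm:
  assumes w: "\<bar>Im w\<bar> < pi / 2"
  shows "\<Phi> (- w) = \<epsilon> * \<Phi> w"
proof -
  define m where "m = 2 * int k + 1"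
  define z where "z = \<i> * exp w / 2"
  have z: "z \<in> upper_half_plane" unfolding z_def by (rule i_exp_upper[OF w])
  have e1: "\<i> = exp (\<i> * of_real (pi / 2))" by (simp add: exp_eq_polar cis_conv_exp[symmetric])
  have e2: "(2::complex) = exp (of_real (ln 2))" by (simp only: exp_of_real) simp
  have e3: "z = exp (w + \<i> * of_real (pi / 2) - of_real (ln 2))"
    unfolding exp_diff exp_add e1[symmetric] e2[symmetric] z_def by simp
  have h1: "half_pow \<i> m = exp (of_int m * (\<i> * of_real (pi / 2) / 2))"
    by (subst e1, subst half_pow_exp) auto
  have h2: "half_pow 2 (- m) = exp (of_int (- m) * (of_real (ln 2) / 2))"
    by (subst e2, subst half_pow_exp) auto
  have h3: "half_pow z (- m) = exp (of_int (- m) * ((w + \<i> * of_real (pi / 2) - of_real (ln 2)) / 2))"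
    unfolding e3 by (subst half_pow_exp) (use w in auto)
  have "half_pow \<i> m * half_pow 2 (- m) * half_pow z (- m) = exp (- of_real \<kappa> * w)"
  proof -
    have "of_int m = (2 * of_real \<kappa> :: complex)" by (simp add: m_def \<kappa>_def field_simps)
    thus ?thesis unfolding h1 h2 h3 exp_add[symmetric] by (simp add: field_simps)
  qed
  moreover have "- 1 / (4 * z) = \<i> * exp (- w) / 2" by (simp add: z_def exp_minus field_simps)
  ultimately have "exp (- of_real \<kappa> * w) * f (\<i> * exp (- w) / 2) = \<epsilon> * f z"
    using fricke_eigen[OF z] unfolding fricke_op_def m_def[symmetric] by (simp only:)
  hence "exp (of_real (\<kappa> / 2) * w) * (exp (- of_real \<kappa> * w) * f (\<i> * exp (- w) / 2)) = \<epsilon> * \<Phi> w"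
    by (simp add: \<Phi>_def z_def)
  moreover have "exp (of_real (\<kappa> / 2) * w) * exp (- of_real \<kappa> * w) = exp (of_real (\<kappa> / 2) * (- w))"
    unfolding exp_add[symmetric] by (simp add: field_simps)
  ultimately show ?thesis unfolding \<Phi>_def[of "- w"] by (metis mult.assoc)
qed

text \<open>Applying the symmetry twice gives $\epsilon^2 = 1$, since $\Phi$ does not vanish identically.\<close>

lemma eps_norm: "norm \<epsilon> = 1"
proof -
  obtain z where z: "z \<in> upper_half_plane" "f z \<noteq> 0" using eigen by (auto simp: eigenvector_of_def)
  define w where "w = Ln (2 * z / \<i>)"
  have z0: "z \<noteq> 0" using z by (auto simp: upper_half_plane_def)
  have "Re (2 * z / \<i>) > 0" using z by (simp add: upper_half_plane_def)
  hence w: "\<bar>Im w\<bar> < pi / 2" unfolding w_def using z0 by (subst Re_Ln_pos_lt) auto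
  have "\<i> * exp w / 2 = z" using z0 by (simp add: w_def)
  hence nz: "\<Phi> w \<noteq> 0" using z by (simp add: \<Phi>_def)
  have "\<Phi> w = \<epsilon> * \<Phi> (- w)" using Phi_symm[of "- w"] w by simp
  also have "\<dots> = \<epsilon>\<^sup>2 * \<Phi> w" using Phi_symm[OF w] by (simp add: power2_eq_square)
  finally have "\<epsilon>\<^sup>2 = 1" using nz by simp
  hence "norm \<epsilon> ^ 2 = 1" by (metis norm_one norm_power)
  thus ?thesis using norm_ge_zero[of \<epsilon>] by (simp only: power2_eq_1_iff) linarith
qed

lemma Phi_decay:
  "\<exists>K. \<forall>u \<theta>. \<bar>\<theta>\<bar> < pi / 2 \<longrightarrow>
     norm (\<Phi> (Complex u \<theta>)) \<le> K * (cos \<theta> powr (- \<kappa> / 2) * exp (- A * max 0 (\<bar>u\<bar> + ln (cos \<theta>))))"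
proof -
  obtain K where K: "\<And>u \<theta>. u \<ge> 0 \<Longrightarrow> \<bar>\<theta>\<bar> < pi / 2 \<Longrightarrow>
     norm (\<Phi> (Complex u \<theta>)) \<le> K * (cos \<theta> powr (- \<kappa> / 2) * exp (- A * max 0 (\<bar>u\<bar> + ln (cos \<theta>))))"
    using Phi_decay_right[of A] by blast
  have "norm (\<Phi> (Complex u \<theta>)) \<le> K * (cos \<theta> powr (- \<kappa> / 2) * exp (- A * max 0 (\<bar>u\<bar> + ln (cos \<theta>))))"
    if t: "\<bar>\<theta>\<bar> < pi / 2" for u \<theta>
  proof (cases "u \<ge> 0")
    case False
    have "- Complex u \<theta> = Complex (- u) (- \<theta>)" by (simp add: complex_eq_iff)
    hence "norm (\<Phi> (Complex u \<theta>)) = norm (\<Phi> (Complex (- u) (- \<theta>)))"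
      using Phi_symm[of "Complex u \<theta>"] t eps_norm by (simp add: norm_mult)
    thus ?thesis using K[of "- u" "- \<theta>"] t False by simp
  qed (use K t in blast)
  thus ?thesis by blast
qed

sublocale strip_function \<Phi> \<kappa> \<epsilon>
  by unfold_locales (use kappa_pos Phi_holomorphic Phi_decay Phi_symm eps_norm in auto)

end

section \<open>The Dirichlet series\<close>

lemma norm_Suc_powr: "norm ((of_nat (Suc n) :: complex) powr z) = real (Suc n) powr Re z"
  by (subst norm_powr_real_powr) auto

text \<open>Euler's integral after the substitution $t = b e^u$.\<close>

lemma Gamma_exp_integral:
  assumes s: "Re s > 0" and b: "b > 0"
  defines "E \<equiv> \<lambda>u::real. exp (s * of_real u - of_real (b * exp u))"
  shows "integrable lborel E" "(\<integral>u. E u \<partial>lborel) = Gamma s * of_real b powr (- s)"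
proof -
  define F where "F = (\<lambda>t::real. complex_of_real t powr (s - 1) / of_real (exp t))"
  have Fabs: "F absolutely_integrable_on {0<..}"
    using absolutely_integrable_Gamma_integral[OF s, of 1] by (simp add: F_def)
  have Fint: "integral {0<..} F = Gamma s"
    using Gamma_integral_complex'[OF s] unfolding F_def by (rule integral_unique)
  have im: "(\<lambda>u. b * exp u) ` UNIV = {0<..}"
  proof (intro equalityI subsetI)
    fix t :: real assume "t \<in> {0<..}"
    hence "t = b * exp (ln (t / b))" using b by simp
    thus "t \<in> (\<lambda>u. b * exp u) ` UNIV" by blast
  qed (use b in auto)
  have inj: "inj (\<lambda>u. b * exp u)" using b by (auto simp: inj_on_def)
  have der: "((\<lambda>u. b * exp u) has_field_derivative b * exp u) (at u within UNIV)" for u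
    by (auto intro!: derivative_eq_intros)
  have "(\<lambda>u. \<bar>b * exp u\<bar> *\<^sub>R F (b * exp u)) absolutely_integrable_on UNIV \<and>
      integral UNIV (\<lambda>u. \<bar>b * exp u\<bar> *\<^sub>R F (b * exp u)) = Gamma s"
    by (subst has_absolute_integral_change_of_variables_real[OF _ der inj]) (simp_all add: im Fabs Fint)
  moreover have H: "\<bar>b * exp u\<bar> *\<^sub>R F (b * exp u) = of_real b powr s * E u" for u
  proof -
    define l where "l = complex_of_real (ln b + u)"
    have p: "b * exp u > 0" using b by simp
    have "ln (b * exp u) = ln b + u" using b by (simp add: ln_mult)
    hence L: "Ln (of_real (b * exp u)) = l" using p by (simp only: Ln_of_real l_def)
    have e: "of_real (b * exp u) = exp l" unfolding L[symmetric] by (rule exp_Ln[symmetric]) (use b in simp)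
    have "F (b * exp u) = exp ((s - 1) * l) / exp (of_real (b * exp u))"
      using p b unfolding F_def powr_def L exp_of_real by simp
    hence "\<bar>b * exp u\<bar> *\<^sub>R F (b * exp u) = exp l * (exp ((s - 1) * l) / exp (of_real (b * exp u)))"
      unfolding scaleR_conv_of_real using e p by simp
    also have "\<dots> = exp (s * l - of_real (b * exp u))"
      unfolding exp_diff exp_add[symmetric] times_divide_eq_right by (simp add: algebra_simps)
    also have "s * l - of_real (b * exp u) = s * of_real (ln b) + (s * of_real u - of_real (b * exp u))"
      by (simp add: l_def algebra_simps)
    also have "exp \<dots> = of_real b powr s * E u"
      unfolding exp_add E_def using b by (simp add: powr_def Ln_of_real)
    finally show ?thesis .
  qed
  ultimately have a: "(\<lambda>u. of_real b powr s * E u) absolutely_integrable_on UNIV"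
    "integral UNIV (\<lambda>u. of_real b powr s * E u) = Gamma s" by simp_all
  have "(\<lambda>u. of_real b powr s * E u) \<in> borel_measurable borel"
    unfolding E_def by (intro borel_measurable_continuous_onI continuous_intros)
  hence m: "(\<lambda>u. of_real b powr s * E u) \<in> borel_measurable lborel" by (simp only: measurable_lborel1 measurable_lborel2)
  have i: "integrable lborel (\<lambda>u. of_real b powr s * E u)"
    using a(1) unfolding integrable_completion[OF m, symmetric]
    by (simp only: set_integrable_def indicator_UNIV scaleR_one)
  have "(\<integral>u. of_real b powr s * E u \<partial>lborel) = Gamma s"
    unfolding integral_completion[OF m, symmetric]
    using set_lebesgue_integral_eq_integral(2)[OF a(1)] a(2) by (simp only: set_lebesgue_integral_def indicator_UNIV scaleR_one)
  moreover have nz: "of_real b powr s \<noteq> (0::complex)" using b by simp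
  ultimately show "(\<integral>u. E u \<partial>lborel) = Gamma s * of_real b powr (- s)"
    by (simp add: powr_minus field_simps)
  show "integrable lborel E"
  proof -
    have c: "inverse (of_real b powr s) * (of_real b powr s * E u) = E u" for u using nz by (simp only: mult.assoc[symmetric]) simp
    show ?thesis using integrable_mult_right[OF i, of "inverse (of_real b powr s)"] unfolding c .
  qed
qed

context fricke_form
begin

definition coef :: "nat \<Rightarrow> complex" where "coef n = fourier_coeff f (Suc n)"

text \<open>This is $L(s, f)$; defined from the entire function $\Lambda$, it is entire because $1/\Gamma$ is.\<close>

definition LL :: "complex \<Rightarrow> complex" where "LL s = of_real pi powr s * rGamma s * Lam s"

lemma coef_summable:
  assumes "\<sigma> > \<kappa> / 2 + 1"
  shows "summable (\<lambda>n. norm (coef n) * real (Suc n) powr (- \<sigma>))"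
proof -
  obtain C where C: "C \<ge> 0" "\<And>n. n \<ge> 1 \<Longrightarrow> norm (fourier_coeff f n) \<le> C * real n powr (\<kappa> / 2)"
    using fourier_coeff_bound by blast
  have "summable (\<lambda>n. real n powr (\<kappa> / 2 - \<sigma>))" using assms by (subst summable_real_powr_iff) simp
  hence "summable (\<lambda>n. real (Suc n) powr (\<kappa> / 2 - \<sigma>))"
    using summable_Suc_iff[of "\<lambda>n. real n powr (\<kappa> / 2 - \<sigma>)"] by simp
  hence s: "summable (\<lambda>n. C * real (Suc n) powr (\<kappa> / 2 - \<sigma>))" by (rule summable_mult)
  show ?thesis
  proof (rule summable_comparison_test'[OF s])
    fix n :: nat
    have "norm (coef n) * real (Suc n) powr (- \<sigma>) \<le> (C * real (Suc n) powr (\<kappa> / 2)) * real (Suc n) powr (- \<sigma>)"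
      using C(2)[of "Suc n"] unfolding coef_def by (intro mult_right_mono) auto
    also have "\<dots> = C * real (Suc n) powr (\<kappa> / 2 - \<sigma>)"
      by (simp only: mult.assoc powr_add[symmetric]) simp
    finally show "norm (norm (coef n) * real (Suc n) powr (- \<sigma>)) \<le> C * real (Suc n) powr (\<kappa> / 2 - \<sigma>)" by simp
  qed
qed

lemma coef_sums:
  "(\<lambda>n. coef n * exp (- of_real (pi * real (Suc n) * exp u))) sums f (\<i> * exp (of_real u) / 2)"
  "summable (\<lambda>n. norm (coef n * exp (- of_real (pi * real (Suc n) * exp u))))"
proof -
  define x where "x = (\<lambda>u::real. exp (- complex_of_real (pi * exp u)))"
  have xe: "exp (2 * of_real pi * \<i> * (\<i> * exp (of_real u) / 2)) = x u" for u :: real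
    by (simp add: x_def exp_of_real[symmetric])
  have uh: "\<i> * exp (of_real u) / 2 \<in> upper_half_plane" for u :: real by (rule i_exp_upper) simp
  have xp: "coef n * x u ^ Suc n = coef n * exp (- of_real (pi * real (Suc n) * exp u))" for n u
    unfolding x_def exp_of_nat_mult[symmetric] by (simp add: algebra_simps)
  have sm: "(\<lambda>n. fourier_coeff f n * x u ^ n) sums f (\<i> * exp (of_real u) / 2)" for u
    using fourier_sums[OF uh[of u]] unfolding xe .
  have "(\<lambda>n. coef n * x u ^ Suc n) sums f (\<i> * exp (of_real u) / 2)"
    unfolding coef_def using sums_Suc_iff[of "\<lambda>n. fourier_coeff f n * x u ^ n" "f (\<i> * exp (of_real u) / 2)"] sm[of u]
    by (simp add: fourier_coeff_0)
  thus "(\<lambda>n. coef n * exp (- of_real (pi * real (Suc n) * exp u))) sums f (\<i> * exp (of_real u) / 2)"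
    by (simp only: xp)
  \<comment> \<open>A power series converges absolutely strictly inside any point of convergence.\<close>
  have "norm (x u) < norm (x (u - 1))" by (simp add: x_def norm_exp_eq_Re)
  from powser_insidea[OF sums_summable[OF sm] this]
  have "summable (\<lambda>n. norm (fourier_coeff f (Suc n) * x u ^ Suc n))" by (subst summable_Suc_iff)
  thus "summable (\<lambda>n. norm (coef n * exp (- of_real (pi * real (Suc n) * exp u))))"
    unfolding coef_def[symmetric] xp .
qed

text \<open>Termwise integration of the Fourier expansion, which is absolutely convergent in this half-plane by the
  trivial bound for the coefficients.\<close>

lemma LL_Dirichlet:
  assumes s: "Re s > \<kappa> / 2 + 1"
  shows "(\<lambda>n. coef n * of_nat (Suc n) powr (- s)) sums LL s"
proof -
  define E where "E = (\<lambda>(z::complex) n (u::real). exp (z * of_real u - of_real (pi * real (Suc n) * exp u)))"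
  have s0: "Re s > 0" using s kappa_pos by linarith
  have pn: "pi * real (Suc n) > 0" for n by simp
  have E: "integrable lborel (E z n)" "(\<integral>u. E z n u \<partial>lborel) = Gamma z * of_real (pi * real (Suc n)) powr (- z)"
    if "Re z > 0" for z n
    using Gamma_exp_integral[OF that pn[of n]] unfolding E_def by auto
  have sp: "of_real (pi * real (Suc n)) powr z = of_real pi powr z * of_nat (Suc n) powr z" for n and z :: complex
    unfolding of_real_mult of_real_of_nat_eq by (rule powr_times_real) auto
  have nE: "complex_of_real (norm (E s n u)) = E (of_real (Re s)) n u" for n u
  proof -
    have "norm (E s n u) = exp (Re s * u - pi * real (Suc n) * exp u)" by (simp add: E_def norm_exp_eq_Re)
    thus ?thesis by (simp add: E_def exp_of_real[symmetric])
  qed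
  define G where "G = norm (Gamma (complex_of_real (Re s))) * pi powr (- Re s)"
  have nI: "(\<integral>u. norm (coef n * E s n u) \<partial>lborel) = G * (norm (coef n) * real (Suc n) powr (- Re s))" for n
  proof -
    have "of_real (\<integral>u. norm (E s n u) \<partial>lborel) = (\<integral>u. E (of_real (Re s)) n u \<partial>lborel)"
      unfolding nE[symmetric] by (rule integral_complex_of_real[symmetric])
    also have "\<dots> = Gamma (of_real (Re s)) * (of_real pi powr (- of_real (Re s)) * of_nat (Suc n) powr (- of_real (Re s)))"
      using E(2)[of "of_real (Re s)" n] s0 unfolding sp by simp
    finally have "norm (complex_of_real (\<integral>u. norm (E s n u) \<partial>lborel)) =
        norm (Gamma (complex_of_real (Re s)) * (of_real pi powr (- of_real (Re s)) * of_nat (Suc n) powr (- of_real (Re s))))"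
      by (rule arg_cong)
    also have "\<dots> = G * real (Suc n) powr (- Re s)"
      unfolding norm_mult norm_Suc_powr by (subst norm_powr_real_powr) (auto simp: G_def)
    finally have "(\<integral>u. norm (E s n u) \<partial>lborel) = G * real (Suc n) powr (- Re s)"
      by (simp add: integral_nonneg_AE)
    thus ?thesis by (simp add: norm_mult)
  qed
  have id: "coef n * E s n u = exp (s * of_real u) * (coef n * exp (- of_real (pi * real (Suc n) * exp u)))" for n u
    unfolding E_def by (simp add: exp_diff exp_minus divide_inverse)
  have "(\<lambda>n. \<integral>u. coef n * E s n u \<partial>lborel) sums (\<integral>u. (\<Sum>n. coef n * E s n u) \<partial>lborel)"
  proof (rule sums_integral)
    show "integrable lborel (\<lambda>u. coef n * E s n u)" for n using E(1)[OF s0] by simp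
    show "AE u in lborel. summable (\<lambda>n. norm (coef n * E s n u))"
      unfolding id norm_mult[of "exp _"] by (intro AE_I2 summable_mult coef_sums(2))
    show "summable (\<lambda>n. \<integral>u. norm (coef n * E s n u) \<partial>lborel)"
      unfolding nI by (intro summable_mult coef_summable s)
  qed
  also have "(\<integral>u. (\<Sum>n. coef n * E s n u) \<partial>lborel) = Lam s"
    unfolding Lam_def
  proof (rule Bochner_Integration.integral_cong[OF refl])
    fix u :: real
    have "(\<Sum>n. coef n * E s n u) = exp (s * of_real u) * f (\<i> * exp (of_real u) / 2)"
      unfolding id by (rule sums_unique[symmetric]) (intro sums_mult coef_sums(1))
    also have "exp (s * of_real u) = exp (of_real (\<kappa> / 2) * of_real u) * exp ((s - of_real (\<kappa> / 2)) * of_real u)"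
      unfolding exp_add[symmetric] by (simp add: algebra_simps)
    finally show "(\<Sum>n. coef n * E s n u) = \<Phi> (of_real u) * exp ((s - of_real (\<kappa> / 2)) * of_real u)"
      unfolding \<Phi>_def by (simp only: mult_ac)
  qed
  finally have "(\<lambda>n. coef n * (Gamma s * (of_real pi powr (- s) * of_nat (Suc n) powr (- s)))) sums Lam s"
    using E(2)[OF s0] unfolding sp by simp
  from sums_mult[OF this, of "of_real pi powr s * rGamma s"]
  have "(\<lambda>n. of_real pi powr s * rGamma s * (coef n * (Gamma s * (of_real pi powr (- s) * of_nat (Suc n) powr (- s))))) sums LL s"
    unfolding LL_def .
  moreover have "of_real pi powr s * rGamma s * (c * (Gamma s * (of_real pi powr (- s) * d))) = c * d" for c d
  proof -
    have "of_real pi powr s * of_real pi powr (- s) = (1::complex)" by (simp add: powr_minus)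
    moreover have "rGamma s * Gamma s = 1"
      unfolding rGamma_inverse_Gamma using Gamma_eq_zero_iff[of s] s0 by (auto elim!: nonpos_Ints_cases)
    moreover have "of_real pi powr s * rGamma s * (c * (Gamma s * (of_real pi powr (- s) * d))) =
       (of_real pi powr s * of_real pi powr (- s)) * (rGamma s * Gamma s) * (c * d)" by (simp only: mult_ac)
    ultimately show ?thesis by simp
  qed
  ultimately show ?thesis by simp
qed

lemma LL_holomorphic: "LL holomorphic_on UNIV"
  unfolding LL_def[abs_def] by (intro holomorphic_intros Lam_entire)

lemma L_function_eq: "L_function f = LL"
  unfolding L_function_def
proof (rule the_equality)
  show "LL holomorphic_on UNIV \<and> (\<exists>\<sigma>. \<forall>s. \<sigma> < Re s \<longrightarrow> (\<lambda>n. fourier_coeff f (Suc n) * of_nat (Suc n) powr - s) sums LL s)"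
    using LL_holomorphic LL_Dirichlet unfolding coef_def by blast
  fix L' assume L': "L' holomorphic_on UNIV \<and> (\<exists>\<sigma>. \<forall>s. \<sigma> < Re s \<longrightarrow> (\<lambda>n. fourier_coeff f (Suc n) * of_nat (Suc n) powr - s) sums L' s)"
  then obtain \<sigma> where \<sigma>: "\<And>s. \<sigma> < Re s \<Longrightarrow> (\<lambda>n. fourier_coeff f (Suc n) * of_nat (Suc n) powr - s) sums L' s" by blast
  \<comment> \<open>Both functions are the sum of the same series on this half-plane.\<close>
  define m where "m = max \<sigma> (\<kappa> / 2 + 1)"
  have eq: "L' s = LL s" if "s \<in> {s. Re s > m}" for s
    using sums_unique2[OF \<sigma>[of s] LL_Dirichlet[of s, unfolded coef_def]] that by (simp add: m_def)
  show "L' = LL"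
  proof
    fix z
    show "L' z = LL z"
    proof (rule analytic_continuation_open[of "{s. Re s > m}" UNIV L' LL])
      have "of_real (m + 1) \<in> {s. Re s > m}" by simp
      thus "{s. Re s > m} \<noteq> {}" by blast
    qed (use L' LL_holomorphic eq in \<open>auto simp: open_halfspace_Re_gt\<close>)
  qed
qed

lemma first_coef: obtains m where "coef m \<noteq> 0" "\<And>n. n < m \<Longrightarrow> coef n = 0"
proof -
  obtain z where z: "z \<in> upper_half_plane" "f z \<noteq> 0" using eigen by (auto simp: eigenvector_of_def)
  have "\<exists>n. coef n \<noteq> 0"
  proof (rule ccontr)
    assume "\<not> (\<exists>n. coef n \<noteq> 0)"
    hence "fourier_coeff f n = 0" for n using fourier_coeff_0 by (cases n) (auto simp: coef_def)
    hence "(\<lambda>n. 0) sums f z" using fourier_sums[OF z(1)] by simp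
    from sums_unique2[OF this sums_zero] z(2) show False by simp
  qed
  hence "coef (LEAST n. coef n \<noteq> 0) \<noteq> 0" by (rule LeastI_ex)
  moreover have "coef n = 0" if "n < (LEAST n. coef n \<noteq> 0)" for n using not_less_Least[OF that] by simp
  ultimately show ?thesis by (rule that)
qed

text \<open>Far to the right the first nonzero term of the Dirichlet series dominates: the remaining ones are smaller
  by a factor that is exponentially small in $\mathrm{Re}\, s$.\<close>

lemma LL_main_term:
  obtains m A where "coef m \<noteq> 0" "A > \<kappa> / 2"
    "\<And>s. Re s \<ge> A \<Longrightarrow> norm (LL s - coef m * of_nat (Suc m) powr (- s)) \<le> norm (coef m * of_nat (Suc m) powr (- s)) / 2"
proof -
  obtain m where m: "coef m \<noteq> 0" "\<And>n. n < m \<Longrightarrow> coef n = 0" by (rule first_coef) (rule that)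
  define \<sigma>1 where "\<sigma>1 = \<kappa> / 2 + 2"
  define a where "a = (\<lambda>n. norm (coef n) * real (Suc n) powr (- \<sigma>1))"
  have sa: "summable a" unfolding a_def by (rule coef_summable) (simp add: \<sigma>1_def)
  define D where "D = suminf a"
  define l where "l = ln (real m + 2) - ln (real m + 1)"
  have l: "l > 0" by (simp add: l_def)
  have "((\<lambda>x::real. exp (- l * x)) \<longlongrightarrow> 0) at_top" using l by real_asymp
  hence "((\<lambda>x. (2 * D / a m) * exp (- l * x)) \<longlongrightarrow> (2 * D / a m) * 0) at_top" by (rule tendsto_mult_left)
  hence "\<forall>\<^sub>F x in at_top. (2 * D / a m) * exp (- l * x) < 1" by (rule order_tendstoD(2)) simp
  then obtain X where X: "\<And>x. x \<ge> X \<Longrightarrow> (2 * D / a m) * exp (- l * x) < 1" by (auto simp: eventually_at_top_linorder)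
  have am: "a m > 0" using m by (simp add: a_def)
  show ?thesis
  proof (rule that[OF m(1)])
    show "\<sigma>1 + max X 0 > \<kappa> / 2" by (simp add: \<sigma>1_def)
    fix s assume s: "Re s \<ge> \<sigma>1 + max X 0"
    define x where "x = Re s - \<sigma>1"
    have x: "x \<ge> X" "x \<ge> 0" using s by (auto simp: x_def)
    define g where "g = (\<lambda>n. coef n * of_nat (Suc n) powr (- s))"
    define h where "h = (\<lambda>n. g n - (if n = m then g n else 0))"
    have "g sums LL s" unfolding g_def by (rule LL_Dirichlet) (use x in \<open>simp add: x_def \<sigma>1_def\<close>)
    hence hs: "h sums (LL s - g m)" unfolding h_def by (intro sums_diff sums_single)
    have ng: "norm (g n) = a n * real (Suc n) powr (- x)" for n
    proof -
      have "real (Suc n) powr (- Re s) = real (Suc n) powr (- \<sigma>1) * real (Suc n) powr (- x)"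
        by (simp only: powr_add[symmetric]) (simp add: x_def)
      thus ?thesis unfolding g_def norm_mult norm_Suc_powr by (simp add: a_def)
    qed
    have le: "norm (h n) \<le> a n * (real m + 2) powr (- x)" for n
    proof -
      consider "n < m" | "n = m" | "n > m" by linarith
      thus ?thesis
      proof cases
        case 3
        hence "real (Suc n) powr (- x) \<le> (real m + 2) powr (- x)" using x by (intro powr_mono2') auto
        hence "norm (g n) \<le> a n * (real m + 2) powr (- x)" unfolding ng by (intro mult_left_mono) (auto simp: a_def)
        thus ?thesis using 3 by (simp add: h_def)
      qed (auto simp: h_def g_def m(2) a_def)
    qed
    have "norm (LL s - g m) \<le> (\<Sum>n. a n * (real m + 2) powr (- x))"
      unfolding sums_unique[OF hs] by (intro norm_suminf_le le summable_mult2 sa)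
    also have "\<dots> = D * (real m + 2) powr (- x)" unfolding D_def by (rule suminf_mult2[OF sa, symmetric])
    also have "(real m + 2) powr (- x) = exp (- l * x) * (real m + 1) powr (- x)"
      unfolding powr_def l_def by (simp add: exp_add[symmetric] algebra_simps)
    also have "D * (exp (- l * x) * (real m + 1) powr (- x)) = ((2 * D / a m) * exp (- l * x)) * ((a m * (real m + 1) powr (- x)) / 2)"
      using am by (simp add: field_simps)
    also have "\<dots> \<le> 1 * ((a m * (real m + 1) powr (- x)) / 2)"
      using X[OF x(1)] am by (intro mult_right_mono) auto
    also have "\<dots> = norm (g m) / 2" unfolding ng by (simp add: add.commute)
    finally show "norm (LL s - coef m * of_nat (Suc m) powr (- s)) \<le> norm (coef m * of_nat (Suc m) powr (- s)) / 2"
      unfolding g_def .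
  qed
qed

end

section \<open>Analytic estimates for the L-function\<close>

context fricke_form
begin

lemma LL_eq_0_iff: "s \<notin> \<int>\<^sub>\<le>\<^sub>0 \<Longrightarrow> LL s = 0 \<longleftrightarrow> Lam s = 0"
  by (simp add: LL_def rGamma_eq_zero_iff)

lemma Lam_reflect_eq_0: "Lam (of_real \<kappa> - s) = 0 \<longleftrightarrow> Lam s = 0"
proof -
  have "\<epsilon> \<noteq> 0" using eps_norm by auto
  thus ?thesis unfolding Lam_functional_equation by simp
qed

lemma Complex_notin_nonpos_Ints: "t \<noteq> 0 \<Longrightarrow> Complex x t \<notin> \<int>\<^sub>\<le>\<^sub>0"
  by (auto elim!: nonpos_Ints_cases simp: complex_eq_iff)

lemma reflect_Complex: "Complex (2 * (\<kappa> / 2) - x) (- t) = of_real \<kappa> - Complex x t"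
  by (simp add: complex_eq_iff)

lemma ln_norm_LL:
  assumes t: "t \<noteq> 0" and nz: "Lam (Complex x t) \<noteq> 0"
  shows "ln (norm (LL (Complex x t))) = x * ln pi - ln (norm (Gamma (Complex x t))) + ln (norm (Lam (Complex x t)))"
proof -
  have G: "norm (Gamma (Complex x t)) > 0" using Complex_notin_nonpos_Ints[OF t] by (simp add: Gamma_eq_zero_iff)
  have p: "norm ((of_real pi :: complex) powr Complex x t) = pi powr x" by (subst norm_powr_real_powr) auto
  have "norm (LL (Complex x t)) = pi powr x * inverse (norm (Gamma (Complex x t))) * norm (Lam (Complex x t))"
    unfolding LL_def norm_mult p rGamma_inverse_Gamma norm_inverse ..
  moreover have "ln (pi powr x * inverse (norm (Gamma (Complex x t))) * norm (Lam (Complex x t))) =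
      ln (pi powr x) + ln (inverse (norm (Gamma (Complex x t)))) + ln (norm (Lam (Complex x t)))"
    using G nz by (simp add: ln_mult_pos)
  moreover have "ln (pi powr x) = x * ln pi" by (simp add: ln_powr)
  moreover have "ln (inverse (norm (Gamma (Complex x t)))) = - ln (norm (Gamma (Complex x t)))"
    using G by (simp add: ln_inverse)
  ultimately show ?thesis by simp
qed

text \<open>The functional equation of $\Lambda$ leaves the quotient of two Gamma factors, evaluated by
  Stirling's formula.\<close>

lemma LL_functional_bound:
  "\<exists>C. \<forall>x t. \<kappa> / 2 - B \<le> x \<longrightarrow> x \<le> \<kappa> / 2 \<longrightarrow> 1 \<le> \<bar>t\<bar> \<longrightarrow> LL (Complex x t) \<noteq> 0 \<longrightarrow>
     \<bar>ln (norm (LL (Complex x t))) - ln (norm (LL (Complex (2 * (\<kappa> / 2) - x) (- t)))) - 2 * (\<kappa> / 2 - x) * ln \<bar>t\<bar>\<bar> \<le> C"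
proof -
  obtain C where C: "\<And>\<sigma> t. \<bar>\<sigma>\<bar> \<le> \<kappa> + \<bar>B\<bar> \<Longrightarrow> \<bar>t\<bar> \<ge> 1 \<Longrightarrow>
           \<bar>ln (norm (Gamma (Complex \<sigma> t))) - ((\<sigma> - 1/2) * ln \<bar>t\<bar> - pi * \<bar>t\<bar> / 2)\<bar> \<le> C"
    using norm_Gamma_Stirling[of "\<kappa> + \<bar>B\<bar>"] by blast
  define M where "M = (\<kappa> + 2 * \<bar>B\<bar>) * \<bar>ln pi\<bar> + 2 * C"
  have "\<bar>ln (norm (LL (Complex x t))) - ln (norm (LL (Complex (2 * (\<kappa> / 2) - x) (- t)))) - 2 * (\<kappa> / 2 - x) * ln \<bar>t\<bar>\<bar> \<le> M"
    if x: "\<kappa> / 2 - B \<le> x" "x \<le> \<kappa> / 2" and t: "1 \<le> \<bar>t\<bar>" and nz: "LL (Complex x t) \<noteq> 0" for x t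
  proof -
    have t0: "t \<noteq> 0" "- t \<noteq> 0" using t by auto
    define x' where "x' = 2 * (\<kappa> / 2) - x"
    have Lnz: "Lam (Complex x t) \<noteq> 0" using nz LL_eq_0_iff[OF Complex_notin_nonpos_Ints[OF t0(1)]] by blast
    have Lr: "Lam (Complex x' (- t)) = \<epsilon> * Lam (Complex x t)"
      unfolding x'_def reflect_Complex Lam_functional_equation ..
    hence Lnz': "Lam (Complex x' (- t)) \<noteq> 0" using Lnz eps_norm by auto
    have nL: "norm (Lam (Complex x' (- t))) = norm (Lam (Complex x t))" unfolding Lr norm_mult eps_norm by simp
    have b: "\<bar>x\<bar> \<le> \<kappa> + \<bar>B\<bar>" "\<bar>x'\<bar> \<le> \<kappa> + \<bar>B\<bar>" using x kappa_pos by (auto simp: x'_def abs_le_iff)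
    define G1 G2 where "G1 = ln (norm (Gamma (Complex x t)))" and "G2 = ln (norm (Gamma (Complex x' (- t))))"
    have S: "\<bar>G1 - ((x - 1/2) * ln \<bar>t\<bar> - pi * \<bar>t\<bar> / 2)\<bar> \<le> C" "\<bar>G2 - ((x' - 1/2) * ln \<bar>t\<bar> - pi * \<bar>t\<bar> / 2)\<bar> \<le> C"
      using C[OF b(1) t] C[OF b(2), of "- t"] t by (simp_all add: G1_def G2_def)
    have "ln (norm (LL (Complex x t))) - ln (norm (LL (Complex x' (- t)))) - 2 * (\<kappa> / 2 - x) * ln \<bar>t\<bar> =
      (x - x') * ln pi - (G1 - ((x - 1/2) * ln \<bar>t\<bar> - pi * \<bar>t\<bar> / 2)) + (G2 - ((x' - 1/2) * ln \<bar>t\<bar> - pi * \<bar>t\<bar> / 2))"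
      unfolding ln_norm_LL[OF t0(1) Lnz] ln_norm_LL[OF t0(2) Lnz'] nL G1_def[symmetric] G2_def[symmetric]
      by (simp add: x'_def algebra_simps)
    moreover have "\<bar>(x - x') * ln pi\<bar> \<le> (\<kappa> + 2 * \<bar>B\<bar>) * \<bar>ln pi\<bar>"
      unfolding abs_mult using x kappa_pos by (intro mult_right_mono) (auto simp: x'_def abs_le_iff)
    ultimately show ?thesis using S unfolding M_def x'_def[symmetric] by linarith
  qed
  thus ?thesis by blast
qed

lemma LL_square_bound:
  assumes q: "q \<ge> \<kappa> / 2"
  shows "\<exists>C\<ge>0. \<forall>x t. \<kappa> / 2 \<le> x \<longrightarrow> x \<le> q \<longrightarrow> 1 \<le> \<bar>t\<bar> \<longrightarrow>
     (norm (LL (Complex x t)))\<^sup>2 \<le> C * (\<bar>t\<bar> powr (1 - 2 * x) * ((norm (Lam (Complex x t)))\<^sup>2 * exp (pi * \<bar>t\<bar>)))"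
proof -
  obtain C where C: "\<And>\<sigma> t. \<bar>\<sigma>\<bar> \<le> q \<Longrightarrow> \<bar>t\<bar> \<ge> 1 \<Longrightarrow>
           \<bar>ln (norm (Gamma (Complex \<sigma> t))) - ((\<sigma> - 1/2) * ln \<bar>t\<bar> - pi * \<bar>t\<bar> / 2)\<bar> \<le> C"
    using norm_Gamma_Stirling[of q] by blast
  define M where "M = exp (2 * q * ln pi + 2 * C)"
  have "(norm (LL (Complex x t)))\<^sup>2 \<le> M * (\<bar>t\<bar> powr (1 - 2 * x) * ((norm (Lam (Complex x t)))\<^sup>2 * exp (pi * \<bar>t\<bar>)))"
    if x: "\<kappa> / 2 \<le> x" "x \<le> q" and t: "1 \<le> \<bar>t\<bar>" for x t
  proof (cases "Lam (Complex x t) = 0")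
    case True
    thus ?thesis by (simp add: LL_def)
  next
    case False
    have t0: "t \<noteq> 0" using t by auto
    have nz: "LL (Complex x t) \<noteq> 0" using False LL_eq_0_iff[OF Complex_notin_nonpos_Ints[OF t0]] by blast
    have x0: "x \<ge> 0" using x kappa_pos by linarith
    define G where "G = ln (norm (Gamma (Complex x t)))"
    define l where "l = ln (norm (Lam (Complex x t)))"
    have S: "\<bar>G - ((x - 1/2) * ln \<bar>t\<bar> - pi * \<bar>t\<bar> / 2)\<bar> \<le> C"
      unfolding G_def using x x0 t by (intro C) auto
    have "x * ln pi \<le> q * ln pi" using x pi_gt3 by (intro mult_right_mono) auto
    hence le: "ln (norm (LL (Complex x t))) * 2 \<le> (2 * q * ln pi + 2 * C) + (1 - 2 * x) * ln \<bar>t\<bar> + 2 * l + pi * \<bar>t\<bar>"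
      unfolding ln_norm_LL[OF t0 False] G_def[symmetric] l_def[symmetric] using S by (simp add: algebra_simps abs_le_iff)
    have sq: "y\<^sup>2 = exp (ln y * 2)" if "y > 0" for y :: real
      using that by (simp add: exp_double mult.commute[of _ 2])
    have "(norm (LL (Complex x t)))\<^sup>2 = exp (ln (norm (LL (Complex x t))) * 2)" by (rule sq) (use nz in simp)
    also have "\<dots> \<le> exp ((2 * q * ln pi + 2 * C) + (1 - 2 * x) * ln \<bar>t\<bar> + 2 * l + pi * \<bar>t\<bar>)" using le by simp
    also have "\<dots> = M * exp ((1 - 2 * x) * ln \<bar>t\<bar>) * exp (l * 2) * exp (pi * \<bar>t\<bar>)"
      unfolding M_def by (simp only: exp_add mult.commute[of l 2])
    also have "exp (l * 2) = (norm (Lam (Complex x t)))\<^sup>2" unfolding l_def by (rule sq[symmetric]) (use False in simp)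
    also have "exp ((1 - 2 * x) * ln \<bar>t\<bar>) = \<bar>t\<bar> powr (1 - 2 * x)" using t0 by (simp add: powr_def)
    finally show ?thesis by (simp only: mult_ac)
  qed
  moreover have "M \<ge> 0" by (simp add: M_def)
  ultimately show ?thesis by blast
qed

lemma continuous_on_LL: "continuous_on S (\<lambda>p. LL (Complex (fst p) (snd p)))"
  by (rule continuous_on_compose2[OF holomorphic_on_imp_continuous_on[OF LL_holomorphic]])
     (auto intro!: continuous_intros)

text \<open>From $\log(1 + y) \le \log a + (1 + y)/a$ with $a = (1 + \log T)(T/|t|)^{2x}$. The factor $T/|t|$ in $a$
  makes the weight $|t|^{1-2x}$ from Stirling's formula harmless for both signs of the exponent, and its logarithm
  has an integral of order $T$. The mean square then loses only $\log(1 + \log T)$.\<close>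

lemma mean_log_line:
  assumes q: "q \<ge> \<kappa> / 2"
  shows "\<exists>C\<ge>0. \<forall>x T. \<kappa> / 2 \<le> x \<longrightarrow> x \<le> q \<longrightarrow> 1 \<le> T \<longrightarrow>
     (\<integral>t. indicator {-T..T} t * ln (1 + (norm (LL (Complex x t)))\<^sup>2) \<partial>lborel) \<le> C * (T * (1 + ln (1 + ln T)))"
proof -
  obtain C1 where C1: "C1 \<ge> 0" "\<And>x t. \<kappa> / 2 \<le> x \<Longrightarrow> x \<le> q \<Longrightarrow> 1 \<le> \<bar>t\<bar> \<Longrightarrow>
     (norm (LL (Complex x t)))\<^sup>2 \<le> C1 * (\<bar>t\<bar> powr (1 - 2 * x) * ((norm (Lam (Complex x t)))\<^sup>2 * exp (pi * \<bar>t\<bar>)))"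
    using LL_square_bound[OF q] by blast
  define W where "W = (\<lambda>x t. (norm (Lam (Complex x t)))\<^sup>2 * exp (pi * \<bar>t\<bar>))"
  obtain C2 where C2: "C2 \<ge> 0" "\<And>x T. \<kappa> / 2 \<le> x \<Longrightarrow> x \<le> q \<Longrightarrow> T \<ge> 1 \<Longrightarrow> integrable lborel (\<lambda>t. indicator {-T..T} t * W x t)"
    "\<And>x T. \<kappa> / 2 \<le> x \<Longrightarrow> x \<le> q \<Longrightarrow> T \<ge> 1 \<Longrightarrow> (\<integral>t. indicator {-T..T} t * W x t \<partial>lborel) \<le> C2 * (T powr (2 * x) * (1 + ln T))"
    using Lam_mean_square[OF q] unfolding W_def by blast
  define F where "F = (\<lambda>p. ln (1 + (norm (LL (Complex (fst p) (snd p))))\<^sup>2))"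
  have "1 + (norm (LL z))\<^sup>2 > 0" for z by (intro add_pos_nonneg) auto
  hence "continuous_on ({\<kappa> / 2..q} \<times> {-1..1}) F" unfolding F_def
    by (intro continuous_intros continuous_on_LL) (auto simp: less_imp_neq[symmetric])
  hence "bounded (F ` ({\<kappa> / 2..q} \<times> {-1..1}))"
    by (intro compact_imp_bounded compact_continuous_image) (auto intro: compact_Times)
  then obtain K1 where K1: "\<And>p. p \<in> {\<kappa> / 2..q} \<times> {-1..1} \<Longrightarrow> norm (F p) \<le> K1" unfolding bounded_iff by blast
  have K1_0: "K1 \<ge> 0" using order_trans[OF norm_ge_zero K1[of "(\<kappa> / 2, 0)"]] q by simp
  define j where "j = (\<lambda>u::real. indicator {-1..1} u * \<bar>ln \<bar>u\<bar>\<bar>)"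
  have j: "integrable lborel j" unfolding j_def using integrable_indicator_ln_abs[of "-1" 1 0] by simp
  have j0: "j u \<ge> 0" for u by (simp add: j_def)
  define J0 where "J0 = (\<integral>u. j u \<partial>lborel)"
  have J0: "J0 \<ge> 0" unfolding J0_def by (intro integral_nonneg_AE) (simp add: j0)
  have q0: "q \<ge> 0" using q kappa_pos by linarith
  define C where "C = 2 * (K1 + 1) + 2 + 2 * q * J0 + C1 * C2"
  have "(\<integral>t. indicator {-T..T} t * ln (1 + (norm (LL (Complex x t)))\<^sup>2) \<partial>lborel) \<le> C * (T * (1 + ln (1 + ln T)))"
    if x: "\<kappa> / 2 \<le> x" "x \<le> q" and T: "1 \<le> T" for x T
  proof -
    have lT: "ln T \<ge> 0" using T by simp
    define b where "b = ln (1 + ln T)"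
    have b: "b \<ge> 0" using lT by (simp add: b_def)
    have x0: "x \<ge> 0" using x kappa_pos by linarith
    define r where "r = C1 * (T powr (1 - 2 * x) / (1 + ln T))"
    have r: "r \<ge> 0" using C1 lT by (simp add: r_def)
    have W0: "W x t \<ge> 0" for t by (simp add: W_def)
    define R where "R = (\<lambda>t. (K1 + b + 1) * indicator {-T..T} t + (2 * q) * j (0 + (1/T) * t) + r * (indicator {-T..T} t * W x t))"
    have jT: "integrable lborel (\<lambda>t. j (0 + (1/T) * t))"
      using T by (intro lborel_integrable_real_affine[OF j]) auto
    have jI: "(\<integral>t. j (0 + (1/T) * t) \<partial>lborel) = T * J0"
      using lborel_integral_real_affine[of "1/T" j 0] T by (simp add: J0_def field_simps)
    have i1: "integrable lborel (\<lambda>t. (K1 + b + 1) * indicator {-T..T} t)" by (intro integrable_mult_right integrable_indicator_Icc)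
    have i2: "integrable lborel (\<lambda>t. (2 * q) * j (0 + (1/T) * t))" by (intro integrable_mult_right jT)
    have i3: "integrable lborel (\<lambda>t. r * (indicator {-T..T} t * W x t))" by (intro integrable_mult_right C2(2) x T)
    have iR: "integrable lborel R" unfolding R_def by (intro Bochner_Integration.integrable_add i1 i2 i3)
    have R0: "R t \<ge> 0" for t using K1_0 b q0 r W0 j0 by (auto simp: R_def intro!: add_nonneg_nonneg mult_nonneg_nonneg)
    have pt: "indicator {-T..T} t * ln (1 + (norm (LL (Complex x t)))\<^sup>2) \<le> R t" for t
    proof (cases "t \<in> {-T..T}")
      case False thus ?thesis using R0[of t] by simp
    next
      case True
      define y where "y = (norm (LL (Complex x t)))\<^sup>2"
      have y: "y \<ge> 0" by (simp add: y_def)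
      have Rt: "R t = K1 + b + 1 + 2 * q * j (t / T) + r * W x t" using True by (simp add: R_def)
      have nn: "2 * q * j (t / T) \<ge> 0" "r * W x t \<ge> 0" using q0 j0 r W0 by auto
      have "ln (1 + y) \<le> R t"
      proof (cases "\<bar>t\<bar> \<le> 1")
        case True
        hence "ln (1 + y) \<le> K1" using K1[of "(x, t)"] x by (simp add: F_def y_def abs_le_iff)
        thus ?thesis unfolding Rt using nn b by linarith
      next
        case False
        hence t: "\<bar>t\<bar> > 1" "\<bar>t\<bar> \<le> T" using True by auto
        define a where "a = (1 + ln T) * (T / \<bar>t\<bar>) powr (2 * x)"
        have g1: "(T / \<bar>t\<bar>) powr (2 * x) \<ge> 1" using t x0 by (intro ge_one_powr_ge_zero) auto
        have a1: "a \<ge> 1" unfolding a_def using mult_mono[of 1 "1 + ln T" 1 "(T / \<bar>t\<bar>) powr (2 * x)"] g1 lT by simp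
        have "ln (1 + y) = ln (a * ((1 + y) / a))" using a1 by simp
        also have "\<dots> = ln a + ln ((1 + y) / a)" using a1 y by (intro ln_mult_pos) auto
        also have "ln ((1 + y) / a) \<le> (1 + y) / a" using a1 y by (intro less_imp_le[OF ln_less_self]) auto
        also have "(1 + y) / a = 1 / a + y / a" by (rule add_divide_distrib)
        also have "1 / a \<le> 1" using a1 by simp
        also have "y / a \<le> r * W x t"
        proof -
          have "y / a \<le> (C1 * (\<bar>t\<bar> powr (1 - 2 * x) * W x t)) / a"
            using C1(2)[OF x, of t] t a1 unfolding y_def W_def by (intro divide_right_mono) auto
          also have "\<dots> = (C1 / (1 + ln T)) * ((\<bar>t\<bar> powr (1 - 2 * x) / (T / \<bar>t\<bar>) powr (2 * x)) * W x t)"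
            unfolding a_def by simp
          also have "\<bar>t\<bar> powr (1 - 2 * x) / (T / \<bar>t\<bar>) powr (2 * x) = \<bar>t\<bar> * T powr (- 2 * x)"
            using t T by (simp add: powr_divide powr_diff powr_minus_divide)
          also have "(C1 / (1 + ln T)) * ((\<bar>t\<bar> * T powr (- 2 * x)) * W x t) \<le> (C1 / (1 + ln T)) * ((T * T powr (- 2 * x)) * W x t)"
            using t W0 C1(1) lT by (intro mult_left_mono mult_right_mono) auto
          also have "T * T powr (- 2 * x) = T powr (1 - 2 * x)" using T by (simp add: powr_diff powr_minus_divide)
          also have "(C1 / (1 + ln T)) * (T powr (1 - 2 * x) * W x t) = r * W x t" by (simp add: r_def)
          finally show ?thesis .
        qed
        also have "ln a \<le> b + 2 * q * j (t / T)"
        proof -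
          have p: "T / \<bar>t\<bar> > 0" using t by simp
          have "ln a = b + ln ((T / \<bar>t\<bar>) powr (2 * x))" unfolding a_def b_def using p lT by (intro ln_mult_pos) auto
          also have "ln ((T / \<bar>t\<bar>) powr (2 * x)) = (2 * x) * ln (T / \<bar>t\<bar>)" using p by (simp add: ln_powr)
          also have "ln (T / \<bar>t\<bar>) = j (t / T)"
          proof -
            have "ln (T / \<bar>t\<bar>) = ln T - ln \<bar>t\<bar>" using t T by (simp add: ln_div)
            moreover have "ln \<bar>t / T\<bar> = ln \<bar>t\<bar> - ln T" using t T by (simp add: ln_div)
            moreover have "ln \<bar>t\<bar> \<le> ln T" using t by simp
            moreover have "t / T \<in> {-1..1}" using True T by (simp add: field_simps)
            ultimately show ?thesis by (simp add: j_def)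
          qed
          also have "b + (2 * x) * j (t / T) \<le> b + (2 * q) * j (t / T)"
            using x j0 by (intro add_left_mono mult_right_mono) auto
          finally show ?thesis .
        qed
        finally show ?thesis unfolding Rt using K1_0 by simp
      qed
      thus ?thesis using True by (simp add: y_def)
    qed
    have "(\<integral>t. indicator {-T..T} t * ln (1 + (norm (LL (Complex x t)))\<^sup>2) \<partial>lborel) \<le> (\<integral>t. R t \<partial>lborel)"
      by (rule integral_mono'[OF iR]) (use pt R0 in auto)
    also have "\<dots> = (K1 + b + 1) * (2 * T) + (2 * q) * (T * J0) + r * (\<integral>t. indicator {-T..T} t * W x t \<partial>lborel)"
    proof -
      have "(\<integral>t. R t \<partial>lborel) = (\<integral>t. (K1 + b + 1) * indicator {-T..T} t \<partial>lborel) + (\<integral>t. (2 * q) * j (0 + (1/T) * t) \<partial>lborel) +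
          (\<integral>t. r * (indicator {-T..T} t * W x t) \<partial>lborel)"
        unfolding R_def using i1 i2 i3 by (subst Bochner_Integration.integral_add, simp_all)+
      moreover have "(\<integral>t. indicator {-T..T} t \<partial>lborel) = 2 * T" using T by simp
      ultimately show ?thesis by (simp only: jI integral_mult_right_zero)
    qed
    also have "\<dots> \<le> (K1 + b + 1) * (2 * T) + (2 * q) * (T * J0) + r * (C2 * (T powr (2 * x) * (1 + ln T)))"
      using r by (intro add_left_mono mult_left_mono C2(3) x T)
    also have "r * (C2 * (T powr (2 * x) * (1 + ln T))) = C1 * C2 * T"
    proof -
      have "T powr (1 - 2 * x) * T powr (2 * x) = T" using T by (simp add: powr_add[symmetric])
      moreover have "1 + ln T \<noteq> 0" using lT by linarith
      moreover have "r * (C2 * (T powr (2 * x) * (1 + ln T))) = C1 * C2 * (T powr (1 - 2 * x) * T powr (2 * x)) * ((1 + ln T) / (1 + ln T))"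
        unfolding r_def by simp
      ultimately show ?thesis by simp
    qed
    also have "(K1 + b + 1) * (2 * T) + (2 * q) * (T * J0) + C1 * C2 * T = (2 * (K1 + 1) + 2 * q * J0 + C1 * C2) * T * 1 + 2 * T * b"
      by (simp add: algebra_simps)
    also have "\<dots> \<le> (2 * (K1 + 1) + 2 * q * J0 + C1 * C2) * T * (1 + b) + 2 * T * (1 + b)"
      using K1_0 q0 J0 C1 C2 b T by (intro add_mono mult_left_mono) auto
    also have "\<dots> = C * (T * (1 + b))" by (simp add: C_def algebra_simps)
    finally show ?thesis unfolding b_def .
  qed
  moreover have "C \<ge> 0" using K1_0 q0 J0 C1 C2 by (simp add: C_def)
  ultimately show ?thesis by blast
qed

lemma mean_log_box:
  "(\<lambda>T. \<integral>p. indicator ({\<kappa> / 2..q} \<times> {-T..T}) p * ln (1 + (norm (LL (Complex (fst p) (snd p))))\<^sup>2) \<partial>lborel)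
     \<in> o(\<lambda>T. T * ln T)"
proof (cases "q \<ge> \<kappa> / 2")
  case False
  hence "{\<kappa> / 2..q} = {}" by simp
  thus ?thesis by simp
next
  case True
  obtain C where C: "C \<ge> 0" "\<And>x T. \<kappa> / 2 \<le> x \<Longrightarrow> x \<le> q \<Longrightarrow> 1 \<le> T \<Longrightarrow>
     (\<integral>t. indicator {-T..T} t * ln (1 + (norm (LL (Complex x t)))\<^sup>2) \<partial>lborel) \<le> C * (T * (1 + ln (1 + ln T)))"
    using mean_log_line[OF True] by blast
  define F where "F = (\<lambda>T p. indicator ({\<kappa> / 2..q} \<times> {-T..T}) p * ln (1 + (norm (LL (Complex (fst p) (snd p))))\<^sup>2))"
  have l0: "ln (1 + (norm z)\<^sup>2) \<ge> 0" for z :: complex by simp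
  have le: "norm (\<integral>p. F T p \<partial>lborel) \<le> ((q - \<kappa> / 2) * C) * norm (T * (1 + ln (1 + ln T)))" if T: "T \<ge> 1" for T
  proof -
    define M where "M = C * (T * (1 + ln (1 + ln T)))"
    have lT: "ln (1 + ln T) \<ge> 0" using T by simp
    have M: "M \<ge> 0" using C(1) T lT by (simp add: M_def)
    have "1 + (norm (LL z))\<^sup>2 > 0" for z by (intro add_pos_nonneg) auto
    hence "continuous_on ({\<kappa> / 2..q} \<times> {-T..T}) (\<lambda>p. ln (1 + (norm (LL (Complex (fst p) (snd p))))\<^sup>2))"
      by (intro continuous_intros continuous_on_LL) (auto simp: less_imp_neq[symmetric])
    hence "continuous_on ({\<kappa> / 2..q} \<times> {-T..T}) (F T)"
      by (rule continuous_on_eq) (simp add: F_def)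
    hence iF: "integrable lborel (F T)" by (rule integrable_continuous_box) (simp add: F_def)
    have "(\<integral>p. F T p \<partial>lborel) = (\<integral>x. (\<integral>t. F T (x, t) \<partial>lborel) \<partial>lborel)" by (rule Fubini_fst[OF iF])
    also have "\<dots> \<le> (\<integral>x. M * indicator {\<kappa> / 2..q} x \<partial>lborel)"
    proof (rule integral_mono')
      show "integrable lborel (\<lambda>x. M * indicator {\<kappa> / 2..q} x)" by (intro integrable_mult_right integrable_indicator_Icc)
      show "0 \<le> M * indicator {\<kappa> / 2..q} x" for x using M by simp
      fix x :: real
      show "(\<integral>t. F T (x, t) \<partial>lborel) \<le> M * indicator {\<kappa> / 2..q} x"
      proof (cases "x \<in> {\<kappa> / 2..q}")
        case True
        hence "(\<lambda>t. F T (x, t)) = (\<lambda>t. indicator {-T..T} t * ln (1 + (norm (LL (Complex x t)))\<^sup>2))"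
          by (auto simp: F_def indicator_def)
        thus ?thesis using C(2)[of x T] True T by (simp add: M_def)
      next
        case False
        hence "(\<lambda>t. F T (x, t)) = (\<lambda>t. 0)" by (auto simp: F_def)
        thus ?thesis using False by simp
      qed
    qed
    also have "\<dots> = (q - \<kappa> / 2) * M" using True by simp
    finally have "(\<integral>p. F T p \<partial>lborel) \<le> (q - \<kappa> / 2) * M" .
    moreover have "(\<integral>p. F T p \<partial>lborel) \<ge> 0" using l0 by (intro integral_nonneg_AE) (simp add: F_def)
    moreover have "norm (T * (1 + ln (1 + ln T))) = T * (1 + ln (1 + ln T))" using T lT by simp
    ultimately show ?thesis by (simp add: M_def)
  qed
  have "(\<lambda>T. \<integral>p. F T p \<partial>lborel) \<in> O(\<lambda>T. T * (1 + ln (1 + ln T)))"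
    by (rule bigoI[of _ "(q - \<kappa> / 2) * C"]) (rule eventually_mono[OF eventually_ge_at_top[of 1]], rule le)
  moreover have "(\<lambda>T::real. T * (1 + ln (1 + ln T))) \<in> o(\<lambda>T. T * ln T)" by real_asymp
  ultimately have "(\<lambda>T. \<integral>p. F T p \<partial>lborel) \<in> o(\<lambda>T. T * ln T)" by (rule landau_o.big_small_trans)
  thus ?thesis unfolding F_def .
qed

text \<open>Zeros outside the nonpositive integers are zeros of $\Lambda$, hence symmetric about $\kappa/2$, and there are
  none with $\mathrm{Re}\, s \ge A$.\<close>

lemma LL_log_framework: "\<exists>A. log_framework LL (\<kappa> / 2) A (A - \<kappa> / 2)"
proof -
  obtain m A where m: "coef m \<noteq> 0" and A: "A > \<kappa> / 2"
    and main: "\<And>s. Re s \<ge> A \<Longrightarrow> norm (LL s - coef m * of_nat (Suc m) powr (- s)) \<le> norm (coef m * of_nat (Suc m) powr (- s)) / 2"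
    by (rule LL_main_term) (rule that)
  define g where "g = (\<lambda>s. norm (coef m) * real (Suc m) powr (- Re s))"
  have ng: "norm (coef m * of_nat (Suc m) powr (- s)) = g s" for s
    unfolding norm_mult norm_Suc_powr g_def by simp
  have g0: "g s > 0" for s using m by (simp add: g_def)
  have bd: "g s / 2 \<le> norm (LL s)" "norm (LL s) \<le> 2 * g s" if "Re s \<ge> A" for s
    using main[OF that] norm_triangle_ineq2[of "coef m * of_nat (Suc m) powr (- s)" "LL s"]
      norm_triangle_ineq2[of "LL s" "coef m * of_nat (Suc m) powr (- s)"] g0[of s]
    unfolding ng norm_minus_commute[of "coef m * of_nat (Suc m) powr (- s)" "LL s"] by linarith+
  have nz: "LL s \<noteq> 0" if "Re s \<ge> A" for s using bd(1)[OF that] g0[of s] by auto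
  have "log_framework LL (\<kappa> / 2) A (A - \<kappa> / 2)"
  proof
    show "LL holomorphic_on UNIV" by (rule LL_holomorphic)
    show "LL s \<noteq> 0" if "A \<le> Re s" for s by (rule nz[OF that])
    show "\<exists>C. \<forall>x t. A \<le> x \<longrightarrow> x \<le> q \<longrightarrow> \<bar>ln (norm (LL (Complex x t)))\<bar> \<le> C" for q
    proof (intro exI[of _ "\<bar>ln (norm (coef m))\<bar> + (\<bar>A\<bar> + \<bar>q\<bar>) * ln (real (Suc m)) + ln 2"] allI impI)
      fix x t assume x: "A \<le> x" "x \<le> q"
      define s where "s = Complex x t"
      have s: "Re s \<ge> A" using x by (simp add: s_def)
      have "ln (norm (LL s)) \<le> ln (2 * g s)" using bd(2)[OF s] nz[OF s] by (intro ln_mono) auto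
      moreover have "ln (g s / 2) \<le> ln (norm (LL s))" using bd(1)[OF s] g0[of s] by (intro ln_mono) auto
      moreover have "ln (2 * g s) = ln 2 + ln (g s)" using g0[of s] by (intro ln_mult_pos) auto
      moreover have "ln (g s / 2) = ln (g s) - ln 2" using g0[of s] by (simp add: ln_div)
      moreover have "ln (g s) = ln (norm (coef m)) + ln (real (Suc m) powr (- x))"
        unfolding g_def s_def using m by (simp add: ln_mult_pos)
      moreover have "ln (real (Suc m) powr (- x)) = - x * ln (real (Suc m))" by (simp add: ln_powr)
      moreover have "\<bar>- x * ln (real (Suc m))\<bar> \<le> (\<bar>A\<bar> + \<bar>q\<bar>) * ln (real (Suc m))"
      proof -
        have "\<bar>- x * ln (real (Suc m))\<bar> = \<bar>x\<bar> * ln (real (Suc m))" by (simp add: abs_mult)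
        also have "\<dots> \<le> (\<bar>A\<bar> + \<bar>q\<bar>) * ln (real (Suc m))" using x by (intro mult_right_mono) auto
        finally show ?thesis .
      qed
      ultimately show "\<bar>ln (norm (LL (Complex x t)))\<bar> \<le> \<bar>ln (norm (coef m))\<bar> + (\<bar>A\<bar> + \<bar>q\<bar>) * ln (real (Suc m)) + ln 2"
        unfolding s_def[symmetric] by linarith
    qed
    show "(\<lambda>T. \<integral>p. indicator ({\<kappa> / 2..q} \<times> {-T..T}) p * ln (1 + (norm (LL (Complex (fst p) (snd p))))\<^sup>2) \<partial>lborel)
       \<in> o(\<lambda>T. T * ln T)" for q by (rule mean_log_box)
    show "\<exists>C. \<forall>x t. \<kappa> / 2 - B \<le> x \<longrightarrow> x \<le> \<kappa> / 2 \<longrightarrow> 1 \<le> \<bar>t\<bar> \<longrightarrow> LL (Complex x t) \<noteq> 0 \<longrightarrow>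
       \<bar>ln (norm (LL (Complex x t))) - ln (norm (LL (Complex (2 * (\<kappa> / 2) - x) (- t)))) - 2 * (\<kappa> / 2 - x) * ln \<bar>t\<bar>\<bar> \<le> C" for B
      by (rule LL_functional_bound)
    show "LL (Complex (2 * (\<kappa> / 2) - x) (- t)) \<noteq> 0" if "1 \<le> \<bar>t\<bar>" "LL (Complex x t) \<noteq> 0" for x t
    proof -
      have t0: "t \<noteq> 0" "- t \<noteq> 0" using that by auto
      show ?thesis using that(2) LL_eq_0_iff[OF Complex_notin_nonpos_Ints[OF t0(1)]]
          LL_eq_0_iff[OF Complex_notin_nonpos_Ints[OF t0(2)]] Lam_reflect_eq_0[of "Complex x t"]
        unfolding reflect_Complex[symmetric] by blast
    qed
    show "\<bar>Re s - \<kappa> / 2\<bar> < A - \<kappa> / 2" if "LL s = 0" "s \<notin> \<int>\<^sub>\<le>\<^sub>0" for s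
    proof -
      have "Lam (of_real \<kappa> - s) = 0" using that LL_eq_0_iff[of s] Lam_reflect_eq_0[of s] by blast
      hence "LL (of_real \<kappa> - s) = 0" by (simp add: LL_def)
      hence "Re (of_real \<kappa> - s) < A" using nz[of "of_real \<kappa> - s"] by force
      moreover have "Re s < A" using nz[of s] that(1) by force
      ultimately show ?thesis by (simp add: abs_less_iff)
    qed
    show "A - \<kappa> / 2 > 0" using A by simp
  qed
  thus ?thesis by blast
qed

end

section \<open>The theorem\<close>

theorem theorem1p1:
  fixes k :: nat and f :: "complex \<Rightarrow> complex"
  assumes "f \<in> cusp_forms k"
    and "\<And>n. n \<ge> 1 \<Longrightarrow> eigenvector_of (hecke_op k n) f"
    and "eigenvector_of (fricke_op k) f"
  shows "(\<exists>\<rho>. lists_nontrivial_zeros (L_function f) \<rho>) \<and>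
    (\<forall>\<rho>. lists_nontrivial_zeros (L_function f) \<rho> \<longrightarrow>
       uniformly_distributed_mod_1 (\<lambda>n. Im (\<rho> n)))"
proof -
  interpret F: fricke_form k f by unfold_locales (use assms in auto)
  obtain A where "log_framework F.LL (F.\<kappa> / 2) A (A - F.\<kappa> / 2)" using F.LL_log_framework by blast
  then interpret L: log_framework F.LL "F.\<kappa> / 2" A "A - F.\<kappa> / 2" .
  show ?thesis unfolding F.L_function_eq
    using L.exists_nontrivial_zero_listing L.nontrivial_zeros_uniformly_distributed by blast
qed

end
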